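(* Let $k$ be a commutative Noetherian ring and $V$ a finitely generated $\mathscr{C}$-module over $k$. There exists a complex of $\mathscr{C}$-modules $$F^{\bullet}:\quad 0\to V\to F^0\to F^1\to\cdots\to F^l\to 0$$ such that: (1) each $F^j$ is a relative projective module with $\mathrm{gd}(F^j)\leq \mathrm{gd}(V)-j$; (2) $l\leq \mathrm{gd}(V)$; (3) all homology groups of this complex (at $V$ and at each $F^j$) are finitely generated torsion modules. Consequently, $\Sigma_1^{n_1}\cdots\Sigma_m^{n_m}V$ is a relative projective module whenever $n_i\geq \mathrm{td}_i(H)+1$ for every homology group $H$ of the complex $F^{\bullet}$ (including the homology at $V$) and every $i\in\{1,\ldots,m\}$.
   Context: Let $m\geq 1$ be an integer and $\mathbb{N}$ the set of nonnegative integers; write $[n]=\{1,\ldots,n\}$, $[0]=\emptyset$. The category $\mathscr{C}$ (skeleton of $\mathrm{FI}^m$) has objects $\mathbf{n}=(n_1,\ldots,n_m)\in\mathbb{N}^m$; a morphism $\mathbf{f}:\mathbf{n}\to\mathbf{t}$ is a tuple $(f_1,\ldots,f_m)$ of injections $f_i:[n_i]\to[t_i]$, composed componentwise. Objects are partially ordered componentwise, $\deg(\mathbf{n})=n_1+\cdots+n_m$, and $\mathbf{1}_i$ is the tuple with $1$ in position $i$ and $0$ elsewhere. A $\mathscr{C}$-module is a covariant functor $V$ from $\mathscr{C}$ to $k$-modules, with values $V_{\mathbf{n}}$; write $\mathbf{f}\cdot v=V(\mathbf{f})(v)$. $M(\mathbf{n})$ is the $k$-linearization of $\mathscr{C}(\mathbf{n},-)$;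 $S_{\mathbf{n}}=\mathscr{C}(\mathbf{n},\mathbf{n})$. $V$ is finitely generated if it is a quotient of a finite direct sum of modules $M(\mathbf{n})$. Generating degree: $k\mathscr{C}$ is the category algebra, $\mathfrak{m}$ its two-sided ideal spanned by all morphisms $\mathbf{i}\to\mathbf{j}$ with $\mathbf{i}<\mathbf{j}$, $H_0(V)=k\mathscr{C}/\mathfrak{m}\otimes_{k\mathscr{C}}V$, and $\mathrm{gd}(V)=\sup\{\deg(\mathbf{n})\mid (H_0(V))_{\mathbf{n}}\neq 0\}$ ($-1$ if the set is empty). A basic relative projective module is one of the form $M(\mathbf{n})\otimes_{kS_{\mathbf{n}}}U$ with $U$ a $kS_{\mathbf{n}}$-module. A module is relative projective if it has a finite filtration from $0$ to itself whose successive quotients are isomorphic to basic relative projective modules. Shift functors: for $i\in\{1,\ldots,m\}$, $\iota_i:\mathscr{C}\to\mathscr{C}$ is the functor $\mathbf{n}\mapsto\mathbf{n}+\mathbf{1}_i$ which leaves $f_j$ unchanged for $j\neq i$ and replaces $f_i:[n_i]\to[t_i]$ by the map $[n_i+1]\to[t_i+1]$, $1\mapsto 1$, $t\mapsto f_i(t-1)+1$ for $t\neq 1$. Put $\Sigma_iV=V\circ\iota_i$. The morphisms $\pi_{\mathbf{n},i}:\mathbf{n}\to\mathbf{n}+\mathbf{1}_i$, whose $i$-th component is $t\mapsto t+1$ and other components are identities, induce a natural map $V\to\Sigma_iV$; let $K_iV$ be its kernel. Torsion: $v\in V_{\mathbf{n}}$ is torsion if $\mathbf{f}\cdot v=0$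 for some object $\mathbf{t}$ and some morphism $\mathbf{f}:\mathbf{n}\to\mathbf{t}$. $V_T$ is the submodule generated by all torsion elements; $V$ is a torsion module if $V_T=V$. Define $\mathrm{td}_i(V)=\sup\{s\mid \exists\,\mathbf{n}\text{ with }(K_iV)_{\mathbf{n}}\neq 0\text{ and }n_i=s\}$, set to $-1$ if the set is empty. *)

theory Defs
  imports
    "HOL-Algebra.Ring_Divisibility"
    "HOL-Algebra.Module"
    "HOL-Library.Extended_Real"
begin

section \<open>Modules over a commutative ring\<close>

text \<open>
  Modules are the records of HOL-Algebra; their ring-multiplication fields carry no meaning
  for a module and are left undefined.
\<close>

definition lin_maps ::
  "('k, 'b) ring_scheme \<Rightarrow> ('k, 'v) module \<Rightarrow> ('k, 'w) module \<Rightarrow> ('v \<Rightarrow> 'w) set" where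
  "lin_maps R M N = {h \<in> carrier M \<rightarrow> carrier N.
     (\<forall>x\<in>carrier M. \<forall>y\<in>carrier M. h (x \<oplus>\<^bsub>M\<^esub> y) = h x \<oplus>\<^bsub>N\<^esub> h y) \<and>
     (\<forall>c\<in>carrier R. \<forall>x\<in>carrier M. h (c \<odot>\<^bsub>M\<^esub> x) = c \<odot>\<^bsub>N\<^esub> h x)}"

definition mod_span :: "('k, 'b) ring_scheme \<Rightarrow> ('k, 'v) module \<Rightarrow> 'v set \<Rightarrow> 'v set" where
  "mod_span R M S = \<Inter>{H. submodule H R M \<and> S \<subseteq> H}"

definition quot_mod :: "('k, 'v) module \<Rightarrow> 'v set \<Rightarrow> ('k, 'v set) module" where
  "quot_mod M N = \<lparr>carrier = a_rcosets\<^bsub>M\<^esub> N, mult = undefined, one = undefined,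
     zero = N, add = (\<lambda>Y Z. Y <+>\<^bsub>M\<^esub> Z), smult = (\<lambda>c Z. N <+>\<^bsub>M\<^esub> (\<lambda>z. c \<odot>\<^bsub>M\<^esub> z) ` Z)\<rparr>"

text \<open>
  The map induced by \<open>h\<close> on cosets, with values in the quotient of \<open>M'\<close> by \<open>N'\<close>: if \<open>h\<close> maps the
  submodule divided out in the source into \<open>N'\<close>, then the coset of \<open>x\<close> goes to the coset of \<open>h x\<close>.
\<close>

definition quot_map :: "('k, 'w) module \<Rightarrow> 'w set \<Rightarrow> ('v \<Rightarrow> 'w) \<Rightarrow> 'v set \<Rightarrow> 'w set" where
  "quot_map M' N' h Z = N' <+>\<^bsub>M'\<^esub> h ` Z"

definition free_mod :: "('k, 'b) ring_scheme \<Rightarrow> 's set \<Rightarrow> ('k, 's \<Rightarrow> 'k) module" where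
  "free_mod R S = \<lparr>carrier = {x. (\<forall>s. x s \<in> carrier R) \<and> finite {s. x s \<noteq> \<zero>\<^bsub>R\<^esub>} \<and>
       {s. x s \<noteq> \<zero>\<^bsub>R\<^esub>} \<subseteq> S},
     mult = undefined, one = undefined,
     zero = (\<lambda>s. \<zero>\<^bsub>R\<^esub>), add = (\<lambda>x y s. x s \<oplus>\<^bsub>R\<^esub> y s), smult = (\<lambda>c x s. c \<otimes>\<^bsub>R\<^esub> x s)\<rparr>"

definition free_gen :: "('k, 'b) ring_scheme \<Rightarrow> 's \<Rightarrow> 's \<Rightarrow> 'k" where
  "free_gen R s = (\<lambda>s'. if s' = s then \<one>\<^bsub>R\<^esub> else \<zero>\<^bsub>R\<^esub>)"

text \<open>The linear map of free modules that sends the generator of \<open>s\<close> to the generator of \<open>\<phi> s\<close>.\<close>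

definition free_map :: "('k, 'b) ring_scheme \<Rightarrow> ('s \<Rightarrow> 't) \<Rightarrow> ('s \<Rightarrow> 'k) \<Rightarrow> 't \<Rightarrow> 'k" where
  "free_map R \<phi> x = (\<lambda>t. \<Oplus>\<^bsub>R\<^esub>s\<in>{s. x s \<noteq> \<zero>\<^bsub>R\<^esub> \<and> \<phi> s = t}. x s)"


section \<open>The skeleton of \<open>FI\<close> to the power \<open>m\<close>\<close>

text \<open>
  The index set of the \<open>m\<close> coordinates is a finite type \<open>'m\<close>.  Objects are functions
  \<open>'m \<Rightarrow> nat\<close>, ordered componentwise by the library order on functions.  A morphism is the tuple of
  its components, each made extensional outside \<open>{1..n i}\<close>; it does not record its source and
  target, so these are passed along explicitly.
\<close>

type_synonym 'm obj = "'m \<Rightarrow> nat"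
type_synonym 'm mor = "'m \<Rightarrow> nat \<Rightarrow> nat"

definition Cmor :: "'m obj \<Rightarrow> 'm obj \<Rightarrow> 'm mor set" where
  "Cmor n t = {f. \<forall>i. f i \<in> {1..n i} \<rightarrow>\<^sub>E {1..t i} \<and> inj_on (f i) {1..n i}}"

definition Cid :: "'m obj \<Rightarrow> 'm mor" where
  "Cid n = (\<lambda>i. \<lambda>a\<in>{1..n i}. a)"

text \<open>\<open>Ccomp n g f\<close> is \<open>g\<close> after \<open>f\<close>, where \<open>n\<close> is the source of \<open>f\<close>.\<close>

definition Ccomp :: "'m obj \<Rightarrow> 'm mor \<Rightarrow> 'm mor \<Rightarrow> 'm mor" where
  "Ccomp n g f = (\<lambda>i. compose {1..n i} (g i) (f i))"

definition deg :: "'m obj \<Rightarrow> nat" where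
  "deg n = (\<Sum>i\<in>UNIV. n i)"

definition add1 :: "'m \<Rightarrow> 'm obj \<Rightarrow> 'm obj" where
  "add1 i n = n(i := n i + 1)"

definition iota :: "'m \<Rightarrow> 'm obj \<Rightarrow> 'm mor \<Rightarrow> 'm mor" where
  "iota i n f = f(i := (\<lambda>a\<in>{1..n i + 1}. if a = 1 then 1 else f i (a - 1) + 1))"

definition pi_mor :: "'m obj \<Rightarrow> 'm \<Rightarrow> 'm mor" where
  "pi_mor n i = (\<lambda>j. \<lambda>a\<in>{1..n j}. if j = i then a + 1 else a)"


section \<open>Modules over the category\<close>

record ('m, 'k, 'v) cmod =
  ob :: "'m obj \<Rightarrow> ('k, 'v) module"
  act :: "'m obj \<Rightarrow> 'm obj \<Rightarrow> 'm mor \<Rightarrow> 'v \<Rightarrow> 'v"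

text \<open>
  Covariant functors to \<open>R\<close>-modules on the full subcategory with object set \<open>D\<close>.  With
  \<open>D = UNIV\<close> these are the modules over the whole category; with \<open>D = {n}\<close> they are the modules over
  the group algebra of the endomorphism group of \<open>n\<close>.
\<close>

definition functor_on :: "('k, 'b) ring_scheme \<Rightarrow> 'm obj set \<Rightarrow> ('m, 'k, 'v) cmod \<Rightarrow> bool" where
  "functor_on R D V \<longleftrightarrow>
     (\<forall>n\<in>D. Module.module R (ob V n)) \<and>
     (\<forall>n\<in>D. \<forall>t\<in>D. \<forall>f\<in>Cmor n t. act V n t f \<in> lin_maps R (ob V n) (ob V t)) \<and>
     (\<forall>n\<in>D. \<forall>v\<in>carrier (ob V n). act V n n (Cid n) v = v) \<and>
     (\<forall>n\<in>D. \<forall>t\<in>D. \<forall>u\<in>D. \<forall>f\<in>Cmor n t. \<forall>g\<in>Cmor t u. \<forall>v\<in>carrier (ob V n).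
        act V n u (Ccomp n g f) v = act V t u g (act V n t f v))"

definition cmodule :: "('k, 'b) ring_scheme \<Rightarrow> ('m, 'k, 'v) cmod \<Rightarrow> bool" where
  "cmodule R V \<longleftrightarrow> functor_on R UNIV V"

definition cmod_hom :: "('k, 'b) ring_scheme \<Rightarrow> ('m, 'k, 'v) cmod \<Rightarrow> ('m, 'k, 'w) cmod \<Rightarrow>
    ('m obj \<Rightarrow> 'v \<Rightarrow> 'w) set" where
  "cmod_hom R V W = {h. (\<forall>n. h n \<in> lin_maps R (ob V n) (ob W n)) \<and>
     (\<forall>n t. \<forall>f\<in>Cmor n t. \<forall>v\<in>carrier (ob V n). h t (act V n t f v) = act W n t f (h n v))}"

definition cmod_iso :: "('k, 'b) ring_scheme \<Rightarrow> ('m, 'k, 'v) cmod \<Rightarrow> ('m, 'k, 'w) cmod \<Rightarrow> bool" where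
  "cmod_iso R V W \<longleftrightarrow>
     (\<exists>h\<in>cmod_hom R V W. \<forall>n. bij_betw (h n) (carrier (ob V n)) (carrier (ob W n)))"

definition is_zero_mod :: "('k, 'v) module \<Rightarrow> bool" where
  "is_zero_mod M \<longleftrightarrow> carrier M = {\<zero>\<^bsub>M\<^esub>}"

definition subfunctor ::
  "('k, 'b) ring_scheme \<Rightarrow> ('m, 'k, 'v) cmod \<Rightarrow> ('m obj \<Rightarrow> 'v set) \<Rightarrow> bool" where
  "subfunctor R V X \<longleftrightarrow> (\<forall>n. submodule (X n) R (ob V n)) \<and>
     (\<forall>n t. \<forall>f\<in>Cmor n t. act V n t f ` X n \<subseteq> X t)"

definition gen_sub :: "('k, 'b) ring_scheme \<Rightarrow> ('m, 'k, 'v) cmod \<Rightarrow> ('m obj \<Rightarrow> 'v set) \<Rightarrow>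
    'm obj \<Rightarrow> 'v set" where
  "gen_sub R V S n = \<Inter>{X n | X. subfunctor R V X \<and> (\<forall>t. S t \<subseteq> X t)}"

text \<open>The quotient \<open>Z/B\<close>, for subfunctors \<open>B \<subseteq> Z\<close> of \<open>V\<close>.\<close>

definition subquot :: "('m, 'k, 'v) cmod \<Rightarrow> ('m obj \<Rightarrow> 'v set) \<Rightarrow> ('m obj \<Rightarrow> 'v set) \<Rightarrow>
    ('m, 'k, 'v set) cmod" where
  "subquot V Z B = \<lparr>ob = (\<lambda>n. quot_mod ((ob V n)\<lparr>carrier := Z n\<rparr>) (B n)),
     act = (\<lambda>n t f. quot_map (ob V t) (B t) (act V n t f))\<rparr>"

definition ker_fam :: "('m, 'k, 'v) cmod \<Rightarrow> ('m, 'k, 'w) cmod \<Rightarrow> ('m obj \<Rightarrow> 'v \<Rightarrow> 'w) \<Rightarrow>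
    'm obj \<Rightarrow> 'v set" where
  "ker_fam V W h n = {v \<in> carrier (ob V n). h n v = \<zero>\<^bsub>ob W n\<^esub>}"

definition im_fam :: "('m, 'k, 'v) cmod \<Rightarrow> ('m obj \<Rightarrow> 'v \<Rightarrow> 'w) \<Rightarrow> 'm obj \<Rightarrow> 'w set" where
  "im_fam V h n = h n ` carrier (ob V n)"

definition zero_fam :: "('m, 'k, 'v) cmod \<Rightarrow> 'm obj \<Rightarrow> 'v set" where
  "zero_fam V n = {\<zero>\<^bsub>ob V n\<^esub>}"


subsection \<open>Finite generation\<close>

definition Mfree :: "('k, 'b) ring_scheme \<Rightarrow> 'm obj \<Rightarrow> ('m, 'k, 'm mor \<Rightarrow> 'k) cmod" where
  "Mfree R n = \<lparr>ob = (\<lambda>t. free_mod R (Cmor n t)), act = (\<lambda>t u f. free_map R (Ccomp n f))\<rparr>"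

definition fin_dsum :: "nat \<Rightarrow> (nat \<Rightarrow> ('m, 'k, 'v) cmod) \<Rightarrow> ('m, 'k, nat \<Rightarrow> 'v) cmod" where
  "fin_dsum N W = \<lparr>
     ob = (\<lambda>t. \<lparr>carrier = (\<Pi>\<^sub>E r\<in>{..<N}. carrier (ob (W r) t)), mult = undefined, one = undefined,
        zero = (\<lambda>r\<in>{..<N}. \<zero>\<^bsub>ob (W r) t\<^esub>),
        add = (\<lambda>x y. \<lambda>r\<in>{..<N}. x r \<oplus>\<^bsub>ob (W r) t\<^esub> y r),
        smult = (\<lambda>c x. \<lambda>r\<in>{..<N}. c \<odot>\<^bsub>ob (W r) t\<^esub> x r)\<rparr>),
     act = (\<lambda>t u f x. \<lambda>r\<in>{..<N}. act (W r) t u f (x r))\<rparr>"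

definition fin_gen :: "('k, 'b) ring_scheme \<Rightarrow> ('m, 'k, 'v) cmod \<Rightarrow> bool" where
  "fin_gen R V \<longleftrightarrow> (\<exists>N (ns :: nat \<Rightarrow> 'm obj). \<exists>h\<in>cmod_hom R (fin_dsum N (\<lambda>r. Mfree R (ns r))) V.
     \<forall>t. h t ` carrier (ob (fin_dsum N (\<lambda>r. Mfree R (ns r))) t) = carrier (ob V t))"


subsection \<open>Tensor products over category algebras\<close>

text \<open>
  Let \<open>X\<close> be a contravariant functor on the full subcategory with object set \<open>D\<close>, where
  \<open>xa d e f\<close> maps \<open>X e\<close> to \<open>X d\<close> for \<open>f\<close> from \<open>d\<close> to \<open>e\<close>, and let \<open>Y\<close> be a covariant one.  Viewed as
  right and left modules over the category algebra, these are the direct sums of their values.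
  As the identities of the objects are orthogonal idempotents of the category algebra, their tensor
  product over it is generated by the \<open>x \<otimes> y\<close> with \<open>x\<close> in \<open>X d\<close> and \<open>y\<close> in \<open>Y d\<close> for the same
  object \<open>d\<close>, subject to bilinearity and \<open>x f \<otimes> y = x \<otimes> f y\<close> for all morphisms \<open>f\<close>.
\<close>

definition tens_free :: "('k, 'b) ring_scheme \<Rightarrow> 'm obj set \<Rightarrow> ('m obj \<Rightarrow> ('k, 'x) module) \<Rightarrow>
    ('m, 'k, 'y) cmod \<Rightarrow> ('k, 'm obj \<times> 'x \<times> 'y \<Rightarrow> 'k) module" where
  "tens_free R D X Y =
     free_mod R {(d, x, y). d \<in> D \<and> x \<in> carrier (X d) \<and> y \<in> carrier (ob Y d)}"

definition tens_rels :: "('k, 'b) ring_scheme \<Rightarrow> 'm obj set \<Rightarrow> ('m obj \<Rightarrow> ('k, 'x) module) \<Rightarrow>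
    ('m obj \<Rightarrow> 'm obj \<Rightarrow> 'm mor \<Rightarrow> 'x \<Rightarrow> 'x) \<Rightarrow> ('m, 'k, 'y) cmod \<Rightarrow>
    ('m obj \<times> 'x \<times> 'y \<Rightarrow> 'k) set" where
  "tens_rels R D X xa Y = (let F = tens_free R D X Y; g = (\<lambda>d x y. free_gen R (d, x, y)) in
     mod_span R F
      ({g d (x \<oplus>\<^bsub>X d\<^esub> x') y \<ominus>\<^bsub>F\<^esub> (g d x y \<oplus>\<^bsub>F\<^esub> g d x' y) | d x x' y.
          d \<in> D \<and> x \<in> carrier (X d) \<and> x' \<in> carrier (X d) \<and> y \<in> carrier (ob Y d)} \<union>
       {g d x (y \<oplus>\<^bsub>ob Y d\<^esub> y') \<ominus>\<^bsub>F\<^esub> (g d x y \<oplus>\<^bsub>F\<^esub> g d x y') | d x y y'.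
          d \<in> D \<and> x \<in> carrier (X d) \<and> y \<in> carrier (ob Y d) \<and> y' \<in> carrier (ob Y d)} \<union>
       {g d (c \<odot>\<^bsub>X d\<^esub> x) y \<ominus>\<^bsub>F\<^esub> c \<odot>\<^bsub>F\<^esub> g d x y | d c x y.
          d \<in> D \<and> c \<in> carrier R \<and> x \<in> carrier (X d) \<and> y \<in> carrier (ob Y d)} \<union>
       {g d x (c \<odot>\<^bsub>ob Y d\<^esub> y) \<ominus>\<^bsub>F\<^esub> c \<odot>\<^bsub>F\<^esub> g d x y | d c x y.
          d \<in> D \<and> c \<in> carrier R \<and> x \<in> carrier (X d) \<and> y \<in> carrier (ob Y d)} \<union>
       {g d (xa d e f x) y \<ominus>\<^bsub>F\<^esub> g e x (act Y d e f y) | d e f x y.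
          d \<in> D \<and> e \<in> D \<and> f \<in> Cmor d e \<and> x \<in> carrier (X e) \<and> y \<in> carrier (ob Y d)}))"

definition tens :: "('k, 'b) ring_scheme \<Rightarrow> 'm obj set \<Rightarrow> ('m obj \<Rightarrow> ('k, 'x) module) \<Rightarrow>
    ('m obj \<Rightarrow> 'm obj \<Rightarrow> 'm mor \<Rightarrow> 'x \<Rightarrow> 'x) \<Rightarrow> ('m, 'k, 'y) cmod \<Rightarrow>
    ('k, ('m obj \<times> 'x \<times> 'y \<Rightarrow> 'k) set) module" where
  "tens R D X xa Y = quot_mod (tens_free R D X Y) (tens_rels R D X xa Y)"

text \<open>Right multiplication with \<open>f\<close> from \<open>d\<close> to \<open>e\<close>, on linear combinations of morphisms out of \<open>e\<close>.\<close>

definition precomp :: "('k, 'b) ring_scheme \<Rightarrow> 'm obj \<Rightarrow> 'm obj \<Rightarrow> 'm mor \<Rightarrow> ('m mor \<Rightarrow> 'k) \<Rightarrow>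
    'm mor \<Rightarrow> 'k" where
  "precomp R d e f = free_map R (\<lambda>g. Ccomp d g f)"


subsection \<open>Generating degree\<close>

text \<open>
  The part of the ideal spanned by all morphisms between distinct comparable objects that consists
  of combinations of morphisms from \<open>i\<close> to \<open>n\<close>.
\<close>

definition mideal :: "('k, 'b) ring_scheme \<Rightarrow> 'm obj \<Rightarrow> 'm obj \<Rightarrow> ('m mor \<Rightarrow> 'k) set" where
  "mideal R i n = mod_span R (free_mod R (Cmor i n)) {free_gen R f | f. f \<in> Cmor i n \<and> i < n}"

text \<open>
  The value at \<open>n\<close> of \<open>H\<^sub>0\<close>: the tensor product over the category algebra of \<open>V\<close> with the right
  module whose value at \<open>i\<close> is the quotient of the combinations of morphisms from \<open>i\<close> to \<open>n\<close> by the
  ideal.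
\<close>

definition H0 :: "('k, 'b) ring_scheme \<Rightarrow> ('m, 'k, 'v) cmod \<Rightarrow> 'm obj \<Rightarrow>
    ('k, ('m obj \<times> ('m mor \<Rightarrow> 'k) set \<times> 'v \<Rightarrow> 'k) set) module" where
  "H0 R V n = tens R UNIV
     (\<lambda>i. quot_mod (free_mod R (Cmor i n)) (mideal R i n))
     (\<lambda>d e f. quot_map (free_mod R (Cmor d n)) (mideal R d n) (precomp R d e f))
     V"

text \<open>Supremum in the extended reals, with the convention that the empty set has supremum \<open>-1\<close>.\<close>

definition sup_nat_set :: "nat set \<Rightarrow> ereal" where
  "sup_nat_set S = (if S = {} then -1 else (SUP s\<in>S. ereal (real s)))"

definition gd :: "('k, 'b) ring_scheme \<Rightarrow> ('m, 'k, 'v) cmod \<Rightarrow> ereal" where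
  "gd R V = sup_nat_set {deg n | n. \<not> is_zero_mod (H0 R V n)}"


subsection \<open>Relative projective modules\<close>

text \<open>
  The module \<open>M(n) \<otimes> U\<close>, tensored over the group algebra of the endomorphisms of \<open>n\<close>; the functor
  \<open>U\<close> is only used at \<open>n\<close>.
\<close>

definition Mtens :: "('k, 'b) ring_scheme \<Rightarrow> 'm obj \<Rightarrow> ('m, 'k, 'u) cmod \<Rightarrow>
    ('m, 'k, ('m obj \<times> ('m mor \<Rightarrow> 'k) \<times> 'u \<Rightarrow> 'k) set) cmod" where
  "Mtens R n U = (let X = (\<lambda>t d. ob (Mfree R d) t) in
     \<lparr>ob = (\<lambda>t. tens R {n} (X t) (precomp R) U),
      act = (\<lambda>t u f. quot_map (tens_free R {n} (X u) U) (tens_rels R {n} (X u) (precomp R) U)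
        (free_map R (\<lambda>(d, x, y). (d, act (Mfree R d) t u f x, y))))\<rparr>)"

text \<open>
  Up to isomorphism, \<open>U\<close> is the value at \<open>n\<close> of \<open>M(n) \<otimes> U\<close>, so it is no restriction to take \<open>U\<close>
  with the same type of elements as \<open>W\<close>.
\<close>

definition basic_rel_projective :: "('k, 'b) ring_scheme \<Rightarrow> ('m, 'k, 'w) cmod \<Rightarrow> bool" where
  "basic_rel_projective R W \<longleftrightarrow>
     (\<exists>n. \<exists>U :: ('m, 'k, 'w) cmod. functor_on R {n} U \<and> cmod_iso R W (Mtens R n U))"

definition rel_projective :: "('k, 'b) ring_scheme \<Rightarrow> ('m, 'k, 'w) cmod \<Rightarrow> bool" where
  "rel_projective R W \<longleftrightarrow> (\<exists>(r::nat) X.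
     (\<forall>s\<le>r. subfunctor R W (X s)) \<and>
     X 0 = zero_fam W \<and> X r = (\<lambda>n. carrier (ob W n)) \<and>
     (\<forall>s<r. (\<forall>n. X s n \<subseteq> X (Suc s) n) \<and> basic_rel_projective R (subquot W (X (Suc s)) (X s))))"


subsection \<open>Shifts and torsion\<close>

definition shift :: "'m \<Rightarrow> ('m, 'k, 'v) cmod \<Rightarrow> ('m, 'k, 'v) cmod" where
  "shift i V = \<lparr>ob = (\<lambda>n. ob V (add1 i n)),
     act = (\<lambda>n t f. act V (add1 i n) (add1 i t) (iota i n f))\<rparr>"

text \<open>
  For \<open>is\<close> an enumeration \<open>i\<^sub>1, \<dots>, i\<^sub>m\<close> of the coordinates, apply the \<open>n i\<close>-fold shifts in
  direction \<open>i\<close>, starting with the last coordinate.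
\<close>

definition shifts :: "'m list \<Rightarrow> 'm obj \<Rightarrow> ('m, 'k, 'v) cmod \<Rightarrow> ('m, 'k, 'v) cmod" where
  "shifts is n V = foldr (\<lambda>i. shift i ^^ n i) is V"

definition K_fam :: "'m \<Rightarrow> ('m, 'k, 'v) cmod \<Rightarrow> 'm obj \<Rightarrow> 'v set" where
  "K_fam i V = ker_fam V (shift i V) (\<lambda>n. act V n (add1 i n) (pi_mor n i))"

definition td :: "'m \<Rightarrow> ('m, 'k, 'v) cmod \<Rightarrow> ereal" where
  "td i V = sup_nat_set {n i | n. K_fam i V n \<noteq> {\<zero>\<^bsub>ob V n\<^esub>}}"

definition torsion_elts :: "('m, 'k, 'v) cmod \<Rightarrow> 'm obj \<Rightarrow> 'v set" where
  "torsion_elts V n = {v \<in> carrier (ob V n). \<exists>t. \<exists>f\<in>Cmor n t. act V n t f v = \<zero>\<^bsub>ob V t\<^esub>}"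

definition torsion_module :: "('k, 'b) ring_scheme \<Rightarrow> ('m, 'k, 'v) cmod \<Rightarrow> bool" where
  "torsion_module R V \<longleftrightarrow> (\<forall>n. gen_sub R V (torsion_elts V) n = carrier (ob V n))"


section \<open>Complexes\<close>

text \<open>
  Complexes \<open>0 \<rightarrow> V \<rightarrow> F 0 \<rightarrow> \<dots> \<rightarrow> F l \<rightarrow> 0\<close>, continued by zero modules beyond \<open>l\<close>.  The value
  \<open>l = -1\<close>, for \<open>0 \<rightarrow> V \<rightarrow> 0\<close>, is included since a bound \<open>l \<le> gd V\<close> forces it for \<open>V = 0\<close>.
\<close>

definition cochain_complex :: "('k, 'b) ring_scheme \<Rightarrow> int \<Rightarrow> ('m, 'k, 'v) cmod \<Rightarrow>
    (nat \<Rightarrow> ('m, 'k, 'f) cmod) \<Rightarrow> ('m obj \<Rightarrow> 'v \<Rightarrow> 'f) \<Rightarrow> (nat \<Rightarrow> 'm obj \<Rightarrow> 'f \<Rightarrow> 'f) \<Rightarrow> bool" where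
  "cochain_complex R l V F \<epsilon> d \<longleftrightarrow> -1 \<le> l \<and>
     cmodule R V \<and> (\<forall>j. cmodule R (F j)) \<and>
     (\<forall>j. l < int j \<longrightarrow> (\<forall>n. is_zero_mod (ob (F j) n))) \<and>
     \<epsilon> \<in> cmod_hom R V (F 0) \<and> (\<forall>j. d j \<in> cmod_hom R (F j) (F (Suc j))) \<and>
     (\<forall>n. \<forall>v\<in>carrier (ob V n). d 0 n (\<epsilon> n v) = \<zero>\<^bsub>ob (F 1) n\<^esub>) \<and>
     (\<forall>j n. \<forall>x\<in>carrier (ob (F j) n). d (Suc j) n (d j n x) = \<zero>\<^bsub>ob (F (Suc (Suc j))) n\<^esub>)"

definition homology_V :: "('m, 'k, 'v) cmod \<Rightarrow> (nat \<Rightarrow> ('m, 'k, 'f) cmod) \<Rightarrow>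
    ('m obj \<Rightarrow> 'v \<Rightarrow> 'f) \<Rightarrow> ('m, 'k, 'v set) cmod" where
  "homology_V V F \<epsilon> = subquot V (ker_fam V (F 0) \<epsilon>) (zero_fam V)"

definition homology_F :: "('m, 'k, 'v) cmod \<Rightarrow> (nat \<Rightarrow> ('m, 'k, 'f) cmod) \<Rightarrow>
    ('m obj \<Rightarrow> 'v \<Rightarrow> 'f) \<Rightarrow> (nat \<Rightarrow> 'm obj \<Rightarrow> 'f \<Rightarrow> 'f) \<Rightarrow> nat \<Rightarrow> ('m, 'k, 'f set) cmod" where
  "homology_F V F \<epsilon> d j = subquot (F j) (ker_fam (F j) (F (Suc j)) (d j))
     (case j of 0 \<Rightarrow> im_fam V \<epsilon> | Suc i \<Rightarrow> im_fam (F i) (d i))"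

text \<open>
  The element type for the terms of the complex: every finitely generated \<open>R\<close>-module, being a
  quotient of some \<open>R\<^sup>p\<close>, has an isomorphic copy whose elements are sets of sequences in \<open>R\<close>.  The
  values of a finitely generated module over the category are finitely generated \<open>R\<close>-modules.
\<close>

type_synonym 'k fg_elt = "(nat \<Rightarrow> 'k) set"

end

theory Submission
  imports Defs
begin

text \<open>
  For an injection with image \<open>S\<close>, the image of its action depends only on the set of points \<open>S\<close>.
  Call \<open>V\<close> acyclic if all morphisms act injectively and the images of the submodules attached to
  families of such sets intersect as expected.  Two facts about this notion carry the proof.

  First, a sufficiently high shift of a finitely generated \<open>V\<close> is acyclic.  Acyclicity asks that
  \<open>K\<^sub>j\<close> vanish on the iterated cokernels \<open>D\<^sub>w V\<close> of the maps into shifts, and this is automatic when \<open>w\<close>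
  is at least as long as the generating degree.  So finitely many modules \<open>K\<^sub>j D\<^sub>w V\<close> remain.  Each is
  finitely generated, by a Groebner basis argument resting on Dickson's lemma, and it vanishes for
  large \<open>n\<^sub>j\<close> because the maps that raise \<open>n\<^sub>j\<close> act on it by zero.

  Second, an acyclic module of finite generating degree is relative projective: the intersections
  distribute over sums, so the filtration by the degrees of the generators has quotients on which the
  images of the different subsets of \<open>t\<close> of a given size are independent, which makes the evaluation
  map from \<open>M(n) \<otimes> W\<^sub>n\<close> an isomorphism.  The kernel of a surjection between acyclic modules is acyclic.

  For the complex, map \<open>V\<close> to a high shift \<open>F\<^sup>0\<close>.  The kernel is torsion, and the cokernel has smaller
  generating degree: an element of the shift that comes from a set of points of \<open>V\<close> containing an
  added point is generated in lower degree, and any other one lies in the image of \<open>V\<close>.  Iterate with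
  the cokernel.  After a shift beyond the torsion degrees the complex is exact and ends in zero, so the
  shift of \<open>V\<close> is an iterated kernel of acyclic modules.
\<close>

text \<open>The modules \<open>D_w V\<close> are never formed. Acyclicity is stated through
  submodules of single values \<open>V_t\<close> indexed by sets of points, so that shifting,
  restricting to a subobject and permuting points all become relabellings, and \<open>A\<close> and
  \<open>y\<close> can be moved into a standard position. Long words are harmless because a set with
  fewer than \<open>e\<close> points cannot contain \<open>e\<close> given points. Shifting helps
  because in a shift \<open>A\<close> and \<open>y\<close> avoid the added points, which leaves room
  in every coordinate.

  The criterion speaks of complements of single points; intersecting with an arbitrary family of
  sets needs a double induction of its own.

  Degrees are tracked by strict natural bounds \<open>e\<close>, with \<open>gd = e - 1\<close> for
  the sharp one. The zero module has bound 0, so the recursion, which lowers \<open>e\<close> by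
  one, stops by itself. Cokernels change the type of the elements, so each term is replaced by a
  copy whose elements are fibres of a parametrisation by coefficient sequences.\<close>

locale coeff_ring = cring R for R :: "('k, 'b) ring_scheme" (structure)
begin

section \<open>Modules, spans and quotients\<close>

lemma lin_mapsD:
  assumes "h \<in> lin_maps R M N" "x \<in> carrier M"
  shows "h x \<in> carrier N"
    and "y \<in> carrier M \<Longrightarrow> h (x \<oplus>\<^bsub>M\<^esub> y) = h x \<oplus>\<^bsub>N\<^esub> h y"
    and "c \<in> carrier R \<Longrightarrow> h (c \<odot>\<^bsub>M\<^esub> x) = c \<odot>\<^bsub>N\<^esub> h x"
  using assms by (auto simp: lin_maps_def)

lemma lin_mapsI:
  assumes "\<And>x. x \<in> carrier M \<Longrightarrow> h x \<in> carrier N"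
    and "\<And>x y. x \<in> carrier M \<Longrightarrow> y \<in> carrier M \<Longrightarrow> h (x \<oplus>\<^bsub>M\<^esub> y) = h x \<oplus>\<^bsub>N\<^esub> h y"
    and "\<And>c x. c \<in> carrier R \<Longrightarrow> x \<in> carrier M \<Longrightarrow> h (c \<odot>\<^bsub>M\<^esub> x) = c \<odot>\<^bsub>N\<^esub> h x"
  shows "h \<in> lin_maps R M N"
  using assms by (auto simp: lin_maps_def)

lemma lin_cong:
  assumes "h \<in> lin_maps R M N" "module R M" "\<And>x. x \<in> carrier M \<Longrightarrow> h x = h' x"
  shows "h' \<in> lin_maps R M N"
proof -
  interpret M: module R M by fact
  show ?thesis
    by (rule lin_mapsI) (use assms(1,3) in \<open>auto simp: lin_mapsD assms(3)[symmetric]\<close>)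
qed

lemma lin_id: "(\<lambda>x. x) \<in> lin_maps R M M"
  by (auto simp: lin_maps_def)

lemma lin_comp:
  assumes "h \<in> lin_maps R M N" "g \<in> lin_maps R N P"
  shows "(\<lambda>x. g (h x)) \<in> lin_maps R M P"
  by (rule lin_mapsI) (simp_all add: lin_mapsD[OF assms(1)] lin_mapsD[OF assms(2)])

lemma lin_zero:
  assumes "h \<in> lin_maps R M N" "module R M" "module R N"
  shows "h \<zero>\<^bsub>M\<^esub> = \<zero>\<^bsub>N\<^esub>"
proof -
  interpret M: module R M by fact
  interpret N: module R N by fact
  have "h (\<zero> \<odot>\<^bsub>M\<^esub> \<zero>\<^bsub>M\<^esub>) = \<zero> \<odot>\<^bsub>N\<^esub> h \<zero>\<^bsub>M\<^esub>"
    by (rule lin_mapsD(3)[OF assms(1)]) simp_all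
  then show ?thesis
    using lin_mapsD(1)[OF assms(1), of "\<zero>\<^bsub>M\<^esub>"] by simp
qed

lemma lin_neg:
  assumes "h \<in> lin_maps R M N" "module R M" "module R N" "x \<in> carrier M"
  shows "h (\<ominus>\<^bsub>M\<^esub> x) = \<ominus>\<^bsub>N\<^esub> h x"
proof -
  interpret M: module R M by fact
  interpret N: module R N by fact
  have "h ((\<ominus> \<one>) \<odot>\<^bsub>M\<^esub> x) = (\<ominus> \<one>) \<odot>\<^bsub>N\<^esub> h x"
    using assms by (intro lin_mapsD(3)) auto
  then show ?thesis
    using lin_mapsD(1)[OF assms(1)] assms(4) by (simp add: M.smult_l_minus N.smult_l_minus)
qed

lemma lin_minus:
  assumes "h \<in> lin_maps R M N" "module R M" "module R N" "x \<in> carrier M" "y \<in> carrier M"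
  shows "h (x \<ominus>\<^bsub>M\<^esub> y) = h x \<ominus>\<^bsub>N\<^esub> h y"
proof -
  interpret M: module R M by fact
  show ?thesis
    using assms by (simp add: a_minus_def lin_mapsD lin_neg)
qed

lemma lin_const_zero:
  assumes "module R M" "module R N"
  shows "(\<lambda>x. \<zero>\<^bsub>N\<^esub>) \<in> lin_maps R M N"
proof -
  interpret N: module R N by fact
  show ?thesis by (rule lin_mapsI) auto
qed

lemma lin_add_maps:
  assumes "h \<in> lin_maps R M N" "g \<in> lin_maps R M N" "module R M" "module R N"
  shows "(\<lambda>x. h x \<oplus>\<^bsub>N\<^esub> g x) \<in> lin_maps R M N"
proof -
  interpret M: module R M by fact
  interpret N: module R N by fact
  show ?thesis
    by (rule lin_mapsI) (use assms in \<open>auto simp: lin_mapsD N.smult_r_distr N.a_ac\<close>)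
qed

lemma lin_smult_map:
  assumes "h \<in> lin_maps R M N" "module R M" "module R N" "c \<in> carrier R"
  shows "(\<lambda>x. c \<odot>\<^bsub>N\<^esub> h x) \<in> lin_maps R M N"
proof -
  interpret M: module R M by fact
  interpret N: module R N by fact
  show ?thesis
    by (rule lin_mapsI)
      (use assms in \<open>auto simp: lin_mapsD N.smult_r_distr N.smult_assoc1[symmetric] m_comm\<close>)
qed

lemma lin_finsum:
  assumes "module R M" "module R N" "finite A" "\<And>a. a \<in> A \<Longrightarrow> h a \<in> lin_maps R M N"
  shows "(\<lambda>x. \<Oplus>\<^bsub>N\<^esub>a\<in>A. h a x) \<in> lin_maps R M N"
proof -
  interpret M: module R M by fact
  interpret N: module R N by fact
  show ?thesis
  proof (rule lin_mapsI)
    fix x y assume x: "x \<in> carrier M" and y: "y \<in> carrier M"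
    have "(\<Oplus>\<^bsub>N\<^esub>a\<in>A. h a (x \<oplus>\<^bsub>M\<^esub> y)) = (\<Oplus>\<^bsub>N\<^esub>a\<in>A. h a x \<oplus>\<^bsub>N\<^esub> h a y)"
      by (rule N.finsum_cong') (use x y assms(4) in \<open>auto intro!: N.add.m_closed lin_mapsD(1)[OF assms(4)] lin_mapsD(2)[OF assms(4)]\<close>)
    also have "\<dots> = (\<Oplus>\<^bsub>N\<^esub>a\<in>A. h a x) \<oplus>\<^bsub>N\<^esub> (\<Oplus>\<^bsub>N\<^esub>a\<in>A. h a y)"
      by (rule N.finsum_addf) (use x y in \<open>auto intro!: lin_mapsD(1)[OF assms(4)]\<close>)
    finally show "(\<Oplus>\<^bsub>N\<^esub>a\<in>A. h a (x \<oplus>\<^bsub>M\<^esub> y)) = \<dots>" .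
  next
    fix c x assume c: "c \<in> carrier R" and x: "x \<in> carrier M"
    have "(\<Oplus>\<^bsub>N\<^esub>a\<in>A. h a (c \<odot>\<^bsub>M\<^esub> x)) = (\<Oplus>\<^bsub>N\<^esub>a\<in>A. c \<odot>\<^bsub>N\<^esub> h a x)"
      by (rule N.finsum_cong') (use x c in \<open>auto intro!: N.smult_closed lin_mapsD(1)[OF assms(4)] lin_mapsD(3)[OF assms(4)]\<close>)
    also have "\<dots> = c \<odot>\<^bsub>N\<^esub> (\<Oplus>\<^bsub>N\<^esub>a\<in>A. h a x)"
      by (rule N.finsum_smult_ldistr[symmetric]) (use x c assms(3) in \<open>auto intro!: lin_mapsD(1)[OF assms(4)]\<close>)
    finally show "(\<Oplus>\<^bsub>N\<^esub>a\<in>A. h a (c \<odot>\<^bsub>M\<^esub> x)) = c \<odot>\<^bsub>N\<^esub> (\<Oplus>\<^bsub>N\<^esub>a\<in>A. h a x)" .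
  qed (auto intro!: N.finsum_closed lin_mapsD(1)[OF assms(4)])
qed

section \<open>Submodules\<close>

lemma sm_in: "submodule H R M \<Longrightarrow> x \<in> H \<Longrightarrow> x \<in> carrier M"
  using subgroup.mem_carrier[OF submodule.axioms(1), of H R M x] by simp

lemma sm_subset: "submodule H R M \<Longrightarrow> H \<subseteq> carrier M"
  using sm_in by auto

lemma sm_zero: "submodule H R M \<Longrightarrow> \<zero>\<^bsub>M\<^esub> \<in> H"
  using subgroup.one_closed[OF submodule.axioms(1), of H R M] by simp

lemma sm_add: "submodule H R M \<Longrightarrow> x \<in> H \<Longrightarrow> y \<in> H \<Longrightarrow> x \<oplus>\<^bsub>M\<^esub> y \<in> H"
  using subgroup.m_closed[OF submodule.axioms(1), of H R M x y] by simp

lemma sm_smult: "submodule H R M \<Longrightarrow> c \<in> carrier R \<Longrightarrow> x \<in> H \<Longrightarrow> c \<odot>\<^bsub>M\<^esub> x \<in> H"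
  by (rule submodule.smult_closed)

lemma sm_neg: "submodule H R M \<Longrightarrow> x \<in> H \<Longrightarrow> \<ominus>\<^bsub>M\<^esub> x \<in> H"
  using subgroup.m_inv_closed[OF submodule.axioms(1), of H R M x] by (simp add: a_inv_def)

lemma sm_minus: "submodule H R M \<Longrightarrow> x \<in> H \<Longrightarrow> y \<in> H \<Longrightarrow> x \<ominus>\<^bsub>M\<^esub> y \<in> H"
  by (simp add: a_minus_def sm_add sm_neg)

text \<open>Closure under negation follows from multiplication by -1.\<close>

lemma sm_I:
  assumes "module R M" "H \<subseteq> carrier M" "\<zero>\<^bsub>M\<^esub> \<in> H"
    and "\<And>x y. x \<in> H \<Longrightarrow> y \<in> H \<Longrightarrow> x \<oplus>\<^bsub>M\<^esub> y \<in> H"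
    and sm: "\<And>c x. c \<in> carrier R \<Longrightarrow> x \<in> H \<Longrightarrow> c \<odot>\<^bsub>M\<^esub> x \<in> H"
  shows "submodule H R M"
proof -
  interpret M: module R M by fact
  show ?thesis
  proof (rule M.submoduleI)
    fix a assume "a \<in> H"
    then have "(\<ominus> \<one>) \<odot>\<^bsub>M\<^esub> a \<in> H" by (intro sm) auto
    then show "\<ominus>\<^bsub>M\<^esub> a \<in> H"
      using \<open>a \<in> H\<close> assms(2) by (auto simp: M.smult_l_minus subset_iff)
  qed (use assms in auto)
qed

lemma sm_carrier: "module R M \<Longrightarrow> submodule (carrier M) R M"
  by (rule module.carrier_is_submodule)

lemma sm_zero_sub: "module R M \<Longrightarrow> submodule {\<zero>\<^bsub>M\<^esub>} R M"
proof -
  assume "module R M"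
  interpret M: module R M by fact
  show ?thesis by (rule sm_I) (auto simp: \<open>module R M\<close>)
qed

lemma sm_preimage:
  assumes "h \<in> lin_maps R M N" "module R M" "module R N" "submodule K R N"
  shows "submodule {x \<in> carrier M. h x \<in> K} R M"
proof -
  interpret M: module R M by fact
  show ?thesis
    by (rule sm_I) (use assms in \<open>auto simp: lin_mapsD lin_zero sm_zero sm_add sm_smult\<close>)
qed

lemma sm_image:
  assumes "h \<in> lin_maps R M N" "module R M" "module R N" "submodule K R M"
  shows "submodule (h ` K) R N"
proof (rule sm_I)
  show "h ` K \<subseteq> carrier N"
    using assms by (auto simp: lin_mapsD sm_in)
  show "\<zero>\<^bsub>N\<^esub> \<in> h ` K"
    using assms sm_zero lin_zero by (metis imageI)
next
  fix x y assume "x \<in> h ` K" "y \<in> h ` K"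
  then obtain a b where "a \<in> K" "b \<in> K" "x = h a" "y = h b" by auto
  then have "x \<oplus>\<^bsub>N\<^esub> y = h (a \<oplus>\<^bsub>M\<^esub> b)" "a \<oplus>\<^bsub>M\<^esub> b \<in> K"
    using assms by (auto simp: lin_mapsD sm_in sm_add)
  then show "x \<oplus>\<^bsub>N\<^esub> y \<in> h ` K" by auto
next
  fix c x assume "c \<in> carrier R" "x \<in> h ` K"
  then obtain a where "a \<in> K" "x = h a" by auto
  then have "c \<odot>\<^bsub>N\<^esub> x = h (c \<odot>\<^bsub>M\<^esub> a)" "c \<odot>\<^bsub>M\<^esub> a \<in> K"
    using assms \<open>c \<in> carrier R\<close> by (auto simp: lin_mapsD sm_in sm_smult)
  then show "c \<odot>\<^bsub>N\<^esub> x \<in> h ` K" by auto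
qed fact

lemma sm_kernel:
  assumes "h \<in> lin_maps R M N" "module R M" "module R N"
  shows "submodule {x \<in> carrier M. h x = \<zero>\<^bsub>N\<^esub>} R M"
  using sm_preimage[OF assms sm_zero_sub[OF assms(3)]] by simp

lemma module_restrict: "module R M \<Longrightarrow> submodule H R M \<Longrightarrow> module R (M\<lparr>carrier := H\<rparr>)"
  by (simp add: submodule.submodule_is_module)

lemma sm_restrict:
  assumes "module R M" "submodule H R M" "submodule K R M" "K \<subseteq> H"
  shows "submodule K R (M\<lparr>carrier := H\<rparr>)"
  by (rule sm_I[OF module_restrict]) (use assms in \<open>auto simp: sm_zero sm_add sm_smult\<close>)

lemma sm_restrictD:
  assumes "module R M" "submodule H R M" "submodule K R (M\<lparr>carrier := H\<rparr>)"
  shows "submodule K R M"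
proof (rule sm_I)
  show "K \<subseteq> carrier M" using sm_subset[OF assms(3)] sm_subset[OF assms(2)] by auto
qed (use sm_zero[OF assms(3)] sm_add[OF assms(3)] sm_smult[OF assms(3)] assms(1) in auto)

section \<open>Spans\<close>

lemma span_incl: "S \<subseteq> mod_span R M S"
  by (auto simp: mod_span_def)

lemma span_least: "submodule H R M \<Longrightarrow> S \<subseteq> H \<Longrightarrow> mod_span R M S \<subseteq> H"
  by (auto simp: mod_span_def)

lemma span_mono: "S \<subseteq> T \<Longrightarrow> mod_span R M S \<subseteq> mod_span R M T"
  by (auto simp: mod_span_def)

lemma span_sm:
  assumes "module R M" "S \<subseteq> carrier M"
  shows "submodule (mod_span R M S) R M"
proof (rule sm_I)
  show "mod_span R M S \<subseteq> carrier M"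
    by (rule span_least) (use assms sm_carrier in auto)
qed (auto simp: mod_span_def assms intro: sm_zero sm_add sm_smult)

lemma span_of_sm: "submodule H R M \<Longrightarrow> mod_span R M H = H"
  using span_incl[of H M] span_least[of H M H] by auto

lemma span_empty: "module R M \<Longrightarrow> mod_span R M {} = {\<zero>\<^bsub>M\<^esub>}"
  using span_least[OF sm_zero_sub, of M "{}"] sm_zero[OF span_sm[of M "{}"]] by auto

lemma span_image:
  assumes h: "h \<in> lin_maps R M N" and M: "module R M" and N: "module R N" and S: "S \<subseteq> carrier M"
  shows "h ` mod_span R M S = mod_span R N (h ` S)"
proof
  have hS: "h ` S \<subseteq> carrier N" using h S by (auto simp: lin_mapsD)
  have "mod_span R M S \<subseteq> {x \<in> carrier M. h x \<in> mod_span R N (h ` S)}"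
  proof (rule span_least)
    show "submodule {x \<in> carrier M. h x \<in> mod_span R N (h ` S)} R M"
      by (rule sm_preimage[OF h M N span_sm[OF N hS]])
  qed (use S span_incl[of "h ` S" N] in auto)
  then show "h ` mod_span R M S \<subseteq> mod_span R N (h ` S)" by auto
  show "mod_span R N (h ` S) \<subseteq> h ` mod_span R M S"
    by (rule span_least[OF sm_image[OF h M N span_sm[OF M S]]]) (use span_incl[of S M] in auto)
qed

lemma span_lin_subset:
  assumes h: "h \<in> lin_maps R M N" and M: "module R M" and N: "module R N" and S: "S \<subseteq> carrier M"
    and K: "submodule K R N" and "h ` S \<subseteq> K"
  shows "h ` mod_span R M S \<subseteq> K"
  unfolding span_image[OF h M N S] by (rule span_least) fact+

lemma span_restrict:
  assumes M: "module R M" and H: "submodule H R M" and S: "S \<subseteq> H"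
  shows "mod_span R (M\<lparr>carrier := H\<rparr>) S = mod_span R M S"
proof
  have SM: "S \<subseteq> carrier M" using S sm_subset[OF H] by auto
  show "mod_span R (M\<lparr>carrier := H\<rparr>) S \<subseteq> mod_span R M S"
    by (rule span_least[OF sm_restrict[OF M H span_sm[OF M SM] span_least[OF H S]] span_incl])
  have 1: "submodule (mod_span R (M\<lparr>carrier := H\<rparr>) S) R (M\<lparr>carrier := H\<rparr>)"
    by (rule span_sm[OF module_restrict[OF M H]]) (use S in auto)
  show "mod_span R M S \<subseteq> mod_span R (M\<lparr>carrier := H\<rparr>) S"
    by (rule span_least[OF sm_restrictD[OF M H 1] span_incl])
qed

text \<open>The sums of an element of one span and an element of the other already form a submodule
  containing both sets.\<close>

lemma span_Un_E:
  assumes M: "module R M" and S: "S \<subseteq> carrier M" and T: "T \<subseteq> carrier M"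
    and x: "x \<in> mod_span R M (S \<union> T)"
  obtains a b where "a \<in> mod_span R M S" "b \<in> mod_span R M T" "x = a \<oplus>\<^bsub>M\<^esub> b"
proof -
  interpret M: module R M by fact
  define A where "A = mod_span R M S"
  define B where "B = mod_span R M T"
  have A: "submodule A R M" and B: "submodule B R M"
    unfolding A_def B_def by (rule span_sm[OF M S], rule span_sm[OF M T])
  note c = sm_in[OF A] sm_in[OF B] sm_zero[OF A] sm_zero[OF B] sm_add[OF A] sm_add[OF B]
    sm_smult[OF A] sm_smult[OF B]
  let ?H = "{a \<oplus>\<^bsub>M\<^esub> b | a b. a \<in> A \<and> b \<in> B}"
  have "submodule ?H R M"
  proof (rule sm_I[OF M])
    show "?H \<subseteq> carrier M" using c by auto
    show "\<zero>\<^bsub>M\<^esub> \<in> ?H" using c(3,4) M.l_zero[OF M.zero_closed, symmetric] by blast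
  next
    fix x y assume "x \<in> ?H" "y \<in> ?H"
    then obtain a b a' b' where *: "a \<in> A" "b \<in> B" "x = a \<oplus>\<^bsub>M\<^esub> b" "a' \<in> A" "b' \<in> B" "y = a' \<oplus>\<^bsub>M\<^esub> b'"
      by auto
    then have "x \<oplus>\<^bsub>M\<^esub> y = (a \<oplus>\<^bsub>M\<^esub> a') \<oplus>\<^bsub>M\<^esub> (b \<oplus>\<^bsub>M\<^esub> b')"
      using c by (simp add: M.a_ac)
    moreover have "a \<oplus>\<^bsub>M\<^esub> a' \<in> A" "b \<oplus>\<^bsub>M\<^esub> b' \<in> B" using * c by auto
    ultimately show "x \<oplus>\<^bsub>M\<^esub> y \<in> ?H" by blast
  next
    fix r x assume "r \<in> carrier R" "x \<in> ?H"
    then obtain a b where *: "a \<in> A" "b \<in> B" "x = a \<oplus>\<^bsub>M\<^esub> b" by auto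
    then have "r \<odot>\<^bsub>M\<^esub> x = r \<odot>\<^bsub>M\<^esub> a \<oplus>\<^bsub>M\<^esub> r \<odot>\<^bsub>M\<^esub> b"
      using c \<open>r \<in> carrier R\<close> by (simp add: M.smult_r_distr)
    moreover have "r \<odot>\<^bsub>M\<^esub> a \<in> A" "r \<odot>\<^bsub>M\<^esub> b \<in> B" using * c \<open>r \<in> carrier R\<close> by auto
    ultimately show "r \<odot>\<^bsub>M\<^esub> x \<in> ?H" by blast
  qed
  moreover have "S \<union> T \<subseteq> ?H"
  proof
    fix s assume "s \<in> S \<union> T"
    then show "s \<in> ?H"
    proof
      assume "s \<in> S"
      then have "s \<in> A" "s = s \<oplus>\<^bsub>M\<^esub> \<zero>\<^bsub>M\<^esub>" using span_incl[of S M] S by (auto simp: A_def)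
      then show ?thesis using c(4) by blast
    next
      assume "s \<in> T"
      then have "s \<in> B" "s = \<zero>\<^bsub>M\<^esub> \<oplus>\<^bsub>M\<^esub> s" using span_incl[of T M] T by (auto simp: B_def)
      then show ?thesis using c(3) by blast
    qed
  qed
  ultimately have "x \<in> ?H" using x span_least by blast
  then show thesis using that by (auto simp: A_def B_def)
qed

lemma span_insert_E:
  assumes M: "module R M" and S: "S \<subseteq> carrier M" and v: "v \<in> carrier M"
    and x: "x \<in> mod_span R M (insert v S)"
  obtains c b where "c \<in> carrier R" "b \<in> mod_span R M S" "x = c \<odot>\<^bsub>M\<^esub> v \<oplus>\<^bsub>M\<^esub> b"
proof -
  interpret M: module R M by fact
  have "submodule {c \<odot>\<^bsub>M\<^esub> v | c. c \<in> carrier R} R M"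
  proof (rule sm_I[OF M])
    show "\<zero>\<^bsub>M\<^esub> \<in> {c \<odot>\<^bsub>M\<^esub> v | c. c \<in> carrier R}"
      using v M.smult_l_null by (smt (verit) mem_Collect_eq zero_closed)
  next
    fix x y assume "x \<in> {c \<odot>\<^bsub>M\<^esub> v | c. c \<in> carrier R}" "y \<in> {c \<odot>\<^bsub>M\<^esub> v | c. c \<in> carrier R}"
    then obtain c d where *: "c \<in> carrier R" "d \<in> carrier R" "x = c \<odot>\<^bsub>M\<^esub> v" "y = d \<odot>\<^bsub>M\<^esub> v" by auto
    then have "x \<oplus>\<^bsub>M\<^esub> y = (c \<oplus> d) \<odot>\<^bsub>M\<^esub> v" using v by (simp add: M.smult_l_distr)
    then show "x \<oplus>\<^bsub>M\<^esub> y \<in> {c \<odot>\<^bsub>M\<^esub> v | c. c \<in> carrier R}" using * by blast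
  next
    fix r x assume r: "r \<in> carrier R" and "x \<in> {c \<odot>\<^bsub>M\<^esub> v | c. c \<in> carrier R}"
    then obtain c where *: "c \<in> carrier R" "x = c \<odot>\<^bsub>M\<^esub> v" by auto
    then have "r \<odot>\<^bsub>M\<^esub> x = (r \<otimes> c) \<odot>\<^bsub>M\<^esub> v" using v r by (simp add: M.smult_assoc1)
    then show "r \<odot>\<^bsub>M\<^esub> x \<in> {c \<odot>\<^bsub>M\<^esub> v | c. c \<in> carrier R}" using * r by blast
  qed (use v in auto)
  moreover have "v = \<one> \<odot>\<^bsub>M\<^esub> v" using v by simp
  then have "{v} \<subseteq> {c \<odot>\<^bsub>M\<^esub> v | c. c \<in> carrier R}" by blast
  ultimately have *: "mod_span R M {v} \<subseteq> {c \<odot>\<^bsub>M\<^esub> v | c. c \<in> carrier R}"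
    by (rule span_least)
  show thesis
    by (rule span_Un_E[of M "{v}" S x]) (use assms * that in auto)
qed

text \<open>The module axioms pass to any image on which the operations are computed on
  representatives. Quotients (with \<open>q\<close> the coset map) and copies along an injection
  both get their module structure this way.\<close>

lemma module_image:
  assumes M: "module R M" and q: "carrier Q = q ` carrier M"
    and qa: "\<And>x y. x \<in> carrier M \<Longrightarrow> y \<in> carrier M \<Longrightarrow> q x \<oplus>\<^bsub>Q\<^esub> q y = q (x \<oplus>\<^bsub>M\<^esub> y)"
    and qs: "\<And>c x. c \<in> carrier R \<Longrightarrow> x \<in> carrier M \<Longrightarrow> c \<odot>\<^bsub>Q\<^esub> q x = q (c \<odot>\<^bsub>M\<^esub> x)"
    and q0: "\<zero>\<^bsub>Q\<^esub> = q \<zero>\<^bsub>M\<^esub>"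
  shows "module R Q"
proof -
  interpret M: module R M by fact
  show ?thesis
  proof (rule moduleI)
    show "cring R" ..
    show "abelian_group Q"
    proof (rule abelian_groupI)
      fix x assume "x \<in> carrier Q"
      then obtain a where a: "a \<in> carrier M" "x = q a" using q by auto
      then have "q (\<ominus>\<^bsub>M\<^esub> a) \<oplus>\<^bsub>Q\<^esub> x = \<zero>\<^bsub>Q\<^esub>" by (simp add: qa q0 M.l_neg)
      moreover have "q (\<ominus>\<^bsub>M\<^esub> a) \<in> carrier Q" using a q by auto
      ultimately show "\<exists>y\<in>carrier Q. y \<oplus>\<^bsub>Q\<^esub> x = \<zero>\<^bsub>Q\<^esub>" by blast
    qed (auto simp: q qa q0 M.a_ac)
  qed (auto simp: q qa qs M.smult_l_distr M.smult_r_distr M.smult_assoc1)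
qed

section \<open>Quotient modules\<close>

abbreviation cst :: "('k, 'v) module \<Rightarrow> 'v set \<Rightarrow> 'v \<Rightarrow> 'v set" where
  "cst M N x \<equiv> N +>\<^bsub>M\<^esub> x"

lemma abelian_subgroup_sm:
  assumes "module R M" "submodule N R M"
  shows "abelian_subgroup N M"
proof -
  interpret M: module R M by fact
  show ?thesis
    by (rule abelian_subgroupI3)
      (auto simp: additive_subgroup_def submodule.axioms(1)[OF assms(2)] M.abelian_group_axioms)
qed

lemma cst_eq_iff:
  assumes M: "module R M" and N: "submodule N R M" and x: "x \<in> carrier M" and y: "y \<in> carrier M"
  shows "cst M N x = cst M N y \<longleftrightarrow> x \<ominus>\<^bsub>M\<^esub> y \<in> N"
proof -
  interpret M: module R M by fact
  interpret N: abelian_subgroup N M by (rule abelian_subgroup_sm[OF M N])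
  show ?thesis
    using N.a_repr_independence' N.a_rcos_module[folded a_minus_def] N.a_rcos_self x y
    by (metis)
qed

lemma quot_mod_simps:
  assumes M: "module R M" and N: "submodule N R M"
  shows "carrier (quot_mod M N) = cst M N ` carrier M"
    and "\<zero>\<^bsub>quot_mod M N\<^esub> = N"
    and "cst M N \<zero>\<^bsub>M\<^esub> = N"
    and "x \<in> carrier M \<Longrightarrow> y \<in> carrier M \<Longrightarrow> cst M N x \<oplus>\<^bsub>quot_mod M N\<^esub> cst M N y = cst M N (x \<oplus>\<^bsub>M\<^esub> y)"
    and "c \<in> carrier R \<Longrightarrow> x \<in> carrier M \<Longrightarrow> c \<odot>\<^bsub>quot_mod M N\<^esub> cst M N x = cst M N (c \<odot>\<^bsub>M\<^esub> x)"
proof -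
  interpret M: module R M by fact
  interpret N: abelian_subgroup N M by (rule abelian_subgroup_sm[OF M N])
  show "carrier (quot_mod M N) = cst M N ` carrier M"
    by (auto simp: quot_mod_def A_RCOSETS_def')
  show "\<zero>\<^bsub>quot_mod M N\<^esub> = N" by (simp add: quot_mod_def)
  show "cst M N \<zero>\<^bsub>M\<^esub> = N" using sm_subset[OF N] by simp
  show "cst M N x \<oplus>\<^bsub>quot_mod M N\<^esub> cst M N y = cst M N (x \<oplus>\<^bsub>M\<^esub> y)"
    if "x \<in> carrier M" "y \<in> carrier M"
    using that by (simp add: quot_mod_def N.a_rcos_sum)
  show "c \<odot>\<^bsub>quot_mod M N\<^esub> cst M N x = cst M N (c \<odot>\<^bsub>M\<^esub> x)" if c: "c \<in> carrier R" and x: "x \<in> carrier M"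
  proof -
    note s = sm_in[OF N]
    have "N <+>\<^bsub>M\<^esub> (\<odot>\<^bsub>M\<^esub>) c ` (cst M N x) = cst M N (c \<odot>\<^bsub>M\<^esub> x)"
    proof
      show "N <+>\<^bsub>M\<^esub> (\<odot>\<^bsub>M\<^esub>) c ` (cst M N x) \<subseteq> cst M N (c \<odot>\<^bsub>M\<^esub> x)"
      proof
        fix z assume "z \<in> N <+>\<^bsub>M\<^esub> (\<odot>\<^bsub>M\<^esub>) c ` (cst M N x)"
        then obtain a b where ab: "a \<in> N" "b \<in> N" "z = a \<oplus>\<^bsub>M\<^esub> c \<odot>\<^bsub>M\<^esub> (b \<oplus>\<^bsub>M\<^esub> x)"
          by (auto simp: set_add_def' a_r_coset_def')
        then have "z = (a \<oplus>\<^bsub>M\<^esub> c \<odot>\<^bsub>M\<^esub> b) \<oplus>\<^bsub>M\<^esub> c \<odot>\<^bsub>M\<^esub> x"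
          using c x s by (simp add: M.smult_r_distr M.a_ac)
        moreover have "a \<oplus>\<^bsub>M\<^esub> c \<odot>\<^bsub>M\<^esub> b \<in> N"
          using ab c by (simp add: sm_add[OF N] sm_smult[OF N])
        ultimately show "z \<in> cst M N (c \<odot>\<^bsub>M\<^esub> x)" by (auto simp: a_r_coset_def')
      qed
      show "cst M N (c \<odot>\<^bsub>M\<^esub> x) \<subseteq> N <+>\<^bsub>M\<^esub> (\<odot>\<^bsub>M\<^esub>) c ` (cst M N x)"
      proof
        fix z assume "z \<in> cst M N (c \<odot>\<^bsub>M\<^esub> x)"
        then obtain a where "a \<in> N" "z = a \<oplus>\<^bsub>M\<^esub> c \<odot>\<^bsub>M\<^esub> x" by (auto simp: a_r_coset_def')
        moreover have "x \<in> cst M N x" by (rule N.a_rcos_self[OF x])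
        ultimately show "z \<in> N <+>\<^bsub>M\<^esub> (\<odot>\<^bsub>M\<^esub>) c ` (cst M N x)" by (auto simp: set_add_def')
      qed
    qed
    then show ?thesis by (simp add: quot_mod_def)
  qed
qed

lemma quot_module: "module R M \<Longrightarrow> submodule N R M \<Longrightarrow> module R (quot_mod M N)"
  by (rule module_image[of M _ "cst M N"]) (simp_all add: quot_mod_simps)

lemma cst_lin: "module R M \<Longrightarrow> submodule N R M \<Longrightarrow> cst M N \<in> lin_maps R M (quot_mod M N)"
  by (rule lin_mapsI) (simp_all add: quot_mod_simps)

lemma cst_eq_zero_iff:
  assumes M: "module R M" and N: "submodule N R M" and x: "x \<in> carrier M"
  shows "cst M N x = N \<longleftrightarrow> x \<in> N"
proof -
  interpret M: module R M by fact
  have "\<ominus>\<^bsub>M\<^esub> \<zero>\<^bsub>M\<^esub> = \<zero>\<^bsub>M\<^esub>"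
    using M.r_neg[OF M.zero_closed] by simp
  then have "x \<ominus>\<^bsub>M\<^esub> \<zero>\<^bsub>M\<^esub> = x"
    using x unfolding a_minus_def by (metis M.r_zero)
  then show ?thesis
    using cst_eq_iff[OF M N x M.zero_closed] by (simp add: quot_mod_simps[OF M N])
qed

lemma quot_map_cst:
  assumes h: "h \<in> lin_maps R M M'" and M: "module R M" and N: "submodule N R M"
    and M': "module R M'" and N': "submodule N' R M'"
    and hN: "h ` N \<subseteq> N'" and x: "x \<in> carrier M"
  shows "quot_map M' N' h (cst M N x) = cst M' N' (h x)"
proof -
  interpret M: module R M by fact
  interpret M': module R M' by fact
  interpret N: abelian_subgroup N M by (rule abelian_subgroup_sm[OF M N])
  note s = sm_in[OF N] sm_in[OF N'] lin_mapsD[OF h]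
  show ?thesis
    unfolding quot_map_def
  proof
    show "N' <+>\<^bsub>M'\<^esub> h ` (cst M N x) \<subseteq> cst M' N' (h x)"
    proof
      fix z assume "z \<in> N' <+>\<^bsub>M'\<^esub> h ` (cst M N x)"
      then obtain a b where ab: "a \<in> N'" "b \<in> N" "z = a \<oplus>\<^bsub>M'\<^esub> h (b \<oplus>\<^bsub>M\<^esub> x)"
        by (auto simp: set_add_def' a_r_coset_def')
      then have "z = (a \<oplus>\<^bsub>M'\<^esub> h b) \<oplus>\<^bsub>M'\<^esub> h x"
        using x s by (simp add: M'.a_ac)
      moreover have "a \<oplus>\<^bsub>M'\<^esub> h b \<in> N'"
        using ab hN by (auto intro: sm_add[OF N'])
      ultimately show "z \<in> cst M' N' (h x)" by (auto simp: a_r_coset_def')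
    qed
    show "cst M' N' (h x) \<subseteq> N' <+>\<^bsub>M'\<^esub> h ` (cst M N x)"
    proof
      fix z assume "z \<in> cst M' N' (h x)"
      then obtain a where "a \<in> N'" "z = a \<oplus>\<^bsub>M'\<^esub> h x" by (auto simp: a_r_coset_def')
      moreover have "x \<in> cst M N x" by (rule N.a_rcos_self[OF x])
      ultimately show "z \<in> N' <+>\<^bsub>M'\<^esub> h ` (cst M N x)" by (auto simp: set_add_def')
    qed
  qed
qed

text \<open>The induced map is read off from a chosen representative of the coset; another
  representative differs by an element of \<open>N\<close>, on which \<open>h\<close>
  vanishes.\<close>

lemma quot_lift:
  assumes h: "h \<in> lin_maps R M P" and M: "module R M" and N: "submodule N R M" and P: "module R P"
    and hN: "\<And>x. x \<in> N \<Longrightarrow> h x = \<zero>\<^bsub>P\<^esub>"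
  obtains g where "g \<in> lin_maps R (quot_mod M N) P" "\<And>x. x \<in> carrier M \<Longrightarrow> g (cst M N x) = h x"
proof -
  interpret M: module R M by fact
  interpret P: module R P by fact
  define g where "g Z = h (SOME x. x \<in> carrier M \<and> cst M N x = Z)" for Z
  have g: "g (cst M N x) = h x" if x: "x \<in> carrier M" for x
  proof -
    define y where "y = (SOME y. y \<in> carrier M \<and> cst M N y = cst M N x)"
    have "y \<in> carrier M \<and> cst M N y = cst M N x"
      unfolding y_def by (rule someI[of _ x]) (use x in auto)
    then have y: "y \<in> carrier M" "y \<ominus>\<^bsub>M\<^esub> x \<in> N" using cst_eq_iff[OF M N _ x] by auto
    have "h y \<ominus>\<^bsub>P\<^esub> h x = \<zero>\<^bsub>P\<^esub>"
      using hN[OF y(2)] lin_minus[OF h M P y(1) x] by simp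
    then have "h y = h x"
      using P.add.inv_solve_right'[of "\<zero>\<^bsub>P\<^esub>" "h y" "h x"] lin_mapsD(1)[OF h] x y(1) by (simp add: a_minus_def)
    then show ?thesis by (simp add: g_def y_def)
  qed
  have "g \<in> lin_maps R (quot_mod M N) P"
    by (rule lin_mapsI)
      (auto simp: quot_mod_simps[OF M N] g lin_mapsD[OF h])
  then show thesis using that g by blast
qed

section \<open>Free modules\<close>

lemma free_mod_simps:
  "x \<in> carrier (free_mod R S) \<longleftrightarrow>
     (\<forall>s. x s \<in> carrier R) \<and> finite {s. x s \<noteq> \<zero>} \<and> {s. x s \<noteq> \<zero>} \<subseteq> S"
  "\<zero>\<^bsub>free_mod R S\<^esub> = (\<lambda>s. \<zero>)"
  "x \<oplus>\<^bsub>free_mod R S\<^esub> y = (\<lambda>s. x s \<oplus> y s)"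
  "c \<odot>\<^bsub>free_mod R S\<^esub> x = (\<lambda>s. c \<otimes> x s)"
  by (auto simp: free_mod_def)

lemma free_add_closed:
  assumes "x \<in> carrier (free_mod R S)" "y \<in> carrier (free_mod R S)"
  shows "(\<lambda>s. x s \<oplus> y s) \<in> carrier (free_mod R S)"
proof -
  have "{s. x s \<oplus> y s \<noteq> \<zero>} \<subseteq> {s. x s \<noteq> \<zero>} \<union> {s. y s \<noteq> \<zero>}" by auto
  then show ?thesis
    using assms by (auto simp: free_mod_simps intro: finite_subset)
qed

lemma free_smult_closed:
  assumes "c \<in> carrier R" "x \<in> carrier (free_mod R S)"
  shows "(\<lambda>s. c \<otimes> x s) \<in> carrier (free_mod R S)"
proof -
  have "{s. c \<otimes> x s \<noteq> \<zero>} \<subseteq> {s. x s \<noteq> \<zero>}" using assms by auto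
  then show ?thesis
    using assms by (auto simp: free_mod_simps intro: finite_subset)
qed

lemma free_module: "module R (free_mod R S)"
proof (rule moduleI)
  show "cring R" ..
  note d = free_mod_simps(2-4)
  have c: "x s \<in> carrier R" if "x \<in> carrier (free_mod R S)" for x s
    using that by (simp add: free_mod_simps)
  show "abelian_group (free_mod R S)"
  proof (rule abelian_groupI)
    fix x assume x: "x \<in> carrier (free_mod R S)"
    have "(\<lambda>s. (\<ominus> \<one>) \<otimes> x s) \<in> carrier (free_mod R S)"
      by (rule free_smult_closed) (use x in auto)
    moreover have "(\<lambda>s. (\<ominus> \<one>) \<otimes> x s) \<oplus>\<^bsub>free_mod R S\<^esub> x = \<zero>\<^bsub>free_mod R S\<^esub>"
      using c[OF x] by (simp add: d l_minus l_neg)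
    ultimately show "\<exists>y\<in>carrier (free_mod R S). y \<oplus>\<^bsub>free_mod R S\<^esub> x = \<zero>\<^bsub>free_mod R S\<^esub>" by blast
  next
    show "\<zero>\<^bsub>free_mod R S\<^esub> \<in> carrier (free_mod R S)" by (simp add: free_mod_simps)
  qed (auto simp: d c a_ac free_add_closed)
next
  fix a x assume "a \<in> carrier R" "x \<in> carrier (free_mod R S)"
  then show "a \<odot>\<^bsub>free_mod R S\<^esub> x \<in> carrier (free_mod R S)"
    unfolding free_mod_simps(4) by (rule free_smult_closed)
qed (auto simp: free_mod_simps m_assoc l_distr r_distr)

lemma free_gen_in: "s \<in> S \<Longrightarrow> free_gen R s \<in> carrier (free_mod R S)"
  by (auto simp: free_mod_simps free_gen_def intro: finite_subset[of _ "{s}"])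

lemma free_gen_span: "mod_span R (free_mod R S) (free_gen R ` S) = carrier (free_mod R S)"
proof
  let ?F = "free_mod R S"
  let ?H = "mod_span R ?F (free_gen R ` S)"
  have gS: "free_gen R ` S \<subseteq> carrier ?F" by (auto intro: free_gen_in)
  have H: "submodule ?H R ?F" by (rule span_sm[OF free_module gS])
  show "?H \<subseteq> carrier ?F" by (rule sm_subset[OF H])
  \<comment> \<open>Induction on a finite set containing the support: the coefficient at
    \<open>a\<close> is split off, and the rest has its support in the smaller set.\<close>
  have "x \<in> ?H" if "finite A" "x \<in> carrier ?F" "{s. x s \<noteq> \<zero>} \<subseteq> A" for x A
    using that
  proof (induction A arbitrary: x rule: finite_induct)
    case empty
    then have "x = \<zero>\<^bsub>?F\<^esub>" by (auto simp: free_mod_simps)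
    then show ?case using sm_zero[OF H] by simp
  next
    case (insert a A)
    show ?case
    proof (cases "x a = \<zero>")
      case True
      then show ?thesis using insert by (intro insert.IH) auto
    next
      case False
      then have a: "a \<in> S" and xa: "x s \<in> carrier R" for s
        using insert.prems by (auto simp: free_mod_simps)
      let ?y = "\<lambda>s. if s = a then \<zero> else x s"
      have "{s. ?y s \<noteq> \<zero>} \<subseteq> {s. x s \<noteq> \<zero>}" by auto
      then have "?y \<in> carrier ?F"
        using insert.prems by (auto simp: free_mod_simps intro: finite_subset)
      then have "?y \<in> ?H"
        using insert by (intro insert.IH) auto
      moreover have "x a \<odot>\<^bsub>?F\<^esub> free_gen R a \<in> ?H"
        by (rule sm_smult[OF H]) (use xa a span_incl[of "free_gen R ` S" ?F] in auto)
      ultimately have "?y \<oplus>\<^bsub>?F\<^esub> x a \<odot>\<^bsub>?F\<^esub> free_gen R a \<in> ?H"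
        by (rule sm_add[OF H])
      also have "?y \<oplus>\<^bsub>?F\<^esub> x a \<odot>\<^bsub>?F\<^esub> free_gen R a = x"
        using xa by (auto simp: free_mod_simps free_gen_def)
      finally show ?thesis .
    qed
  qed
  then show "carrier ?F \<subseteq> ?H" by (force simp: free_mod_simps)
qed

lemma lin_eq_on_span:
  assumes h: "h \<in> lin_maps R M N" and g: "g \<in> lin_maps R M N" and M: "module R M" and N: "module R N"
    and eq: "\<And>s. s \<in> S \<Longrightarrow> h s = g s" and S: "S \<subseteq> carrier M" and x: "x \<in> mod_span R M S"
  shows "h x = g x"
proof -
  interpret M: module R M by fact
  interpret N: module R N by fact
  have "submodule {x \<in> carrier M. h x = g x} R M"
    by (rule sm_I[OF M]) (use assms in \<open>auto simp: lin_mapsD lin_zero\<close>)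
  then have "mod_span R M S \<subseteq> {x \<in> carrier M. h x = g x}"
    by (rule span_least) (use S eq in auto)
  then show ?thesis using x by auto
qed

lemma free_lin_eq:
  assumes "h \<in> lin_maps R (free_mod R S) N" "g \<in> lin_maps R (free_mod R S) N" "module R N"
    and "\<And>s. s \<in> S \<Longrightarrow> h (free_gen R s) = g (free_gen R s)" "x \<in> carrier (free_mod R S)"
  shows "h x = g x"
  by (rule lin_eq_on_span[of h "free_mod R S" N g "free_gen R ` S"])
    (use assms in \<open>auto simp: free_module free_gen_span intro: free_gen_in\<close>)

text \<open>The linear extension of \<open>\<phi>\<close> given by the universal property of the
  free module. The sum runs over the support of \<open>x\<close>, which changes with
  \<open>x\<close>; linearity is therefore proved after enlarging the index set to a common finite
  one by \<open>free_ext_superset\<close>.\<close>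

definition free_ext :: "('k, 'v) module \<Rightarrow> ('s \<Rightarrow> 'v) \<Rightarrow> ('s \<Rightarrow> 'k) \<Rightarrow> 'v" where
  "free_ext M \<phi> x = (\<Oplus>\<^bsub>M\<^esub>s\<in>{s. x s \<noteq> \<zero>}. x s \<odot>\<^bsub>M\<^esub> \<phi> s)"

lemma free_ext_superset:
  assumes M: "module R M" and \<phi>: "\<And>s. s \<in> S \<Longrightarrow> \<phi> s \<in> carrier M"
    and x: "x \<in> carrier (free_mod R S)" and A: "finite A" "{s. x s \<noteq> \<zero>} \<subseteq> A" "A \<subseteq> S"
  shows "free_ext M \<phi> x = (\<Oplus>\<^bsub>M\<^esub>s\<in>A. x s \<odot>\<^bsub>M\<^esub> \<phi> s)"
proof -
  interpret M: module R M by fact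
  show ?thesis
    unfolding free_ext_def
    by (rule M.add.finprod_mono_neutral_cong_left)
      (use A x \<phi> in \<open>auto simp: free_mod_simps intro!: M.smult_l_null M.smult_closed\<close>)
qed

lemma free_ext_lin:
  assumes M: "module R M" and \<phi>: "\<And>s. s \<in> S \<Longrightarrow> \<phi> s \<in> carrier M"
  shows "free_ext M \<phi> \<in> lin_maps R (free_mod R S) M"
proof -
  interpret M: module R M by fact
  let ?F = "free_mod R S"
  have cl: "(\<lambda>s. x s \<odot>\<^bsub>M\<^esub> \<phi> s) \<in> A \<rightarrow> carrier M" if "x \<in> carrier ?F" "A \<subseteq> S" for x A
    using that \<phi> by (auto simp: free_mod_simps intro!: M.smult_closed)
  show ?thesis
  proof (rule lin_mapsI)
    fix x assume x: "x \<in> carrier ?F"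
    then show "free_ext M \<phi> x \<in> carrier M"
      unfolding free_ext_def by (intro M.finsum_closed cl) (auto simp: free_mod_simps)
  next
    fix x y assume x: "x \<in> carrier ?F" and y: "y \<in> carrier ?F"
    let ?A = "{s. x s \<noteq> \<zero>} \<union> {s. y s \<noteq> \<zero>}"
    have A: "finite ?A" "?A \<subseteq> S" using x y by (auto simp: free_mod_simps)
    have xy: "(\<lambda>s. x s \<oplus> y s) \<in> carrier ?F" by (rule free_add_closed[OF x y])
    have "free_ext M \<phi> (x \<oplus>\<^bsub>?F\<^esub> y) = (\<Oplus>\<^bsub>M\<^esub>s\<in>?A. (x s \<oplus> y s) \<odot>\<^bsub>M\<^esub> \<phi> s)"
      unfolding free_mod_simps(3) by (rule free_ext_superset[OF M \<phi> xy A(1) _ A(2)]) auto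
    also have "\<dots> = (\<Oplus>\<^bsub>M\<^esub>s\<in>?A. x s \<odot>\<^bsub>M\<^esub> \<phi> s \<oplus>\<^bsub>M\<^esub> y s \<odot>\<^bsub>M\<^esub> \<phi> s)"
      by (rule M.finsum_cong')
        (use A x y \<phi> in \<open>auto intro!: M.smult_l_distr M.a_closed M.smult_closed simp: free_mod_simps\<close>)
    also have "\<dots> = (\<Oplus>\<^bsub>M\<^esub>s\<in>?A. x s \<odot>\<^bsub>M\<^esub> \<phi> s) \<oplus>\<^bsub>M\<^esub> (\<Oplus>\<^bsub>M\<^esub>s\<in>?A. y s \<odot>\<^bsub>M\<^esub> \<phi> s)"
      by (rule M.finsum_addf[OF cl[OF x A(2)] cl[OF y A(2)]])
    also have "(\<Oplus>\<^bsub>M\<^esub>s\<in>?A. x s \<odot>\<^bsub>M\<^esub> \<phi> s) = free_ext M \<phi> x"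
      by (rule free_ext_superset[OF M \<phi> x A(1) _ A(2), symmetric]) auto
    also have "(\<Oplus>\<^bsub>M\<^esub>s\<in>?A. y s \<odot>\<^bsub>M\<^esub> \<phi> s) = free_ext M \<phi> y"
      by (rule free_ext_superset[OF M \<phi> y A(1) _ A(2), symmetric]) auto
    finally show "free_ext M \<phi> (x \<oplus>\<^bsub>?F\<^esub> y) = free_ext M \<phi> x \<oplus>\<^bsub>M\<^esub> free_ext M \<phi> y" .
  next
    fix c x assume c: "c \<in> carrier R" and x: "x \<in> carrier ?F"
    let ?A = "{s. x s \<noteq> \<zero>}"
    have A: "finite ?A" "?A \<subseteq> S" using x by (auto simp: free_mod_simps)
    have "free_ext M \<phi> (c \<odot>\<^bsub>?F\<^esub> x) = (\<Oplus>\<^bsub>M\<^esub>s\<in>?A. (c \<otimes> x s) \<odot>\<^bsub>M\<^esub> \<phi> s)"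
      unfolding free_mod_simps(4)
      by (rule free_ext_superset[OF M \<phi> free_smult_closed[OF c x] A(1) _ A(2)]) (use c in auto)
    also have "\<dots> = (\<Oplus>\<^bsub>M\<^esub>s\<in>?A. c \<odot>\<^bsub>M\<^esub> (x s \<odot>\<^bsub>M\<^esub> \<phi> s))"
      by (rule M.finsum_cong')
        (use A x c \<phi> in \<open>auto intro!: M.smult_assoc1 M.smult_closed simp: free_mod_simps\<close>)
    also have "\<dots> = c \<odot>\<^bsub>M\<^esub> free_ext M \<phi> x"
      unfolding free_ext_def by (rule M.finsum_smult_ldistr[symmetric, OF A(1) c cl[OF x A(2)]])
    finally show "free_ext M \<phi> (c \<odot>\<^bsub>?F\<^esub> x) = c \<odot>\<^bsub>M\<^esub> free_ext M \<phi> x" .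
  qed
qed

lemma free_ext_gen:
  assumes M: "module R M" and \<phi>: "\<phi> s \<in> carrier M"
  shows "free_ext M \<phi> (free_gen R s) = \<phi> s"
proof -
  interpret M: module R M by fact
  have "free_ext M \<phi> (free_gen R s) = (\<Oplus>\<^bsub>M\<^esub>s'\<in>{s}. free_gen R s s' \<odot>\<^bsub>M\<^esub> \<phi> s')"
    by (rule free_ext_superset[OF M, of "{s}"]) (use \<phi> free_gen_in[of s "{s}"] in \<open>auto simp: free_gen_def split: if_splits\<close>)
  also have "\<dots> = free_gen R s s \<odot>\<^bsub>M\<^esub> \<phi> s"
    using \<phi> by (subst M.finsum_insert) (auto simp: free_gen_def)
  also have "\<dots> = \<phi> s" using \<phi> by (simp add: free_gen_def)
  finally show ?thesis .
qed

lemma free_map_superset: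
  assumes x: "x \<in> carrier (free_mod R S)" and A: "finite A" "{s. x s \<noteq> \<zero>} \<subseteq> A"
  shows "free_map R \<phi> x t = (\<Oplus>s\<in>{s \<in> A. \<phi> s = t}. x s)"
  unfolding free_map_def
  by (rule add.finprod_mono_neutral_cong_left) (use A x in \<open>auto simp: free_mod_simps\<close>)

lemma free_map_lin:
  assumes \<phi>: "\<And>s. s \<in> S \<Longrightarrow> \<phi> s \<in> T"
  shows "free_map R \<phi> \<in> lin_maps R (free_mod R S) (free_mod R T)"
proof (rule lin_mapsI)
  fix x assume x: "x \<in> carrier (free_mod R S)"
  then have c: "x s \<in> carrier R" for s by (simp add: free_mod_simps)
  have "{t. free_map R \<phi> x t \<noteq> \<zero>} \<subseteq> \<phi> ` {s. x s \<noteq> \<zero>}"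
  proof
    fix t assume t: "t \<in> {t. free_map R \<phi> x t \<noteq> \<zero>}"
    have "{s. x s \<noteq> \<zero> \<and> \<phi> s = t} \<noteq> {}"
    proof
      assume "{s. x s \<noteq> \<zero> \<and> \<phi> s = t} = {}"
      then have "free_map R \<phi> x t = \<zero>" unfolding free_map_def by (simp only: finsum_empty)
      then show False using t by simp
    qed
    then show "t \<in> \<phi> ` {s. x s \<noteq> \<zero>}" by auto
  qed
  moreover have "finite {s. x s \<noteq> \<zero>}" "{s. x s \<noteq> \<zero>} \<subseteq> S" using x by (auto simp: free_mod_simps)
  moreover have "free_map R \<phi> x t \<in> carrier R" for t
    unfolding free_map_def by (rule finsum_closed) (use c in auto)
  ultimately show "free_map R \<phi> x \<in> carrier (free_mod R T)"
    using \<phi> by (auto simp: free_mod_simps intro: finite_subset)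
next
  fix x y assume x: "x \<in> carrier (free_mod R S)" and y: "y \<in> carrier (free_mod R S)"
  then have c: "x s \<in> carrier R" "y s \<in> carrier R" for s by (simp_all add: free_mod_simps)
  let ?A = "{s. x s \<noteq> \<zero>} \<union> {s. y s \<noteq> \<zero>}"
  have A: "finite ?A" using x y by (auto simp: free_mod_simps)
  have "free_map R \<phi> (x \<oplus>\<^bsub>free_mod R S\<^esub> y) t = free_map R \<phi> x t \<oplus> free_map R \<phi> y t" for t
  proof -
    have "free_map R \<phi> (\<lambda>s. x s \<oplus> y s) t = (\<Oplus>s\<in>{s \<in> ?A. \<phi> s = t}. x s \<oplus> y s)"
      by (rule free_map_superset[OF free_add_closed[OF x y] A]) auto
    also have "\<dots> = (\<Oplus>s\<in>{s \<in> ?A. \<phi> s = t}. x s) \<oplus> (\<Oplus>s\<in>{s \<in> ?A. \<phi> s = t}. y s)"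
      by (rule finsum_addf) (use c in auto)
    also have "(\<Oplus>s\<in>{s \<in> ?A. \<phi> s = t}. x s) = free_map R \<phi> x t"
      by (rule free_map_superset[OF x A, symmetric]) auto
    also have "(\<Oplus>s\<in>{s \<in> ?A. \<phi> s = t}. y s) = free_map R \<phi> y t"
      by (rule free_map_superset[OF y A, symmetric]) auto
    finally show ?thesis by (simp add: free_mod_simps)
  qed
  then show "free_map R \<phi> (x \<oplus>\<^bsub>free_mod R S\<^esub> y) = free_map R \<phi> x \<oplus>\<^bsub>free_mod R T\<^esub> free_map R \<phi> y"
    by (auto simp: free_mod_simps)
next
  fix a x assume a: "a \<in> carrier R" and x: "x \<in> carrier (free_mod R S)"
  then have c: "x s \<in> carrier R" for s by (simp add: free_mod_simps)
  let ?A = "{s. x s \<noteq> \<zero>}"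
  have A: "finite ?A" using x by (auto simp: free_mod_simps)
  have "free_map R \<phi> (a \<odot>\<^bsub>free_mod R S\<^esub> x) t = a \<otimes> free_map R \<phi> x t" for t
  proof -
    have "free_map R \<phi> (\<lambda>s. a \<otimes> x s) t = (\<Oplus>s\<in>{s \<in> ?A. \<phi> s = t}. a \<otimes> x s)"
      by (rule free_map_superset[OF free_smult_closed[OF a x] A]) (use a in auto)
    also have "\<dots> = a \<otimes> (\<Oplus>s\<in>{s \<in> ?A. \<phi> s = t}. x s)"
      by (rule finsum_rdistr[symmetric]) (use a c A in auto)
    finally show ?thesis by (simp add: free_mod_simps free_map_def)
  qed
  then show "free_map R \<phi> (a \<odot>\<^bsub>free_mod R S\<^esub> x) = a \<odot>\<^bsub>free_mod R T\<^esub> free_map R \<phi> x"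
    by (auto simp: free_mod_simps)
qed

lemma free_map_gen: "free_map R \<phi> (free_gen R s) = free_gen R (\<phi> s)"
proof
  fix t
  have "free_map R \<phi> (free_gen R s) t = (\<Oplus>s'\<in>{s' \<in> {s}. \<phi> s' = t}. free_gen R s s')"
    by (rule free_map_superset[of _ "{s}"])
      (auto intro: free_gen_in, auto simp: free_gen_def split: if_splits)
  also have "\<dots> = (if \<phi> s = t then \<one> else \<zero>)"
  proof (cases "\<phi> s = t")
    case True
    then have "{s' \<in> {s}. \<phi> s' = t} = {s}" by auto
    then show ?thesis using True by (simp add: free_gen_def)
  next
    case False
    then have "{s' \<in> {s}. \<phi> s' = t} = {}" by auto
    then show ?thesis using False by (simp only: finsum_empty if_False)
  qed
  finally show "free_map R \<phi> (free_gen R s) t = free_gen R (\<phi> s) t"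
    by (simp add: free_gen_def)
qed

end

section \<open>Points and morphisms\<close>

text \<open>An object is viewed as one finite set, the disjoint union of its coordinate sets.
  Morphisms become injections over the index set, acting through \<open>pmap\<close>, and images and
  their complements are plain sets of points.\<close>

definition pts :: "'m obj \<Rightarrow> ('m \<times> nat) set" where
  "pts t = {(i, a). 1 \<le> a \<and> a \<le> t i}"

definition pmap :: "'m mor \<Rightarrow> 'm \<times> nat \<Rightarrow> 'm \<times> nat" where
  "pmap f = (\<lambda>(i, a). (i, f i a))"

text \<open>The object that a set of points is a copy of: morphisms with image \<open>S\<close>
  start at \<open>csize S\<close> (\<open>csize_mimg\<close>), and there is one
  (\<open>emb_exists\<close>).\<close>

definition csize :: "('m \<times> nat) set \<Rightarrow> 'm obj" where
  "csize S = (\<lambda>i. card {a. (i, a) \<in> S})"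

definition mk_mor :: "'m obj \<Rightarrow> 'm mor \<Rightarrow> 'm mor" where
  "mk_mor n \<phi> = (\<lambda>i. restrict (\<phi> i) {1..n i})"

lemma pts_iff: "(i, a) \<in> pts t \<longleftrightarrow> 1 \<le> a \<and> a \<le> t i"
  by (simp add: pts_def)

lemma pmap_simp: "pmap f (i, a) = (i, f i a)"
  by (simp add: pmap_def)

lemma finite_pts [simp]: "finite (pts (t :: 'm :: finite obj))"
proof -
  have "pts t = (SIGMA i:UNIV. {1..t i})" by (auto simp: pts_def)
  then show ?thesis by simp
qed

lemma CmorD:
  assumes "f \<in> Cmor n t"
  shows "p \<in> pts n \<Longrightarrow> pmap f p \<in> pts t" and "inj_on (pmap f) (pts n)"
    and "f i \<in> extensional {1..n i}" and "inj_on (f i) {1..n i}"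
    and "1 \<le> a \<Longrightarrow> a \<le> n i \<Longrightarrow> 1 \<le> f i a \<and> f i a \<le> t i"
proof -
  have f: "f i \<in> {1..n i} \<rightarrow>\<^sub>E {1..t i}" "inj_on (f i) {1..n i}" for i
    using assms by (auto simp: Cmor_def)
  show *: "1 \<le> a \<Longrightarrow> a \<le> n i \<Longrightarrow> 1 \<le> f i a \<and> f i a \<le> t i" for i a
    using f(1)[of i] by (auto simp: PiE_def Pi_def)
  show "p \<in> pts n \<Longrightarrow> pmap f p \<in> pts t"
    using * by (cases p) (auto simp: pmap_simp pts_def)
  show "inj_on (pmap f) (pts n)"
  proof (rule inj_onI)
    fix p q assume "p \<in> pts n" "q \<in> pts n" "pmap f p = pmap f q"
    then show "p = q"
      using f(2) by (cases p; cases q) (auto simp: pmap_simp pts_def inj_on_def)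
  qed
  show "f i \<in> extensional {1..n i}" "inj_on (f i) {1..n i}"
    using f[of i] by (auto simp: PiE_def)
qed

lemma Cmor_inj:
  assumes "f \<in> Cmor n t" "f i a = f i b" "1 \<le> a" "a \<le> n i" "1 \<le> b" "b \<le> n i"
  shows "a = b"
  using inj_onD[OF CmorD(4)[OF assms(1)] assms(2)] assms(3-6) by simp

lemma CmorI:
  assumes "\<And>i. f i \<in> extensional {1..n i}" "\<And>i a. 1 \<le> a \<Longrightarrow> a \<le> n i \<Longrightarrow> 1 \<le> f i a \<and> f i a \<le> t i"
    and "\<And>i. inj_on (f i) {1..n i}"
  shows "f \<in> Cmor n t"
  using assms by (auto simp: Cmor_def PiE_def)

lemma mk_morI:
  assumes "\<And>i a. 1 \<le> a \<Longrightarrow> a \<le> n i \<Longrightarrow> 1 \<le> \<phi> i a \<and> \<phi> i a \<le> t i" "\<And>i. inj_on (\<phi> i) {1..n i}"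
  shows "mk_mor n \<phi> \<in> Cmor n t"
  by (rule CmorI) (use assms in \<open>auto simp: mk_mor_def inj_on_def\<close>)

lemma pmap_mk_mor: "p \<in> pts n \<Longrightarrow> pmap (mk_mor n \<phi>) p = pmap \<phi> p"
  by (cases p) (auto simp: pmap_simp mk_mor_def pts_def)

lemma Cmor_eqI:
  assumes f: "f \<in> Cmor n t" and g: "g \<in> Cmor n u" and eq: "\<And>p. p \<in> pts n \<Longrightarrow> pmap f p = pmap g p"
  shows "f = g"
proof
  fix i
  show "f i = g i"
  proof (rule extensionalityI[of _ "{1..n i}"])
    fix a assume "a \<in> {1..n i}"
    then show "f i a = g i a" using eq[of "(i, a)"] by (simp add: pts_def pmap_simp)
  qed (use CmorD(3)[OF f] CmorD(3)[OF g] in auto)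
qed

lemma pmap_image_subset: "f \<in> Cmor n t \<Longrightarrow> S \<subseteq> pts n \<Longrightarrow> pmap f ` S \<subseteq> pts t"
  using CmorD(1)[of f n t] by auto

lemma Ccomp_in:
  assumes f: "f \<in> Cmor n t" and g: "g \<in> Cmor t u"
  shows "Ccomp n g f \<in> Cmor n u"
proof (rule CmorI)
  fix i
  show "inj_on (Ccomp n g f i) {1..n i}"
  proof (rule inj_onI)
    fix a b assume *: "a \<in> {1..n i}" "b \<in> {1..n i}" "Ccomp n g f i a = Ccomp n g f i b"
    have "f i a = f i b"
      by (rule inj_onD[OF CmorD(4)[OF g, of i]])
        (use * CmorD(5)[OF f, of a i] CmorD(5)[OF f, of b i] in \<open>auto simp: Ccomp_def compose_def\<close>)
    then show "a = b" using inj_onD[OF CmorD(4)[OF f, of i]] * by blast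
  qed
  show "Ccomp n g f i \<in> extensional {1..n i}" by (simp add: Ccomp_def)
  fix a assume "1 \<le> a" "a \<le> n i"
  then show "1 \<le> Ccomp n g f i a \<and> Ccomp n g f i a \<le> u i"
    using CmorD(5)[OF f, of a i] CmorD(5)[OF g, of "f i a" i] by (simp add: Ccomp_def compose_def)
qed

lemma pmap_Ccomp: "p \<in> pts n \<Longrightarrow> pmap (Ccomp n g f) p = pmap g (pmap f p)"
  by (cases p) (auto simp: pmap_simp Ccomp_def compose_def pts_def)

lemma pmap_Ccomp_image: "S \<subseteq> pts n \<Longrightarrow> pmap (Ccomp n g f) ` S = pmap g ` pmap f ` S"
  unfolding image_image by (rule image_cong) (auto simp: pmap_Ccomp)

lemma Cid_in: "Cid n \<in> Cmor n n"
  by (rule CmorI) (auto simp: Cid_def inj_on_def)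

lemma pmap_Cid: "p \<in> pts n \<Longrightarrow> pmap (Cid n) p = p"
  by (cases p) (auto simp: pmap_simp Cid_def pts_def)

lemma pmap_Cid_image: "S \<subseteq> pts n \<Longrightarrow> pmap (Cid n) ` S = S"
  using image_cong[of S S "pmap (Cid n)" "\<lambda>p. p"] pmap_Cid by fastforce

lemma Ccomp_id_right:
  assumes f: "f \<in> Cmor n t"
  shows "Ccomp n f (Cid n) = f"
  by (rule Cmor_eqI[OF Ccomp_in[OF Cid_in f] f]) (simp add: pmap_Ccomp pmap_Cid)

lemma Ccomp_id_left:
  assumes f: "f \<in> Cmor n t"
  shows "Ccomp n (Cid t) f = f"
  by (rule Cmor_eqI[OF Ccomp_in[OF f Cid_in] f]) (simp add: pmap_Ccomp pmap_Cid CmorD(1)[OF f])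

lemma Ccomp_assoc:
  assumes f: "f \<in> Cmor n t" and g: "g \<in> Cmor t u" and h: "h \<in> Cmor u v"
  shows "Ccomp n h (Ccomp n g f) = Ccomp n (Ccomp t h g) f"
  by (rule Cmor_eqI[OF Ccomp_in[OF Ccomp_in[OF f g] h] Ccomp_in[OF f Ccomp_in[OF g h]]])
    (simp add: pmap_Ccomp CmorD(1)[OF f])

lemma finite_Cmor: "finite (Cmor n (t :: 'm :: finite obj))"
proof (rule finite_subset)
  show "Cmor n t \<subseteq> (\<Pi>\<^sub>E i\<in>UNIV. {1..n i} \<rightarrow>\<^sub>E {1..t i})"
    by (auto simp: Cmor_def)
qed (auto intro!: finite_PiE)

section \<open>Sets of points as subobjects\<close>

lemma card_fibre_pts: "{a. (i, a) \<in> pts t} = {1..t i}"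
  by (auto simp: pts_def)

lemma csize_pts [simp]: "csize (pts t) = t"
  by (auto simp: csize_def card_fibre_pts)

lemma finite_fibre: "finite S \<Longrightarrow> finite {a. (i, a) \<in> S}"
  by (rule finite_subset[of _ "snd ` S"]) force+

lemma finite_fibre_pts: "S \<subseteq> pts t \<Longrightarrow> finite {a. (i, a) \<in> S}"
  by (rule finite_subset[of _ "{1..t i}"]) (auto simp: pts_def)

lemma csize_mono: "S \<subseteq> T \<Longrightarrow> T \<subseteq> pts t \<Longrightarrow> csize S \<le> csize T"
  unfolding le_fun_def csize_def by (blast intro: card_mono finite_fibre_pts)

lemma card_csize: "finite S \<Longrightarrow> card S = deg (csize (S :: ('m :: finite \<times> nat) set))"
proof -
  assume S: "finite S"
  have "S = (SIGMA i:UNIV. {a. (i, a) \<in> S})" by auto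
  then have "card S = card (SIGMA i:UNIV. {a. (i, a) \<in> S})" by simp
  also have "\<dots> = deg (csize S)"
    unfolding deg_def csize_def by (rule card_SigmaI) (auto simp: finite_fibre S)
  finally show ?thesis .
qed

lemma card_pts: "card (pts (t :: 'm :: finite obj)) = deg t"
  by (simp add: card_csize)

lemma csize_image:
  assumes f: "f \<in> Cmor n t" and S: "S \<subseteq> pts n"
  shows "csize (pmap f ` S) = csize S"
proof
  fix i
  have "{a. (i, a) \<in> pmap f ` S} = f i ` {a. (i, a) \<in> S}" by (force simp: pmap_def)
  moreover have "inj_on (f i) {a. (i, a) \<in> S}"
    using CmorD(4)[OF f, of i] S by (auto simp: inj_on_def pts_def subset_iff)
  ultimately show "csize (pmap f ` S) i = csize S i"
    by (simp add: csize_def card_image)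
qed

lemma csize_mimg: "f \<in> Cmor n t \<Longrightarrow> csize (pmap f ` pts n) = n"
  by (simp add: csize_image)

lemma Cmor_le: "f \<in> Cmor n t \<Longrightarrow> n \<le> t"
  using csize_mono[OF pmap_image_subset[of f n t "pts n"], of t] by (simp add: csize_mimg)

lemma Cmor_self_image: "f \<in> Cmor n n \<Longrightarrow> pmap f ` pts n = pts (n :: 'm :: finite obj)"
  by (rule endo_inj_surj) (auto simp: CmorD(2) dest: CmorD(1))

lemma deg_mono: "n \<le> t \<Longrightarrow> deg n \<le> deg (t :: 'm :: finite obj)"
  unfolding deg_def by (rule sum_mono) (auto simp: le_fun_def)

lemma deg_strict: "n \<le> t \<Longrightarrow> n \<noteq> t \<Longrightarrow> deg n < deg (t :: 'm :: finite obj)"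
proof -
  assume *: "n \<le> t" "n \<noteq> t"
  then obtain i where "n i \<noteq> t i" by auto
  then have "n i < t i" using * by (simp add: le_fun_def le_neq_implies_less)
  then show ?thesis
    unfolding deg_def by (intro sum_strict_mono_ex1) (use * in \<open>auto simp: le_fun_def\<close>)
qed

text \<open>Each value of \<open>f\<close> has a preimage under \<open>e\<close>, and these
  preimages are the values of \<open>g\<close>; they are distinct because those of \<open>f\<close>
  are.\<close>

lemma factor_through:
  assumes f: "f \<in> Cmor n t" and e: "e \<in> Cmor k t" and sub: "pmap f ` pts n \<subseteq> pmap e ` pts k"
  obtains g where "g \<in> Cmor n k" "f = Ccomp n e g"
proof -
  define \<phi> where "\<phi> i a = (SOME b. 1 \<le> b \<and> b \<le> k i \<and> e i b = f i a)" for i a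
  have \<phi>: "1 \<le> \<phi> i a \<and> \<phi> i a \<le> k i \<and> e i (\<phi> i a) = f i a" if "1 \<le> a" "a \<le> n i" for i a
  proof -
    have "(i, f i a) \<in> pmap e ` pts k" using that sub by (force simp: pts_def pmap_simp)
    then obtain b where "1 \<le> b \<and> b \<le> k i \<and> e i b = f i a" by (auto simp: pts_def pmap_simp)
    then show ?thesis unfolding \<phi>_def by (rule someI)
  qed
  have g: "mk_mor n \<phi> \<in> Cmor n k"
  proof (rule mk_morI)
    show "inj_on (\<phi> i) {1..n i}" for i
    proof (rule inj_onI)
      fix a b assume *: "a \<in> {1..n i}" "b \<in> {1..n i}" "\<phi> i a = \<phi> i b"
      then have "f i a = f i b" using \<phi>[of a i] \<phi>[of b i] by auto
      then show "a = b" using Cmor_inj[OF f, of i a b] * by simp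
    qed
  qed (use \<phi> in auto)
  have "f = Ccomp n e (mk_mor n \<phi>)"
    by (rule Cmor_eqI[OF f Ccomp_in[OF g e]]) (use \<phi> in \<open>auto simp: pmap_Ccomp pmap_mk_mor pts_def pmap_simp\<close>)
  then show thesis using that g by blast
qed

text \<open>Each fibre of \<open>S\<close> over an index is finite and can be enumerated by an
  initial segment of the positive integers.\<close>

lemma emb_exists:
  assumes S: "S \<subseteq> pts t"
  obtains e where "e \<in> Cmor (csize S) t" "pmap e ` pts (csize S) = S"
proof -
  have "\<forall>i. \<exists>h. bij_betw h {1..csize S i} {a. (i, a) \<in> S}"
    unfolding csize_def using ex_bij_betw_nat_finite_1[OF finite_fibre_pts[OF S]] by auto
  then obtain h where h: "\<And>i. bij_betw (h i) {1..csize S i} {a. (i, a) \<in> S}" by metis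
  have hS: "h i ` {1..csize S i} = {a. (i, a) \<in> S}" for i
    using h[of i] by (simp add: bij_betw_def)
  have "(i, h i a) \<in> S" if "1 \<le> a" "a \<le> csize S i" for i a
    using hS[of i] that by auto
  then have "(i, h i a) \<in> pts t" if "1 \<le> a" "a \<le> csize S i" for i a
    using that S by auto
  then have 1: "mk_mor (csize S) h \<in> Cmor (csize S) t"
    by (intro mk_morI) (use h in \<open>auto simp: pts_def bij_betw_def\<close>)
  have "pmap (mk_mor (csize S) h) ` pts (csize S) = pmap h ` pts (csize S)"
    by (rule image_cong) (auto simp: pmap_mk_mor)
  also have "\<dots> = S"
  proof safe
    fix i a assume "(i, a) \<in> S"
    then have "a \<in> h i ` {1..csize S i}" using hS[of i] by auto
    then obtain b where "b \<in> {1..csize S i}" "a = h i b" by auto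
    then show "(i, a) \<in> pmap h ` pts (csize S)"
      by (intro image_eqI[of _ _ "(i, b)"]) (auto simp: pts_def pmap_simp)
  next
    fix i a i' b assume "(i, a) = pmap h (i', b)" "(i', b) \<in> pts (csize S)"
    then show "(i, a) \<in> S" using hS[of i] by (auto simp: pts_def pmap_simp)
  qed
  finally show thesis using that 1 by blast
qed

text \<open>An endomorphism is onto by finiteness, so the identity factors through it and it has a
  right inverse \<open>g\<close>. The same holds for \<open>g\<close>, and a right inverse of
  \<open>g\<close> must be \<open>f\<close>.\<close>

lemma iso_inverse:
  assumes f: "f \<in> Cmor n (n :: 'm :: finite obj)"
  obtains g where "g \<in> Cmor n n" "Ccomp n f g = Cid n" "Ccomp n g f = Cid n"
proof -
  have right: "\<exists>g\<in>Cmor n n. Ccomp n f g = Cid n" if f: "f \<in> Cmor n n" for f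
  proof (rule factor_through[OF Cid_in f])
    show "pmap (Cid n) ` pts n \<subseteq> pmap f ` pts n"
      by (simp add: Cmor_self_image[OF f] Cmor_self_image[OF Cid_in])
  qed auto
  obtain g where g: "g \<in> Cmor n n" "Ccomp n f g = Cid n" using right[OF f] by blast
  obtain h where h: "h \<in> Cmor n n" "Ccomp n g h = Cid n" using right[OF g(1)] by blast
  have "f = Ccomp n f (Ccomp n g h)" using h Ccomp_id_right[OF f] by simp
  also have "\<dots> = h" using Ccomp_assoc[OF h(1) g(1) f] g h by (simp add: Ccomp_id_left)
  finally show thesis using that g h by simp
qed

section \<open>Factoring through the morphisms that add one point\<close>

lemma pi_mor_in: "pi_mor n i \<in> Cmor n (add1 i n)"
  by (rule CmorI) (auto simp: pi_mor_def add1_def inj_on_def)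

text \<open>The point \<open>b\<close> that \<open>f\<close> misses becomes the value of
  \<open>g\<close> at the new lowest point of coordinate \<open>i\<close>, and the old points move
  up by one. Hence whatever \<open>pi_mor n i\<close> kills is killed by every morphism that misses
  a point of coordinate \<open>i\<close>.\<close>

lemma factor_pi:
  assumes f: "f \<in> Cmor n t" and b: "(i, b) \<in> pts t" "(i, b) \<notin> pmap f ` pts n"
  obtains g where "g \<in> Cmor (add1 i n) t" "f = Ccomp n g (pi_mor n i)"
proof -
  define \<phi> where "\<phi> j a = (if j = i then if a = 1 then b else f j (a - 1) else f j a)" for j a
  have fb: "f i a \<noteq> b" if "1 \<le> a" "a \<le> n i" for a
    using that b(2) by (force simp: pts_def pmap_simp)
  have g: "mk_mor (add1 i n) \<phi> \<in> Cmor (add1 i n) t"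
  proof (rule mk_morI)
    fix j a assume "1 \<le> a" "a \<le> add1 i n j"
    then show "1 \<le> \<phi> j a \<and> \<phi> j a \<le> t j"
      using CmorD(5)[OF f, of a j] CmorD(5)[OF f, of "a - 1" j] b(1)
      by (auto simp: \<phi>_def add1_def pts_def split: if_splits)
  next
    fix j
    show "inj_on (\<phi> j) {1..add1 i n j}"
    proof (rule inj_onI)
      fix x y assume *: "x \<in> {1..add1 i n j}" "y \<in> {1..add1 i n j}" "\<phi> j x = \<phi> j y"
      have inj: "f j u = f j v \<Longrightarrow> u = v" if "1 \<le> u" "u \<le> n j" "1 \<le> v" "v \<le> n j" for u v
        using Cmor_inj[OF f, of j u v] that by simp
      show "x = y"
      proof (cases "j = i")
        case False
        then show ?thesis using * inj by (auto simp: \<phi>_def add1_def)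
      next
        case True
        then have xy: "1 \<le> x" "x \<le> n i + 1" "1 \<le> y" "y \<le> n i + 1"
          and e: "(if x = 1 then b else f i (x - 1)) = (if y = 1 then b else f i (y - 1))"
          using * by (auto simp: \<phi>_def add1_def)
        consider "x = 1" "y = 1" | "x = 1" "y \<noteq> 1" | "x \<noteq> 1" "y = 1" | "x \<noteq> 1" "y \<noteq> 1" by blast
        then show ?thesis
        proof cases
          case 4
          then have "x - 1 = y - 1" using e xy True inj[of "x - 1" "y - 1"] by auto
          then show ?thesis using xy 4 by auto
        next
          case 2
          then have "f i (y - 1) \<noteq> b" using xy by (intro fb) auto
          then show ?thesis using e 2 by simp
        next
          case 3
          then have "f i (x - 1) \<noteq> b" using xy by (intro fb) auto
          then show ?thesis using e 3 by simp
        qed simp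
      qed
    qed
  qed
  have "f = Ccomp n (mk_mor (add1 i n) \<phi>) (pi_mor n i)"
  proof (rule Cmor_eqI[OF f Ccomp_in[OF pi_mor_in g]])
    fix p assume p: "p \<in> pts n"
    then have "pmap (pi_mor n i) p \<in> pts (add1 i n)" by (rule CmorD(1)[OF pi_mor_in])
    then have "pmap (Ccomp n (mk_mor (add1 i n) \<phi>) (pi_mor n i)) p = pmap \<phi> (pmap (pi_mor n i) p)"
      by (simp add: pmap_Ccomp[OF p] pmap_mk_mor)
    then show "pmap f p = pmap (Ccomp n (mk_mor (add1 i n) \<phi>) (pi_mor n i)) p"
      using p by (cases p) (auto simp: pmap_simp pts_def \<phi>_def pi_mor_def)
  qed
  then show thesis using that g by blast
qed

lemma missing_point:
  assumes f: "f \<in> Cmor n t" and "n \<noteq> t"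
  obtains i b where "(i, b) \<in> pts t" "(i, b) \<notin> pmap f ` pts n"
proof -
  have "pmap f ` pts n \<noteq> pts t" using csize_mimg[OF f] assms(2) by (metis csize_pts)
  moreover have "pmap f ` pts n \<subseteq> pts t" by (rule pmap_image_subset[OF f]) simp
  ultimately obtain p where "p \<in> pts t" "p \<notin> pmap f ` pts n" by blast
  then show thesis using that by (cases p) auto
qed

lemma missing_point_coord:
  assumes f: "f \<in> Cmor n t" and "n i < t i"
  obtains b where "(i, b) \<in> pts t" "(i, b) \<notin> pmap f ` pts n"
proof -
  have "\<not> {a. (i, a) \<in> pts t} \<subseteq> {a. (i, a) \<in> pmap f ` pts n}"
  proof
    assume "{a. (i, a) \<in> pts t} \<subseteq> {a. (i, a) \<in> pmap f ` pts n}"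
    then have "csize (pts t) i \<le> csize (pmap f ` pts n) i"
      unfolding csize_def
      by (intro card_mono finite_fibre_pts[OF pmap_image_subset[OF f subset_refl]]) auto
    then show False using csize_mimg[OF f] assms(2) by simp
  qed
  then show thesis using that by auto
qed

subsection \<open>Iterated shifts\<close>

definition oadd :: "'m obj \<Rightarrow> 'm obj \<Rightarrow> 'm obj" where
  "oadd n N = (\<lambda>i. n i + N i)"

text \<open>The effect on morphisms of all single shifts together, \<open>N i\<close> of them in
  direction \<open>i\<close>: the added points form the initial segments \<open>{1..N i}\<close> and
  are fixed, and the old points sit above them.\<close>

definition iotaN :: "'m obj \<Rightarrow> 'm obj \<Rightarrow> 'm mor \<Rightarrow> 'm mor" where
  "iotaN N n f = mk_mor (oadd n N) (\<lambda>i a. if a \<le> N i then a else f i (a - N i) + N i)"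

definition nu :: "'m obj \<Rightarrow> 'm obj \<Rightarrow> 'm mor" where
  "nu N n = mk_mor n (\<lambda>i a. a + N i)"

definition up_pt :: "'m obj \<Rightarrow> 'm \<times> nat \<Rightarrow> 'm \<times> nat" where
  "up_pt N = (\<lambda>(i, a). (i, a + N i))"

text \<open>Supports in the shifted module: \<open>iotaN\<close> fixes the added points, so these
  belong to the image of every shifted morphism.\<close>

definition up_set :: "'m obj \<Rightarrow> ('m \<times> nat) set \<Rightarrow> ('m \<times> nat) set" where
  "up_set N S = pts N \<union> up_pt N ` S"

lemma up_pt_simp: "up_pt N (i, a) = (i, a + N i)"
  by (simp add: up_pt_def)

lemma inj_up_pt: "inj (up_pt N)"
  by (rule injI) (auto simp: up_pt_def split: prod.splits)

lemma up_pt_notin: "p \<in> pts t \<Longrightarrow> up_pt N p \<notin> pts N"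
  by (cases p) (auto simp: up_pt_simp pmap_simp pts_def)

lemma up_pts: "up_set N (pts t) = pts (oadd t N)"
proof safe
  fix i a assume "(i, a) \<in> up_set N (pts t)"
  then show "(i, a) \<in> pts (oadd t N)" by (auto simp: up_set_def up_pt_simp pts_def oadd_def)
next
  fix i a assume *: "(i, a) \<in> pts (oadd t N)"
  show "(i, a) \<in> up_set N (pts t)"
  proof (cases "a \<le> N i")
    case True
    then show ?thesis using * by (auto simp: up_set_def pts_def)
  next
    case False
    then have "(i, a) = up_pt N (i, a - N i)" "(i, a - N i) \<in> pts t"
      using * by (auto simp: up_pt_simp pts_def oadd_def)
    then show ?thesis unfolding up_set_def by blast
  qed
qed

lemma up_diff: "S \<subseteq> pts t \<Longrightarrow> T \<subseteq> pts t \<Longrightarrow> up_set N (S - T) = up_set N S - up_pt N ` T"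
  using up_pt_notin[of _ t N] image_set_diff[OF inj_up_pt, of N S T] by (auto simp: up_set_def)

lemma iotaN_in:
  assumes f: "f \<in> Cmor n t"
  shows "iotaN N n f \<in> Cmor (oadd n N) (oadd t N)"
  unfolding iotaN_def
proof (rule mk_morI)
  fix i a assume a: "1 \<le> a" "a \<le> oadd n N i"
  show "1 \<le> (if a \<le> N i then a else f i (a - N i) + N i) \<and>
       (if a \<le> N i then a else f i (a - N i) + N i) \<le> oadd t N i"
  proof (cases "a \<le> N i")
    case False
    then have "1 \<le> f i (a - N i) \<and> f i (a - N i) \<le> t i"
      using a by (intro CmorD(5)[OF f]) (auto simp: oadd_def)
    then show ?thesis using False by (simp add: oadd_def)
  qed (use a in \<open>simp add: oadd_def\<close>)
next
  fix i
  show "inj_on (\<lambda>a. if a \<le> N i then a else f i (a - N i) + N i) {1..oadd n N i}"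
  proof (rule inj_onI)
    fix x y assume *: "x \<in> {1..oadd n N i}" "y \<in> {1..oadd n N i}"
      "(if x \<le> N i then x else f i (x - N i) + N i) = (if y \<le> N i then y else f i (y - N i) + N i)"
    have pos: "1 \<le> f i (u - N i)" if "\<not> u \<le> N i" "u \<in> {1..oadd n N i}" for u
      using CmorD(5)[OF f, of "u - N i" i] that by (auto simp: oadd_def)
    consider "x \<le> N i" "y \<le> N i" | "x \<le> N i" "\<not> y \<le> N i" | "\<not> x \<le> N i" "y \<le> N i"
      | "\<not> x \<le> N i" "\<not> y \<le> N i" by blast
    then show "x = y"
    proof cases
      case 4
      have "x - N i = y - N i"
        by (rule Cmor_inj[OF f, of i]) (use 4 * in \<open>auto simp: oadd_def\<close>)
      then show ?thesis using 4 by simp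
    qed (use * pos[of x] pos[of y] in auto)
  qed
qed

lemma pmap_iotaN_low: "p \<in> pts N \<Longrightarrow> pmap (iotaN N n f) p = p"
  by (cases p) (auto simp: up_pt_simp pmap_simp iotaN_def mk_mor_def pts_def oadd_def)

lemma pmap_iotaN_high: "p \<in> pts n \<Longrightarrow> pmap (iotaN N n f) (up_pt N p) = up_pt N (pmap f p)"
  by (cases p) (auto simp: up_pt_simp pmap_simp iotaN_def mk_mor_def pts_def oadd_def)

lemma pmap_iotaN_up: "S \<subseteq> pts n \<Longrightarrow> pmap (iotaN N n f) ` up_set N S = up_set N (pmap f ` S)"
proof -
  assume S: "S \<subseteq> pts n"
  have "pmap (iotaN N n f) ` pts N = pts N"
    by (force simp: pmap_iotaN_low)
  moreover have "pmap (iotaN N n f) ` up_pt N ` S = up_pt N ` pmap f ` S"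
    unfolding image_image by (rule image_cong) (use S in \<open>simp_all add: pmap_iotaN_high subsetD\<close>)
  ultimately show ?thesis by (simp add: up_set_def image_Un)
qed

lemma mimg_iotaN: "pmap (iotaN N n f) ` pts (oadd n N) = up_set N (pmap f ` pts n)"
  unfolding up_pts[symmetric] by (rule pmap_iotaN_up) simp

lemma pts_oadd_cases:
  assumes "p \<in> pts (oadd n N)"
  obtains "p \<in> pts N" | q where "q \<in> pts n" "p = up_pt N q"
  using assms unfolding up_pts[symmetric] up_set_def by auto

lemma iotaN_comp:
  assumes f: "f \<in> Cmor n t" and g: "g \<in> Cmor t u"
  shows "iotaN N n (Ccomp n g f) = Ccomp (oadd n N) (iotaN N t g) (iotaN N n f)"
proof (rule Cmor_eqI[OF iotaN_in[OF Ccomp_in[OF f g]] Ccomp_in[OF iotaN_in[OF f] iotaN_in[OF g]]])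
  fix p assume p: "p \<in> pts (oadd n N)"
  then show "pmap (iotaN N n (Ccomp n g f)) p = pmap (Ccomp (oadd n N) (iotaN N t g) (iotaN N n f)) p"
    by (cases rule: pts_oadd_cases)
      (use p in \<open>simp_all add: pmap_Ccomp pmap_iotaN_low pmap_iotaN_high CmorD(1)[OF f]\<close>)
qed

lemma iotaN_id: "iotaN N n (Cid n) = Cid (oadd n N)"
proof (rule Cmor_eqI[OF iotaN_in[OF Cid_in] Cid_in])
  fix p assume p: "p \<in> pts (oadd n N)"
  then show "pmap (iotaN N n (Cid n)) p = pmap (Cid (oadd n N)) p"
    by (cases rule: pts_oadd_cases)
      (use p in \<open>simp_all add: pmap_Cid pmap_iotaN_low pmap_iotaN_high\<close>)
qed

lemma nu_in: "nu N n \<in> Cmor n (oadd n N)"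
  unfolding nu_def by (rule mk_morI) (auto simp: oadd_def inj_on_def)

lemma pmap_nu: "p \<in> pts n \<Longrightarrow> pmap (nu N n) p = up_pt N p"
  by (cases p) (simp add: nu_def mk_mor_def pmap_simp up_pt_simp pts_def)

lemma pmap_nu_image: "S \<subseteq> pts n \<Longrightarrow> pmap (nu N n) ` S = up_pt N ` S"
  by (rule image_cong) (auto simp: pmap_nu)

lemma mimg_nu: "pmap (nu N n) ` pts n = pts (oadd n N) - pts N"
  using up_pt_notin[of _ n N] by (auto simp: pmap_nu_image up_pts[symmetric] up_set_def)

lemma nu_natural:
  assumes f: "f \<in> Cmor n t"
  shows "Ccomp n (iotaN N n f) (nu N n) = Ccomp n (nu N t) f"
  by (rule Cmor_eqI[OF Ccomp_in[OF nu_in iotaN_in[OF f]] Ccomp_in[OF f nu_in]])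
    (simp add: pmap_Ccomp pmap_nu pmap_iotaN_high CmorD(1)[OF f])

text \<open>In each coordinate the points are listed as those of \<open>A\<close>, then
  \<open>b\<close> if the coordinate is \<open>j\<close>, then the rest; reading off the lists gives
  the permutation. It carries a standard pair, initial segments together with the next point of
  coordinate \<open>j\<close>, to an arbitrary set with a further point. Iterated cokernels are
  expressed through the standard pair.\<close>

lemma perm_exists:
  assumes A: "A \<subseteq> pts t" and y: "(j, b) \<in> pts t" "(j, b) \<notin> A"
  obtains \<sigma> where "\<sigma> \<in> Cmor t (t :: 'm :: finite obj)" "pmap \<sigma> ` pts (csize A) = A"
    "pmap \<sigma> (j, csize A j + 1) = (j, b)"
proof -
  define As where "As i = {a. (i, a) \<in> A}" for i
  define B where "B i = (if i = j then [b] else [])" for i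
  define L where "L i = sorted_list_of_set (As i) @ B i @ sorted_list_of_set ({1..t i} - As i - set (B i))" for i
  have fA: "finite (As i)" "As i \<subseteq> {1..t i}" for i
    using finite_fibre_pts[OF A] A by (auto simp: As_def pts_def)
  have sL: "set (L i) = {1..t i}" for i
    using fA[of i] y by (auto simp: L_def B_def pts_def)
  have dL: "distinct (L i)" for i
    using fA[of i] y by (auto simp: L_def B_def As_def)
  have lL: "length (L i) = t i" for i
    using distinct_card[OF dL[of i]] sL[of i] by simp
  have lA: "length (sorted_list_of_set (As i)) = csize A i" for i
    by (simp add: csize_def As_def)
  define \<phi> where "\<phi> i a = L i ! (a - 1)" for i a
  have \<phi>: "\<phi> i a \<in> {1..t i}" if "1 \<le> a" "a \<le> t i" for i a
    using nth_mem[of "a - 1" "L i"] that by (simp add: \<phi>_def sL lL)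
  have in_Cmor: "mk_mor t \<phi> \<in> Cmor t t"
  proof (rule mk_morI)
    show "inj_on (\<phi> i) {1..t i}" for i
    proof (rule inj_onI)
      fix x y assume "x \<in> {1..t i}" "y \<in> {1..t i}" "\<phi> i x = \<phi> i y"
      then show "x = y"
        using nth_eq_iff_index_eq[OF dL[of i], of "x - 1" "y - 1"] lL[of i]
        by (simp add: \<phi>_def) linarith
    qed
  qed (use \<phi> in auto)
  have "csize A \<le> t" using csize_mono[OF A, of t] by simp
  then have cA: "pts (csize A) \<subseteq> pts t"
    by (auto simp: pts_def le_fun_def intro: order_trans)
  have "pmap (mk_mor t \<phi>) ` pts (csize A) \<subseteq> A"
  proof safe
    fix i' a' i a assume *: "(i', a') \<in> pts (csize A)" "(i, a) = pmap (mk_mor t \<phi>) (i', a')"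
    then have "(i, a) = pmap \<phi> (i', a')" using cA by (simp add: pmap_mk_mor subsetD)
    then have "i = i'" "a = \<phi> i a'" by (simp_all add: pmap_simp)
    moreover have "\<phi> i a' = sorted_list_of_set (As i) ! (a' - 1)"
      using * lA[of i] \<open>i = i'\<close> by (auto simp: \<phi>_def L_def nth_append pts_def)
    moreover have "a' - 1 < length (sorted_list_of_set (As i))"
      using lA[of i] * \<open>i = i'\<close> by (auto simp: pts_def)
    then have "sorted_list_of_set (As i) ! (a' - 1) \<in> As i"
      using nth_mem[of "a' - 1" "sorted_list_of_set (As i)"] fA[of i] by simp
    ultimately show "(i, a) \<in> A" by (simp add: As_def)
  qed
  moreover have "card (pmap (mk_mor t \<phi>) ` pts (csize A)) = card A"
    using finite_subset[OF A] card_image[OF inj_on_subset[OF CmorD(2)[OF in_Cmor] cA]]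
    by (simp add: card_pts card_csize)
  ultimately have 1: "pmap (mk_mor t \<phi>) ` pts (csize A) = A"
    using finite_subset[OF A] by (simp add: card_subset_eq)
  have "csize A j + 1 \<le> t j"
  proof -
    have "card (As j) < card {1..t j}"
      by (rule psubset_card_mono) (use fA[of j] y in \<open>auto simp: As_def pts_def\<close>)
    then show ?thesis by (simp add: csize_def As_def)
  qed
  moreover have "\<phi> j (csize A j + 1) = b"
    using lA[of j] by (simp add: \<phi>_def L_def B_def nth_append)
  ultimately have "pmap (mk_mor t \<phi>) (j, csize A j + 1) = (j, b)"
    by (simp add: mk_mor_def pmap_simp)
  then show thesis using that in_Cmor 1 by blast
qed

context coeff_ring
begin

section \<open>Modules over the category\<close>

lemma cmD:
  assumes "cmodule R V"
  shows "module R (ob V n)"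
    and "f \<in> Cmor n t \<Longrightarrow> act V n t f \<in> lin_maps R (ob V n) (ob V t)"
    and "v \<in> carrier (ob V n) \<Longrightarrow> act V n n (Cid n) v = v"
    and "f \<in> Cmor n t \<Longrightarrow> g \<in> Cmor t u \<Longrightarrow> v \<in> carrier (ob V n) \<Longrightarrow>
      act V n u (Ccomp n g f) v = act V t u g (act V n t f v)"
  using assms by (auto simp: cmodule_def functor_on_def)

lemma cmI:
  assumes "\<And>n. module R (ob V n)"
    and "\<And>n t f. f \<in> Cmor n t \<Longrightarrow> act V n t f \<in> lin_maps R (ob V n) (ob V t)"
    and "\<And>n v. v \<in> carrier (ob V n) \<Longrightarrow> act V n n (Cid n) v = v"
    and "\<And>n t u f g v. f \<in> Cmor n t \<Longrightarrow> g \<in> Cmor t u \<Longrightarrow> v \<in> carrier (ob V n) \<Longrightarrow>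
      act V n u (Ccomp n g f) v = act V t u g (act V n t f v)"
  shows "cmodule R V"
  unfolding cmodule_def functor_on_def using assms by blast

lemma act_in:
  assumes "cmodule R V" "f \<in> Cmor n t" "v \<in> carrier (ob V n)"
  shows "act V n t f v \<in> carrier (ob V t)"
  using lin_mapsD(1)[OF cmD(2)[OF assms(1,2)] assms(3)] .

lemma act_zero:
  assumes "cmodule R V" "f \<in> Cmor n t"
  shows "act V n t f \<zero>\<^bsub>ob V n\<^esub> = \<zero>\<^bsub>ob V t\<^esub>"
  by (rule lin_zero[OF cmD(2)[OF assms] cmD(1)[OF assms(1)] cmD(1)[OF assms(1)]])

subsection \<open>Elements supported on a set of points\<close>

text \<open>The elements of \<open>V_t\<close> that come from the points of \<open>S\<close>.
  Although written as a union over all morphisms with image in \<open>S\<close>, this is the image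
  of a single one, an embedding onto \<open>S \<inter> pts t\<close>, and hence a submodule.\<close>

definition part :: "('m, 'k, 'v) cmod \<Rightarrow> 'm obj \<Rightarrow> ('m \<times> nat) set \<Rightarrow> 'v set" where
  "part V t S = {act V n t f v | n f v. f \<in> Cmor n t \<and> v \<in> carrier (ob V n) \<and> pmap f ` pts n \<subseteq> S}"

definition psum :: "('m, 'k, 'v) cmod \<Rightarrow> 'm obj \<Rightarrow> ('m \<times> nat) set set \<Rightarrow> 'v set" where
  "psum V t FF = mod_span R (ob V t) (\<Union>S\<in>FF. part V t S)"

lemma partI: "f \<in> Cmor n t \<Longrightarrow> v \<in> carrier (ob V n) \<Longrightarrow> pmap f ` pts n \<subseteq> S \<Longrightarrow> act V n t f v \<in> part V t S"
  by (auto simp: part_def)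

lemma partE:
  assumes "x \<in> part V t S"
  obtains n f v where "f \<in> Cmor n t" "v \<in> carrier (ob V n)" "pmap f ` pts n \<subseteq> S" "x = act V n t f v"
  using assms unfolding part_def by blast

lemma part_mono: "S \<subseteq> T \<Longrightarrow> part V t S \<subseteq> part V t T"
  unfolding part_def by blast

lemma part_Int_pts: "part V t (S \<inter> pts t) = part V t S"
proof
  show "part V t S \<subseteq> part V t (S \<inter> pts t)"
  proof
    fix x assume "x \<in> part V t S"
    then obtain n f v where "f \<in> Cmor n t" "v \<in> carrier (ob V n)" "pmap f ` pts n \<subseteq> S" "x = act V n t f v"
      by (rule partE)
    then show "x \<in> part V t (S \<inter> pts t)"
      using pmap_image_subset[of f n t "pts n"] by (auto intro: partI)
  qed
qed (rule part_mono, simp)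

text \<open>Every morphism with image inside that of \<open>e\<close> factors through
  \<open>e\<close>.\<close>

lemma part_emb:
  assumes V: "cmodule R V" and e: "e \<in> Cmor k t"
  shows "part V t (pmap e ` pts k) = act V k t e ` carrier (ob V k)"
proof
  show "part V t (pmap e ` pts k) \<subseteq> act V k t e ` carrier (ob V k)"
  proof
    fix x assume "x \<in> part V t (pmap e ` pts k)"
    then obtain n f v where *: "f \<in> Cmor n t" "v \<in> carrier (ob V n)"
      "pmap f ` pts n \<subseteq> pmap e ` pts k" "x = act V n t f v"
      by (rule partE)
    from factor_through[OF *(1) e *(3)] obtain g where g: "g \<in> Cmor n k" "f = Ccomp n e g" .
    then have "x = act V k t e (act V n k g v)" using * cmD(4)[OF V g(1) e] by simp
    then show "x \<in> act V k t e ` carrier (ob V k)" using act_in[OF V g(1) *(2)] by simp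
  qed
  show "act V k t e ` carrier (ob V k) \<subseteq> part V t (pmap e ` pts k)"
    using e by (auto intro: partI)
qed

lemma part_embE:
  assumes "cmodule R V"
  obtains e where "e \<in> Cmor (csize (S \<inter> pts t)) t" "pmap e ` pts (csize (S \<inter> pts t)) = S \<inter> pts t"
    "part V t S = act V (csize (S \<inter> pts t)) t e ` carrier (ob V (csize (S \<inter> pts t)))"
proof -
  obtain e where e: "e \<in> Cmor (csize (S \<inter> pts t)) t" "pmap e ` pts (csize (S \<inter> pts t)) = S \<inter> pts t"
    using emb_exists[of "S \<inter> pts t" t] by auto
  show thesis
    using that[OF e] part_emb[OF assms e(1)] e(2) by (simp add: part_Int_pts)
qed

lemma part_sm:
  assumes "cmodule R V"
  shows "submodule (part V t S) R (ob V t)"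
proof -
  obtain e where e: "e \<in> Cmor (csize (S \<inter> pts t)) t"
    "part V t S = act V (csize (S \<inter> pts t)) t e ` carrier (ob V (csize (S \<inter> pts t)))"
    by (rule part_embE[OF assms])
  show ?thesis
    unfolding e(2)
    by (rule sm_image[OF cmD(2)[OF assms e(1)]]) (simp_all add: cmD(1)[OF assms] sm_carrier)
qed

lemma part_carrier: "cmodule R V \<Longrightarrow> part V t S \<subseteq> carrier (ob V t)"
  by (rule sm_subset[OF part_sm])

lemma part_pts: "cmodule R V \<Longrightarrow> part V t (pts t) = carrier (ob V t)"
  using part_emb[of V "Cid t" t t] cmD(3)[of V _ t] by (force simp: Cid_in pmap_Cid_image)

text \<open>An embedding onto \<open>S\<close> followed by \<open>g\<close> is an embedding onto the
  image of \<open>S\<close>, so equality holds and not only an inclusion.\<close>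

lemma part_act:
  assumes V: "cmodule R V" and g: "g \<in> Cmor t u" and S: "S \<subseteq> pts t"
  shows "act V t u g ` part V t S = part V u (pmap g ` S)"
proof -
  obtain e where e: "e \<in> Cmor (csize S) t" "pmap e ` pts (csize S) = S"
    using emb_exists[OF S] .
  have ge: "pmap (Ccomp (csize S) g e) ` pts (csize S) = pmap g ` S"
    by (simp add: pmap_Ccomp_image e(2))
  have "part V u (pmap g ` S) = act V (csize S) u (Ccomp (csize S) g e) ` carrier (ob V (csize S))"
    using part_emb[OF V Ccomp_in[OF e(1) g]] by (simp add: ge)
  also have "\<dots> = act V t u g ` act V (csize S) t e ` carrier (ob V (csize S))"
    unfolding image_image by (rule image_cong) (simp_all add: cmD(4)[OF V e(1) g])
  also have "act V (csize S) t e ` carrier (ob V (csize S)) = part V t S"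
    using part_emb[OF V e(1)] by (simp add: e(2))
  finally show ?thesis by simp
qed

lemma psum_Union_carrier: "cmodule R V \<Longrightarrow> (\<Union>S\<in>FF. part V t S) \<subseteq> carrier (ob V t)"
  using part_carrier by blast

lemma psum_sm: "cmodule R V \<Longrightarrow> submodule (psum V t FF) R (ob V t)"
  unfolding psum_def by (rule span_sm[OF cmD(1) psum_Union_carrier])

lemma psum_least:
  assumes "submodule H R (ob V t)" "\<And>S. S \<in> FF \<Longrightarrow> part V t S \<subseteq> H"
  shows "psum V t FF \<subseteq> H"
  unfolding psum_def by (rule span_least) (use assms in auto)

lemma part_le_psum: "S \<in> FF \<Longrightarrow> part V t S \<subseteq> psum V t FF"
  unfolding psum_def using span_incl by fastforce

lemma psum_mono_sub:
  assumes "cmodule R V" "\<And>S. S \<in> FF \<Longrightarrow> \<exists>T\<in>GG. S \<subseteq> T"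
  shows "psum V t FF \<subseteq> psum V t GG"
proof (rule psum_least[OF psum_sm[OF assms(1)]])
  fix S assume "S \<in> FF"
  then obtain T where "T \<in> GG" "S \<subseteq> T" using assms(2) by blast
  then show "part V t S \<subseteq> psum V t GG" using part_mono[of S T V t] part_le_psum[of T GG V t] by blast
qed

lemma psum_mono: "FF \<subseteq> GG \<Longrightarrow> psum V t FF \<subseteq> psum V t GG"
  unfolding psum_def by (rule span_mono) blast

lemma psum_empty: "cmodule R V \<Longrightarrow> psum V t {} = {\<zero>\<^bsub>ob V t\<^esub>}"
  by (simp add: psum_def span_empty cmD)

lemma psum_le_part:
  assumes "cmodule R V" "\<And>S. S \<in> FF \<Longrightarrow> S \<subseteq> T"
  shows "psum V t FF \<subseteq> part V t T"
  by (rule psum_least[OF part_sm[OF assms(1)] part_mono[OF assms(2)]])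

lemma psum_act:
  assumes V: "cmodule R V" and g: "g \<in> Cmor t u" and FF: "\<And>S. S \<in> FF \<Longrightarrow> S \<subseteq> pts t"
  shows "act V t u g ` psum V t FF = psum V u ((`) (pmap g) ` FF)"
proof -
  have "act V t u g ` (\<Union>S\<in>FF. part V t S) = (\<Union>S\<in>FF. act V t u g ` part V t S)" by blast
  also have "\<dots> = (\<Union>S\<in>(`) (pmap g) ` FF. part V u S)"
    using FF by (simp add: part_act[OF V g])
  finally show ?thesis
    unfolding psum_def
    by (simp add: span_image[OF cmD(2)[OF V g] cmD(1)[OF V] cmD(1)[OF V] psum_Union_carrier[OF V]])
qed

lemma psum_Un_E:
  assumes V: "cmodule R V" and x: "x \<in> psum V t (FF \<union> GG)"
  obtains a b where "a \<in> psum V t FF" "b \<in> psum V t GG" "x = a \<oplus>\<^bsub>ob V t\<^esub> b"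
proof -
  have "x \<in> mod_span R (ob V t) ((\<Union>S\<in>FF. part V t S) \<union> (\<Union>S\<in>GG. part V t S))"
    using x by (simp add: psum_def UN_Un)
  then show thesis
    by (rule span_Un_E[OF cmD(1)[OF V] psum_Union_carrier[OF V] psum_Union_carrier[OF V]])
      (use that in \<open>auto simp: psum_def\<close>)
qed

lemma psum_singleton: "cmodule R V \<Longrightarrow> psum V t {S} = part V t S"
  by (simp add: psum_def span_of_sm part_sm)

lemma psum_insert_E:
  assumes V: "cmodule R V" and x: "x \<in> psum V t (insert S GG)"
  obtains a b where "a \<in> part V t S" "b \<in> psum V t GG" "x = a \<oplus>\<^bsub>ob V t\<^esub> b"
  by (rule psum_Un_E[OF V, of x t "{S}" GG]) (use x that in \<open>auto simp: psum_singleton[OF V]\<close>)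

subsection \<open>The acyclicity criterion\<close>

definition tors_free :: "('m, 'k, 'v) cmod \<Rightarrow> bool" where
  "tors_free V \<longleftrightarrow> (\<forall>n t. \<forall>f\<in>Cmor n t. inj_on (act V n t f) (carrier (ob V n)))"

text \<open>
  With \<open>D\<^sub>i\<close> the cokernel of the natural map to \<open>\<Sigma>\<^sub>i\<close>, the second condition says that
  \<open>K\<^sub>j D\<^sub>w V = 0\<close> for all words \<open>w\<close> and all \<open>j\<close>: the points of \<open>A\<close> are the ones added by \<open>D\<^sub>w\<close>
  and \<open>y\<close> is the one added by \<open>\<Sigma>\<^sub>j\<close>.
\<close>

definition acyc :: "('m, 'k, 'v) cmod \<Rightarrow> bool" where
  "acyc V \<longleftrightarrow> tors_free V \<and>
     (\<forall>t A y. A \<subseteq> pts t \<longrightarrow> y \<in> pts t - A \<longrightarrow>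
        part V t (pts t - {y}) \<inter> psum V t ((\<lambda>x. pts t - {x}) ` A) \<subseteq> psum V t ((\<lambda>x. pts t - {x, y}) ` A))"

lemma acycD:
  assumes "acyc V"
  shows "tors_free V"
    and "A \<subseteq> pts t \<Longrightarrow> y \<in> pts t \<Longrightarrow> y \<notin> A \<Longrightarrow> v \<in> part V t (pts t - {y}) \<Longrightarrow>
      v \<in> psum V t ((\<lambda>x. pts t - {x}) ` A) \<Longrightarrow> v \<in> psum V t ((\<lambda>x. pts t - {x, y}) ` A)"
  using assms unfolding acyc_def by blast+

lemma tors_freeD:
  assumes "cmodule R V" "tors_free V" "f \<in> Cmor n t" "v \<in> carrier (ob V n)"
    and "act V n t f v = \<zero>\<^bsub>ob V t\<^esub>"
  shows "v = \<zero>\<^bsub>ob V n\<^esub>"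
proof -
  interpret M: module R "ob V n" by (rule cmD(1)[OF assms(1)])
  have "act V n t f v = act V n t f \<zero>\<^bsub>ob V n\<^esub>" using assms by (simp add: act_zero)
  moreover have "inj_on (act V n t f) (carrier (ob V n))" using assms(2,3) by (simp add: tors_free_def)
  ultimately show ?thesis
    using assms(4) M.zero_closed by (metis inj_onD)
qed

lemma lin_inj_onI:
  assumes h: "h \<in> lin_maps R M N" and M: "module R M" and N: "module R N"
    and ker: "\<And>x. x \<in> carrier M \<Longrightarrow> h x = \<zero>\<^bsub>N\<^esub> \<Longrightarrow> x = \<zero>\<^bsub>M\<^esub>"
  shows "inj_on h (carrier M)"
proof (rule inj_onI)
  interpret M: module R M by fact
  interpret N: module R N by fact
  fix x y assume *: "x \<in> carrier M" "y \<in> carrier M" "h x = h y"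
  have "h (x \<ominus>\<^bsub>M\<^esub> y) = \<zero>\<^bsub>N\<^esub>"
    using lin_mapsD(1)[OF h *(2)] lin_minus[OF h M N *(1,2)] *(3) by (simp add: a_minus_def N.r_neg)
  then have "x \<ominus>\<^bsub>M\<^esub> y = \<zero>\<^bsub>M\<^esub>" using * by (intro ker) auto
  then show "x = y"
    using M.add.inv_solve_right'[of "\<zero>\<^bsub>M\<^esub>" x y] * by (simp add: a_minus_def)
qed

lemma tors_freeI:
  assumes V: "cmodule R V"
    and "\<And>n t f v. f \<in> Cmor n t \<Longrightarrow> v \<in> carrier (ob V n) \<Longrightarrow> act V n t f v = \<zero>\<^bsub>ob V t\<^esub> \<Longrightarrow> v = \<zero>\<^bsub>ob V n\<^esub>"
  shows "tors_free V"
  unfolding tors_free_def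
  by (intro allI ballI lin_inj_onI[OF cmD(2)[OF V] cmD(1)[OF V] cmD(1)[OF V]]) (use assms in auto)

text \<open>The criterion for whole objects transports to a set \<open>W\<close> of points by
  pulling back along an embedding with image \<open>W\<close>. The two hypotheses on
  \<open>v\<close> give two preimages, and these coincide because the embedding acts
  injectively.\<close>

lemma acyc_window:
  assumes V: "cmodule R V" and ac: "acyc V" and W: "W \<subseteq> pts t" and A: "A \<subseteq> W" and y: "y \<in> W - A"
    and v: "v \<in> part V t (W - {y})" "v \<in> psum V t ((\<lambda>x. W - {x}) ` A)"
  shows "v \<in> psum V t ((\<lambda>x. W - {x, y}) ` A)"
proof -
  obtain e where e: "e \<in> Cmor (csize W) t" "pmap e ` pts (csize W) = W"
    using emb_exists[OF W] .
  let ?k = "csize W"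
  have inj: "inj_on (pmap e) (pts ?k)" by (rule CmorD(2)[OF e(1)])
  define A' where "A' = {x \<in> pts ?k. pmap e x \<in> A}"
  have "p \<in> pmap e ` A'" if "p \<in> A" for p
  proof -
    have "p \<in> pmap e ` pts ?k" using that A e(2) by auto
    then obtain q where "q \<in> pts ?k" "p = pmap e q" by blast
    then show ?thesis using that by (simp add: A'_def)
  qed
  then have A': "A' \<subseteq> pts ?k" "pmap e ` A' = A" by (auto simp: A'_def)
  have "y \<in> pmap e ` pts ?k" using y e(2) by simp
  then obtain y' where y': "y' \<in> pts ?k" "pmap e y' = y" by blast
  have y'A: "y' \<in> pts ?k - A'" using y y' by (auto simp: A'_def)
  have im1: "pmap e ` (pts ?k - {x}) = W - {pmap e x}" if "x \<in> pts ?k" for x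
    using inj_on_image_set_diff[OF inj, of "pts ?k" "{x}"] that e(2) by simp
  have im2: "pmap e ` (pts ?k - {x, z}) = W - {pmap e x, pmap e z}" if "x \<in> pts ?k" "z \<in> pts ?k" for x z
    using inj_on_image_set_diff[OF inj, of "pts ?k" "{x, z}"] that e(2) by simp
  have f1: "(`) (pmap e) ` (\<lambda>x. pts ?k - {x}) ` A' = (\<lambda>x. W - {x}) ` A"
    unfolding A'(2)[symmetric] image_image by (rule image_cong) (simp_all add: im1 subsetD[OF A'(1)])
  have f2: "(`) (pmap e) ` (\<lambda>x. pts ?k - {x, y'}) ` A' = (\<lambda>x. W - {x, y}) ` A"
    unfolding A'(2)[symmetric] image_image by (rule image_cong) (simp_all add: im2[OF _ y'(1)] y'(2) subsetD[OF A'(1)])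
  have "v \<in> act V ?k t e ` part V ?k (pts ?k - {y'})"
    using v(1) part_act[OF V e(1), of "pts ?k - {y'}"] im1[OF y'(1)] y'(2) by simp
  then obtain u where u: "u \<in> part V ?k (pts ?k - {y'})" "v = act V ?k t e u" by auto
  have "v \<in> act V ?k t e ` psum V ?k ((\<lambda>x. pts ?k - {x}) ` A')"
    using v(2) psum_act[OF V e(1), of "(\<lambda>x. pts ?k - {x}) ` A'"] f1 by auto
  then obtain u' where u': "u' \<in> psum V ?k ((\<lambda>x. pts ?k - {x}) ` A')" "v = act V ?k t e u'" by auto
  have "inj_on (act V ?k t e) (carrier (ob V ?k))"
    using acycD(1)[OF ac] e(1) by (simp add: tors_free_def)
  then have "u = u'"
    by (rule inj_onD) (use u u' subsetD[OF part_carrier[OF V]] sm_in[OF psum_sm[OF V]] in auto)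
  then have "u \<in> psum V ?k ((\<lambda>x. pts ?k - {x, y'}) ` A')"
    using acycD(2)[OF ac A'(1) y'(1) _ u(1)] u'(1) y'A by simp
  then have "v \<in> act V ?k t e ` psum V ?k ((\<lambda>x. pts ?k - {x, y'}) ` A')" using u(2) by auto
  then show ?thesis
    using psum_act[OF V e(1), of "(\<lambda>x. pts ?k - {x, y'}) ` A'"] f2 by auto
qed

text \<open>A strict bound on the degrees of generators. The zero module has bound 0, where
  \<open>gd\<close> takes the value -1, and passing to a cokernel subtracts one with truncation at
  0.\<close>

definition gen_lt :: "('m, 'k, 'v) cmod \<Rightarrow> nat \<Rightarrow> bool" where
  "gen_lt V e \<longleftrightarrow> (\<forall>t. carrier (ob V t) \<subseteq> psum V t {S. S \<subseteq> pts t \<and> card S < e})"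

subsection \<open>Homomorphisms, submodules and quotients\<close>

lemma homD:
  assumes "h \<in> cmod_hom R V W"
  shows "h n \<in> lin_maps R (ob V n) (ob W n)"
    and "v \<in> carrier (ob V n) \<Longrightarrow> h n v \<in> carrier (ob W n)"
    and "f \<in> Cmor n t \<Longrightarrow> v \<in> carrier (ob V n) \<Longrightarrow> h t (act V n t f v) = act W n t f (h n v)"
  using assms by (auto simp: cmod_hom_def dest: lin_mapsD(1))

lemma homI:
  assumes "\<And>n. h n \<in> lin_maps R (ob V n) (ob W n)"
    and "\<And>n t f v. f \<in> Cmor n t \<Longrightarrow> v \<in> carrier (ob V n) \<Longrightarrow> h t (act V n t f v) = act W n t f (h n v)"
  shows "h \<in> cmod_hom R V W"
  using assms by (auto simp: cmod_hom_def)

lemma hom_comp: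
  assumes g: "g \<in> cmod_hom R V W" and h: "h \<in> cmod_hom R W U"
  shows "(\<lambda>n v. h n (g n v)) \<in> cmod_hom R V U"
  by (rule homI[OF lin_comp[OF homD(1)[OF g] homD(1)[OF h]]])
    (simp add: homD(2)[OF g] homD(3)[OF g] homD(3)[OF h])

definition onto :: "('m, 'k, 'v) cmod \<Rightarrow> ('m, 'k, 'w) cmod \<Rightarrow> ('m obj \<Rightarrow> 'v \<Rightarrow> 'w) \<Rightarrow> bool" where
  "onto V W h \<longleftrightarrow> h \<in> cmod_hom R V W \<and> (\<forall>n. h n ` carrier (ob V n) = carrier (ob W n))"

lemma hom_part:
  assumes h: "h \<in> cmod_hom R V W"
  shows "h t ` part V t S \<subseteq> part W t S"
proof
  fix x assume "x \<in> h t ` part V t S"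
  then obtain y where "y \<in> part V t S" "x = h t y" by auto
  then obtain n f v where "f \<in> Cmor n t" "v \<in> carrier (ob V n)" "pmap f ` pts n \<subseteq> S" "x = h t (act V n t f v)"
    by (auto elim!: partE)
  then show "x \<in> part W t S" using homD(2,3)[OF h] by (auto intro: partI)
qed

lemma onto_part:
  assumes h: "onto V W h"
  shows "h t ` part V t S = part W t S"
proof
  have hh: "h \<in> cmod_hom R V W" using h by (simp add: onto_def)
  then show "h t ` part V t S \<subseteq> part W t S" by (rule hom_part)
  show "part W t S \<subseteq> h t ` part V t S"
  proof
    fix x assume "x \<in> part W t S"
    then obtain n f w where *: "f \<in> Cmor n t" "w \<in> carrier (ob W n)" "pmap f ` pts n \<subseteq> S" "x = act W n t f w"
      by (rule partE)
    then obtain v where "v \<in> carrier (ob V n)" "w = h n v" using h unfolding onto_def by blast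
    then show "x \<in> h t ` part V t S" using * homD(3)[OF hh *(1)] by (auto intro!: image_eqI partI)
  qed
qed

lemma onto_psum:
  assumes V: "cmodule R V" and W: "cmodule R W" and h: "onto V W h"
  shows "h t ` psum V t FF = psum W t FF"
proof -
  have hh: "h \<in> cmod_hom R V W" using h by (simp add: onto_def)
  have "h t ` (\<Union>S\<in>FF. part V t S) = (\<Union>S\<in>FF. part W t S)"
    using onto_part[OF h] by blast
  then show ?thesis
    unfolding psum_def
    by (simp add: span_image[OF homD(1)[OF hh] cmD(1)[OF V] cmD(1)[OF W] psum_Union_carrier[OF V]])
qed

lemma onto_gen_lt:
  assumes V: "cmodule R V" and W: "cmodule R W" and h: "onto V W h" and "gen_lt V e"
  shows "gen_lt W e"
  unfolding gen_lt_def
proof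
  fix t
  have "h t ` carrier (ob V t) \<subseteq> h t ` psum V t {S. S \<subseteq> pts t \<and> card S < e}"
    using assms(4) by (intro image_mono) (auto simp: gen_lt_def)
  then show "carrier (ob W t) \<subseteq> psum W t {S. S \<subseteq> pts t \<and> card S < e}"
    using h by (simp add: onto_psum[OF V W h] onto_def)
qed

text \<open>Used to pass between a module, its copies, and the kernels it is isomorphic to.\<close>

lemma iso_acyc:
  fixes V :: "('m, 'k, 'v) cmod"
  assumes V: "cmodule R V" and W: "cmodule R W" and h: "onto V W h"
    and inj: "\<And>n. inj_on (h n) (carrier (ob V n))" and ac: "acyc V"
  shows "acyc W"
  unfolding acyc_def
proof (intro conjI allI impI)
  have hh: "h \<in> cmod_hom R V W" using h by (simp add: onto_def)
  have tf: "tors_free V" using ac by (simp add: acyc_def)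
  show "tors_free W"
  proof (rule tors_freeI[OF W])
    fix n t f w assume *: "f \<in> Cmor n t" "w \<in> carrier (ob W n)" "act W n t f w = \<zero>\<^bsub>ob W t\<^esub>"
    then obtain v where v: "v \<in> carrier (ob V n)" "w = h n v" using h unfolding onto_def by blast
    have 0: "h n' \<zero>\<^bsub>ob V n'\<^esub> = \<zero>\<^bsub>ob W n'\<^esub>" for n'
      by (rule lin_zero[OF homD(1)[OF hh] cmD(1)[OF V] cmD(1)[OF W]])
    have "h t (act V n t f v) = h t \<zero>\<^bsub>ob V t\<^esub>"
      using * v homD(3)[OF hh *(1) v(1)] 0 by simp
    then have "act V n t f v = \<zero>\<^bsub>ob V t\<^esub>"
      by (rule inj_onD[OF inj]) (use act_in[OF V *(1) v(1)] sm_zero[OF sm_carrier[OF cmD(1)[OF V]]] in auto)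
    then have "v = \<zero>\<^bsub>ob V n\<^esub>" by (rule tors_freeD[OF V tf *(1) v(1)])
    then show "w = \<zero>\<^bsub>ob W n\<^esub>" using v 0 by simp
  qed
next
  fix t :: "'m obj" and A y assume A: "A \<subseteq> pts t" and y: "y \<in> pts t - A"
  let ?F = "(\<lambda>x. pts t - {x}) ` A" and ?G = "(\<lambda>x. pts t - {x, y}) ` A"
  show "part W t (pts t - {y}) \<inter> psum W t ?F \<subseteq> psum W t ?G"
  proof
    fix w assume "w \<in> part W t (pts t - {y}) \<inter> psum W t ?F"
    then have "w \<in> h t ` part V t (pts t - {y})" "w \<in> h t ` psum V t ?F"
      by (simp_all add: onto_part[OF h] onto_psum[OF V W h])
    then obtain v v' where v: "v \<in> part V t (pts t - {y})" "w = h t v" and v': "v' \<in> psum V t ?F" "w = h t v'"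
      by auto
    have "v = v'"
      by (rule inj_onD[OF inj, of t]) (use v v' part_carrier[OF V] sm_in[OF psum_sm[OF V]] in auto)
    then have "v \<in> psum V t ?G" using acycD(2)[OF ac A _ _ v(1)] v' y by simp
    then show "w \<in> psum W t ?G" using onto_psum[OF V W h, of t ?G] v by auto
  qed
qed

definition subcmod :: "('m, 'k, 'v) cmod \<Rightarrow> ('m obj \<Rightarrow> 'v set) \<Rightarrow> ('m, 'k, 'v) cmod" where
  "subcmod V X = \<lparr>ob = (\<lambda>n. (ob V n)\<lparr>carrier := X n\<rparr>), act = act V\<rparr>"

lemma subcmod_simps [simp]:
  "ob (subcmod V X) n = (ob V n)\<lparr>carrier := X n\<rparr>" "act (subcmod V X) = act V"
  by (simp_all add: subcmod_def)

lemma subfunctorD: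
  assumes "subfunctor R V X"
  shows "submodule (X n) R (ob V n)" and "f \<in> Cmor n t \<Longrightarrow> x \<in> X n \<Longrightarrow> act V n t f x \<in> X t"
    and "x \<in> X n \<Longrightarrow> x \<in> carrier (ob V n)"
proof -
  show 1: "submodule (X n) R (ob V n)" for n
    using assms by (auto simp: subfunctor_def)
  show "f \<in> Cmor n t \<Longrightarrow> x \<in> X n \<Longrightarrow> act V n t f x \<in> X t"
    using assms unfolding subfunctor_def by blast
  show "x \<in> X n \<Longrightarrow> x \<in> carrier (ob V n)" by (rule sm_in[OF 1])
qed

lemma subfunctorI:
  assumes "\<And>n. submodule (X n) R (ob V n)" "\<And>n t f x. f \<in> Cmor n t \<Longrightarrow> x \<in> X n \<Longrightarrow> act V n t f x \<in> X t"
  shows "subfunctor R V X"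
  using assms by (auto simp: subfunctor_def)

lemma subcmod_cmodule:
  assumes V: "cmodule R V" and X: "subfunctor R V X"
  shows "cmodule R (subcmod V X)"
proof (rule cmI)
  show "module R (ob (subcmod V X) n)" for n
    using module_restrict[OF cmD(1)[OF V] subfunctorD(1)[OF X]] by simp
  show "act (subcmod V X) n t f \<in> lin_maps R (ob (subcmod V X) n) (ob (subcmod V X) t)"
    if "f \<in> Cmor n t" for n t f
    by (rule lin_mapsI)
      (use subfunctorD(2,3)[OF X] lin_mapsD(2,3)[OF cmD(2)[OF V that]] that in auto)
qed (use cmD(3,4)[OF V] subfunctorD(3)[OF X] in auto)

lemma carrier_subfunctor: "cmodule R V \<Longrightarrow> subfunctor R V (\<lambda>n. carrier (ob V n))"
  by (rule subfunctorI) (auto simp: sm_carrier cmD(1) act_in)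

lemma zero_subfunctor: "cmodule R V \<Longrightarrow> subfunctor R V (zero_fam V)"
  by (rule subfunctorI) (auto simp: zero_fam_def sm_zero_sub cmD(1) act_zero)

lemma ker_subfunctor:
  assumes V: "cmodule R V" and W: "cmodule R W" and h: "h \<in> cmod_hom R V W"
  shows "subfunctor R V (ker_fam V W h)"
proof (rule subfunctorI)
  show "submodule (ker_fam V W h n) R (ob V n)" for n
    unfolding ker_fam_def by (rule sm_kernel[OF homD(1)[OF h] cmD(1)[OF V] cmD(1)[OF W]])
qed (auto simp: ker_fam_def act_in[OF V] homD(3)[OF h] act_zero[OF W])

lemma im_subfunctor:
  assumes V: "cmodule R V" and W: "cmodule R W" and h: "h \<in> cmod_hom R V W"
  shows "subfunctor R W (im_fam V h)"
proof (rule subfunctorI)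
  show "submodule (im_fam V h n) R (ob W n)" for n
    unfolding im_fam_def by (rule sm_image[OF homD(1)[OF h] cmD(1)[OF V] cmD(1)[OF W] sm_carrier[OF cmD(1)[OF V]]])
  fix n t f x assume f: "f \<in> Cmor n t" and "x \<in> im_fam V h n"
  then obtain v where v: "v \<in> carrier (ob V n)" "x = h n v" by (auto simp: im_fam_def)
  then have "act W n t f x = h t (act V n t f v)" using homD(3)[OF h f] by simp
  then show "act W n t f x \<in> im_fam V h t" using act_in[OF V f v(1)] by (auto simp: im_fam_def)
qed

lemma subcmod_part_le: "(\<And>n. X n \<subseteq> carrier (ob V n)) \<Longrightarrow> part (subcmod V X) t S \<subseteq> part V t S"
  unfolding part_def by fastforce

lemma subcmod_psum:
  assumes V: "cmodule R V" and X: "subfunctor R V X"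
  shows "psum (subcmod V X) t FF = mod_span R (ob V t) (\<Union>S\<in>FF. part (subcmod V X) t S)"
proof -
  have "(\<Union>S\<in>FF. part (subcmod V X) t S) \<subseteq> X t"
    using psum_Union_carrier[OF subcmod_cmodule[OF V X], where FF = FF and t = t] by simp
  then show ?thesis
    by (simp add: psum_def span_restrict[OF cmD(1)[OF V] subfunctorD(1)[OF X]])
qed

lemma subcmod_psum_le:
  assumes V: "cmodule R V" and X: "subfunctor R V X"
  shows "psum (subcmod V X) t FF \<subseteq> psum V t FF"
  unfolding subcmod_psum[OF V X] unfolding psum_def
  by (rule span_mono, rule UN_mono[OF subset_refl], rule subcmod_part_le) (use subfunctorD(3)[OF X] in blast)

subsection \<open>Kernels of epimorphisms\<close>

text \<open>If \<open>x\<close> is the image of \<open>v\<close> under \<open>f\<close> and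
  \<open>h\<close> kills \<open>x\<close>, then \<open>f\<close> kills the image of \<open>v\<close>
  in \<open>C\<close>. As \<open>C\<close> is torsion free, \<open>v\<close> itself lies in the
  kernel.\<close>

lemma ker_part:
  assumes B: "cmodule R B" and C: "cmodule R C" and h: "h \<in> cmod_hom R B C" and tf: "tors_free C"
    and x: "x \<in> part B t S" "h t x = \<zero>\<^bsub>ob C t\<^esub>"
  shows "x \<in> part (subcmod B (ker_fam B C h)) t S"
proof -
  obtain n f v where *: "f \<in> Cmor n t" "v \<in> carrier (ob B n)" "pmap f ` pts n \<subseteq> S" "x = act B n t f v"
    using x(1) by (rule partE)
  have "act C n t f (h n v) = \<zero>\<^bsub>ob C t\<^esub>" using * x homD(3)[OF h *(1,2)] by simp
  then have "h n v = \<zero>\<^bsub>ob C n\<^esub>" by (rule tors_freeD[OF C tf *(1) homD(2)[OF h *(2)]])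
  then have "v \<in> carrier (ob (subcmod B (ker_fam B C h)) n)" using * by (simp add: ker_fam_def)
  then show ?thesis using partI[OF *(1) _ *(3), of v "subcmod B (ker_fam B C h)"] * by simp
qed

text \<open>Taking kernels commutes with these sums because \<open>C\<close> is acyclic. In
  \<open>x = a + r\<close>, with \<open>a\<close> supported off \<open>p\<close> and
  \<open>r\<close> in the sum for the other points, \<open>h a = - h r\<close> lies in an
  intersection to which acyclicity of \<open>C\<close> applies. It therefore has a lift
  \<open>s\<close> that is supported off \<open>p\<close> and also belongs to the sum for the other
  points. This corrects both summands: \<open>a - s\<close> and \<open>s + r\<close> are in the
  kernel, and induction handles the second.\<close>

lemma ker_psum:
  assumes B: "cmodule R B" and C: "cmodule R C" and h: "onto B C h" and ac: "acyc C"
    and W: "W \<subseteq> pts t" and P: "finite P" "P \<subseteq> W"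
    and x: "x \<in> psum B t ((\<lambda>p. W - {p}) ` P)" "h t x = \<zero>\<^bsub>ob C t\<^esub>"
  shows "x \<in> psum (subcmod B (ker_fam B C h)) t ((\<lambda>p. W - {p}) ` P)"
  using P x
proof (induction P arbitrary: x rule: finite_induct)
  case empty
  have hh: "h \<in> cmod_hom R B C" using h by (simp add: onto_def)
  have "cmodule R (subcmod B (ker_fam B C h))"
    by (rule subcmod_cmodule[OF B ker_subfunctor[OF B C hh]])
  then show ?case using empty by (simp add: psum_empty[OF B] psum_empty)
next
  case (insert p P)
  have hh: "h \<in> cmod_hom R B C" using h by (simp add: onto_def)
  let ?A = "subcmod B (ker_fam B C h)"
  have A: "cmodule R ?A" by (rule subcmod_cmodule[OF B ker_subfunctor[OF B C hh]])
  interpret Bt: module R "ob B t" by (rule cmD(1)[OF B])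
  interpret Ct: module R "ob C t" by (rule cmD(1)[OF C])
  note ht = homD(1)[OF hh, of t]
  let ?F = "(\<lambda>p. W - {p}) ` P" and ?G = "(\<lambda>x. W - {x, p}) ` P"
  have "x \<in> psum B t (insert (W - {p}) ?F)" using insert.prems by simp
  then obtain a r where ar: "a \<in> part B t (W - {p})" "r \<in> psum B t ?F" "x = a \<oplus>\<^bsub>ob B t\<^esub> r"
    by (rule psum_insert_E[OF B])
  have c: "a \<in> carrier (ob B t)" "r \<in> carrier (ob B t)"
    using ar part_carrier[OF B] sm_in[OF psum_sm[OF B]] by auto
  have "h t a \<oplus>\<^bsub>ob C t\<^esub> h t r = \<zero>\<^bsub>ob C t\<^esub>"
    using insert.prems ar c lin_mapsD(2)[OF ht] by simp
  then have "h t a = \<ominus>\<^bsub>ob C t\<^esub> h t r"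
    using lin_mapsD(1)[OF ht] c by (simp add: Ct.minus_equality)
  moreover have "h t r \<in> psum C t ?F" using ar(2) onto_psum[OF B C h, of t ?F] by auto
  ultimately have "h t a \<in> psum C t ?F" using sm_neg[OF psum_sm[OF C]] by simp
  moreover have "h t a \<in> part C t (W - {p})" using ar(1) onto_part[OF h, of t "W - {p}"] by auto
  ultimately have "h t a \<in> psum C t ?G"
    using acyc_window[OF C ac W] insert.prems insert.hyps by blast
  then have "h t a \<in> h t ` psum B t ?G" by (simp only: onto_psum[OF B C h])
  then obtain s where s: "s \<in> psum B t ?G" "h t a = h t s" by (rule imageE)
  have sp: "s \<in> part B t (W - {p})"
    using s(1) psum_le_part[OF B, of ?G "W - {p}" t] by (auto simp: subset_iff)
  have "psum B t ?G \<subseteq> psum B t ?F"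
  proof (rule psum_mono_sub[OF B])
    fix S assume "S \<in> ?G"
    then obtain x where "x \<in> P" "S = W - {x, p}" by (rule imageE)
    then show "\<exists>T\<in>?F. S \<subseteq> T" by (intro bexI[of _ "W - {x}"]) auto
  qed
  then have sF: "s \<in> psum B t ?F" using s(1) by blast
  have sc: "s \<in> carrier (ob B t)" using sp part_carrier[OF B] by auto
  have a0: "a \<ominus>\<^bsub>ob B t\<^esub> s \<in> part B t (W - {p})" by (rule sm_minus[OF part_sm[OF B] ar(1) sp])
  have ha0: "h t (a \<ominus>\<^bsub>ob B t\<^esub> s) = \<zero>\<^bsub>ob C t\<^esub>"
    using lin_mapsD(1)[OF ht sc] s(2) lin_minus[OF ht cmD(1)[OF B] cmD(1)[OF C] c(1) sc]
    by (simp add: a_minus_def Ct.r_neg)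
  have 1: "a \<ominus>\<^bsub>ob B t\<^esub> s \<in> psum ?A t ((\<lambda>p. W - {p}) ` insert p P)"
    using ker_part[OF B C hh _ a0 ha0] ac part_le_psum[of "W - {p}" "(\<lambda>p. W - {p}) ` insert p P" ?A t]
    by (auto simp: acyc_def)
  have sr: "s \<oplus>\<^bsub>ob B t\<^esub> r \<in> psum B t ?F" by (rule sm_add[OF psum_sm[OF B] sF ar(2)])
  have x_eq: "x = (a \<ominus>\<^bsub>ob B t\<^esub> s) \<oplus>\<^bsub>ob B t\<^esub> (s \<oplus>\<^bsub>ob B t\<^esub> r)"
    using ar(3) c sc by (simp add: a_minus_def Bt.a_ac Bt.r_neg Bt.r_neg1 Bt.r_neg2)
  have "h t (s \<oplus>\<^bsub>ob B t\<^esub> r) = \<zero>\<^bsub>ob C t\<^esub>"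
    using \<open>h t a \<oplus>\<^bsub>ob C t\<^esub> h t r = \<zero>\<^bsub>ob C t\<^esub>\<close> s(2) lin_mapsD(2)[OF ht sc c(2)] by simp
  then have "s \<oplus>\<^bsub>ob B t\<^esub> r \<in> psum ?A t ?F"
    by (intro insert.IH) (use sr insert.prems in auto)
  then have 2: "s \<oplus>\<^bsub>ob B t\<^esub> r \<in> psum ?A t ((\<lambda>p. W - {p}) ` insert p P)"
    using psum_mono[of ?F "(\<lambda>p. W - {p}) ` insert p P" ?A t] by auto
  show ?case
    unfolding x_eq using sm_add[OF psum_sm[OF A] 1 2] by simp
qed

text \<open>Acyclicity of \<open>B\<close> improves the decomposition of \<open>v\<close> inside
  \<open>B\<close>, and acyclicity of \<open>C\<close> brings the improved decomposition back into
  the kernel.\<close>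

lemma ker_acyc:
  fixes B :: "('m :: finite, 'k, 'v) cmod"
  assumes B: "cmodule R B" and C: "cmodule R C" and h: "onto B C h" and acB: "acyc B" and acC: "acyc C"
  shows "acyc (subcmod B (ker_fam B C h))"
  unfolding acyc_def
proof (intro conjI allI impI)
  have hh: "h \<in> cmod_hom R B C" using h by (simp add: onto_def)
  let ?A = "subcmod B (ker_fam B C h)"
  note X = ker_subfunctor[OF B C hh]
  have A: "cmodule R ?A" by (rule subcmod_cmodule[OF B X])
  show "tors_free ?A"
    using acB unfolding acyc_def tors_free_def by (auto simp: ker_fam_def intro: inj_on_subset)
  fix t :: "'m obj" and Q y assume Q: "Q \<subseteq> pts t" and y: "y \<in> pts t - Q"
  let ?F = "(\<lambda>x. pts t - {x}) ` Q" and ?G = "(\<lambda>x. pts t - {x, y}) ` Q"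
  show "part ?A t (pts t - {y}) \<inter> psum ?A t ?F \<subseteq> psum ?A t ?G"
  proof
    fix v assume v: "v \<in> part ?A t (pts t - {y}) \<inter> psum ?A t ?F"
    then have "v \<in> part B t (pts t - {y})" "v \<in> psum B t ?F" "h t v = \<zero>\<^bsub>ob C t\<^esub>"
      using subcmod_part_le[of "ker_fam B C h" B t] subcmod_psum_le[OF B X, of t ?F]
        part_carrier[OF A, of t "pts t - {y}"]
      by (auto simp: ker_fam_def subset_iff)
    then have vG: "v \<in> psum B t ?G" "h t v = \<zero>\<^bsub>ob C t\<^esub>"
      using acycD(2)[OF acB Q, of y v] y by simp_all
    \<comment> \<open>With \<open>y\<close> removed once and for all, the family consists of
      complements of single points in the window \<open>pts t - {y}\<close>, the shape that
      \<open>ker_psum\<close> handles.\<close>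
    have G: "?G = (\<lambda>p. (pts t - {y}) - {p}) ` Q" by (rule image_cong) auto
    show "v \<in> psum ?A t ?G"
      unfolding G
      by (rule ker_psum[OF B C h acC]) (use vG G Q y finite_subset[OF Q] in auto)
  qed
qed

subsection \<open>Subquotients\<close>

text \<open>The subquotient is described as the image of a surjection from \<open>Z\<close> with
  kernel \<open>B\<close>, so that later arguments need not look inside cosets.\<close>

lemma subquot_cst:
  assumes V: "cmodule R V" and Z: "subfunctor R V Z" and B: "subfunctor R V B" and BZ: "\<And>n. B n \<subseteq> Z n"
  shows "cmodule R (subquot V Z B)"
    and "onto (subcmod V Z) (subquot V Z B) (\<lambda>n. cst (ob V n) (B n))"
    and "\<zero>\<^bsub>ob (subquot V Z B) n\<^esub> = B n"
    and "x \<in> Z n \<Longrightarrow> cst (ob V n) (B n) x = B n \<longleftrightarrow> x \<in> B n"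
    and "carrier (ob (subquot V Z B) n) = cst (ob V n) (B n) ` Z n"
proof -
  let ?M = "\<lambda>n. (ob V n)\<lparr>carrier := Z n\<rparr>"
  let ?Q = "subquot V Z B"
  have M: "module R (?M n)" for n
    by (rule module_restrict[OF cmD(1)[OF V] subfunctorD(1)[OF Z]])
  have Bn: "submodule (B n) R (?M n)" for n
    by (rule sm_restrict[OF cmD(1)[OF V] subfunctorD(1)[OF Z] subfunctorD(1)[OF B] BZ])
  \<comment> \<open>A coset is formed with the addition alone, which restricting the carrier leaves
    unchanged.\<close>
  have [simp]: "cst (?M n) (B n) = cst (ob V n) (B n)" for n
    by (simp add: a_r_coset_def r_coset_def fun_eq_iff)
  have ob: "ob ?Q n = quot_mod (?M n) (B n)" for n by (simp add: subquot_def)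
  show 5: "carrier (ob ?Q n) = cst (ob V n) (B n) ` Z n" for n
    using quot_mod_simps(1)[OF M Bn, of n] by (simp add: ob)
  show 3: "\<zero>\<^bsub>ob ?Q n\<^esub> = B n" for n
    using quot_mod_simps(2)[OF M Bn, of n] by (simp add: ob)
  show 4: "x \<in> Z n \<Longrightarrow> cst (ob V n) (B n) x = B n \<longleftrightarrow> x \<in> B n" for n x
    using cst_eq_zero_iff[OF M Bn, of x n] by simp
  have Q: "module R (ob ?Q n)" for n unfolding ob by (rule quot_module[OF M Bn])
  have lin: "cst (ob V n) (B n) \<in> lin_maps R (?M n) (ob ?Q n)" for n
    using cst_lin[OF M Bn, of n] by (simp add: ob)
  have act: "act ?Q n t f (cst (ob V n) (B n) x) = cst (ob V t) (B t) (act V n t f x)"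
    if f: "f \<in> Cmor n t" and x: "x \<in> Z n" for n t f x
    unfolding subquot_def cmod.simps
    by (rule quot_map_cst[OF cmD(2)[OF V f] cmD(1)[OF V] subfunctorD(1)[OF B] cmD(1)[OF V] subfunctorD(1)[OF B]])
      (use subfunctorD(2)[OF B f] subfunctorD(3)[OF Z x] in auto)
  show 1: "cmodule R ?Q"
  proof (rule cmI[OF Q])
    fix n t :: "'a obj" and f assume f: "f \<in> Cmor n t"
    show "act ?Q n t f \<in> lin_maps R (ob ?Q n) (ob ?Q t)"
    proof (rule lin_mapsI)
      fix X assume "X \<in> carrier (ob ?Q n)"
      then show "act ?Q n t f X \<in> carrier (ob ?Q t)"
        using subfunctorD(2)[OF Z f] by (auto simp: 5 act[OF f])
    next
      fix X Y assume "X \<in> carrier (ob ?Q n)" "Y \<in> carrier (ob ?Q n)"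
      then obtain x y where xy: "x \<in> Z n" "y \<in> Z n" "X = cst (ob V n) (B n) x" "Y = cst (ob V n) (B n) y"
        by (auto simp: 5)
      have "X \<oplus>\<^bsub>ob ?Q n\<^esub> Y = cst (ob V n) (B n) (x \<oplus>\<^bsub>ob V n\<^esub> y)"
        using lin_mapsD(2)[OF lin, of x n y] xy by simp
      then have "act ?Q n t f (X \<oplus>\<^bsub>ob ?Q n\<^esub> Y) = cst (ob V t) (B t) (act V n t f (x \<oplus>\<^bsub>ob V n\<^esub> y))"
        using sm_add[OF subfunctorD(1)[OF Z] xy(1,2)] by (simp add: act[OF f])
      also have "\<dots> = cst (ob V t) (B t) (act V n t f x \<oplus>\<^bsub>ob V t\<^esub> act V n t f y)"
        using lin_mapsD(2)[OF cmD(2)[OF V f]] subfunctorD(3)[OF Z] xy by simp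
      also have "\<dots> = act ?Q n t f X \<oplus>\<^bsub>ob ?Q t\<^esub> act ?Q n t f Y"
        using lin_mapsD(2)[OF lin, of "act V n t f x" t "act V n t f y"] subfunctorD(2)[OF Z f] xy
        by (simp add: act[OF f])
      finally show "act ?Q n t f (X \<oplus>\<^bsub>ob ?Q n\<^esub> Y) = act ?Q n t f X \<oplus>\<^bsub>ob ?Q t\<^esub> act ?Q n t f Y" .
    next
      fix c X assume c: "c \<in> carrier R" and "X \<in> carrier (ob ?Q n)"
      then obtain x where x: "x \<in> Z n" "X = cst (ob V n) (B n) x"
        by (auto simp: 5)
      have "c \<odot>\<^bsub>ob ?Q n\<^esub> X = cst (ob V n) (B n) (c \<odot>\<^bsub>ob V n\<^esub> x)"
        using lin_mapsD(3)[OF lin, of x n c] x c by simp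
      then have "act ?Q n t f (c \<odot>\<^bsub>ob ?Q n\<^esub> X) = cst (ob V t) (B t) (act V n t f (c \<odot>\<^bsub>ob V n\<^esub> x))"
        using sm_smult[OF subfunctorD(1)[OF Z] c x(1)] by (simp add: act[OF f])
      also have "\<dots> = cst (ob V t) (B t) (c \<odot>\<^bsub>ob V t\<^esub> act V n t f x)"
        using lin_mapsD(3)[OF cmD(2)[OF V f]] subfunctorD(3)[OF Z] x c by simp
      also have "\<dots> = c \<odot>\<^bsub>ob ?Q t\<^esub> act ?Q n t f X"
        using lin_mapsD(3)[OF lin, of "act V n t f x" t c] subfunctorD(2)[OF Z f] x c
        by (simp add: act[OF f])
      finally show "act ?Q n t f (c \<odot>\<^bsub>ob ?Q n\<^esub> X) = c \<odot>\<^bsub>ob ?Q t\<^esub> act ?Q n t f X" .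
    qed
  next
    fix n :: "'a obj" and v assume "v \<in> carrier (ob ?Q n)"
    then show "act ?Q n n (Cid n) v = v"
      using subfunctorD(3)[OF Z] by (auto simp: 5 act[OF Cid_in] cmD(3)[OF V])
  next
    fix n t u :: "'a obj" and f g v assume f: "f \<in> Cmor n t" and g: "g \<in> Cmor t u" and "v \<in> carrier (ob ?Q n)"
    then show "act ?Q n u (Ccomp n g f) v = act ?Q t u g (act ?Q n t f v)"
      using subfunctorD(2)[OF Z f] subfunctorD(3)[OF Z]
      by (auto simp: 5 act[OF Ccomp_in[OF f g]] act[OF f] act[OF g] cmD(4)[OF V f g])
  qed
  show "onto (subcmod V Z) ?Q (\<lambda>n. cst (ob V n) (B n))"
    unfolding onto_def by (auto intro!: homI lin simp: 5 act)
qed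

subsection \<open>Shifts\<close>

definition shiftN :: "'m obj \<Rightarrow> ('m, 'k, 'v) cmod \<Rightarrow> ('m, 'k, 'v) cmod" where
  "shiftN N V = \<lparr>ob = (\<lambda>n. ob V (oadd n N)),
     act = (\<lambda>n t f. act V (oadd n N) (oadd t N) (iotaN N n f))\<rparr>"

lemma shiftN_simps [simp]:
  "ob (shiftN N V) n = ob V (oadd n N)"
  "act (shiftN N V) n t f = act V (oadd n N) (oadd t N) (iotaN N n f)"
  by (simp_all add: shiftN_def)

lemma shiftN_cmodule: "cmodule R V \<Longrightarrow> cmodule R (shiftN N V)"
  by (rule cmI) (auto simp: cmD(1) iotaN_id cmD(3) iotaN_comp intro!: cmD(2,4) iotaN_in)

lemma shiftN_hom: "h \<in> cmod_hom R V W \<Longrightarrow> (\<lambda>n. h (oadd n N)) \<in> cmod_hom R (shiftN N V) (shiftN N W)"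
  by (rule homI) (auto simp: homD(1) homD(3)[OF _ iotaN_in])

text \<open>Shifted morphisms contain the added points in their image; conversely, a set
  \<open>up_set N S\<close> is the image of the shift of an embedding onto \<open>S\<close>.\<close>

lemma shiftN_part:
  assumes V: "cmodule R V" and S: "S \<subseteq> pts t"
  shows "part (shiftN N V) t S = part V (oadd t N) (up_set N S)"
proof
  show "part (shiftN N V) t S \<subseteq> part V (oadd t N) (up_set N S)"
  proof
    fix x assume "x \<in> part (shiftN N V) t S"
    then obtain n f v where *: "f \<in> Cmor n t" "v \<in> carrier (ob (shiftN N V) n)" "pmap f ` pts n \<subseteq> S"
      "x = act (shiftN N V) n t f v" by (rule partE)
    have "pmap (iotaN N n f) ` pts (oadd n N) \<subseteq> up_set N S"
      unfolding mimg_iotaN using *(3) by (auto simp: up_set_def)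
    then have "act V (oadd n N) (oadd t N) (iotaN N n f) v \<in> part V (oadd t N) (up_set N S)"
      using *(2) by (intro partI iotaN_in *(1)) simp_all
    then show "x \<in> part V (oadd t N) (up_set N S)" using *(4) by simp
  qed
  obtain e where e: "e \<in> Cmor (csize S) t" "pmap e ` pts (csize S) = S"
    using emb_exists[OF S] .
  have "part V (oadd t N) (up_set N S) = part V (oadd t N) (pmap (iotaN N (csize S) e) ` pts (oadd (csize S) N))"
    by (simp add: mimg_iotaN e(2))
  also have "\<dots> = act (shiftN N V) (csize S) t e ` carrier (ob (shiftN N V) (csize S))"
    by (simp add: part_emb[OF V iotaN_in[OF e(1)]])
  also have "\<dots> \<subseteq> part (shiftN N V) t S"
    using e by (blast intro: partI)
  finally show "part V (oadd t N) (up_set N S) \<subseteq> part (shiftN N V) t S" .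
qed

lemma shiftN_psum:
  assumes V: "cmodule R V" and FF: "\<And>S. S \<in> FF \<Longrightarrow> S \<subseteq> pts t"
  shows "psum (shiftN N V) t FF = psum V (oadd t N) (up_set N ` FF)"
  unfolding psum_def by (simp add: shiftN_part[OF V FF])

lemma shiftN_families:
  assumes A: "A \<subseteq> pts t" and y: "y \<in> pts t"
  shows "up_set N (pts t - {y}) = pts (oadd t N) - {up_pt N y}"
    and "up_set N ` (\<lambda>x. pts t - {x}) ` A = (\<lambda>x. pts (oadd t N) - {x}) ` up_pt N ` A"
    and "up_set N ` (\<lambda>x. pts t - {x, y}) ` A = (\<lambda>x. pts (oadd t N) - {x, up_pt N y}) ` up_pt N ` A"
proof -
  have 1: "up_set N (pts t - {x}) = pts (oadd t N) - {up_pt N x}" if "x \<in> pts t" for x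
    using up_diff[of "pts t" t "{x}" N] that by (simp add: up_pts)
  have 2: "up_set N (pts t - {x, y}) = pts (oadd t N) - {up_pt N x, up_pt N y}" if "x \<in> pts t" for x
    using up_diff[of "pts t" t "{x, y}" N] that y by (simp add: up_pts)
  show "up_set N (pts t - {y}) = pts (oadd t N) - {up_pt N y}" using 1 y by simp
  show "up_set N ` (\<lambda>x. pts t - {x}) ` A = (\<lambda>x. pts (oadd t N) - {x}) ` up_pt N ` A"
    unfolding image_image by (rule image_cong) (use 1 A in auto)
  show "up_set N ` (\<lambda>x. pts t - {x, y}) ` A = (\<lambda>x. pts (oadd t N) - {x, up_pt N y}) ` up_pt N ` A"
    unfolding image_image by (rule image_cong) (use 2 A in auto)
qed

lemma up_pt_pts: "S \<subseteq> pts t \<Longrightarrow> up_pt N ` S \<subseteq> pts (oadd t N) - pts N"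
proof
  fix p assume S: "S \<subseteq> pts t" and "p \<in> up_pt N ` S"
  then obtain q where q: "q \<in> pts t" "p = up_pt N q" by auto
  then have "p \<in> up_set N (pts t)" unfolding up_set_def by blast
  then show "p \<in> pts (oadd t N) - pts N" using up_pt_notin[OF q(1), of N] q(2) by (simp add: up_pts)
qed

text \<open>For a shift the criterion is tested with \<open>A\<close> and \<open>y\<close> outside
  \<open>pts N\<close>, since the added points lie in every support. These spare points in each
  coordinate are what makes high shifts acyclic.\<close>

lemma shiftN_acycI:
  fixes V :: "('m, 'k, 'v) cmod"
  assumes V: "cmodule R V"
    and tf: "\<And>n t f v. f \<in> Cmor n t \<Longrightarrow> v \<in> carrier (ob V (oadd n N)) \<Longrightarrow>
      act V (oadd n N) (oadd t N) (iotaN N n f) v = \<zero>\<^bsub>ob V (oadd t N)\<^esub> \<Longrightarrow> v = \<zero>\<^bsub>ob V (oadd n N)\<^esub>"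
    and ac: "\<And>t A y. A \<subseteq> pts (oadd t N) - pts N \<Longrightarrow> y \<in> pts (oadd t N) - pts N \<Longrightarrow> y \<notin> A \<Longrightarrow>
      part V (oadd t N) (pts (oadd t N) - {y}) \<inter> psum V (oadd t N) ((\<lambda>x. pts (oadd t N) - {x}) ` A)
        \<subseteq> psum V (oadd t N) ((\<lambda>x. pts (oadd t N) - {x, y}) ` A)"
  shows "acyc (shiftN N V)"
  unfolding acyc_def
proof (intro conjI allI impI)
  show "tors_free (shiftN N V)"
    by (rule tors_freeI[OF shiftN_cmodule[OF V]]) (use tf in auto)
  fix t :: "'m obj" and A y assume A: "A \<subseteq> pts t" and y: "y \<in> pts t - A"
  have yt: "y \<in> pts t" using y by simp
  have s: "up_pt N ` A \<subseteq> pts (oadd t N) - pts N" by (rule up_pt_pts[OF A])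
  have "up_pt N ` {y} \<subseteq> pts (oadd t N) - pts N" by (rule up_pt_pts) (use yt in simp)
  moreover have "up_pt N y \<notin> up_pt N ` A" using y by (simp add: inj_image_mem_iff[OF inj_up_pt])
  ultimately show "part (shiftN N V) t (pts t - {y}) \<inter> psum (shiftN N V) t ((\<lambda>x. pts t - {x}) ` A)
      \<subseteq> psum (shiftN N V) t ((\<lambda>x. pts t - {x, y}) ` A)"
    using ac[OF s, of "up_pt N y"] shiftN_families[OF A yt, of N]
      shiftN_part[OF V, of "pts t - {y}" t N]
      shiftN_psum[OF V, of "(\<lambda>x. pts t - {x}) ` A" t N]
      shiftN_psum[OF V, of "(\<lambda>x. pts t - {x, y}) ` A" t N]
    by auto
qed

lemma shiftN_acyc:
  assumes V: "cmodule R V" and ac: "acyc V"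
  shows "acyc (shiftN N V)"
proof (rule shiftN_acycI[OF V])
  fix n t f v assume "f \<in> Cmor n t" "v \<in> carrier (ob V (oadd n N))"
      "act V (oadd n N) (oadd t N) (iotaN N n f) v = \<zero>\<^bsub>ob V (oadd t N)\<^esub>"
  then show "v = \<zero>\<^bsub>ob V (oadd n N)\<^esub>"
    using tors_freeD[OF V acycD(1)[OF ac] iotaN_in] by blast
next
  fix t A y assume "A \<subseteq> pts (oadd t N) - pts N" "y \<in> pts (oadd t N) - pts N" "y \<notin> A"
  then show "part V (oadd t N) (pts (oadd t N) - {y}) \<inter> psum V (oadd t N) ((\<lambda>x. pts (oadd t N) - {x}) ` A)
        \<subseteq> psum V (oadd t N) ((\<lambda>x. pts (oadd t N) - {x, y}) ` A)"
    using acycD(2)[OF ac, of A "oadd t N" y] by blast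
qed

text \<open>\<open>T\<close> consists of the points of \<open>t\<close> whose translates lie in
  \<open>S\<close>, that is, of \<open>S\<close> without its added points. The strict inequality is
  the source of the drop of the generating degree in the cokernel.\<close>

lemma card_up_Int:
  fixes t :: "'m :: finite obj"
  assumes "S \<subseteq> pts (oadd t N)"
  obtains T where "T \<subseteq> pts t" "card T \<le> card S" "S \<subseteq> up_set N T" "S \<inter> pts N \<noteq> {} \<longrightarrow> card T < card S"
    "S \<inter> pts N = {} \<longrightarrow> S = up_pt N ` T"
proof -
  define T where "T = {p \<in> pts t. up_pt N p \<in> S}"
  have fS: "finite S" using finite_subset[OF assms] by simp
  have im: "up_pt N ` T = S - pts N"
  proof
    show "up_pt N ` T \<subseteq> S - pts N" using up_pt_notin[of _ t N] by (auto simp: T_def)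
    show "S - pts N \<subseteq> up_pt N ` T"
      using assms unfolding up_pts[symmetric] by (auto simp: T_def up_set_def)
  qed
  have c: "card T = card (S - pts N)"
    unfolding im[symmetric] by (rule card_image[symmetric]) (rule inj_on_subset[OF inj_up_pt], simp)
  show thesis
  proof (rule that)
    show "card T \<le> card S" unfolding c by (rule card_mono[OF fS]) auto
    show "S \<subseteq> up_set N T" using im by (auto simp: up_set_def)
    show "S \<inter> pts N \<noteq> {} \<longrightarrow> card T < card S"
      unfolding c by (intro impI psubset_card_mono[OF fS]) auto
  qed (use im in \<open>auto simp: T_def\<close>)
qed

lemma shiftN_gen_lt:
  fixes V :: "('m :: finite, 'k, 'v) cmod"
  assumes V: "cmodule R V" and g: "gen_lt V e"
  shows "gen_lt (shiftN N V) e"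
  unfolding gen_lt_def
proof
  fix t :: "'m obj"
  let ?F = "{S. S \<subseteq> pts t \<and> card S < e}"
  have "psum V (oadd t N) {S. S \<subseteq> pts (oadd t N) \<and> card S < e} \<subseteq> psum V (oadd t N) (up_set N ` ?F)"
  proof (rule psum_mono_sub[OF V])
    fix S assume S: "S \<in> {S. S \<subseteq> pts (oadd t N) \<and> card S < e}"
    then have "S \<subseteq> pts (oadd t N)" by simp
    then obtain T where "T \<subseteq> pts t" "card T \<le> card S" "S \<subseteq> up_set N T"
      "S \<inter> pts N \<noteq> {} \<longrightarrow> card T < card S" "S \<inter> pts N = {} \<longrightarrow> S = up_pt N ` T"
      by (rule card_up_Int)
    then show "\<exists>T\<in>up_set N ` ?F. S \<subseteq> T" using S by (intro bexI[of _ "up_set N T"]) auto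
  qed
  then show "carrier (ob (shiftN N V) t) \<subseteq> psum (shiftN N V) t ?F"
    using g shiftN_psum[OF V, of ?F t N] by (auto simp: gen_lt_def)
qed

lemma nu_hom:
  assumes V: "cmodule R V"
  shows "(\<lambda>n. act V n (oadd n N) (nu N n)) \<in> cmod_hom R V (shiftN N V)"
proof (rule homI)
  fix n t f v assume f: "f \<in> Cmor n t" and v: "v \<in> carrier (ob V n)"
  show "act V t (oadd t N) (nu N t) (act V n t f v) = act (shiftN N V) n t f (act V n (oadd n N) (nu N n) v)"
    using cmD(4)[OF V f nu_in v] cmD(4)[OF V nu_in iotaN_in[OF f] v] by (simp add: nu_natural[OF f])
qed (simp add: cmD(2)[OF V nu_in])

end

section \<open>Noetherianity\<close>

text \<open>Every sequence has a monotone subsequence, and a decreasing sequence of natural numbers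
  is constant from the place where its minimum is attained.\<close>

lemma nat_seq_mono_subseq:
  fixes f :: "nat \<Rightarrow> nat"
  obtains s :: "nat \<Rightarrow> nat" where "strict_mono s" "\<And>j k. j \<le> k \<Longrightarrow> f (s j) \<le> f (s k)"
proof -
  obtain g where g: "strict_mono (g :: nat \<Rightarrow> nat)" "monoseq (\<lambda>n. f (g n))"
    using seq_monosub[of f] by blast
  from g(2) consider "incseq (\<lambda>n. f (g n))" | "decseq (\<lambda>n. f (g n))"
    by (auto simp: monoseq_iff)
  then show thesis
  proof cases
    case 1
    then show thesis using that[OF g(1)] by (simp add: incseq_def)
  next
    case 2
    define m where "m = (LEAST x. x \<in> range (\<lambda>n. f (g n)))"
    have "m \<in> range (\<lambda>n. f (g n))" unfolding m_def by (rule LeastI) (rule rangeI)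
    then obtain K where K: "m = f (g K)" by auto
    have min: "m \<le> f (g n)" for n unfolding m_def by (rule Least_le) (rule rangeI)
    have "f (g n) = m" if "n \<ge> K" for n
      using 2 that min[of n] K by (metis decseqD le_antisym)
    then have eq: "f (g (K + j)) = m" for j by simp
    show thesis
    proof (rule that[of "\<lambda>j. g (K + j)"])
      show "strict_mono (\<lambda>j. g (K + j))" using g(1) by (simp add: strict_mono_def)
    qed (simp add: eq)
  qed
qed

text \<open>Dickson's lemma for the finitely many numerical functions in \<open>C\<close>:
  subsequences are refined for one function after another.\<close>

lemma dickson:
  fixes p :: "nat \<Rightarrow> 'p" and C :: "('p \<Rightarrow> nat) set"
  assumes "finite C"
  obtains s :: "nat \<Rightarrow> nat" where "strict_mono s" "\<And>c j k. c \<in> C \<Longrightarrow> j \<le> k \<Longrightarrow> c (p (s j)) \<le> c (p (s k))"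
  using assms
proof (induction C arbitrary: thesis rule: finite_induct)
  case empty
  show ?case by (rule empty[of id]) (auto simp: strict_mono_def)
next
  case (insert c C)
  obtain s where s: "strict_mono (s :: nat \<Rightarrow> nat)" "\<And>c j k. c \<in> C \<Longrightarrow> j \<le> k \<Longrightarrow> c (p (s j)) \<le> c (p (s k))"
    using insert.IH by blast
  obtain s' where s': "strict_mono (s' :: nat \<Rightarrow> nat)" "\<And>j k. j \<le> k \<Longrightarrow> c (p (s (s' j))) \<le> c (p (s (s' k)))"
    using nat_seq_mono_subseq[of "\<lambda>n. c (p (s n))"] by auto
  show ?case
  proof (rule insert.prems[of "s \<circ> s'"])
    show "strict_mono (s \<circ> s')" using s(1) s'(1) by (rule strict_mono_o)
    fix d j k assume "d \<in> insert c C" "(j::nat) \<le> k"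
    moreover have "s' j \<le> s' k" using s'(1) \<open>j \<le> k\<close> by (simp add: strict_mono_less_eq)
    ultimately show "d (p ((s \<circ> s') j)) \<le> d (p ((s \<circ> s') k))"
      using s(2)[of d "s' j" "s' k"] s'(2)[of j k] by auto
  qed
qed

text \<open>Composition with an arbitrary injection does not respect the order on monomials, so
  divisibility of monomials is restricted to factors that are increasing in each coordinate.\<close>

definition increasing :: "'m obj \<Rightarrow> 'm mor \<Rightarrow> bool" where
  "increasing t g \<longleftrightarrow> (\<forall>i x y. 1 \<le> x \<longrightarrow> x < y \<longrightarrow> y \<le> t i \<longrightarrow> g i x < g i y)"

text \<open>
  The gaps of \<open>f\<close>, including the two outer ones, are at most those of \<open>f'\<close>; moving each point by as
  much as the closest value of \<open>f\<close> below it turns \<open>f\<close> into \<open>f'\<close>.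
\<close>

lemma increasing_factor:
  assumes f: "f \<in> Cmor n t" and f': "f' \<in> Cmor n t'"
    and t: "\<And>i. t i \<le> t' i"
    and lo: "\<And>i a. (i, a) \<in> pts n \<Longrightarrow> f i a \<le> f' i a"
    and hi: "\<And>i a. (i, a) \<in> pts n \<Longrightarrow> t i - f i a \<le> t' i - f' i a"
    and gap: "\<And>i a b. (i, a) \<in> pts n \<Longrightarrow> (i, b) \<in> pts n \<Longrightarrow> f i b - f i a \<le> f' i b - f' i a"
  obtains g where "g \<in> Cmor t t'" "increasing t g" "f' = Ccomp n g f"
proof -
  \<comment> \<open>\<open>\<phi> i x\<close> is the maximum of \<open>x\<close> and of the
    translates of \<open>x\<close> by the displacements of the points \<open>f i a\<close> below it.
    From \<open>x\<close> to a larger \<open>y\<close> each candidate grows by exactly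
    \<open>y - x\<close>, whence strict monotonicity. The hypothesis \<open>hi\<close> keeps the
    maximum within \<open>t' i\<close>, while \<open>gap\<close> and \<open>lo\<close> make the
    candidate of \<open>a\<close> the largest one at \<open>f i a\<close>.\<close>
  define E where "E i x = insert x {f' i a + (x - f i a) | a. (i, a) \<in> pts n \<and> f i a \<le> x}" for i x
  define \<phi> where "\<phi> i x = Max (E i x)" for i x
  have fin: "finite (E i x)" for i x
  proof -
    have "{f' i a + (x - f i a) | a. (i, a) \<in> pts n \<and> f i a \<le> x} \<subseteq> (\<lambda>a. f' i a + (x - f i a)) ` {1..n i}"
      by (auto simp: pts_def)
    then have "finite {f' i a + (x - f i a) | a. (i, a) \<in> pts n \<and> f i a \<le> x}"
      by (rule finite_subset) simp
    then show ?thesis by (simp add: E_def)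
  qed
  have ge: "u \<le> \<phi> i x" if "u \<in> E i x" for u i x
    unfolding \<phi>_def using fin that by (rule Max_ge)
  have mem: "\<phi> i x \<in> E i x" for i x
    unfolding \<phi>_def by (rule Max_in[OF fin]) (auto simp: E_def)
  have inc: "\<phi> i x < \<phi> i y" if xy: "x < y" for i x y
  proof -
    from mem[of i x] consider "\<phi> i x = x" | a where "(i, a) \<in> pts n" "f i a \<le> x" "\<phi> i x = f' i a + (x - f i a)"
      by (auto simp: E_def)
    then show ?thesis
    proof cases
      case 1
      then show ?thesis using ge[of y i y] xy by (simp add: E_def)
    next
      case 2
      then have "f' i a + (y - f i a) \<in> E i y" using xy unfolding E_def by (intro insertI2 CollectI exI[of _ a]) auto
      then show ?thesis using ge[of "f' i a + (y - f i a)" i y] 2 xy by linarith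
    qed
  qed
  have bd: "1 \<le> \<phi> i x \<and> \<phi> i x \<le> t' i" if "1 \<le> x" "x \<le> t i" for i x
  proof
    show "1 \<le> \<phi> i x" using ge[of x i x] that by (simp add: E_def)
    from mem[of i x] consider "\<phi> i x = x" | a where "(i, a) \<in> pts n" "f i a \<le> x" "\<phi> i x = f' i a + (x - f i a)"
      by (auto simp: E_def)
    then show "\<phi> i x \<le> t' i"
    proof cases
      case 1
      then show ?thesis using t[of i] that by simp
    next
      case 2
      have "f' i a \<le> t' i" using CmorD(5)[OF f', of a i] 2 by (simp add: pts_def)
      then show ?thesis using hi[OF 2(1)] 2(2,3) that by linarith
    qed
  qed
  have val: "\<phi> i (f i a) = f' i a" if a: "(i, a) \<in> pts n" for i a
  proof (rule antisym)
    from mem[of i "f i a"] consider "\<phi> i (f i a) = f i a"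
      | b where "(i, b) \<in> pts n" "f i b \<le> f i a" "\<phi> i (f i a) = f' i b + (f i a - f i b)"
      by (auto simp: E_def)
    then show "\<phi> i (f i a) \<le> f' i a"
    proof cases
      case 1
      then show ?thesis using lo[OF a] by simp
    next
      case 2
      show ?thesis
      proof (cases "f i b = f i a")
        case True
        then have "b = a" using Cmor_inj[OF f, of i b a] 2 a by (simp add: pts_def)
        then show ?thesis using 2 by simp
      next
        case False
        then show ?thesis using gap[OF 2(1) a] 2(2,3) by linarith
      qed
    qed
    have "f' i a + (f i a - f i a) \<in> E i (f i a)"
      unfolding E_def using a by (intro insertI2 CollectI exI[of _ a]) simp
    then show "f' i a \<le> \<phi> i (f i a)" using ge by fastforce
  qed
  have g: "mk_mor t \<phi> \<in> Cmor t t'"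
  proof (rule mk_morI)
    show "inj_on (\<phi> i) {1..t i}" for i
    proof (rule inj_onI)
      fix x y assume "\<phi> i x = \<phi> i y"
      then show "x = y" using inc[of x y i] inc[of y x i] by (cases x y rule: linorder_cases) auto
    qed
  qed (rule bd)
  have "increasing t (mk_mor t \<phi>)"
    using inc by (auto simp: increasing_def mk_mor_def)
  moreover have "f' = Ccomp n (mk_mor t \<phi>) f"
  proof (rule Cmor_eqI[OF f' Ccomp_in[OF f g]])
    fix p assume p: "p \<in> pts n"
    obtain i a where ia: "p = (i, a)" by (cases p)
    have "pmap (Ccomp n (mk_mor t \<phi>) f) p = pmap \<phi> (pmap f p)"
      using CmorD(1)[OF f p] by (simp add: pmap_Ccomp[OF p] pmap_mk_mor)
    then show "pmap f' p = pmap (Ccomp n (mk_mor t \<phi>) f) p"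
      using val p ia by (simp add: pmap_simp)
  qed
  ultimately show thesis using that g by blast
qed

context coeff_ring
begin

definition orb :: "('m, 'k, 'v) cmod \<Rightarrow> ('m obj \<times> 'v) set \<Rightarrow> 'm obj \<Rightarrow> 'v set" where
  "orb V G t = {act V n t f v | n v f. (n, v) \<in> G \<and> f \<in> Cmor n t}"

text \<open>Finite generation in terms of elements, which avoids direct sums of free modules. By
  \<open>fin_gen_imp_fgen\<close> and \<open>fgen_imp_fin_gen\<close> it is equivalent to
  \<open>fin_gen\<close>.\<close>

definition fgen :: "('m, 'k, 'v) cmod \<Rightarrow> bool" where
  "fgen V \<longleftrightarrow> (\<exists>G. finite G \<and> (\<forall>(n, v)\<in>G. v \<in> carrier (ob V n)) \<and>
     (\<forall>t. carrier (ob V t) \<subseteq> mod_span R (ob V t) (orb V G t)))"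

lemma orb_carrier:
  assumes "cmodule R V" "\<forall>(n, v)\<in>G. v \<in> carrier (ob V n)"
  shows "orb V G t \<subseteq> carrier (ob V t)"
proof
  fix x assume "x \<in> orb V G t"
  then obtain n v f where "(n, v) \<in> G" "f \<in> Cmor n t" "x = act V n t f v" by (auto simp: orb_def)
  then show "x \<in> carrier (ob V t)" using assms(2) act_in[OF assms(1)] by auto
qed

lemma orb_subfunctor:
  assumes V: "cmodule R V" and G: "\<forall>(n, v)\<in>G. v \<in> carrier (ob V n)"
  shows "subfunctor R V (\<lambda>t. mod_span R (ob V t) (orb V G t))"
proof (rule subfunctorI)
  show S: "submodule (mod_span R (ob V t) (orb V G t)) R (ob V t)" for t
    by (rule span_sm[OF cmD(1)[OF V] orb_carrier[OF V G]])
  fix n t f x assume f: "f \<in> Cmor n t" and x: "x \<in> mod_span R (ob V n) (orb V G n)"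
  have "act V n t f ` orb V G n \<subseteq> orb V G t"
  proof
    fix y assume "y \<in> act V n t f ` orb V G n"
    then obtain k v g where *: "(k, v) \<in> G" "g \<in> Cmor k n" "y = act V n t f (act V k n g v)"
      by (auto simp: orb_def)
    then have "y = act V k t (Ccomp k f g) v" using cmD(4)[OF V *(2) f] G by auto
    then show "y \<in> orb V G t" using * Ccomp_in[OF *(2) f] by (auto simp: orb_def)
  qed
  then have "act V n t f ` orb V G n \<subseteq> mod_span R (ob V t) (orb V G t)"
    using span_incl by (rule order_trans)
  then have "act V n t f ` mod_span R (ob V n) (orb V G n) \<subseteq> mod_span R (ob V t) (orb V G t)"
    by (rule span_lin_subset[OF cmD(2)[OF V f] cmD(1)[OF V] cmD(1)[OF V] orb_carrier[OF V G] S])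
  then show "act V n t f x \<in> mod_span R (ob V t) (orb V G t)" using x by blast
qed

lemma ideal_sequence_stable:
  assumes "noetherian_ring R" "\<And>k :: nat. ideal (J k) R" "\<And>k. J k \<subseteq> J (Suc k)"
  obtains k where "J (Suc k) = J k"
proof -
  have mono: "J j \<subseteq> J k" if "j \<le> k" for j k
    using that assms(3) by (rule lift_Suc_mono_le[rotated])
  have "\<Union>(range J) \<in> range J"
  proof (rule noetherian_ring.ideal_chain_is_trivial[OF assms(1)])
    have "J j \<subseteq> J k \<or> J k \<subseteq> J j" for j k using mono[of j k] mono[of k j] by (cases "j \<le> k") auto
    then show "subset.chain {I. ideal I R} (range J)"
      using assms(2) by (auto simp: subset.chain_def)
  qed simp
  then obtain k where "\<Union>(range J) = J k" by auto
  then show thesis using that[of k] assms(3)[of k] by blast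
qed

text \<open>If there were no finite \<open>B\<close>, elements of \<open>P\<close> could be chosen
  one after another so that none is covered by an earlier one. A subsequence increasing for
  \<open>le\<close> would carry an ascending chain of ideals, and its stabilisation contradicts the
  choice.\<close>

lemma finite_basis_of_monotone_ideals:
  fixes le :: "'p \<Rightarrow> 'p \<Rightarrow> bool" and J :: "'p \<Rightarrow> 'k set"
  assumes noeth: "noetherian_ring R" and id: "\<And>p. p \<in> P \<Longrightarrow> ideal (J p) R"
    and mono: "\<And>p q. p \<in> P \<Longrightarrow> q \<in> P \<Longrightarrow> le p q \<Longrightarrow> J p \<subseteq> J q"
    and wqo: "\<And>p :: nat \<Rightarrow> 'p. range p \<subseteq> P \<Longrightarrow> \<exists>s. strict_mono (s :: nat \<Rightarrow> nat) \<and> (\<forall>j k. j < k \<longrightarrow> le (p (s j)) (p (s k)))"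
  shows "\<exists>B. finite B \<and> B \<subseteq> P \<and> (\<forall>p\<in>P. \<exists>b\<in>B. le b p \<and> J p = J b)"
proof (rule ccontr)
  assume no: "\<not> ?thesis"
  have bad: "\<exists>p\<in>P. \<forall>b\<in>B. \<not> (le b p \<and> J p = J b)" if "finite B" "B \<subseteq> P" for B
  proof (rule ccontr)
    assume "\<not> (\<exists>p\<in>P. \<forall>b\<in>B. \<not> (le b p \<and> J p = J b))"
    then have "\<forall>p\<in>P. \<exists>b\<in>B. le b p \<and> J p = J b" by simp
    then have ex: "\<exists>B. finite B \<and> B \<subseteq> P \<and> (\<forall>p\<in>P. \<exists>b\<in>B. le b p \<and> J p = J b)"
      using that by (intro exI[of _ B] conjI)
    show False using no ex by (rule notE)
  qed
  define b where "b B = (SOME p. p \<in> P \<and> (\<forall>b\<in>B. \<not> (le b p \<and> J p = J b)))" for B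
  have b: "b B \<in> P" "\<And>x. x \<in> B \<Longrightarrow> \<not> (le x (b B) \<and> J (b B) = J x)" if B: "finite B" "B \<subseteq> P" for B
  proof -
    have "b B \<in> P \<and> (\<forall>x\<in>B. \<not> (le x (b B) \<and> J (b B) = J x))"
      unfolding b_def by (rule someI_ex) (use bad[OF B] in blast)
    then show "b B \<in> P" "\<And>x. x \<in> B \<Longrightarrow> \<not> (le x (b B) \<and> J (b B) = J x)" by blast+
  qed
  \<comment> \<open>\<open>S k\<close> is the set of the first \<open>k\<close> choices.\<close>
  define S where "S = rec_nat {} (\<lambda>_ B. insert (b B) B)"
  have S: "S 0 = {}" "S (Suc k) = insert (b (S k)) (S k)" for k by (simp_all add: S_def)
  have SP: "finite (S k) \<and> S k \<subseteq> P" for k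
    by (induction k) (use b(1) in \<open>auto simp: S\<close>)
  define p where "p k = b (S k)" for k
  have pS: "p j \<in> S k" if "j < k" for j k
    using that by (induction k) (auto simp: S p_def less_Suc_eq)
  have pP: "p k \<in> P" for k using b(1) SP by (simp add: p_def)
  have pbad: "\<not> (le (p j) (p k) \<and> J (p k) = J (p j))" if "j < k" for j k
    using b(2)[of "S k" "p j"] SP pS[OF that] by (simp add: p_def)
  obtain s where s: "strict_mono (s :: nat \<Rightarrow> nat)" "\<And>j k. j < k \<Longrightarrow> le (p (s j)) (p (s k))"
    using wqo[of p] pP by blast
  obtain k where "J (p (s (Suc k))) = J (p (s k))"
  proof (rule ideal_sequence_stable[OF noeth, of "\<lambda>k. J (p (s k))"])
    show "ideal (J (p (s k))) R" for k using id pP by simp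
    show "J (p (s k)) \<subseteq> J (p (s (Suc k)))" for k using mono[OF pP pP s(2)] by simp
  qed
  moreover have "s k < s (Suc k)" using s(1) by (simp add: strict_mono_def)
  ultimately show False using pbad[of "s k" "s (Suc k)"] s(2)[of k "Suc k"] by simp
qed

end

text \<open>
  A monomial at a fixed target is a pair of the index of a generator and a morphism from the object of
  that generator; \<open>L\<close> enumerates the points of each of these objects.
\<close>

definition mon_less :: "(nat \<Rightarrow> ('m \<times> nat) list) \<Rightarrow> nat \<times> 'm mor \<Rightarrow> nat \<times> 'm mor \<Rightarrow> bool" where
  "mon_less L \<mu> \<nu> \<longleftrightarrow> fst \<mu> < fst \<nu> \<or> (fst \<mu> = fst \<nu> \<and>
     (\<exists>q<length (L (fst \<mu>)). (\<forall>q'<q. pmap (snd \<mu>) (L (fst \<mu>) ! q') = pmap (snd \<nu>) (L (fst \<mu>) ! q')) \<and>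
        snd (pmap (snd \<mu>) (L (fst \<mu>) ! q)) < snd (pmap (snd \<nu>) (L (fst \<mu>) ! q))))"

lemma mon_less_irrefl: "\<not> mon_less L \<mu> \<mu>"
  by (auto simp: mon_less_def)

lemma mon_less_trans:
  assumes 1: "mon_less L \<mu> \<nu>" and 2: "mon_less L \<nu> \<rho>"
  shows "mon_less L \<mu> \<rho>"
proof (cases "fst \<mu> = fst \<nu> \<and> fst \<nu> = fst \<rho>")
  case True
  define l where "l = L (fst \<mu>)"
  define F where "F \<kappa> q = pmap (snd \<kappa>) (l ! q)" for \<kappa> :: "nat \<times> 'a mor" and q
  from 1 True obtain q where q: "q < length l" "\<And>q'. q' < q \<Longrightarrow> F \<mu> q' = F \<nu> q'" "snd (F \<mu> q) < snd (F \<nu> q)"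
    by (auto simp: mon_less_def l_def F_def)
  from 2 True obtain r where r: "r < length l" "\<And>q'. q' < r \<Longrightarrow> F \<nu> q' = F \<rho> q'" "snd (F \<nu> r) < snd (F \<rho> r)"
    by (auto simp: mon_less_def l_def F_def)
  \<comment> \<open>The first place where \<open>\<mu>\<close> and \<open>\<rho>\<close> differ is
    the earlier of the two known places of difference.\<close>
  define z where "z = min q r"
  have "z < length l" using q r by (simp add: z_def)
  moreover have "\<forall>q'<z. F \<mu> q' = F \<rho> q'" using q(2) r(2) by (simp add: z_def)
  moreover have "snd (F \<mu> z) < snd (F \<rho> z)"
    using q(3) r(3) q(2)[of r] r(2)[of q] by (cases q r rule: linorder_cases) (simp_all add: z_def)
  ultimately show ?thesis using True unfolding mon_less_def F_def l_def by auto
next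
  case False
  then show ?thesis using 1 2 by (auto simp: mon_less_def)
qed

text \<open>Two distinct morphisms from the same object differ at some listed point. The first such
  point decides: \<open>pmap\<close> preserves the index, so the two images there differ in their
  second component.\<close>

lemma mon_less_total:
  assumes L: "\<And>r. set (L r) = pts (ns r)" and f: "f \<in> Cmor (ns r) t" and g: "g \<in> Cmor (ns r') t"
    and ne: "(r, f) \<noteq> (r', g)"
  shows "mon_less L (r, f) (r', g) \<or> mon_less L (r', g) (r, f)"
proof (cases "r = r'")
  case True
  define D where "D q \<longleftrightarrow> q < length (L r) \<and> pmap f (L r ! q) \<noteq> pmap g (L r ! q)" for q
  have "\<exists>q. D q"
  proof (rule ccontr)
    assume "\<nexists>q. D q"
    then have "\<forall>q<length (L r). pmap f (L r ! q) = pmap g (L r ! q)" by (auto simp: D_def)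
    then have "pmap f p = pmap g p" if "p \<in> pts (ns r)" for p
      using that unfolding L[of r, symmetric] in_set_conv_nth by auto
    then have "f = g" using Cmor_eqI[OF f, of g t] g True by simp
    then show False using ne True by simp
  qed
  then obtain q where q: "D q" "\<And>q'. q' < q \<Longrightarrow> \<not> D q'"
    using exists_least_iff[of D] by blast
  have fst: "fst (pmap h p) = fst p" for h :: "'a mor" and p by (cases p) (simp add: pmap_simp)
  have len: "q < length (L r)" and ne: "pmap f (L r ! q) \<noteq> pmap g (L r ! q)"
    using q(1) by (auto simp: D_def)
  have eq: "pmap f (L r ! q') = pmap g (L r ! q')" if "q' < q" for q'
    using q(2)[OF that] that len by (simp add: D_def)
  have "snd (pmap f (L r ! q)) \<noteq> snd (pmap g (L r ! q))"
    using ne fst[of f] fst[of g] by (simp add: prod_eq_iff)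
  then consider "snd (pmap f (L r ! q)) < snd (pmap g (L r ! q))"
    | "snd (pmap g (L r ! q)) < snd (pmap f (L r ! q))" by linarith
  then show ?thesis
    unfolding mon_less_def using len eq True by cases (auto intro!: exI[of _ q])
qed (auto simp: mon_less_def)

text \<open>Composition with \<open>g\<close> keeps the agreement before the decisive point and, as
  \<open>g\<close> is increasing, the strict inequality at it.\<close>

lemma mon_less_Ccomp:
  assumes L: "\<And>r. set (L r) = pts (ns r)" and f: "f \<in> Cmor (ns r) t" and f': "f' \<in> Cmor (ns r') t"
    and g: "increasing t g" and less: "mon_less L (r, f) (r', f')"
  shows "mon_less L (r, Ccomp (ns r) g f) (r', Ccomp (ns r') g f')"
proof (cases "r = r'")
  case True
  with less obtain q where q: "q < length (L r)" "\<And>q'. q' < q \<Longrightarrow> pmap f (L r ! q') = pmap f' (L r ! q')"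
    "snd (pmap f (L r ! q)) < snd (pmap f' (L r ! q))"
    by (auto simp: mon_less_def)
  have pt: "L r ! q' \<in> pts (ns r)" if "q' < length (L r)" for q'
    using nth_mem[OF that] L by simp
  obtain i a where ia: "L r ! q = (i, a)" by (cases "L r ! q")
  then have a: "1 \<le> a" "a \<le> ns r i" using pt[OF q(1)] by (simp_all add: pts_def)
  have "g i (f i a) < g i (f' i a)"
    using g q(3) CmorD(5)[OF f, of a i] CmorD(5)[OF f', of a i] a True ia
    by (auto simp: increasing_def pmap_simp)
  then have "snd (pmap (Ccomp (ns r) g f) (L r ! q)) < snd (pmap (Ccomp (ns r) g f') (L r ! q))"
    using pt[OF q(1)] ia unfolding pmap_Ccomp[OF pt[OF q(1)]] by (simp add: pmap_simp)
  moreover have "\<forall>q'<q. pmap (Ccomp (ns r) g f) (L r ! q') = pmap (Ccomp (ns r) g f') (L r ! q')"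
    using q(1,2) pt by (simp add: pmap_Ccomp)
  ultimately show ?thesis using q(1) True by (auto simp: mon_less_def)
qed (use less in \<open>auto simp: mon_less_def\<close>)

lemma monomials_wqo:
  fixes ns :: "nat \<Rightarrow> 'm :: finite obj" and p :: "nat \<Rightarrow> 'm obj \<times> nat \<times> 'm mor"
  assumes p: "range p \<subseteq> {(t, r, f). r < N \<and> f \<in> Cmor (ns r) t}"
  shows "\<exists>s. strict_mono (s :: nat \<Rightarrow> nat) \<and> (\<forall>j k. j < k \<longrightarrow>
    (\<lambda>(t, r, f) (t', r', f'). r = r' \<and> (\<exists>g\<in>Cmor t t'. increasing t g \<and> f' = Ccomp (ns r) g f))
      (p (s j)) (p (s k)))"
proof -
  define Q where "Q = (\<Union>r<N. pts (ns r))"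
  \<comment> \<open>These are the quantities compared in \<open>increasing_factor\<close>.
    Monotonicity of both \<open>r\<close> and \<open>N - r\<close> forces the index \<open>r\<close>
    to be constant along the subsequence, so that the values and gaps of \<open>f\<close> and
    \<open>f'\<close> refer to the same source.\<close>
  define C :: "('m obj \<times> nat \<times> 'm mor \<Rightarrow> nat) set" where
    "C = {\<lambda>(t, r, f). r, \<lambda>(t, r, f). N - r} \<union> range (\<lambda>i (t, r, f). t i)
      \<union> (\<lambda>(i, a) (t, r, f). f i a) ` Q \<union> (\<lambda>(i, a) (t, r, f). t i - f i a) ` Q
      \<union> (\<lambda>((i, a), (i', b)) (t, r, f). f i' b - f i a) ` (Q \<times> Q)"
  have "finite C" by (auto simp: C_def Q_def)
  then obtain s where s: "strict_mono (s :: nat \<Rightarrow> nat)"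
    and mono: "\<And>c j k. c \<in> C \<Longrightarrow> j \<le> k \<Longrightarrow> c (p (s j)) \<le> c (p (s k))"
    using dickson[of C p] by blast
  have "(\<lambda>(t, r, f) (t', r', f'). r = r' \<and> (\<exists>g\<in>Cmor t t'. increasing t g \<and> f' = Ccomp (ns r) g f))
      (p (s j)) (p (s k))" if jk: "j < k" for j k
  proof -
    obtain t r f where 1: "p (s j) = (t, r, f)" by (cases "p (s j)")
    obtain t' r' f' where 2: "p (s k) = (t', r', f')" by (cases "p (s k)")
    have f: "r < N" "f \<in> Cmor (ns r) t" using p 1 rangeI[of p "s j"] by auto
    have f': "r' < N" "f' \<in> Cmor (ns r') t'" using p 2 rangeI[of p "s k"] by auto
    have m: "c (t, r, f) \<le> c (t', r', f')" if "c \<in> C" for c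
      using mono[OF that, of j k] jk 1 2 by simp
    have "r \<le> r'" using m[of "\<lambda>(t, r, f). r"] by (simp add: C_def)
    moreover have "N - r \<le> N - r'" using m[of "\<lambda>(t, r, f). N - r"] by (simp add: C_def)
    ultimately have r: "r' = r" using f(1) f'(1) by linarith
    have Q: "x \<in> Q" if "x \<in> pts (ns r)" for x using that f(1) by (auto simp: Q_def)
    obtain g where "g \<in> Cmor t t'" "increasing t g" "f' = Ccomp (ns r) g f"
    proof (rule increasing_factor[OF f(2)])
      show "f' \<in> Cmor (ns r) t'" using f'(2) r by simp
      show "t i \<le> t' i" for i
        using m[of "\<lambda>(t, r, f). t i"] by (auto simp: C_def)
      show "f i a \<le> f' i a" if "(i, a) \<in> pts (ns r)" for i a
      proof -
        have "(\<lambda>(t, r, f). f i a) \<in> C"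
          unfolding C_def using Q[OF that] by (intro UnI1[of _ _ "_ ` (Q \<times> Q)"] UnI1 UnI2 image_eqI[of _ _ "(i, a)"]) auto
        then show ?thesis using m by fastforce
      qed
      show "t i - f i a \<le> t' i - f' i a" if "(i, a) \<in> pts (ns r)" for i a
      proof -
        have "(\<lambda>(t, r, f). t i - f i a) \<in> C"
          unfolding C_def using Q[OF that] by (intro UnI1[of _ _ "_ ` (Q \<times> Q)"] UnI2 image_eqI[of _ _ "(i, a)"]) auto
        then show ?thesis using m by fastforce
      qed
      show "f i b - f i a \<le> f' i b - f' i a" if "(i, a) \<in> pts (ns r)" "(i, b) \<in> pts (ns r)" for i a b
      proof -
        have "(\<lambda>(t, r, f). f i b - f i a) \<in> C"
          unfolding C_def using Q[OF that(1)] Q[OF that(2)] by (intro UnI2 image_eqI[of _ _ "((i, a), (i, b))"]) auto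
        then show ?thesis using m by fastforce
      qed
    qed
    then show ?thesis using 1 2 r by auto
  qed
  then show ?thesis using s by blast
qed

context coeff_ring
begin

lemma add_swap_minus:
  assumes M: "module R M" and c: "a \<in> carrier M" "x \<in> carrier M" "y \<in> carrier M"
  shows "a \<oplus>\<^bsub>M\<^esub> x = (a \<oplus>\<^bsub>M\<^esub> y) \<oplus>\<^bsub>M\<^esub> (x \<ominus>\<^bsub>M\<^esub> y)"
proof -
  interpret M: module R M by fact
  have "y \<oplus>\<^bsub>M\<^esub> (x \<oplus>\<^bsub>M\<^esub> \<ominus>\<^bsub>M\<^esub> y) = x \<oplus>\<^bsub>M\<^esub> (y \<oplus>\<^bsub>M\<^esub> \<ominus>\<^bsub>M\<^esub> y)"
    using c by (intro M.a_lcomm) auto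
  then show ?thesis using c by (simp add: a_minus_def M.a_assoc M.r_neg)
qed

lemma add_minus_cancel:
  assumes M: "module R M" and c: "a \<in> carrier M" "d \<in> carrier M"
  shows "(a \<oplus>\<^bsub>M\<^esub> d) \<ominus>\<^bsub>M\<^esub> a = d"
proof -
  interpret M: module R M by fact
  have "(a \<oplus>\<^bsub>M\<^esub> d) \<ominus>\<^bsub>M\<^esub> a = \<ominus>\<^bsub>M\<^esub> a \<oplus>\<^bsub>M\<^esub> (a \<oplus>\<^bsub>M\<^esub> d)"
    using c unfolding a_minus_def by (intro M.a_comm) auto
  also have "\<dots> = d" using c by (simp add: M.a_assoc[symmetric] M.l_neg)
  finally show ?thesis .
qed

text \<open>The argument runs in \<open>V\<close> itself: monomials are evaluated at the generators
  by \<open>mv\<close>, and the evaluated monomials may satisfy relations. Leading coefficients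
  still form ideals that grow along increasing morphisms, so finitely many elements of
  \<open>X\<close> account for all of them. Subtracting combinations of translates of these elements
  lowers the leading monomial until nothing is left.\<close>

lemma noetherian_sub:
  fixes V :: "('m :: finite, 'k, 'v) cmod"
  assumes noeth: "noetherian_ring R" and V: "cmodule R V" and fg: "fgen V" and X: "subfunctor R V X"
  obtains G where "finite G" "\<forall>(n, v)\<in>G. v \<in> X n" "\<And>t. X t \<subseteq> mod_span R (ob V t) (orb V G t)"
proof -
  obtain G0 where G0: "finite G0" "\<forall>(n, v)\<in>G0. v \<in> carrier (ob V n)"
      "\<And>t. carrier (ob V t) \<subseteq> mod_span R (ob V t) (orb V G0 t)"
    using fg by (auto simp: fgen_def)
  obtain gs where gs: "set gs = G0" using finite_list[OF G0(1)] by blast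
  define N where "N = length gs"
  define ns where "ns r = fst (gs ! r)" for r
  define vs where "vs r = snd (gs ! r)" for r
  have vs: "vs r \<in> carrier (ob V (ns r))" if "r < N" for r
    using G0(2) nth_mem[of r gs] that gs by (fastforce simp: N_def ns_def vs_def)
  have "\<exists>l. set l = pts (ns r)" for r by (rule finite_list) simp
  then obtain L where L: "\<And>r. set (L r) = pts (ns r)" by metis
  define Mon where "Mon t = {(r, f). r < N \<and> f \<in> Cmor (ns r) t}" for t
  define mv where "mv t \<mu> = act V (ns (fst \<mu>)) t (snd \<mu>) (vs (fst \<mu>))" for t and \<mu> :: "nat \<times> 'm mor"
  define lower where "lower t \<mu> = {\<nu> \<in> Mon t. mon_less L \<nu> \<mu>}" for t \<mu>
  define sp where "sp t D = mod_span R (ob V t) (mv t ` D)" for t D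
  have finMon: "finite (Mon t)" for t
  proof -
    have "Mon t = (SIGMA r:{..<N}. Cmor (ns r) t)" by (auto simp: Mon_def)
    then show ?thesis by (simp add: finite_Cmor)
  qed
  have mvc: "mv t \<mu> \<in> carrier (ob V t)" if "\<mu> \<in> Mon t" for t \<mu>
    using that vs by (auto simp: Mon_def mv_def intro!: act_in[OF V])
  have mvD: "mv t ` D \<subseteq> carrier (ob V t)" if "D \<subseteq> Mon t" for t D using that mvc by blast
  have lowerM: "lower t \<mu> \<subseteq> Mon t" for t \<mu> by (auto simp: lower_def)
  have sps: "submodule (sp t D) R (ob V t)" if "D \<subseteq> Mon t" for t D
    unfolding sp_def by (rule span_sm[OF cmD(1)[OF V] mvD[OF that]])
  note sl = sps[OF lowerM]
  \<comment> \<open>The possible coefficients at \<open>\<mu>\<close> of elements of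
    \<open>Y t\<close> that otherwise involve monomials below \<open>\<mu>\<close>. They are not
    determined by the element, but they form an ideal all the same.\<close>
  define I where "I Y t \<mu> = {c \<in> carrier R. \<exists>y\<in>sp t (lower t \<mu>). c \<odot>\<^bsub>ob V t\<^esub> mv t \<mu> \<oplus>\<^bsub>ob V t\<^esub> y \<in> Y t}"
    for Y :: "'m obj \<Rightarrow> 'v set" and t \<mu>
  have ideal_I: "ideal (I Y t \<mu>) R" if Y: "subfunctor R V Y" and \<mu>: "\<mu> \<in> Mon t" for Y t \<mu>
  proof -
    interpret M: module R "ob V t" by (rule cmD(1)[OF V])
    note Yt = subfunctorD(1)[OF Y, of t]
    note mm = mvc[OF \<mu>]
    have mult: "c \<otimes> d \<in> I Y t \<mu>" if c: "c \<in> carrier R" and d: "d \<in> I Y t \<mu>" for c d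
    proof -
      from d obtain y where y: "d \<in> carrier R" "y \<in> sp t (lower t \<mu>)" "d \<odot>\<^bsub>ob V t\<^esub> mv t \<mu> \<oplus>\<^bsub>ob V t\<^esub> y \<in> Y t"
        by (auto simp: I_def)
      have "c \<odot>\<^bsub>ob V t\<^esub> (d \<odot>\<^bsub>ob V t\<^esub> mv t \<mu> \<oplus>\<^bsub>ob V t\<^esub> y) \<in> Y t" by (rule sm_smult[OF Yt c y(3)])
      moreover have "c \<odot>\<^bsub>ob V t\<^esub> (d \<odot>\<^bsub>ob V t\<^esub> mv t \<mu> \<oplus>\<^bsub>ob V t\<^esub> y)
          = (c \<otimes> d) \<odot>\<^bsub>ob V t\<^esub> mv t \<mu> \<oplus>\<^bsub>ob V t\<^esub> c \<odot>\<^bsub>ob V t\<^esub> y"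
        using c y mm sm_in[OF sl y(2)] by (simp add: M.smult_r_distr M.smult_assoc1)
      ultimately show ?thesis using c y sm_smult[OF sl c y(2)] by (auto simp: I_def)
    qed
    have add: "c \<oplus> d \<in> I Y t \<mu>" if c: "c \<in> I Y t \<mu>" and d: "d \<in> I Y t \<mu>" for c d
    proof -
      from c obtain x where x: "c \<in> carrier R" "x \<in> sp t (lower t \<mu>)" "c \<odot>\<^bsub>ob V t\<^esub> mv t \<mu> \<oplus>\<^bsub>ob V t\<^esub> x \<in> Y t"
        by (auto simp: I_def)
      from d obtain y where y: "d \<in> carrier R" "y \<in> sp t (lower t \<mu>)" "d \<odot>\<^bsub>ob V t\<^esub> mv t \<mu> \<oplus>\<^bsub>ob V t\<^esub> y \<in> Y t"
        by (auto simp: I_def)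
      have "(c \<odot>\<^bsub>ob V t\<^esub> mv t \<mu> \<oplus>\<^bsub>ob V t\<^esub> x) \<oplus>\<^bsub>ob V t\<^esub> (d \<odot>\<^bsub>ob V t\<^esub> mv t \<mu> \<oplus>\<^bsub>ob V t\<^esub> y) \<in> Y t"
        by (rule sm_add[OF Yt x(3) y(3)])
      moreover have "(c \<odot>\<^bsub>ob V t\<^esub> mv t \<mu> \<oplus>\<^bsub>ob V t\<^esub> x) \<oplus>\<^bsub>ob V t\<^esub> (d \<odot>\<^bsub>ob V t\<^esub> mv t \<mu> \<oplus>\<^bsub>ob V t\<^esub> y)
          = (c \<oplus> d) \<odot>\<^bsub>ob V t\<^esub> mv t \<mu> \<oplus>\<^bsub>ob V t\<^esub> (x \<oplus>\<^bsub>ob V t\<^esub> y)"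
        using x(1) y(1) mm sm_in[OF sl x(2)] sm_in[OF sl y(2)] by (simp add: M.smult_l_distr M.a_ac)
      ultimately show ?thesis using x y sm_add[OF sl x(2) y(2)] by (auto simp: I_def)
    qed
    have z: "\<zero> \<in> I Y t \<mu>"
      using mm sm_zero[OF sl[of t \<mu>]] sm_zero[OF Yt] by (auto simp: I_def intro!: bexI[of _ "\<zero>\<^bsub>ob V t\<^esub>"])
    show ?thesis
    proof (rule idealI)
      show "subgroup (I Y t \<mu>) (add_monoid R)"
      proof (rule add.subgroupI)
        show "I Y t \<mu> \<subseteq> carrier R" by (auto simp: I_def)
        show "I Y t \<mu> \<noteq> {}" using z by auto
        show "\<ominus> c \<in> I Y t \<mu>" if c: "c \<in> I Y t \<mu>" for c
        proof -
          have "c \<in> carrier R" using c by (simp add: I_def)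
          then show ?thesis using mult[of "\<ominus> \<one>" c] c by (simp add: l_minus)
        qed
      qed (use add in auto)
      show "x \<otimes> a \<in> I Y t \<mu>" "a \<otimes> x \<in> I Y t \<mu>" if "a \<in> I Y t \<mu>" "x \<in> carrier R" for a x
      proof -
        show 1: "x \<otimes> a \<in> I Y t \<mu>" using mult that by simp
        have "a \<in> carrier R" using that by (simp add: I_def)
        then show "a \<otimes> x \<in> I Y t \<mu>" using 1 that m_comm by simp
      qed
    qed (rule ring_axioms)
  qed
  have I_mono: "I Y t (r, f) \<subseteq> I Y t' (r, Ccomp (ns r) g f)"
    if Y: "subfunctor R V Y" and rf: "(r, f) \<in> Mon t" and g: "g \<in> Cmor t t'" "increasing t g" for Y t r f g t'
  proof
    fix c assume "c \<in> I Y t (r, f)"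
    then obtain y where y: "c \<in> carrier R" "y \<in> sp t (lower t (r, f))"
      "c \<odot>\<^bsub>ob V t\<^esub> mv t (r, f) \<oplus>\<^bsub>ob V t\<^esub> y \<in> Y t" by (auto simp: I_def)
    have comp: "act V t t' g (mv t (r', f')) = mv t' (r', Ccomp (ns r') g f')" if "(r', f') \<in> Mon t" for r' f'
      using that cmD(4)[OF V _ g(1)] vs by (simp add: Mon_def mv_def)
    have "act V t t' g ` mv t ` lower t (r, f) \<subseteq> mv t' ` lower t' (r, Ccomp (ns r) g f)"
    proof
      fix z assume "z \<in> act V t t' g ` mv t ` lower t (r, f)"
      then obtain r' f' where *: "(r', f') \<in> lower t (r, f)" "z = act V t t' g (mv t (r', f'))" by auto
      then have M: "(r', f') \<in> Mon t" "mon_less L (r', f') (r, f)" by (auto simp: lower_def)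
      then have "mon_less L (r', Ccomp (ns r') g f') (r, Ccomp (ns r) g f)"
        using rf by (intro mon_less_Ccomp[OF L _ _ g(2)]) (auto simp: Mon_def)
      moreover have "(r', Ccomp (ns r') g f') \<in> Mon t'"
        using M(1) Ccomp_in[OF _ g(1)] by (auto simp: Mon_def)
      ultimately show "z \<in> mv t' ` lower t' (r, Ccomp (ns r) g f)"
        using comp[OF M(1)] *(2) by (auto simp: lower_def)
    qed
    then have "act V t t' g ` sp t (lower t (r, f)) \<subseteq> sp t' (lower t' (r, Ccomp (ns r) g f))"
      unfolding sp_def
      by (simp add: span_image[OF cmD(2)[OF V g(1)] cmD(1)[OF V] cmD(1)[OF V] mvD[OF lowerM]] span_mono)
    then have "act V t t' g y \<in> sp t' (lower t' (r, Ccomp (ns r) g f))" using y(2) by blast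
    moreover have "act V t t' g (c \<odot>\<^bsub>ob V t\<^esub> mv t (r, f) \<oplus>\<^bsub>ob V t\<^esub> y) \<in> Y t'"
      by (rule subfunctorD(2)[OF Y g(1) y(3)])
    moreover have "act V t t' g (c \<odot>\<^bsub>ob V t\<^esub> mv t (r, f) \<oplus>\<^bsub>ob V t\<^esub> y)
        = c \<odot>\<^bsub>ob V t'\<^esub> mv t' (r, Ccomp (ns r) g f) \<oplus>\<^bsub>ob V t'\<^esub> act V t t' g y"
    proof -
      interpret M: module R "ob V t" by (rule cmD(1)[OF V])
      note l = lin_mapsD[OF cmD(2)[OF V g(1)]]
      show ?thesis using y(1) mvc[OF rf] sm_in[OF sl y(2)] by (simp add: l(2,3) comp[OF rf])
    qed
    ultimately show "c \<in> I Y t' (r, Ccomp (ns r) g f)" using y(1) by (auto simp: I_def)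
  qed
  define P where "P = {(t, r, f). r < N \<and> f \<in> Cmor (ns r) t}"
  define le where "le = (\<lambda>(t, r, f) (t', r', f'). r = r' \<and>
    (\<exists>g\<in>Cmor t t'. increasing t g \<and> f' = Ccomp (ns r) g f))"
  define J where "J Y = (\<lambda>(t, \<mu>). I Y t \<mu>)" for Y :: "'m obj \<Rightarrow> 'v set"
  have J_mono: "J Y p \<subseteq> J Y q" if Y: "subfunctor R V Y" and pP: "p \<in> P" and le_pq: "le p q" for Y p q
  proof -
    obtain t r f where p: "p = (t, r, f)" by (cases p)
    obtain t' r' f' where q: "q = (t', r', f')" by (cases q)
    obtain g where g: "r' = r" "g \<in> Cmor t t'" "increasing t g" "f' = Ccomp (ns r) g f"
      using le_pq p q by (auto simp: le_def)
    have "(r, f) \<in> Mon t" using pP p by (simp add: P_def Mon_def)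
    then show ?thesis using I_mono[OF Y _ g(2,3)] p q g(1,4) by (simp add: J_def)
  qed
  have J_ideal: "ideal (J Y p) R" if "subfunctor R V Y" "p \<in> P" for Y p
    using that ideal_I by (auto simp: J_def P_def Mon_def)
  have "\<exists>B. finite B \<and> B \<subseteq> P \<and> (\<forall>p\<in>P. \<exists>b\<in>B. le b p \<and> J X p = J X b)"
  proof (rule finite_basis_of_monotone_ideals[OF noeth])
    show "\<exists>s. strict_mono (s :: nat \<Rightarrow> nat) \<and> (\<forall>j k. j < k \<longrightarrow> le (p (s j)) (p (s k)))" if "range p \<subseteq> P" for p
      using monomials_wqo[of p N ns] that unfolding P_def le_def by blast
  qed (use J_ideal J_mono X in auto)
  then obtain B where B: "finite B" "B \<subseteq> P" "\<And>p. p \<in> P \<Longrightarrow> \<exists>b\<in>B. le b p \<and> J X p = J X b"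
    by blast
  have "\<exists>A. A \<subseteq> carrier R \<and> finite A \<and> J X b = Idl A" if "b \<in> B" for b
    using noetherian_ring.finetely_gen[OF noeth J_ideal[OF X]] that B(2) by blast
  then obtain A where A: "\<And>b. b \<in> B \<Longrightarrow> A b \<subseteq> carrier R \<and> finite (A b) \<and> J X b = Idl (A b)" by metis
  have wit: "\<exists>x\<in>X (fst b). \<exists>y\<in>sp (fst b) (lower (fst b) (snd b)).
      x = c \<odot>\<^bsub>ob V (fst b)\<^esub> mv (fst b) (snd b) \<oplus>\<^bsub>ob V (fst b)\<^esub> y" if "b \<in> B" "c \<in> A b" for b c
  proof -
    have "c \<in> J X b" using A[OF that(1)] that(2) genideal_self by blast
    then show ?thesis by (auto simp: J_def I_def split: prod.splits)
  qed
  \<comment> \<open>\<open>w b c\<close> is an element of \<open>X\<close> at the object of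
    \<open>b\<close> with leading coefficient \<open>c\<close>, one for each of the finitely many
    generators \<open>c\<close> of the ideal at \<open>b\<close>.\<close>
  define w where "w b c = (SOME x. x \<in> X (fst b) \<and> (\<exists>y\<in>sp (fst b) (lower (fst b) (snd b)).
      x = c \<odot>\<^bsub>ob V (fst b)\<^esub> mv (fst b) (snd b) \<oplus>\<^bsub>ob V (fst b)\<^esub> y))" for b c
  have w: "w b c \<in> X (fst b)" "\<exists>y\<in>sp (fst b) (lower (fst b) (snd b)).
      w b c = c \<odot>\<^bsub>ob V (fst b)\<^esub> mv (fst b) (snd b) \<oplus>\<^bsub>ob V (fst b)\<^esub> y" if "b \<in> B" "c \<in> A b" for b c
  proof -
    have "w b c \<in> X (fst b) \<and> (\<exists>y\<in>sp (fst b) (lower (fst b) (snd b)).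
      w b c = c \<odot>\<^bsub>ob V (fst b)\<^esub> mv (fst b) (snd b) \<oplus>\<^bsub>ob V (fst b)\<^esub> y)"
      unfolding w_def by (rule someI_ex) (use wit[OF that] in blast)
    then show "w b c \<in> X (fst b)" "\<exists>y\<in>sp (fst b) (lower (fst b) (snd b)).
      w b c = c \<odot>\<^bsub>ob V (fst b)\<^esub> mv (fst b) (snd b) \<oplus>\<^bsub>ob V (fst b)\<^esub> y" by blast+
  qed
  define G where "G = (\<Union>b\<in>B. (\<lambda>c. (fst b, w b c)) ` A b)"
  have finG: "finite G" using B(1) A by (auto simp: G_def)
  have GX: "\<forall>(n, v)\<in>G. v \<in> X n" using w(1) by (auto simp: G_def)
  then have GV: "\<forall>(n, v)\<in>G. v \<in> carrier (ob V n)" using subfunctorD(3)[OF X] by auto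
  define X' where "X' t = mod_span R (ob V t) (orb V G t)" for t
  have X': "subfunctor R V X'" unfolding X'_def by (rule orb_subfunctor[OF V GV])
  have X'X: "X' t \<subseteq> X t" for t
    unfolding X'_def
  proof (rule span_least[OF subfunctorD(1)[OF X]])
    show "orb V G t \<subseteq> X t" using GX subfunctorD(2)[OF X] by (auto simp: orb_def)
  qed
  have GX': "v \<in> X' n" if "(n, v) \<in> G" for n v
  proof -
    have "v \<in> orb V G n"
      using that GV cmD(3)[OF V, of v n] Cid_in[of n] unfolding orb_def by force
    then show ?thesis unfolding X'_def by (rule subsetD[OF span_incl])
  qed
  have JB: "J X b \<subseteq> J X' b" if b: "b \<in> B" for b
  proof -
    have "A b \<subseteq> J X' b"
    proof
      fix c assume c: "c \<in> A b"
      have "w b c \<in> X' (fst b)" by (rule GX') (use b c in \<open>auto simp: G_def\<close>)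
      then show "c \<in> J X' b"
        using w(2)[OF b c] A[OF b] c by (auto simp: J_def I_def split: prod.splits)
    qed
    then have "Idl (A b) \<subseteq> J X' b"
      using genideal_minimal[OF J_ideal[OF X', of b]] b B(2) by blast
    then show ?thesis using A[OF b] by simp
  qed
  have JX: "J X p \<subseteq> J X' p" if p: "p \<in> P" for p
  proof -
    obtain b where b: "b \<in> B" "le b p" "J X p = J X b" using B(3)[OF p] by blast
    then show ?thesis using JB[OF b(1)] J_mono[OF X' _ b(2)] B(2) by blast
  qed
  \<comment> \<open>Division with remainder, by induction on the size of a set \<open>D\<close> of
    monomials that is closed under taking smaller ones.\<close>
  have main: "X t \<inter> sp t D \<subseteq> X' t"
    if "card D = k" "D \<subseteq> Mon t" "\<And>\<mu> \<nu>. \<mu> \<in> D \<Longrightarrow> \<nu> \<in> Mon t \<Longrightarrow> mon_less L \<nu> \<mu> \<Longrightarrow> \<nu> \<in> D" for t D k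
    using that
  proof (induction k arbitrary: D)
    case 0
    then have "D = {}" using finite_subset[OF 0(2) finMon] by simp
    then show ?case using sm_zero[OF subfunctorD(1)[OF X', of t]] by (auto simp: sp_def span_empty[OF cmD(1)[OF V]])
  next
    case (Suc k)
    have finD: "finite D" using finite_subset[OF Suc.prems(2) finMon] .
    have "D \<noteq> {}" using Suc.prems(1) by auto
    \<comment> \<open>The order is reversed, so that a minimal element for \<open>rr\<close> is the
      largest monomial \<open>\<mu>\<close> of \<open>D\<close>. Without it, \<open>D\<close>
      consists of exactly the monomials below \<open>\<mu>\<close>.\<close>
    define rr where "rr = {(\<mu>, \<nu>). \<mu> \<in> D \<and> \<nu> \<in> D \<and> mon_less L \<nu> \<mu>}"
    have "wf rr"
    proof (rule finite_acyclic_wf)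
      show "finite rr" by (rule finite_subset[of _ "D \<times> D"]) (use finD in \<open>auto simp: rr_def\<close>)
      have "trans rr" by (auto simp: trans_def rr_def intro: mon_less_trans)
      then show "acyclic rr" by (auto simp: acyclic_def trancl_id rr_def mon_less_irrefl)
    qed
    then obtain \<mu> where \<mu>: "\<mu> \<in> D" "\<And>\<nu>. (\<nu>, \<mu>) \<in> rr \<Longrightarrow> \<nu> \<notin> D"
      using \<open>D \<noteq> {}\<close> unfolding wf_eq_minimal by (metis all_not_in_conv)
    have \<mu>M: "\<mu> \<in> Mon t" using \<mu> Suc.prems(2) by auto
    have D': "D - {\<mu>} = lower t \<mu>"
    proof
      show "D - {\<mu>} \<subseteq> lower t \<mu>"
      proof
        fix \<nu> assume \<nu>: "\<nu> \<in> D - {\<mu>}"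
        then have "\<nu> \<in> Mon t" using Suc.prems(2) by auto
        moreover have "\<not> mon_less L \<mu> \<nu>"
        proof
          assume "mon_less L \<mu> \<nu>"
          then have "(\<nu>, \<mu>) \<in> rr" using \<mu>(1) \<nu> by (simp add: rr_def)
          then show False using \<mu>(2)[of \<nu>] \<nu> by simp
        qed
        moreover have "mon_less L \<mu> \<nu> \<or> mon_less L \<nu> \<mu>"
        proof -
          obtain r f where rf: "\<mu> = (r, f)" by (cases \<mu>)
          obtain r' f' where rf': "\<nu> = (r', f')" by (cases \<nu>)
          have "f \<in> Cmor (ns r) t" "f' \<in> Cmor (ns r') t" "(r, f) \<noteq> (r', f')"
            using \<mu>M \<open>\<nu> \<in> Mon t\<close> \<nu> rf rf' by (auto simp: Mon_def)
          then show ?thesis unfolding rf rf' by (rule mon_less_total[OF L])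
        qed
        ultimately show "\<nu> \<in> lower t \<mu>" by (simp add: lower_def)
      qed
      show "lower t \<mu> \<subseteq> D - {\<mu>}"
        using Suc.prems(3)[OF \<mu>(1)] by (auto simp: lower_def mon_less_irrefl)
    qed
    interpret M: module R "ob V t" by (rule cmD(1)[OF V])
    show ?case
    proof
      fix x assume x: "x \<in> X t \<inter> sp t D"
      have "mv t ` D = insert (mv t \<mu>) (mv t ` lower t \<mu>)" using \<mu>(1) D' by auto
      then have "x \<in> mod_span R (ob V t) (insert (mv t \<mu>) (mv t ` lower t \<mu>))" using x by (simp add: sp_def)
      then obtain c y where cy: "c \<in> carrier R" "y \<in> sp t (lower t \<mu>)" "x = c \<odot>\<^bsub>ob V t\<^esub> mv t \<mu> \<oplus>\<^bsub>ob V t\<^esub> y"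
        using span_insert_E[OF cmD(1)[OF V] mvD[OF lowerM] mvc[OF \<mu>M], of x \<mu>] unfolding sp_def by blast
      have "c \<in> J X (t, \<mu>)" using cy x by (auto simp: J_def I_def)
      then have "c \<in> J X' (t, \<mu>)" using JX[of "(t, \<mu>)"] \<mu>M by (auto simp: P_def Mon_def)
      then obtain y' where y': "y' \<in> sp t (lower t \<mu>)" "c \<odot>\<^bsub>ob V t\<^esub> mv t \<mu> \<oplus>\<^bsub>ob V t\<^esub> y' \<in> X' t"
        by (auto simp: J_def I_def)
      \<comment> \<open>\<open>z\<close> lies in \<open>X'\<close> and has the same leading term as
        \<open>x\<close>, so the difference involves smaller monomials alone.\<close>
      define z where "z = c \<odot>\<^bsub>ob V t\<^esub> mv t \<mu> \<oplus>\<^bsub>ob V t\<^esub> y'"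
      have c: "c \<odot>\<^bsub>ob V t\<^esub> mv t \<mu> \<in> carrier (ob V t)" "y \<in> carrier (ob V t)" "y' \<in> carrier (ob V t)"
        using cy(1) mvc[OF \<mu>M] sm_in[OF sl cy(2)] sm_in[OF sl y'(1)] by auto
      have eq: "x = z \<oplus>\<^bsub>ob V t\<^esub> (y \<ominus>\<^bsub>ob V t\<^esub> y')"
        unfolding cy(3) z_def by (rule add_swap_minus[OF cmD(1)[OF V] c])
      have "y \<ominus>\<^bsub>ob V t\<^esub> y' = x \<ominus>\<^bsub>ob V t\<^esub> z"
        unfolding eq by (rule add_minus_cancel[OF cmD(1)[OF V], symmetric]) (use c in \<open>auto simp: z_def\<close>)
      moreover have "x \<ominus>\<^bsub>ob V t\<^esub> z \<in> X t"
      proof (rule sm_minus[OF subfunctorD(1)[OF X]])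
        show "x \<in> X t" using x by simp
        show "z \<in> X t" unfolding z_def by (rule subsetD[OF X'X y'(2)])
      qed
      ultimately have 1: "y \<ominus>\<^bsub>ob V t\<^esub> y' \<in> X t \<inter> sp t (lower t \<mu>)"
        using sm_minus[OF sl cy(2) y'(1)] by simp
      have "X t \<inter> sp t (D - {\<mu>}) \<subseteq> X' t"
      proof (rule Suc.IH)
        show "card (D - {\<mu>}) = k" using Suc.prems(1) \<mu>(1) finD by simp
        show "D - {\<mu>} \<subseteq> Mon t" using Suc.prems(2) by auto
        fix \<rho> \<nu> assume "\<rho> \<in> D - {\<mu>}" "\<nu> \<in> Mon t" "mon_less L \<nu> \<rho>"
        then show "\<nu> \<in> D - {\<mu>}"
          unfolding D' lower_def using mon_less_trans by blast
      qed
      then have "y \<ominus>\<^bsub>ob V t\<^esub> y' \<in> X' t" using 1 D' by auto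
      then show "x \<in> X' t"
        unfolding eq using y'(2) sm_add[OF subfunctorD(1)[OF X']] by (simp add: z_def)
    qed
  qed
  have "X t \<subseteq> X' t" for t
  proof -
    have "orb V G0 t \<subseteq> mv t ` Mon t"
    proof
      fix x assume "x \<in> orb V G0 t"
      then obtain n v f where *: "(n, v) \<in> G0" "f \<in> Cmor n t" "x = act V n t f v" by (auto simp: orb_def)
      then obtain r where "r < N" "gs ! r = (n, v)" using gs by (auto simp: in_set_conv_nth N_def)
      then show "x \<in> mv t ` Mon t"
        using * by (intro image_eqI[of _ _ "(r, f)"]) (auto simp: mv_def Mon_def ns_def vs_def)
    qed
    then have "X t \<subseteq> sp t (Mon t)"
      using G0(3)[of t] subfunctorD(3)[OF X] span_mono[of "orb V G0 t" "mv t ` Mon t" "ob V t"]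
      unfolding sp_def by blast
    then show ?thesis using main[of "Mon t" _ t] by auto
  qed
  then show thesis using that[OF finG GX] by (simp add: X'_def)
qed

section \<open>High shifts are acyclic\<close>

lemma fgen_bound:
  fixes V :: "('m :: finite, 'k, 'v) cmod"
  assumes V: "cmodule R V" and fg: "fgen V"
  obtains e where "gen_lt V e"
proof -
  obtain G where G: "finite G" "\<forall>(n, v)\<in>G. v \<in> carrier (ob V n)"
      "\<And>t. carrier (ob V t) \<subseteq> mod_span R (ob V t) (orb V G t)"
    using fg by (auto simp: fgen_def)
  \<comment> \<open>The sum of the degrees bounds each of them; the successor makes the bound
    strict.\<close>
  define e where "e = Suc (\<Sum>(n, v)\<in>G. deg n)"
  have e: "deg n < e" if "(n, v) \<in> G" for n v
    using member_le_sum[of "(n, v)" G "\<lambda>(n, v). deg n"] that G(1) by (simp add: e_def)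
  have "gen_lt V e"
    unfolding gen_lt_def
  proof
    fix t
    have "orb V G t \<subseteq> psum V t {S. S \<subseteq> pts t \<and> card S < e}"
    proof
      fix x assume "x \<in> orb V G t"
      then obtain n v f where *: "(n, v) \<in> G" "f \<in> Cmor n t" "x = act V n t f v" by (auto simp: orb_def)
      have "card (pmap f ` pts n) = deg n"
        using card_image[OF CmorD(2)[OF *(2)]] by (simp add: card_pts)
      then have "pmap f ` pts n \<in> {S. S \<subseteq> pts t \<and> card S < e}"
        using e[OF *(1)] pmap_image_subset[OF *(2) subset_refl] by simp
      moreover have "x \<in> part V t (pmap f ` pts n)"
        using * G(2) by (auto intro: partI)
      ultimately show "x \<in> psum V t {S. S \<subseteq> pts t \<and> card S < e}"
        by (rule subsetD[OF part_le_psum])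
    qed
    then have "mod_span R (ob V t) (orb V G t) \<subseteq> psum V t {S. S \<subseteq> pts t \<and> card S < e}"
      by (rule span_least[OF psum_sm[OF V]])
    then show "carrier (ob V t) \<subseteq> psum V t {S. S \<subseteq> pts t \<and> card S < e}"
      using G(3)[of t] by (rule order_trans[rotated])
  qed
  then show thesis by (rule that)
qed

lemma finite_le_obj: "finite {k :: 'm :: finite obj. k \<le> n}"
proof (rule finite_subset)
  show "{k. k \<le> n} \<subseteq> (\<Pi>\<^sub>E i\<in>UNIV. {..n i})" by (auto simp: le_fun_def)
qed (auto intro: finite_PiE)

lemma csize_up_pt: "csize (up_pt N ` S) = csize S"
proof
  fix i
  have "{a. (i, a) \<in> up_pt N ` S} = (\<lambda>a. a + N i) ` {a. (i, a) \<in> S}"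
    by (auto simp: up_pt_def image_iff split: prod.splits)
  then show "csize (up_pt N ` S) i = csize S i"
    by (simp add: csize_def card_image)
qed

text \<open>A morphism \<open>f\<close> from \<open>n\<close> to \<open>oadd t N\<close> factors
  through the shift of an embedding of the set \<open>T\<close> of old points that it meets. Since
  \<open>T\<close> has size at most \<open>n\<close>, finitely many first factors occur, and the
  images of the generators under these generate the shift.\<close>

lemma fgen_shiftN:
  fixes V :: "('m :: finite, 'k, 'v) cmod"
  assumes V: "cmodule R V" and fg: "fgen V"
  shows "fgen (shiftN N V)"
proof -
  obtain G where G: "finite G" "\<forall>(n, v)\<in>G. v \<in> carrier (ob V n)"
      "\<And>t. carrier (ob V t) \<subseteq> mod_span R (ob V t) (orb V G t)"
    using fg by (auto simp: fgen_def)
  define G' where "G' = (\<Union>(n, v)\<in>G. \<Union>k\<in>{k. k \<le> n}. (\<lambda>g. (k, act V n (oadd k N) g v)) ` Cmor n (oadd k N))"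
  show ?thesis
    unfolding fgen_def
  proof (intro exI[of _ G'] conjI allI)
    show "finite G'"
      unfolding G'_def by (intro finite_UN_I G(1)) (auto simp: finite_le_obj finite_Cmor)
    show "\<forall>(n, v)\<in>G'. v \<in> carrier (ob (shiftN N V) n)"
      using G(2) act_in[OF V] by (fastforce simp: G'_def)
    fix t
    have "orb V G (oadd t N) \<subseteq> orb (shiftN N V) G' t"
    proof
      fix x assume "x \<in> orb V G (oadd t N)"
      then obtain n v f where *: "(n, v) \<in> G" "f \<in> Cmor n (oadd t N)" "x = act V n (oadd t N) f v"
        by (auto simp: orb_def)
      define T where "T = {p \<in> pts t. up_pt N p \<in> pmap f ` pts n}"
      have T: "T \<subseteq> pts t" by (auto simp: T_def)
      have sub: "pmap f ` pts n \<subseteq> up_set N T"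
      proof
        fix p assume p: "p \<in> pmap f ` pts n"
        then have "p \<in> up_set N (pts t)"
          using pmap_image_subset[OF *(2) subset_refl] unfolding up_pts by blast
        then consider "p \<in> pts N" | q where "q \<in> pts t" "p = up_pt N q" unfolding up_set_def by blast
        then show "p \<in> up_set N T"
        proof cases
          case (2 q)
          then have "q \<in> T" using p by (simp add: T_def)
          then show ?thesis using 2(2) by (simp add: up_set_def)
        qed (simp add: up_set_def)
      qed
      obtain e where e: "e \<in> Cmor (csize T) t" "pmap e ` pts (csize T) = T"
        using emb_exists[OF T] .
      have im: "pmap f ` pts n \<subseteq> pmap (iotaN N (csize T) e) ` pts (oadd (csize T) N)"
        unfolding mimg_iotaN e(2) by (rule sub)
      obtain g where g: "g \<in> Cmor n (oadd (csize T) N)" "f = Ccomp n (iotaN N (csize T) e) g"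
        using factor_through[OF *(2) iotaN_in[OF e(1)] im] .
      have "up_pt N ` T \<subseteq> pmap f ` pts n" by (auto simp: T_def)
      then have "csize (up_pt N ` T) \<le> csize (pmap f ` pts n)"
        by (rule csize_mono[OF _ pmap_image_subset[OF *(2) subset_refl]])
      then have "csize T \<le> n" by (simp add: csize_up_pt csize_mimg[OF *(2)])
      then have "(csize T, act V n (oadd (csize T) N) g v) \<in> G'"
        using *(1) g(1) unfolding G'_def by (intro UN_I[of "(n, v)"]) auto
      moreover have "x = act (shiftN N V) (csize T) t e (act V n (oadd (csize T) N) g v)"
        using cmD(4)[OF V g(1) iotaN_in[OF e(1)], of v] *(1,3) g(2) G(2) by auto
      ultimately show "x \<in> orb (shiftN N V) G' t"
        using e(1) unfolding orb_def by blast
    qed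
    then show "carrier (ob (shiftN N V) t) \<subseteq> mod_span R (ob (shiftN N V) t) (orb (shiftN N V) G' t)"
      using order_trans[OF G(3)[of "oadd t N"] span_mono] by simp
  qed
qed

section \<open>Kernels on the iterated cokernels of maps into shifts\<close>

definition unit_obj :: "'m \<Rightarrow> 'm obj" where
  "unit_obj j = (\<lambda>i. if i = j then 1 else 0)"

lemma add1_oadd: "add1 j n = oadd n (unit_obj j)"
  by (auto simp: add1_def oadd_def unit_obj_def)

lemma pi_mor_nu: "pi_mor n j = nu (unit_obj j) n"
  by (auto simp: pi_mor_def nu_def mk_mor_def unit_obj_def fun_eq_iff)

lemma pts_unit_obj: "pts (unit_obj j) = {(j, 1)}"
  by (auto simp: pts_def unit_obj_def split: if_splits)

text \<open>The kernel of the projection from \<open>\<Sigma>\<^sub>w V\<close> to \<open>D\<^sub>w V\<close>.\<close>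

definition low_psum :: "('m, 'k, 'v) cmod \<Rightarrow> 'm obj \<Rightarrow> 'm obj \<Rightarrow> 'v set" where
  "low_psum V w n = psum V (oadd n w) ((\<lambda>x. pts (oadd n w) - {x}) ` pts w)"

text \<open>Shifted morphisms fix each added point \<open>x\<close>, so by injectivity they send the
  complement of \<open>x\<close> into the complement of \<open>x\<close>.\<close>

lemma low_psum_act:
  assumes V: "cmodule R V" and f: "f \<in> Cmor n t" and x: "x \<in> low_psum V w n"
  shows "act V (oadd n w) (oadd t w) (iotaN w n f) x \<in> low_psum V w t"
proof -
  let ?f = "iotaN w n f"
  let ?F = "(\<lambda>x. pts (oadd n w) - {x}) ` pts w"
  have f': "?f \<in> Cmor (oadd n w) (oadd t w)" by (rule iotaN_in[OF f])
  have "act V (oadd n w) (oadd t w) ?f ` psum V (oadd n w) ?F = psum V (oadd t w) ((`) (pmap ?f) ` ?F)"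
    by (rule psum_act[OF V f']) auto
  also have "\<dots> \<subseteq> low_psum V w t"
    unfolding low_psum_def
  proof (rule psum_mono_sub[OF V])
    fix S assume "S \<in> (`) (pmap ?f) ` ?F"
    then obtain x where x: "x \<in> pts w" "S = pmap ?f ` (pts (oadd n w) - {x})" by auto
    have xn: "x \<in> pts (oadd n w)" using x(1) by (simp add: up_pts[symmetric] up_set_def)
    have "S = pmap ?f ` pts (oadd n w) - {x}"
      using inj_on_image_set_diff[OF CmorD(2)[OF f'], of "pts (oadd n w)" "{x}"] xn
      by (simp add: x(2) pmap_iotaN_low[OF x(1)])
    then have "S \<subseteq> pts (oadd t w) - {x}"
      using pmap_image_subset[OF f' subset_refl] by auto
    then show "\<exists>T\<in>(\<lambda>x. pts (oadd t w) - {x}) ` pts w. S \<subseteq> T" using x(1) by auto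
  qed
  finally show ?thesis using x by (auto simp: low_psum_def)
qed

text \<open>The preimage of \<open>K_j (D_w V)\<close> in the shift by \<open>w\<close>. Vanishing
  of \<open>K_j (D_w V)\<close> at \<open>n\<close> becomes the inclusion of
  \<open>low_ker V w j n\<close> in \<open>low_psum V w n\<close>, so no quotient is formed and
  Noetherianity is applied to a subfunctor of the shift.\<close>

definition low_ker :: "('m, 'k, 'v) cmod \<Rightarrow> 'm obj \<Rightarrow> 'm \<Rightarrow> 'm obj \<Rightarrow> 'v set" where
  "low_ker V w j n = {v \<in> carrier (ob V (oadd n w)).
     act V (oadd n w) (oadd (add1 j n) w) (iotaN w n (pi_mor n j)) v \<in> low_psum V w (add1 j n)}"

text \<open>The morphisms \<open>pi_mor\<close> are natural with respect to the shift by one point,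
  so the defining condition can be moved along \<open>f\<close>.\<close>

lemma low_ker_subfunctor:
  assumes V: "cmodule R V"
  shows "subfunctor R (shiftN w V) (low_ker V w j)"
proof (rule subfunctorI)
  fix n
  have "submodule {v \<in> carrier (ob V (oadd n w)). act V (oadd n w) (oadd (add1 j n) w) (iotaN w n (pi_mor n j)) v
     \<in> psum V (oadd (add1 j n) w) ((\<lambda>x. pts (oadd (add1 j n) w) - {x}) ` pts w)} R (ob V (oadd n w))"
    by (rule sm_preimage[OF cmD(2)[OF V iotaN_in[OF pi_mor_in]] cmD(1)[OF V] cmD(1)[OF V] psum_sm[OF V]])
  then show "submodule (low_ker V w j n) R (ob (shiftN w V) n)"
    by (simp add: low_ker_def low_psum_def)
next
  fix n t f x assume f: "f \<in> Cmor n t" and x: "x \<in> low_ker V w j n"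
  let ?u = "unit_obj j"
  let ?g = "iotaN ?u n f"
  have g: "?g \<in> Cmor (add1 j n) (add1 j t)" unfolding add1_oadd by (rule iotaN_in[OF f])
  have sq: "Ccomp n (pi_mor t j) f = Ccomp n ?g (pi_mor n j)"
    unfolding pi_mor_nu by (rule nu_natural[OF f, symmetric])
  have xc: "x \<in> carrier (ob V (oadd n w))" using x by (simp add: low_ker_def)
  have "act V (oadd t w) (oadd (add1 j t) w) (iotaN w t (pi_mor t j)) (act V (oadd n w) (oadd t w) (iotaN w n f) x)
      = act V (oadd n w) (oadd (add1 j t) w) (iotaN w n (Ccomp n (pi_mor t j) f)) x"
    using cmD(4)[OF V iotaN_in[OF f] iotaN_in[OF pi_mor_in] xc]
    by (simp add: iotaN_comp[OF f pi_mor_in])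
  also have "\<dots> = act V (oadd (add1 j n) w) (oadd (add1 j t) w) (iotaN w (add1 j n) ?g)
      (act V (oadd n w) (oadd (add1 j n) w) (iotaN w n (pi_mor n j)) x)"
    unfolding sq using cmD(4)[OF V iotaN_in[OF pi_mor_in] iotaN_in[OF g] xc]
    by (simp add: iotaN_comp[OF pi_mor_in g])
  also have "\<dots> \<in> low_psum V w (add1 j t)"
    by (rule low_psum_act[OF V g]) (use x in \<open>simp add: low_ker_def\<close>)
  finally show "act (shiftN w V) n t f x \<in> low_ker V w j t"
    using act_in[OF V iotaN_in[OF f] xc] by (simp add: low_ker_def)
qed

text \<open>A morphism from the object of a generator of \<open>low_ker\<close> to one with larger
  coordinate \<open>j\<close> misses a point there and so factors through \<open>pi_mor\<close>. By
  the definition of \<open>low_ker\<close>, \<open>pi_mor\<close> takes the generator into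
  \<open>low_psum\<close>.\<close>

lemma low_ker_bound:
  fixes V :: "('m :: finite, 'k, 'v) cmod"
  assumes noeth: "noetherian_ring R" and V: "cmodule R V" and fg: "fgen V"
  obtains K where "\<And>n. K \<le> n j \<Longrightarrow> low_ker V w j n \<subseteq> low_psum V w n"
proof -
  let ?W = "shiftN w V"
  have W: "cmodule R ?W" by (rule shiftN_cmodule[OF V])
  note X = low_ker_subfunctor[OF V, of w j]
  obtain G where G: "finite G" "\<forall>(n, v)\<in>G. v \<in> low_ker V w j n"
      "\<And>t. low_ker V w j t \<subseteq> mod_span R (ob ?W t) (orb ?W G t)"
    using noetherian_sub[OF noeth W fgen_shiftN[OF V fg] X] by metis
  define K where "K = Suc (\<Sum>(n, v)\<in>G. n j)"
  have K: "n j < K" if "(n, v) \<in> G" for n v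
    using member_le_sum[of "(n, v)" G "\<lambda>(n, v). n j"] that G(1) by (simp add: K_def)
  have "low_ker V w j t \<subseteq> low_psum V w t" if "K \<le> t j" for t
  proof -
    have "orb ?W G t \<subseteq> low_psum V w t"
    proof
      fix x assume "x \<in> orb ?W G t"
      then obtain n v f where *: "(n, v) \<in> G" "f \<in> Cmor n t" "x = act V (oadd n w) (oadd t w) (iotaN w n f) v"
        by (auto simp: orb_def)
      have v: "v \<in> low_ker V w j n" using G(2) *(1) by auto
      have "n j < t j" using K[OF *(1)] that by simp
      then obtain b where "(j, b) \<in> pts t" "(j, b) \<notin> pmap f ` pts n"
        using missing_point_coord[OF *(2)] by blast
      then obtain g where g: "g \<in> Cmor (add1 j n) t" "f = Ccomp n g (pi_mor n j)"
        using factor_pi[OF *(2)] by blast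
      have "x = act V (oadd (add1 j n) w) (oadd t w) (iotaN w (add1 j n) g)
          (act V (oadd n w) (oadd (add1 j n) w) (iotaN w n (pi_mor n j)) v)"
        using cmD(4)[OF V iotaN_in[OF pi_mor_in] iotaN_in[OF g(1)]] v *(3) g(2)
        by (simp add: iotaN_comp[OF pi_mor_in g(1)] low_ker_def)
      also have "\<dots> \<in> low_psum V w t"
        by (rule low_psum_act[OF V g(1)]) (use v in \<open>simp add: low_ker_def\<close>)
      finally show "x \<in> low_psum V w t" .
    qed
    then have "mod_span R (ob ?W t) (orb ?W G t) \<subseteq> low_psum V w t"
      unfolding low_psum_def shiftN_simps by (rule span_least[OF psum_sm[OF V]])
    then show ?thesis using G(3)[of t] by (rule order_trans[rotated])
  qed
  then show thesis by (rule that)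
qed

lemma gen_lt_part:
  fixes V :: "('m :: finite, 'k, 'v) cmod"
  assumes V: "cmodule R V" and g: "gen_lt V e" and S: "S \<subseteq> pts t"
  shows "part V t S \<subseteq> psum V t {U. U \<subseteq> S \<and> card U < e}"
proof -
  obtain h where h: "h \<in> Cmor (csize S) t" "pmap h ` pts (csize S) = S"
    using emb_exists[OF S] .
  let ?F = "{U. U \<subseteq> pts (csize S) \<and> card U < e}"
  have "part V t S = act V (csize S) t h ` carrier (ob V (csize S))"
    using part_emb[OF V h(1)] h(2) by simp
  also have "\<dots> \<subseteq> act V (csize S) t h ` psum V (csize S) ?F"
    using g by (intro image_mono) (simp add: gen_lt_def)
  also have "\<dots> = psum V t ((`) (pmap h) ` ?F)"
    by (rule psum_act[OF V h(1)]) auto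
  also have "\<dots> \<subseteq> psum V t {U. U \<subseteq> S \<and> card U < e}"
  proof (rule psum_mono)
    show "(`) (pmap h) ` ?F \<subseteq> {U. U \<subseteq> S \<and> card U < e}"
    proof
      fix U' assume "U' \<in> (`) (pmap h) ` ?F"
      then obtain U where U: "U \<subseteq> pts (csize S)" "card U < e" "U' = pmap h ` U" by auto
      have "card U' < e"
        using card_image[OF inj_on_subset[OF CmorD(2)[OF h(1)] U(1)]] U(2,3) by simp
      moreover have "U' \<subseteq> S" using U(1,3) h(2) by blast
      ultimately show "U' \<in> {U. U \<subseteq> S \<and> card U < e}" by simp
    qed
  qed
  finally show ?thesis .
qed

text \<open>A set with fewer than \<open>e\<close> points cannot contain \<open>A\<close>, so it
  misses one of its points. This makes the acyclicity condition automatic once \<open>A\<close> has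
  at least \<open>e\<close> points.\<close>

lemma gen_lt_part_avoid:
  fixes V :: "('m :: finite, 'k, 'v) cmod"
  assumes V: "cmodule R V" and g: "gen_lt V e" and S: "S \<subseteq> pts t" and A: "finite A" "e \<le> card A"
  shows "part V t S \<subseteq> psum V t ((\<lambda>x. S - {x}) ` A)"
proof (rule order_trans[OF gen_lt_part[OF V g S]], rule psum_mono_sub[OF V])
  fix U assume U: "U \<in> {U. U \<subseteq> S \<and> card U < e}"
  have "\<not> A \<subseteq> U"
  proof
    assume "A \<subseteq> U"
    moreover have "finite U" using U S finite_subset[of U "pts t"] by auto
    ultimately have "card A \<le> card U" by (rule card_mono[rotated])
    then show False using U A(2) by simp
  qed
  then obtain x where "x \<in> A" "x \<notin> U" by blast
  then show "\<exists>T\<in>(\<lambda>x. S - {x}) ` A. U \<subseteq> T" using U by auto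
qed

theorem shift_acyclic:
  fixes V :: "('m :: finite, 'k, 'v) cmod"
  assumes noeth: "noetherian_ring R" and V: "cmodule R V" and fg: "fgen V"
  obtains N where "acyc (shiftN N V)"
proof -
  obtain e where e: "gen_lt V e" using fgen_bound[OF V fg] .
  have ex: "\<exists>K. \<forall>n. K \<le> n j \<longrightarrow> low_ker V w j n \<subseteq> low_psum V w n" for w j
    using low_ker_bound[OF noeth V fg, of j w] by metis
  define K0 where "K0 w j = (SOME K. \<forall>n. K \<le> n j \<longrightarrow> low_ker V w j n \<subseteq> low_psum V w n)" for w j
  have K0: "low_ker V w j n \<subseteq> low_psum V w n" if "K0 w j \<le> n j" for w j n
    using someI_ex[OF ex, of j w] that unfolding K0_def by blast
  \<comment> \<open>The object \<open>w\<close> records how often each index occurs in a word. For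
    \<open>card A < e\<close> the object \<open>csize A\<close> is bounded by \<open>e\<close> in
    every coordinate, so finitely many \<open>w\<close> matter and a common bound \<open>K\<close>
    exists for all of them and all indices.\<close>
  define Ws where "Ws = {w :: 'm obj. w \<le> (\<lambda>_. e)}"
  have finW: "finite Ws" unfolding Ws_def by (rule finite_le_obj)
  define K where "K = (\<Sum>(w, j)\<in>Ws \<times> UNIV. K0 w j)"
  have K: "low_ker V w j n \<subseteq> low_psum V w n" if "w \<in> Ws" "K \<le> n j" for w j n
  proof (rule K0)
    have "K0 w j \<le> K"
      using member_le_sum[of "(w, j)" "Ws \<times> UNIV" "\<lambda>(w, j). K0 w j"] finW that(1) by (simp add: K_def)
    then show "K0 w j \<le> n j" using that(2) by simp
  qed
  define N :: "'m obj" where "N = (\<lambda>_. K)"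
  \<comment> \<open>Torsion freeness is the case of the empty word: a morphism that kills
    \<open>v\<close> is peeled off one \<open>pi_mor\<close> at a time, and each kernel
    \<open>K_i V\<close> vanishes above \<open>N\<close>.\<close>
  have inj: "v = \<zero>\<^bsub>ob V a\<^esub>"
    if "N \<le> a" "f \<in> Cmor a b" "v \<in> carrier (ob V a)" "act V a b f v = \<zero>\<^bsub>ob V b\<^esub>" for a b f v
    using that
  proof (induction "deg b - deg a" arbitrary: a f v rule: less_induct)
    case less
    show ?case
    proof (cases "a = b")
      case True
      then obtain g where g: "g \<in> Cmor a a" "Ccomp a g f = Cid a" using iso_inverse less.prems(2) by blast
      have "v = act V a a (Ccomp a g f) v" using g cmD(3)[OF V less.prems(3)] by simp
      also have "\<dots> = act V a a g (act V a a f v)"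
        using cmD(4)[OF V _ g(1) less.prems(3)] less.prems(2) True by simp
      also have "\<dots> = \<zero>\<^bsub>ob V a\<^esub>" using less.prems(4) True act_zero[OF V g(1)] by simp
      finally show ?thesis .
    next
      case False
      obtain i c where ic: "(i, c) \<in> pts b" "(i, c) \<notin> pmap f ` pts a"
        using missing_point[OF less.prems(2) False] .
      obtain g where g: "g \<in> Cmor (add1 i a) b" "f = Ccomp a g (pi_mor a i)"
        using factor_pi[OF less.prems(2) ic] .
      have p: "act V a (add1 i a) (pi_mor a i) v \<in> carrier (ob V (add1 i a))"
        by (rule act_in[OF V pi_mor_in less.prems(3)])
      have le: "a \<le> add1 i a" "a \<noteq> add1 i a" by (auto simp: add1_def le_fun_def fun_eq_iff)
      have "deg a < deg (add1 i a)" by (rule deg_strict[OF le])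
      moreover have "deg (add1 i a) \<le> deg b" by (rule deg_mono[OF Cmor_le[OF g(1)]])
      ultimately have "act V a (add1 i a) (pi_mor a i) v = \<zero>\<^bsub>ob V (add1 i a)\<^esub>"
        using less.prems(4) g cmD(4)[OF V pi_mor_in g(1) less.prems(3)]
        by (intro less.hyps[OF _ order_trans[OF less.prems(1) le(1)] g(1) p]) simp_all
      \<comment> \<open>For the word of length zero, \<open>low_psum\<close> is zero and
        \<open>low_ker\<close> is \<open>K_i V\<close>.\<close>
      moreover define z :: "'m obj" where "z = (\<lambda>_. 0)"
      have z: "oadd n z = n" "pts z = {}" for n :: "'m obj" by (auto simp: oadd_def z_def pts_def)
      have "iotaN z a (pi_mor a i) = pi_mor a i"
        by (auto simp: iotaN_def mk_mor_def z_def oadd_def pi_mor_def fun_eq_iff)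
      ultimately have "v \<in> low_ker V z i a"
        using less.prems(3) by (simp add: low_ker_def low_psum_def z psum_empty[OF V])
      moreover have "z \<in> Ws" by (simp add: Ws_def z_def le_fun_def)
      moreover have "K \<le> a i" using less.prems(1) by (simp add: N_def le_fun_def)
      ultimately have "v \<in> low_psum V z a" using K[of z a i] by blast
      then show ?thesis by (simp add: low_psum_def z psum_empty[OF V])
    qed
  qed
  have "acyc (shiftN N V)"
  proof (rule shiftN_acycI[OF V])
    fix n t f v assume f: "f \<in> Cmor n t" and v: "v \<in> carrier (ob V (oadd n N))"
      "act V (oadd n N) (oadd t N) (iotaN N n f) v = \<zero>\<^bsub>ob V (oadd t N)\<^esub>"
    have "N \<le> oadd n N" by (simp add: oadd_def le_fun_def)
    then show "v = \<zero>\<^bsub>ob V (oadd n N)\<^esub>" by (rule inj[OF _ iotaN_in[OF f] v])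
  next
    fix s :: "'m obj" and A y
    assume A: "A \<subseteq> pts (oadd s N) - pts N" and y: "y \<in> pts (oadd s N) - pts N" and yA: "y \<notin> A"
    define t where "t = oadd s N"
    have At: "A \<subseteq> pts t" and yt: "y \<in> pts t" using A y by (auto simp: t_def)
    have finA: "finite A" using finite_subset[OF At] by simp
    have "part V t (pts t - {y}) \<inter> psum V t ((\<lambda>x. pts t - {x}) ` A) \<subseteq> psum V t ((\<lambda>x. pts t - {x, y}) ` A)"
    proof (cases "e \<le> card A")
      case True
      have "part V t (pts t - {y}) \<subseteq> psum V t ((\<lambda>x. pts t - {y} - {x}) ` A)"
        by (rule gen_lt_part_avoid[OF V e _ finA True]) auto
      moreover have "(\<lambda>x. pts t - {y} - {x}) ` A = (\<lambda>x. pts t - {x, y}) ` A" by (rule image_cong) auto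
      ultimately show ?thesis by auto
    next
      case False
      obtain j b where jb: "y = (j, b)" by (cases y)
      \<comment> \<open>\<open>n\<close> is chosen so that \<open>t\<close> is the sum of
        \<open>n\<close>, \<open>unit_obj j\<close> and \<open>w\<close>. Since \<open>A\<close> and
        \<open>y\<close> lie outside \<open>pts N\<close>, the subtractions are not truncated and
        coordinate \<open>j\<close> of \<open>n\<close> is at least \<open>K\<close>.\<close>
      define w where "w = csize A"
      define n where "n i = t i - w i - unit_obj j i" for i
      have yA': "insert y A \<subseteq> pts (oadd s N) - pts N" using A y by auto
      define S' where "S' = {p \<in> pts s. up_pt N p \<in> insert y A}"
      have imS: "up_pt N ` S' = insert y A"
        using yA' unfolding up_pts[symmetric] by (auto simp: S'_def up_set_def)
      have csz: "csize (insert y A) i = w i + unit_obj j i" for i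
      proof (cases "i = j")
        case True
        have "{a. (i, a) \<in> insert y A} = insert b {a. (i, a) \<in> A}" using True jb by auto
        moreover have "b \<notin> {a. (i, a) \<in> A}" using True jb yA by auto
        ultimately show ?thesis using True finite_fibre[OF finA, of i] by (simp add: csize_def w_def unit_obj_def)
      next
        case False
        then have "{a. (i, a) \<in> insert y A} = {a. (i, a) \<in> A}" using jb by auto
        then show ?thesis using False by (simp add: csize_def w_def unit_obj_def)
      qed
      have "csize S' i \<le> s i" for i
        using csize_mono[of S' "pts s" s] by (simp add: S'_def le_fun_def)
      then have ws: "w i + unit_obj j i \<le> s i" for i
        using csz[of i] csize_up_pt[of N S'] imS by metis
      have tn: "t = oadd (oadd n (unit_obj j)) w"
      proof
        fix i show "t i = oadd (oadd n (unit_obj j)) w i"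
          using ws[of i] by (simp add: t_def n_def oadd_def)
      qed
      have nj: "K \<le> n j" using ws[of j] by (simp add: n_def t_def oadd_def N_def)
      have "w i \<le> e" for i
      proof -
        have "w i \<le> deg w" unfolding deg_def by (rule member_le_sum) auto
        also have "deg w = card A" by (simp add: w_def card_csize[OF finA])
        finally show ?thesis using False by simp
      qed
      then have wW: "w \<in> Ws" by (simp add: Ws_def le_fun_def)
      \<comment> \<open>\<open>\<delta>\<close> is the shifted \<open>pi_mor\<close>, the map that
        defines \<open>low_ker\<close>. Its image misses the single point \<open>y0\<close>, which
        lies directly above the \<open>w j\<close> lowest points of coordinate
        \<open>j\<close>.\<close>
      define \<delta> where "\<delta> = iotaN w n (nu (unit_obj j) n)"
      have \<delta>: "\<delta> \<in> Cmor (oadd n w) t" unfolding \<delta>_def tn by (rule iotaN_in[OF nu_in])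
      define y0 where "y0 = (j, w j + 1)"
      have "up_pt w ` pts (unit_obj j) = {y0}" by (simp add: pts_unit_obj up_pt_simp y0_def)
      moreover have "pts (unit_obj j) \<subseteq> pts (oadd n (unit_obj j))"
        by (auto simp: up_pts[symmetric] up_set_def)
      ultimately have im\<delta>: "pmap \<delta> ` pts (oadd n w) = pts t - {y0}"
        unfolding \<delta>_def mimg_iotaN mimg_nu tn
        using up_diff[of "pts (oadd n (unit_obj j))" "oadd n (unit_obj j)" "pts (unit_obj j)" w]
        by (simp add: up_pts)
      \<comment> \<open>The permutation reduces \<open>A\<close> and \<open>y\<close> to the
        standard pair \<open>pts w\<close> and \<open>y0\<close>, for which the claim is the
        vanishing of \<open>K_j (D_w V)\<close> at \<open>n\<close>.\<close>
      obtain \<sigma> where \<sigma>: "\<sigma> \<in> Cmor t t" "pmap \<sigma> ` pts w = A" "pmap \<sigma> y0 = y"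
        using perm_exists[of A t j b] At yt yA unfolding jb y0_def w_def by blast
      have wt: "pts w \<subseteq> pts t" unfolding tn by (auto simp: up_pts[symmetric] up_set_def)
      have y0t: "y0 \<in> pts t"
        using tn by (auto simp: y0_def pts_iff oadd_def unit_obj_def)
      have y0w: "y0 \<notin> pts w" by (simp add: y0_def pts_iff)
      have \<sigma>t: "pmap \<sigma> ` pts t = pts t" by (rule Cmor_self_image[OF \<sigma>(1)])
      have d1: "pmap \<sigma> ` (pts t - {x}) = pts t - {pmap \<sigma> x}" if "x \<in> pts t" for x
        using inj_on_image_set_diff[OF CmorD(2)[OF \<sigma>(1)], of "pts t" "{x}"] that \<sigma>t by simp
      have d2: "pmap \<sigma> ` (pts t - {x, y0}) = pts t - {pmap \<sigma> x, y}" if "x \<in> pts t" for x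
        using inj_on_image_set_diff[OF CmorD(2)[OF \<sigma>(1)], of "pts t" "{x, y0}"] that \<sigma>t \<sigma>(3) y0t by simp
      have f1: "(`) (pmap \<sigma>) ` (\<lambda>x. pts t - {x}) ` pts w = (\<lambda>x. pts t - {x}) ` A"
        unfolding \<sigma>(2)[symmetric] image_image by (rule image_cong) (simp_all add: d1 subsetD[OF wt])
      have f2: "(`) (pmap \<sigma>) ` (\<lambda>x. pts t - {x, y0}) ` pts w = (\<lambda>x. pts t - {x, y}) ` A"
        unfolding \<sigma>(2)[symmetric] image_image by (rule image_cong) (simp_all add: d2 subsetD[OF wt])
      show ?thesis
      proof
        fix v assume v: "v \<in> part V t (pts t - {y}) \<inter> psum V t ((\<lambda>x. pts t - {x}) ` A)"
        have "v \<in> act V t t \<sigma> ` part V t (pts t - {y0})"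
          using v part_act[OF V \<sigma>(1), of "pts t - {y0}"] d1[OF y0t] \<sigma>(3) by simp
        then obtain v1 where v1: "v1 \<in> part V t (pts t - {y0})" "v = act V t t \<sigma> v1" by blast
        have "v \<in> act V t t \<sigma> ` psum V t ((\<lambda>x. pts t - {x}) ` pts w)"
          using v psum_act[OF V \<sigma>(1), of "(\<lambda>x. pts t - {x}) ` pts w"] f1 by auto
        then obtain v2 where v2: "v2 \<in> psum V t ((\<lambda>x. pts t - {x}) ` pts w)" "v = act V t t \<sigma> v2" by blast
        have c: "v1 \<in> carrier (ob V t)" "v2 \<in> carrier (ob V t)"
          using subsetD[OF part_carrier[OF V] v1(1)] sm_in[OF psum_sm[OF V] v2(1)] by auto
        obtain \<tau> where \<tau>: "\<tau> \<in> Cmor t t" "Ccomp t \<tau> \<sigma> = Cid t" using iso_inverse[OF \<sigma>(1)] by blast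
        have "u = act V t t \<tau> (act V t t \<sigma> u)" if "u \<in> carrier (ob V t)" for u
          using cmD(4)[OF V \<sigma>(1) \<tau>(1) that] \<tau>(2) cmD(3)[OF V that] by simp
        then have v12: "v1 = v2" using c v1(2) v2(2) by metis
        have "v1 \<in> act V (oadd n w) t \<delta> ` carrier (ob V (oadd n w))"
          using v1(1) part_emb[OF V \<delta>] im\<delta> by simp
        then obtain u where u: "u \<in> carrier (ob V (oadd n w))" "v1 = act V (oadd n w) t \<delta> u" by blast
        have "u \<in> low_ker V w j n"
          using u v2(1) v12 unfolding low_ker_def low_psum_def add1_oadd pi_mor_nu tn[symmetric] \<delta>_def by simp
        then have "u \<in> low_psum V w n" using K[of w n j] wW nj by blast
        then have "v1 \<in> act V (oadd n w) t \<delta> ` psum V (oadd n w) ((\<lambda>x. pts (oadd n w) - {x}) ` pts w)"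
          using u(2) by (auto simp: low_psum_def)
        also have "\<dots> = psum V t ((`) (pmap \<delta>) ` (\<lambda>x. pts (oadd n w) - {x}) ` pts w)"
          by (rule psum_act[OF V \<delta>]) auto
        also have "(`) (pmap \<delta>) ` (\<lambda>x. pts (oadd n w) - {x}) ` pts w = (\<lambda>x. pts t - {x, y0}) ` pts w"
          unfolding image_image
        proof (rule image_cong[OF refl])
          fix x assume x: "x \<in> pts w"
          have xn: "x \<in> pts (oadd n w)" using x by (simp add: up_pts[symmetric] up_set_def)
          have "pmap \<delta> x = x" unfolding \<delta>_def by (rule pmap_iotaN_low[OF x])
          then have "pmap \<delta> ` (pts (oadd n w) - {x}) = pts t - {y0} - {x}"
            using inj_on_image_set_diff[OF CmorD(2)[OF \<delta>], of "pts (oadd n w)" "{x}"] xn im\<delta> by simp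
          then show "pmap \<delta> ` (pts (oadd n w) - {x}) = pts t - {x, y0}" by auto
        qed
        finally have "v \<in> act V t t \<sigma> ` psum V t ((\<lambda>x. pts t - {x, y0}) ` pts w)" using v1(2) by blast
        also have "\<dots> = psum V t ((`) (pmap \<sigma>) ` (\<lambda>x. pts t - {x, y0}) ` pts w)"
          by (rule psum_act[OF V \<sigma>(1)]) auto
        finally show "v \<in> psum V t ((\<lambda>x. pts t - {x, y}) ` A)" unfolding f2 .
      qed
    qed
    then show "part V (oadd s N) (pts (oadd s N) - {y}) \<inter> psum V (oadd s N) ((\<lambda>x. pts (oadd s N) - {x}) ` A)
        \<subseteq> psum V (oadd s N) ((\<lambda>x. pts (oadd s N) - {x, y}) ` A)"
      by (simp add: t_def)
  qed
  then show thesis by (rule that)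
qed

section \<open>Finite generation\<close>

lemma lin_map_finsum:
  assumes h: "h \<in> lin_maps R M N" and M: "module R M" and N: "module R N"
    and "finite A" "\<And>a. a \<in> A \<Longrightarrow> x a \<in> carrier M"
  shows "h (\<Oplus>\<^bsub>M\<^esub>a\<in>A. x a) = (\<Oplus>\<^bsub>N\<^esub>a\<in>A. h (x a))"
  using assms(4,5)
proof (induction A rule: finite_induct)
  case empty
  interpret M: module R M by fact
  interpret N: module R N by fact
  show ?case using lin_zero[OF h M N] by simp
next
  case (insert b A)
  interpret M: module R M by fact
  interpret N: module R N by fact
  have c: "x \<in> A \<rightarrow> carrier M" "x b \<in> carrier M" using insert.prems by auto
  have c': "(\<lambda>a. h (x a)) \<in> A \<rightarrow> carrier N" "h (x b) \<in> carrier N"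
    using lin_mapsD(1)[OF h] c by auto
  have "h (\<Oplus>\<^bsub>M\<^esub>a\<in>insert b A. x a) = h (x b \<oplus>\<^bsub>M\<^esub> (\<Oplus>\<^bsub>M\<^esub>a\<in>A. x a))"
    using insert.hyps c by simp
  also have "\<dots> = h (x b) \<oplus>\<^bsub>N\<^esub> h (\<Oplus>\<^bsub>M\<^esub>a\<in>A. x a)"
    using c by (intro lin_mapsD(2)[OF h] M.finsum_closed)
  also have "h (\<Oplus>\<^bsub>M\<^esub>a\<in>A. x a) = (\<Oplus>\<^bsub>N\<^esub>a\<in>A. h (x a))"
    by (rule insert.IH) (use insert.prems in auto)
  finally show ?case using insert.hyps c' by simp
qed

lemma fin_dsum_simps:
  "carrier (ob (fin_dsum N W) t) = (\<Pi>\<^sub>E r\<in>{..<N}. carrier (ob (W r) t))"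
  "\<zero>\<^bsub>ob (fin_dsum N W) t\<^esub> = (\<lambda>r\<in>{..<N}. \<zero>\<^bsub>ob (W r) t\<^esub>)"
  "x \<oplus>\<^bsub>ob (fin_dsum N W) t\<^esub> y = (\<lambda>r\<in>{..<N}. x r \<oplus>\<^bsub>ob (W r) t\<^esub> y r)"
  "c \<odot>\<^bsub>ob (fin_dsum N W) t\<^esub> x = (\<lambda>r\<in>{..<N}. c \<odot>\<^bsub>ob (W r) t\<^esub> x r)"
  "act (fin_dsum N W) t u f x = (\<lambda>r\<in>{..<N}. act (W r) t u f (x r))"
  by (simp_all add: fin_dsum_def)

lemma fin_dsum_comp: "x \<in> carrier (ob (fin_dsum N W) t) \<Longrightarrow> r < N \<Longrightarrow> x r \<in> carrier (ob (W r) t)"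
  by (auto simp: fin_dsum_simps)

lemma fin_dsum_module:
  assumes M: "\<And>r. r < N \<Longrightarrow> module R (ob (W r) t)"
  shows "module R (ob (fin_dsum N W) t)"
proof (rule moduleI)
  note d = fin_dsum_simps
  let ?D = "ob (fin_dsum N W) t"
  show "cring R" ..
  have add: "x \<in> carrier (ob (W r) t) \<Longrightarrow> y \<in> carrier (ob (W r) t) \<Longrightarrow> x \<oplus>\<^bsub>ob (W r) t\<^esub> y \<in> carrier (ob (W r) t)"
    if "r < N" for r x y
  proof -
    interpret M: module R "ob (W r) t" by (rule M[OF that])
    show "x \<in> carrier (ob (W r) t) \<Longrightarrow> y \<in> carrier (ob (W r) t) \<Longrightarrow> x \<oplus>\<^bsub>ob (W r) t\<^esub> y \<in> carrier (ob (W r) t)"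
      by simp
  qed
  show "abelian_group ?D"
  proof (rule abelian_groupI)
    fix x assume x: "x \<in> carrier ?D"
    let ?y = "\<lambda>r\<in>{..<N}. \<ominus>\<^bsub>ob (W r) t\<^esub> x r"
    have "?y r \<in> carrier (ob (W r) t) \<and> ?y r \<oplus>\<^bsub>ob (W r) t\<^esub> x r = \<zero>\<^bsub>ob (W r) t\<^esub>" if r: "r < N" for r
    proof -
      interpret M: module R "ob (W r) t" by (rule M[OF r])
      show ?thesis using fin_dsum_comp[OF x r] r by (simp add: M.l_neg)
    qed
    then have "?y \<in> carrier ?D" "?y \<oplus>\<^bsub>?D\<^esub> x = \<zero>\<^bsub>?D\<^esub>"
      by (auto simp: d fun_eq_iff)
    then show "\<exists>y\<in>carrier ?D. y \<oplus>\<^bsub>?D\<^esub> x = \<zero>\<^bsub>?D\<^esub>" by blast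
  next
    fix x y assume x: "x \<in> carrier ?D" and y: "y \<in> carrier ?D"
    have "x r \<oplus>\<^bsub>ob (W r) t\<^esub> y r \<in> carrier (ob (W r) t)" if "r < N" for r
      by (rule add[OF that fin_dsum_comp[OF x that] fin_dsum_comp[OF y that]])
    then show "x \<oplus>\<^bsub>?D\<^esub> y \<in> carrier ?D" by (auto simp: d(1,3))
  next
    show "\<zero>\<^bsub>?D\<^esub> \<in> carrier ?D"
      using sm_zero[OF sm_carrier[OF M]] by (auto simp: d)
  next
    fix x y z assume *: "x \<in> carrier ?D" "y \<in> carrier ?D" "z \<in> carrier ?D"
    show "x \<oplus>\<^bsub>?D\<^esub> y \<oplus>\<^bsub>?D\<^esub> z = x \<oplus>\<^bsub>?D\<^esub> (y \<oplus>\<^bsub>?D\<^esub> z)"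
    proof -
      have "x r \<oplus>\<^bsub>ob (W r) t\<^esub> y r \<oplus>\<^bsub>ob (W r) t\<^esub> z r = x r \<oplus>\<^bsub>ob (W r) t\<^esub> (y r \<oplus>\<^bsub>ob (W r) t\<^esub> z r)"
        if r: "r < N" for r
      proof -
        interpret M: module R "ob (W r) t" by (rule M[OF r])
        show ?thesis using fin_dsum_comp[OF *(1) r] fin_dsum_comp[OF *(2) r] fin_dsum_comp[OF *(3) r]
          by (simp add: M.a_assoc)
      qed
      then show ?thesis by (auto simp: d fun_eq_iff)
    qed
  next
    fix x y assume *: "x \<in> carrier ?D" "y \<in> carrier ?D"
    have "x r \<oplus>\<^bsub>ob (W r) t\<^esub> y r = y r \<oplus>\<^bsub>ob (W r) t\<^esub> x r" if r: "r < N" for r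
    proof -
      interpret M: module R "ob (W r) t" by (rule M[OF r])
      show ?thesis using fin_dsum_comp[OF *(1) r] fin_dsum_comp[OF *(2) r] by (simp add: M.a_comm)
    qed
    then show "x \<oplus>\<^bsub>?D\<^esub> y = y \<oplus>\<^bsub>?D\<^esub> x" by (auto simp: d fun_eq_iff)
  next
    fix x assume *: "x \<in> carrier ?D"
    have "\<zero>\<^bsub>ob (W r) t\<^esub> \<oplus>\<^bsub>ob (W r) t\<^esub> x r = x r" if r: "r < N" for r
    proof -
      interpret M: module R "ob (W r) t" by (rule M[OF r])
      show ?thesis using fin_dsum_comp[OF * r] by simp
    qed
    then show "\<zero>\<^bsub>?D\<^esub> \<oplus>\<^bsub>?D\<^esub> x = x"
      using * by (auto simp: d fun_eq_iff PiE_def extensional_def)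
  qed
  fix a b x y assume ab: "a \<in> carrier R" "b \<in> carrier R" and *: "x \<in> carrier ?D" "y \<in> carrier ?D"
  have r: "a \<odot>\<^bsub>ob (W r) t\<^esub> x r \<in> carrier (ob (W r) t)"
      "(a \<oplus> b) \<odot>\<^bsub>ob (W r) t\<^esub> x r = a \<odot>\<^bsub>ob (W r) t\<^esub> x r \<oplus>\<^bsub>ob (W r) t\<^esub> b \<odot>\<^bsub>ob (W r) t\<^esub> x r"
      "a \<odot>\<^bsub>ob (W r) t\<^esub> (x r \<oplus>\<^bsub>ob (W r) t\<^esub> y r) = a \<odot>\<^bsub>ob (W r) t\<^esub> x r \<oplus>\<^bsub>ob (W r) t\<^esub> a \<odot>\<^bsub>ob (W r) t\<^esub> y r"
      "(a \<otimes> b) \<odot>\<^bsub>ob (W r) t\<^esub> x r = a \<odot>\<^bsub>ob (W r) t\<^esub> (b \<odot>\<^bsub>ob (W r) t\<^esub> x r)"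
      "\<one> \<odot>\<^bsub>ob (W r) t\<^esub> x r = x r" if r: "r < N" for r
  proof -
    interpret M: module R "ob (W r) t" by (rule M[OF r])
    have c: "x r \<in> carrier (ob (W r) t)" "y r \<in> carrier (ob (W r) t)"
      using fin_dsum_comp[OF *(1) r] fin_dsum_comp[OF *(2) r] .
    show "a \<odot>\<^bsub>ob (W r) t\<^esub> x r \<in> carrier (ob (W r) t)"
      "(a \<oplus> b) \<odot>\<^bsub>ob (W r) t\<^esub> x r = a \<odot>\<^bsub>ob (W r) t\<^esub> x r \<oplus>\<^bsub>ob (W r) t\<^esub> b \<odot>\<^bsub>ob (W r) t\<^esub> x r"
      "a \<odot>\<^bsub>ob (W r) t\<^esub> (x r \<oplus>\<^bsub>ob (W r) t\<^esub> y r) = a \<odot>\<^bsub>ob (W r) t\<^esub> x r \<oplus>\<^bsub>ob (W r) t\<^esub> a \<odot>\<^bsub>ob (W r) t\<^esub> y r"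
      "(a \<otimes> b) \<odot>\<^bsub>ob (W r) t\<^esub> x r = a \<odot>\<^bsub>ob (W r) t\<^esub> (b \<odot>\<^bsub>ob (W r) t\<^esub> x r)"
      "\<one> \<odot>\<^bsub>ob (W r) t\<^esub> x r = x r"
      using ab c by (simp_all add: M.smult_l_distr M.smult_r_distr M.smult_assoc1)
  qed
  show "a \<odot>\<^bsub>?D\<^esub> x \<in> carrier ?D" "(a \<oplus> b) \<odot>\<^bsub>?D\<^esub> x = a \<odot>\<^bsub>?D\<^esub> x \<oplus>\<^bsub>?D\<^esub> b \<odot>\<^bsub>?D\<^esub> x"
    "a \<odot>\<^bsub>?D\<^esub> (x \<oplus>\<^bsub>?D\<^esub> y) = a \<odot>\<^bsub>?D\<^esub> x \<oplus>\<^bsub>?D\<^esub> a \<odot>\<^bsub>?D\<^esub> y"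
    "(a \<otimes> b) \<odot>\<^bsub>?D\<^esub> x = a \<odot>\<^bsub>?D\<^esub> (b \<odot>\<^bsub>?D\<^esub> x)"
    using r by (auto simp: d fun_eq_iff)
next
  fix x assume *: "x \<in> carrier (ob (fin_dsum N W) t)"
  have "\<one> \<odot>\<^bsub>ob (W r) t\<^esub> x r = x r" if r: "r < N" for r
  proof -
    interpret M: module R "ob (W r) t" by (rule M[OF r])
    show ?thesis using fin_dsum_comp[OF * r] by simp
  qed
  then show "\<one> \<odot>\<^bsub>ob (fin_dsum N W) t\<^esub> x = x"
    using * by (auto simp: fin_dsum_simps fun_eq_iff PiE_def extensional_def)
qed

definition dsum_inj :: "nat \<Rightarrow> (nat \<Rightarrow> ('m, 'k, 'v) cmod) \<Rightarrow> 'm obj \<Rightarrow> nat \<Rightarrow> 'v \<Rightarrow> nat \<Rightarrow> 'v" where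
  "dsum_inj N W t r y = (\<lambda>q\<in>{..<N}. if q = r then y else \<zero>\<^bsub>ob (W q) t\<^esub>)"

lemma dsum_inj_lin:
  assumes M: "\<And>r. r < N \<Longrightarrow> module R (ob (W r) t)" and r: "r < N"
  shows "dsum_inj N W t r \<in> lin_maps R (ob (W r) t) (ob (fin_dsum N W) t)"
proof -
  have z: "\<zero>\<^bsub>ob (W q) t\<^esub> \<in> carrier (ob (W q) t)"
    "\<zero>\<^bsub>ob (W q) t\<^esub> \<oplus>\<^bsub>ob (W q) t\<^esub> \<zero>\<^bsub>ob (W q) t\<^esub> = \<zero>\<^bsub>ob (W q) t\<^esub>"
    "c \<in> carrier R \<Longrightarrow> c \<odot>\<^bsub>ob (W q) t\<^esub> \<zero>\<^bsub>ob (W q) t\<^esub> = \<zero>\<^bsub>ob (W q) t\<^esub>" if q: "q < N" for q c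
  proof -
    interpret M: module R "ob (W q) t" by (rule M[OF q])
    show "\<zero>\<^bsub>ob (W q) t\<^esub> \<in> carrier (ob (W q) t)"
    "\<zero>\<^bsub>ob (W q) t\<^esub> \<oplus>\<^bsub>ob (W q) t\<^esub> \<zero>\<^bsub>ob (W q) t\<^esub> = \<zero>\<^bsub>ob (W q) t\<^esub>"
    "c \<in> carrier R \<Longrightarrow> c \<odot>\<^bsub>ob (W q) t\<^esub> \<zero>\<^bsub>ob (W q) t\<^esub> = \<zero>\<^bsub>ob (W q) t\<^esub>" by simp_all
  qed
  show ?thesis
    by (rule lin_mapsI) (use z in \<open>auto simp: dsum_inj_def fin_dsum_simps fun_eq_iff\<close>)
qed

lemma dsum_span:
  assumes M: "\<And>r. r < N \<Longrightarrow> module R (ob (W r) t)"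
    and S: "\<And>r. r < N \<Longrightarrow> S r \<subseteq> carrier (ob (W r) t)"
    and span: "\<And>r. r < N \<Longrightarrow> carrier (ob (W r) t) \<subseteq> mod_span R (ob (W r) t) (S r)"
  shows "carrier (ob (fin_dsum N W) t) \<subseteq> mod_span R (ob (fin_dsum N W) t) (\<Union>r<N. dsum_inj N W t r ` S r)"
proof
  let ?D = "ob (fin_dsum N W) t"
  let ?H = "mod_span R ?D (\<Union>r<N. dsum_inj N W t r ` S r)"
  have D: "module R ?D" by (rule fin_dsum_module[OF M])
  have inj_lin: "dsum_inj N W t r \<in> lin_maps R (ob (W r) t) ?D" if "r < N" for r
    by (rule dsum_inj_lin[OF M that])
  have "dsum_inj N W t r ` S r \<subseteq> carrier ?D" if "r < N" for r
    by (rule image_subsetI, rule lin_mapsD(1)[OF inj_lin[OF that]], rule subsetD[OF S[OF that]])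
  then have H: "submodule ?H R ?D" by (intro span_sm[OF D]) blast
  fix x assume x: "x \<in> carrier ?D"
  have inj: "dsum_inj N W t r y \<in> ?H" if r: "r < N" and y: "y \<in> carrier (ob (W r) t)" for r y
  proof -
    have "dsum_inj N W t r ` mod_span R (ob (W r) t) (S r) = mod_span R ?D (dsum_inj N W t r ` S r)"
      by (rule span_image[OF inj_lin[OF r] M[OF r] D S[OF r]])
    also have "\<dots> \<subseteq> ?H" by (rule span_mono) (use r in blast)
    finally show ?thesis using span[OF r] y by blast
  qed
  \<comment> \<open>Truncations of \<open>x\<close>: each step adds one coordinate, an element of a
    single summand.\<close>
  define tr where "tr k = (\<lambda>q\<in>{..<N}. if q < k then x q else \<zero>\<^bsub>ob (W q) t\<^esub>)" for k
  have "tr k \<in> ?H" if "k \<le> N" for k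
    using that
  proof (induction k)
    case 0
    have "tr 0 = \<zero>\<^bsub>?D\<^esub>" by (simp add: tr_def fin_dsum_simps)
    then show ?case using sm_zero[OF H] by simp
  next
    case (Suc k)
    have xk: "x k \<in> carrier (ob (W k) t)" using fin_dsum_comp[OF x] Suc.prems by simp
    have "tr (Suc k) = tr k \<oplus>\<^bsub>?D\<^esub> dsum_inj N W t k (x k)"
    proof
      fix q
      show "tr (Suc k) q = (tr k \<oplus>\<^bsub>?D\<^esub> dsum_inj N W t k (x k)) q"
      proof (cases "q < N")
        case True
        interpret M: module R "ob (W q) t" by (rule M[OF True])
        have "x q \<in> carrier (ob (W q) t)" by (rule fin_dsum_comp[OF x True])
        then have "\<zero>\<^bsub>ob (W q) t\<^esub> \<oplus>\<^bsub>ob (W q) t\<^esub> x q = x q" "x q \<oplus>\<^bsub>ob (W q) t\<^esub> \<zero>\<^bsub>ob (W q) t\<^esub> = x q"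
          by simp_all
        then show ?thesis using True
          by (cases q k rule: linorder_cases) (simp_all add: tr_def fin_dsum_simps dsum_inj_def)
      qed (simp add: tr_def fin_dsum_simps)
    qed
    also have "\<dots> \<in> ?H"
      by (rule sm_add[OF H Suc.IH inj]) (use Suc.prems xk in auto)
    finally show ?case .
  qed
  then have "tr N \<in> ?H" by simp
  moreover have "tr N = x" using x by (auto simp: tr_def fin_dsum_simps fun_eq_iff PiE_def extensional_def)
  ultimately show "x \<in> ?H" by simp
qed

lemma Mfree_simps:
  "ob (Mfree R n) t = free_mod R (Cmor n t)" "act (Mfree R n) t u f = free_map R (Ccomp n f)"
  by (simp_all add: Mfree_def)

lemma fin_gen_imp_fgen:
  assumes V: "cmodule R V" and fg: "fin_gen R V"
  shows "fgen V"
proof -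
  obtain N ns h where h: "h \<in> cmod_hom R (fin_dsum N (\<lambda>r. Mfree R (ns r))) V"
    and sur: "\<And>t. h t ` carrier (ob (fin_dsum N (\<lambda>r. Mfree R (ns r))) t) = carrier (ob V t)"
    using fg unfolding fin_gen_def by blast
  let ?W = "\<lambda>r. Mfree R (ns r)"
  let ?D = "fin_dsum N ?W"
  have M: "module R (ob (?W r) t)" for r t by (simp add: Mfree_simps free_module)
  have D: "module R (ob ?D t)" for t by (rule fin_dsum_module[OF M])
  have inj_lin: "dsum_inj N ?W t r \<in> lin_maps R (ob (?W r) t) (ob ?D t)" if "r < N" for t r
    by (rule dsum_inj_lin[OF M that])
  \<comment> \<open>The universal element of the summand \<open>M(ns r)\<close>: its images under
    all morphisms are the free generators of that summand.\<close>
  define \<delta> where "\<delta> r = dsum_inj N ?W (ns r) r (free_gen R (Cid (ns r)))" for r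
  have \<delta>: "\<delta> r \<in> carrier (ob ?D (ns r))" if "r < N" for r
    unfolding \<delta>_def
    by (rule lin_mapsD(1)[OF inj_lin[OF that]]) (simp add: Mfree_simps free_gen_in Cid_in)
  define G where "G = (\<lambda>r. (ns r, h (ns r) (\<delta> r))) ` {..<N}"
  show ?thesis
    unfolding fgen_def
  proof (intro exI[of _ G] conjI allI)
    show "finite G" by (simp add: G_def)
    show "\<forall>(n, v)\<in>G. v \<in> carrier (ob V n)" using homD(2)[OF h] \<delta> by (auto simp: G_def)
    then have oc: "orb V G t \<subseteq> carrier (ob V t)" for t by (rule orb_carrier[OF V])
    fix t
    let ?S = "\<lambda>r. free_gen R ` Cmor (ns r) t"
    have Sc: "?S r \<subseteq> carrier (ob (?W r) t)" for r by (auto simp: Mfree_simps free_gen_in)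
    have act: "act ?D (ns r) t f (\<delta> r) = dsum_inj N ?W t r (free_gen R f)"
      if r: "r < N" and f: "f \<in> Cmor (ns r) t" for r f
    proof
      fix q
      have "free_map R (Ccomp (ns q) f) (\<lambda>s. \<zero>) = (\<lambda>s. \<zero>)"
        by (simp add: free_map_def)
      then show "act ?D (ns r) t f (\<delta> r) q = dsum_inj N ?W t r (free_gen R f) q"
        using r by (auto simp: fin_dsum_simps \<delta>_def dsum_inj_def Mfree_simps free_map_gen
            Ccomp_id_right[OF f] free_mod_simps(2))
    qed
    have DS: "(\<Union>r<N. dsum_inj N ?W t r ` ?S r) \<subseteq> carrier (ob ?D t)"
      using lin_mapsD(1)[OF inj_lin] Sc by blast
    have "carrier (ob ?D t) \<subseteq> mod_span R (ob ?D t) (\<Union>r<N. dsum_inj N ?W t r ` ?S r)"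
      by (rule dsum_span[OF M Sc]) (simp add: Mfree_simps free_gen_span)
    then have "carrier (ob V t) \<subseteq> h t ` mod_span R (ob ?D t) (\<Union>r<N. dsum_inj N ?W t r ` ?S r)"
      using sur[of t] by blast
    also have "\<dots> \<subseteq> mod_span R (ob V t) (orb V G t)"
    proof (rule span_lin_subset[OF homD(1)[OF h] D cmD(1)[OF V] DS span_sm[OF cmD(1)[OF V] oc]])
      show "h t ` (\<Union>r<N. dsum_inj N ?W t r ` ?S r) \<subseteq> mod_span R (ob V t) (orb V G t)"
      proof
        fix x assume "x \<in> h t ` (\<Union>r<N. dsum_inj N ?W t r ` ?S r)"
        then obtain r f where rf: "r < N" "f \<in> Cmor (ns r) t" "x = h t (dsum_inj N ?W t r (free_gen R f))"
          by auto
        then have "x = act V (ns r) t f (h (ns r) (\<delta> r))"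
          using homD(3)[OF h rf(2) \<delta>[OF rf(1)]] by (simp add: act)
        then have "x \<in> orb V G t" using rf by (auto simp: orb_def G_def)
        then show "x \<in> mod_span R (ob V t) (orb V G t)" by (rule subsetD[OF span_incl])
      qed
    qed
    finally show "carrier (ob V t) \<subseteq> mod_span R (ob V t) (orb V G t)" .
  qed
qed

text \<open>By the Yoneda lemma an element \<open>v\<close> of \<open>V_n\<close> gives a map from
  \<open>M(n)\<close> that sends the generator of \<open>f\<close> to the image of \<open>v\<close>
  under \<open>f\<close>. The surjection \<open>h\<close> is the sum of these maps over the given
  generators.\<close>

lemma fgen_imp_fin_gen:
  assumes V: "cmodule R V" and fg: "fgen V"
  shows "fin_gen R V"
proof -
  obtain G where G: "finite G" "\<forall>(n, v)\<in>G. v \<in> carrier (ob V n)"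
      "\<And>t. carrier (ob V t) \<subseteq> mod_span R (ob V t) (orb V G t)"
    using fg by (auto simp: fgen_def)
  obtain gs where gs: "set gs = G" using finite_list[OF G(1)] by blast
  define N where "N = length gs"
  define ns where "ns r = fst (gs ! r)" for r
  define vs where "vs r = snd (gs ! r)" for r
  have vs: "vs r \<in> carrier (ob V (ns r))" if "r < N" for r
    using G(2) nth_mem[of r gs] that gs by (fastforce simp: N_def ns_def vs_def)
  let ?W = "\<lambda>r. Mfree R (ns r)"
  let ?D = "fin_dsum N ?W"
  have M: "module R (ob (?W r) t)" for r t by (simp add: Mfree_simps free_module)
  have D: "module R (ob ?D t)" for t by (rule fin_dsum_module[OF M])
  have inj_lin: "dsum_inj N ?W t r \<in> lin_maps R (ob (?W r) t) (ob ?D t)" if "r < N" for t r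
    by (rule dsum_inj_lin[OF M that])
  note Vm = cmD(1)[OF V]
  define ev where "ev t r = free_ext (ob V t) (\<lambda>f. act V (ns r) t f (vs r))" for t r
  have evc: "act V (ns r) t f (vs r) \<in> carrier (ob V t)" if "r < N" "f \<in> Cmor (ns r) t" for r t f
    by (rule act_in[OF V that(2) vs[OF that(1)]])
  have ev: "ev t r \<in> lin_maps R (free_mod R (Cmor (ns r) t)) (ob V t)" if "r < N" for t r
    unfolding ev_def by (rule free_ext_lin[OF Vm evc[OF that]])
  have ev_gen: "ev t r (free_gen R f) = act V (ns r) t f (vs r)" if "r < N" "f \<in> Cmor (ns r) t" for t r f
    unfolding ev_def
    by (rule free_ext_gen[where \<phi> = "\<lambda>f. act V (ns r) t f (vs r)", OF Vm evc[OF that]])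
  have ev_nat: "ev u r (free_map R (Ccomp (ns r) f) x) = act V t u f (ev t r x)"
    if r: "r < N" and f: "f \<in> Cmor t u" and x: "x \<in> carrier (free_mod R (Cmor (ns r) t))" for t u r f x
  proof (rule free_lin_eq[OF _ _ Vm _ x])
    show "(\<lambda>x. ev u r (free_map R (Ccomp (ns r) f) x)) \<in> lin_maps R (free_mod R (Cmor (ns r) t)) (ob V u)"
      by (rule lin_comp[OF free_map_lin ev[OF r]]) (rule Ccomp_in[OF _ f])
    show "(\<lambda>x. act V t u f (ev t r x)) \<in> lin_maps R (free_mod R (Cmor (ns r) t)) (ob V u)"
      by (rule lin_comp[OF ev[OF r] cmD(2)[OF V f]])
    fix g assume g: "g \<in> Cmor (ns r) t"
    show "ev u r (free_map R (Ccomp (ns r) f) (free_gen R g)) = act V t u f (ev t r (free_gen R g))"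
      using cmD(4)[OF V g f vs[OF r]]
      by (simp add: free_map_gen ev_gen[OF r g] ev_gen[OF r Ccomp_in[OF g f]])
  qed
  have comp: "x r \<in> carrier (free_mod R (Cmor (ns r) t))" if "x \<in> carrier (ob ?D t)" "r < N" for x r t
    using fin_dsum_comp[OF that] by (simp add: Mfree_simps)
  have pr: "(\<lambda>x. x r) \<in> lin_maps R (ob ?D t) (free_mod R (Cmor (ns r) t))" if r: "r < N" for r t
    by (rule lin_mapsI) (use comp r in \<open>auto simp: fin_dsum_simps Mfree_simps\<close>)
  define h where "h t x = (\<Oplus>\<^bsub>ob V t\<^esub>r\<in>{..<N}. ev t r (x r))" for t and x :: "nat \<Rightarrow> 'a mor \<Rightarrow> 'k"
  have h_lin: "h t \<in> lin_maps R (ob ?D t) (ob V t)" for t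
    unfolding h_def by (rule lin_finsum[OF D Vm]) (auto intro: lin_comp[OF pr ev])
  have h: "h \<in> cmod_hom R ?D V"
  proof (rule homI[OF h_lin])
    fix t u f x assume f: "f \<in> Cmor t u" and x: "x \<in> carrier (ob ?D t)"
    interpret Vu: module R "ob V u" by (rule Vm)
    have "act V t u f (h t x) = (\<Oplus>\<^bsub>ob V u\<^esub>r\<in>{..<N}. act V t u f (ev t r (x r)))"
      unfolding h_def
      by (rule lin_map_finsum[OF cmD(2)[OF V f] Vm Vm]) (auto intro!: lin_mapsD(1)[OF ev] comp[OF x])
    also have "\<dots> = (\<Oplus>\<^bsub>ob V u\<^esub>r\<in>{..<N}. ev u r ((act ?D t u f x) r))"
    proof (rule Vu.finsum_cong'[OF refl])
      have eq: "ev u r ((act ?D t u f x) r) = act V t u f (ev t r (x r))" if "r < N" for r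
        using that by (simp add: fin_dsum_simps Mfree_simps ev_nat[OF _ f comp[OF x]])
      show "(\<lambda>r. ev u r ((act ?D t u f x) r)) \<in> {..<N} \<rightarrow> carrier (ob V u)"
        using act_in[OF V f lin_mapsD(1)[OF ev comp[OF x]]] by (simp add: eq)
      show "act V t u f (ev t r (x r)) = ev u r ((act ?D t u f x) r)" if "r \<in> {..<N}" for r
        using that eq[of r] by simp
    qed
    finally show "h u (act ?D t u f x) = act V t u f (h t x)" by (simp add: h_def)
  qed
  have "h t ` carrier (ob ?D t) = carrier (ob V t)" for t
  proof
    show "h t ` carrier (ob ?D t) \<subseteq> carrier (ob V t)" using lin_mapsD(1)[OF h_lin] by blast
    have "orb V G t \<subseteq> h t ` carrier (ob ?D t)"
    proof
      fix x assume "x \<in> orb V G t"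
      then obtain n v f where *: "(n, v) \<in> G" "f \<in> Cmor n t" "x = act V n t f v" by (auto simp: orb_def)
      then obtain r where r: "r < N" "gs ! r = (n, v)" using gs by (auto simp: in_set_conv_nth N_def)
      then have nv: "n = ns r" "v = vs r" by (simp_all add: ns_def vs_def)
      interpret Vt: module R "ob V t" by (rule Vm)
      let ?y = "dsum_inj N ?W t r (free_gen R f)"
      have fr: "f \<in> Cmor (ns r) t" using * nv by simp
      have y: "?y \<in> carrier (ob ?D t)"
        using lin_mapsD(1)[OF inj_lin[OF r(1)], of "free_gen R f" t] fr
        by (simp add: Mfree_simps free_gen_in)
      have "h t ?y = (\<Oplus>\<^bsub>ob V t\<^esub>q\<in>{..<N}. if r = q then ev t q (free_gen R f) else \<zero>\<^bsub>ob V t\<^esub>)"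
        unfolding h_def
      proof (rule Vt.finsum_cong'[OF refl])
        show "(\<lambda>q. if r = q then ev t q (free_gen R f) else \<zero>\<^bsub>ob V t\<^esub>) \<in> {..<N} \<rightarrow> carrier (ob V t)"
          using lin_mapsD(1)[OF ev[OF r(1)] free_gen_in[OF fr]] by auto
        fix q assume "q \<in> {..<N}"
        then show "ev t q (?y q) = (if r = q then ev t q (free_gen R f) else \<zero>\<^bsub>ob V t\<^esub>)"
          using lin_zero[OF ev free_module Vm, of q t] by (auto simp: dsum_inj_def Mfree_simps)
      qed
      also have "\<dots> = ev t r (free_gen R f)"
      proof -
        have "(\<Oplus>\<^bsub>ob V t\<^esub>q\<in>{..<N}. if r = q then ev t q (free_gen R f) else \<zero>\<^bsub>ob V t\<^esub>)
            = (\<Oplus>\<^bsub>ob V t\<^esub>q\<in>{..<N}. if r = q then ev t r (free_gen R f) else \<zero>\<^bsub>ob V t\<^esub>)"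
          by (rule arg_cong[where f = "\<lambda>g. finsum (ob V t) g {..<N}"]) auto
        also have "\<dots> = ev t r (free_gen R f)"
          by (rule Vt.add.finprod_singleton[where f = "\<lambda>_. ev t r (free_gen R f)"])
            (use r(1) lin_mapsD(1)[OF ev[OF r(1)] free_gen_in[OF fr]] in auto)
        finally show ?thesis .
      qed
      also have "\<dots> = x" using ev_gen[OF r(1) fr] *(3) nv by simp
      finally show "x \<in> h t ` carrier (ob ?D t)" using y by blast
    qed
    then have "mod_span R (ob V t) (orb V G t) \<subseteq> h t ` carrier (ob ?D t)"
      by (rule span_least[OF sm_image[OF h_lin D Vm sm_carrier[OF D]]])
    then show "carrier (ob V t) \<subseteq> h t ` carrier (ob ?D t)" using G(3)[of t] by (rule order_trans[rotated])
  qed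
  then show ?thesis unfolding fin_gen_def using h by blast
qed

lemma onto_fgen:
  assumes V: "cmodule R V" and W: "cmodule R W" and h: "onto V W h" and fg: "fgen V"
  shows "fgen W"
proof -
  have hh: "h \<in> cmod_hom R V W" using h by (simp add: onto_def)
  obtain G where G: "finite G" "\<forall>(n, v)\<in>G. v \<in> carrier (ob V n)"
      "\<And>t. carrier (ob V t) \<subseteq> mod_span R (ob V t) (orb V G t)"
    using fg by (auto simp: fgen_def)
  let ?G = "(\<lambda>(n, v). (n, h n v)) ` G"
  show ?thesis
    unfolding fgen_def
  proof (intro exI[of _ ?G] conjI allI)
    show "finite ?G" using G(1) by simp
    show G': "\<forall>(n, v)\<in>?G. v \<in> carrier (ob W n)" using G(2) homD(2)[OF hh] by auto
    fix t
    have "h t ` orb V G t \<subseteq> orb W ?G t"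
    proof
      fix x assume "x \<in> h t ` orb V G t"
      then obtain n v f where *: "(n, v) \<in> G" "f \<in> Cmor n t" "x = h t (act V n t f v)" by (auto simp: orb_def)
      then have "x = act W n t f (h n v)" using homD(3)[OF hh *(2)] G(2) by auto
      moreover have "(n, h n v) \<in> ?G" using *(1) by force
      ultimately show "x \<in> orb W ?G t" using *(2) unfolding orb_def by blast
    qed
    then have "h t ` orb V G t \<subseteq> mod_span R (ob W t) (orb W ?G t)"
      using span_incl by (rule order_trans)
    then have "h t ` mod_span R (ob V t) (orb V G t) \<subseteq> mod_span R (ob W t) (orb W ?G t)"
      by (rule span_lin_subset[OF homD(1)[OF hh] cmD(1)[OF V] cmD(1)[OF W] orb_carrier[OF V G(2)]
          span_sm[OF cmD(1)[OF W] orb_carrier[OF W G']]])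
    moreover have "carrier (ob W t) = h t ` carrier (ob V t)" using h by (simp add: onto_def)
    ultimately show "carrier (ob W t) \<subseteq> mod_span R (ob W t) (orb W ?G t)"
      using image_mono[OF G(3)[of t], of "h t"] by (auto intro: order_trans)
  qed
qed

lemma subcmod_fgen:
  fixes V :: "('m :: finite, 'k, 'v) cmod"
  assumes noeth: "noetherian_ring R" and V: "cmodule R V" and fg: "fgen V" and X: "subfunctor R V X"
  shows "fgen (subcmod V X)"
proof -
  obtain G where G: "finite G" "\<forall>(n, v)\<in>G. v \<in> X n" "\<And>t. X t \<subseteq> mod_span R (ob V t) (orb V G t)"
    using noetherian_sub[OF assms] by blast
  have o: "orb (subcmod V X) G t = orb V G t" for t by (simp add: orb_def)
  have oX: "orb V G t \<subseteq> X t" for t using G(2) subfunctorD(2)[OF X] by (auto simp: orb_def)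
  show ?thesis
    unfolding fgen_def
    by (intro exI[of _ G])
      (use G o span_restrict[OF cmD(1)[OF V] subfunctorD(1)[OF X] oX] in auto)
qed

lemma subquot_fin_gen:
  fixes V :: "('m :: finite, 'k, 'v) cmod"
  assumes noeth: "noetherian_ring R" and V: "cmodule R V" and fg: "fgen V"
    and Z: "subfunctor R V Z" and B: "subfunctor R V B" and BZ: "\<And>n. B n \<subseteq> Z n"
  shows "fin_gen R (subquot V Z B)"
  by (rule fgen_imp_fin_gen[OF subquot_cst(1)[OF V Z B BZ]],
      rule onto_fgen[OF subcmod_cmodule[OF V Z] subquot_cst(1,2)[OF V Z B BZ] subcmod_fgen[OF noeth V fg Z]])

end

section \<open>Tensor products\<close>

text \<open>A common setting for the two tensor products in use: \<open>H0\<close> takes all objects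
  for \<open>D\<close>, and \<open>Mtens\<close> takes \<open>D = {n}\<close>.\<close>

locale tens_data = coeff_ring R for R :: "('k, 'b) ring_scheme" (structure) +
  fixes D :: "'m obj set" and X :: "'m obj \<Rightarrow> ('k, 'x) module"
    and xa :: "'m obj \<Rightarrow> 'm obj \<Rightarrow> 'm mor \<Rightarrow> 'x \<Rightarrow> 'x" and Y :: "('m, 'k, 'y) cmod"
  assumes X: "\<And>d. d \<in> D \<Longrightarrow> module R (X d)" and Y: "\<And>d. d \<in> D \<Longrightarrow> module R (ob Y d)"
    and xa_in: "\<And>d e f x. d \<in> D \<Longrightarrow> e \<in> D \<Longrightarrow> f \<in> Cmor d e \<Longrightarrow> x \<in> carrier (X e) \<Longrightarrow>
      xa d e f x \<in> carrier (X d)"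
    and Ya_in: "\<And>d e f y. d \<in> D \<Longrightarrow> e \<in> D \<Longrightarrow> f \<in> Cmor d e \<Longrightarrow> y \<in> carrier (ob Y d) \<Longrightarrow>
      act Y d e f y \<in> carrier (ob Y e)"
begin

abbreviation F :: "('k, 'm obj \<times> 'x \<times> 'y \<Rightarrow> 'k) module" where "F \<equiv> tens_free R D X Y"
abbreviation N :: "('m obj \<times> 'x \<times> 'y \<Rightarrow> 'k) set" where "N \<equiv> tens_rels R D X xa Y"
abbreviation Q :: "('k, ('m obj \<times> 'x \<times> 'y \<Rightarrow> 'k) set) module" where "Q \<equiv> tens R D X xa Y"
abbreviation T :: "('m obj \<times> 'x \<times> 'y) set" where
  "T \<equiv> {(d, x, y). d \<in> D \<and> x \<in> carrier (X d) \<and> y \<in> carrier (ob Y d)}"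
abbreviation g :: "'m obj \<Rightarrow> 'x \<Rightarrow> 'y \<Rightarrow> 'm obj \<times> 'x \<times> 'y \<Rightarrow> 'k" where "g d x y \<equiv> free_gen R (d, x, y)"

definition rel_gens :: "('m obj \<times> 'x \<times> 'y \<Rightarrow> 'k) set" where
  "rel_gens =
      ({g d (x \<oplus>\<^bsub>X d\<^esub> x') y \<ominus>\<^bsub>F\<^esub> (g d x y \<oplus>\<^bsub>F\<^esub> g d x' y) | d x x' y.
          d \<in> D \<and> x \<in> carrier (X d) \<and> x' \<in> carrier (X d) \<and> y \<in> carrier (ob Y d)} \<union>
       {g d x (y \<oplus>\<^bsub>ob Y d\<^esub> y') \<ominus>\<^bsub>F\<^esub> (g d x y \<oplus>\<^bsub>F\<^esub> g d x y') | d x y y'.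
          d \<in> D \<and> x \<in> carrier (X d) \<and> y \<in> carrier (ob Y d) \<and> y' \<in> carrier (ob Y d)} \<union>
       {g d (c \<odot>\<^bsub>X d\<^esub> x) y \<ominus>\<^bsub>F\<^esub> c \<odot>\<^bsub>F\<^esub> g d x y | d c x y.
          d \<in> D \<and> c \<in> carrier R \<and> x \<in> carrier (X d) \<and> y \<in> carrier (ob Y d)} \<union>
       {g d x (c \<odot>\<^bsub>ob Y d\<^esub> y) \<ominus>\<^bsub>F\<^esub> c \<odot>\<^bsub>F\<^esub> g d x y | d c x y.
          d \<in> D \<and> c \<in> carrier R \<and> x \<in> carrier (X d) \<and> y \<in> carrier (ob Y d)} \<union>
       {g d (xa d e f x) y \<ominus>\<^bsub>F\<^esub> g e x (act Y d e f y) | d e f x y.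
          d \<in> D \<and> e \<in> D \<and> f \<in> Cmor d e \<and> x \<in> carrier (X e) \<and> y \<in> carrier (ob Y d)})"

lemma N_eq: "N = mod_span R F rel_gens"
  unfolding tens_rels_def rel_gens_def Let_def ..

lemma F_eq: "F = free_mod R T"
  by (simp add: tens_free_def)

lemma F_module: "module R F"
  unfolding F_eq by (rule free_module)

lemma g_in: "d \<in> D \<Longrightarrow> x \<in> carrier (X d) \<Longrightarrow> y \<in> carrier (ob Y d) \<Longrightarrow> g d x y \<in> carrier F"
  unfolding F_eq by (rule free_gen_in) simp

lemma X_add: "d \<in> D \<Longrightarrow> x \<in> carrier (X d) \<Longrightarrow> x' \<in> carrier (X d) \<Longrightarrow> x \<oplus>\<^bsub>X d\<^esub> x' \<in> carrier (X d)"
  by (rule sm_add[OF sm_carrier[OF X]])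

lemma X_smult: "d \<in> D \<Longrightarrow> c \<in> carrier R \<Longrightarrow> x \<in> carrier (X d) \<Longrightarrow> c \<odot>\<^bsub>X d\<^esub> x \<in> carrier (X d)"
  by (rule sm_smult[OF sm_carrier[OF X]])

lemma Y_add: "d \<in> D \<Longrightarrow> x \<in> carrier (ob Y d) \<Longrightarrow> x' \<in> carrier (ob Y d) \<Longrightarrow> x \<oplus>\<^bsub>ob Y d\<^esub> x' \<in> carrier (ob Y d)"
  by (rule sm_add[OF sm_carrier[OF Y]])

lemma Y_smult: "d \<in> D \<Longrightarrow> c \<in> carrier R \<Longrightarrow> x \<in> carrier (ob Y d) \<Longrightarrow> c \<odot>\<^bsub>ob Y d\<^esub> x \<in> carrier (ob Y d)"
  by (rule sm_smult[OF sm_carrier[OF Y]])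

lemma rel_gens_in: "rel_gens \<subseteq> carrier F"
proof -
  note F = sm_carrier[OF F_module]
  show ?thesis
    unfolding rel_gens_def
    by (auto intro!: sm_minus[OF F] sm_add[OF F] sm_smult[OF F] g_in X_add X_smult Y_add Y_smult xa_in Ya_in)
qed

lemma N_sm: "submodule N R F"
  unfolding N_eq by (rule span_sm[OF F_module rel_gens_in])

lemma Q_module: "module R Q"
  unfolding tens_def by (rule quot_module[OF F_module N_sm])

definition pure :: "'m obj \<Rightarrow> 'x \<Rightarrow> 'y \<Rightarrow> ('m obj \<times> 'x \<times> 'y \<Rightarrow> 'k) set" where
  "pure d x y = cst F N (g d x y)"

lemma cst_Q: "cst F N \<in> lin_maps R F Q"
  unfolding tens_def by (rule cst_lin[OF F_module N_sm])

lemma pure_in: "d \<in> D \<Longrightarrow> x \<in> carrier (X d) \<Longrightarrow> y \<in> carrier (ob Y d) \<Longrightarrow> pure d x y \<in> carrier Q"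
  unfolding pure_def by (rule lin_mapsD(1)[OF cst_Q g_in])

lemma cst_eqI:
  assumes "a \<in> carrier F" "b \<in> carrier F" "a \<ominus>\<^bsub>F\<^esub> b \<in> rel_gens"
  shows "cst F N a = cst F N b"
  using cst_eq_iff[OF F_module N_sm assms(1,2)] assms(3) span_incl[of rel_gens F] by (auto simp: N_eq)

lemma pure_add_left:
  assumes "d \<in> D" "x \<in> carrier (X d)" "x' \<in> carrier (X d)" "y \<in> carrier (ob Y d)"
  shows "pure d (x \<oplus>\<^bsub>X d\<^esub> x') y = pure d x y \<oplus>\<^bsub>Q\<^esub> pure d x' y"
proof -
  have "cst F N (g d (x \<oplus>\<^bsub>X d\<^esub> x') y) = cst F N (g d x y \<oplus>\<^bsub>F\<^esub> g d x' y)"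
    by (rule cst_eqI)
      (use assms in \<open>auto simp: rel_gens_def intro!: g_in X_add sm_add[OF sm_carrier[OF F_module]]\<close>)
  then show ?thesis using assms by (simp add: pure_def lin_mapsD(2)[OF cst_Q g_in g_in])
qed

lemma pure_add_right:
  assumes "d \<in> D" "x \<in> carrier (X d)" "y \<in> carrier (ob Y d)" "y' \<in> carrier (ob Y d)"
  shows "pure d x (y \<oplus>\<^bsub>ob Y d\<^esub> y') = pure d x y \<oplus>\<^bsub>Q\<^esub> pure d x y'"
proof -
  have "cst F N (g d x (y \<oplus>\<^bsub>ob Y d\<^esub> y')) = cst F N (g d x y \<oplus>\<^bsub>F\<^esub> g d x y')"
    by (rule cst_eqI)
      (use assms in \<open>auto simp: rel_gens_def intro!: g_in Y_add sm_add[OF sm_carrier[OF F_module]]\<close>)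
  then show ?thesis using assms by (simp add: pure_def lin_mapsD(2)[OF cst_Q g_in g_in])
qed

lemma pure_smult_left:
  assumes "d \<in> D" "c \<in> carrier R" "x \<in> carrier (X d)" "y \<in> carrier (ob Y d)"
  shows "pure d (c \<odot>\<^bsub>X d\<^esub> x) y = c \<odot>\<^bsub>Q\<^esub> pure d x y"
proof -
  have "cst F N (g d (c \<odot>\<^bsub>X d\<^esub> x) y) = cst F N (c \<odot>\<^bsub>F\<^esub> g d x y)"
  proof (rule cst_eqI)
    show "g d (c \<odot>\<^bsub>X d\<^esub> x) y \<ominus>\<^bsub>F\<^esub> c \<odot>\<^bsub>F\<^esub> g d x y \<in> rel_gens"
      unfolding rel_gens_def using assms by auto
  qed (use assms in \<open>auto intro!: g_in X_smult sm_smult[OF sm_carrier[OF F_module]]\<close>)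
  then show ?thesis using assms by (simp add: pure_def lin_mapsD(3)[OF cst_Q g_in])
qed

lemma pure_smult_right:
  assumes "d \<in> D" "c \<in> carrier R" "x \<in> carrier (X d)" "y \<in> carrier (ob Y d)"
  shows "pure d x (c \<odot>\<^bsub>ob Y d\<^esub> y) = c \<odot>\<^bsub>Q\<^esub> pure d x y"
proof -
  have "cst F N (g d x (c \<odot>\<^bsub>ob Y d\<^esub> y)) = cst F N (c \<odot>\<^bsub>F\<^esub> g d x y)"
  proof (rule cst_eqI)
    show "g d x (c \<odot>\<^bsub>ob Y d\<^esub> y) \<ominus>\<^bsub>F\<^esub> c \<odot>\<^bsub>F\<^esub> g d x y \<in> rel_gens"
      unfolding rel_gens_def using assms by auto
  qed (use assms in \<open>auto intro!: g_in Y_smult sm_smult[OF sm_carrier[OF F_module]]\<close>)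
  then show ?thesis using assms by (simp add: pure_def lin_mapsD(3)[OF cst_Q g_in])
qed

lemma pure_balance:
  assumes "d \<in> D" "e \<in> D" "f \<in> Cmor d e" "x \<in> carrier (X e)" "y \<in> carrier (ob Y d)"
  shows "pure d (xa d e f x) y = pure e x (act Y d e f y)"
  unfolding pure_def
proof (rule cst_eqI)
  show "g d (xa d e f x) y \<ominus>\<^bsub>F\<^esub> g e x (act Y d e f y) \<in> rel_gens"
    unfolding rel_gens_def using assms by auto
qed (use assms in \<open>auto intro!: g_in xa_in Ya_in\<close>)

lemma pure_lin_left: "d \<in> D \<Longrightarrow> y \<in> carrier (ob Y d) \<Longrightarrow> (\<lambda>x. pure d x y) \<in> lin_maps R (X d) Q"
  by (rule lin_mapsI) (simp_all add: pure_in pure_add_left pure_smult_left)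

lemma pure_lin_right: "d \<in> D \<Longrightarrow> x \<in> carrier (X d) \<Longrightarrow> pure d x \<in> lin_maps R (ob Y d) Q"
  by (rule lin_mapsI) (simp_all add: pure_in pure_add_right pure_smult_right)

definition pures :: "('m obj \<times> 'x \<times> 'y \<Rightarrow> 'k) set set" where
  "pures = (\<lambda>(d, x, y). pure d x y) ` T"

lemma pure_span: "carrier Q = mod_span R Q pures"
proof -
  have "carrier Q = cst F N ` carrier F" unfolding tens_def by (rule quot_mod_simps(1)[OF F_module N_sm])
  also have "carrier F = mod_span R F (free_gen R ` T)" by (simp add: F_eq free_gen_span)
  also have "cst F N ` \<dots> = mod_span R Q (cst F N ` free_gen R ` T)"
    by (rule span_image[OF cst_Q F_module Q_module]) (auto intro: g_in)
  also have "cst F N ` free_gen R ` T = pures"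
    unfolding pures_def image_image by (rule image_cong) (auto simp: pure_def)
  finally show ?thesis .
qed

text \<open>The universal property: the linear extension of \<open>\<phi>\<close> to the free module
  kills each of the five kinds of relations, hence the submodule that they span.\<close>

lemma tens_lift:
  assumes P: "module R P"
    and \<phi>: "\<And>d x y. d \<in> D \<Longrightarrow> x \<in> carrier (X d) \<Longrightarrow> y \<in> carrier (ob Y d) \<Longrightarrow> \<phi> d x y \<in> carrier P"
    and left: "\<And>d y. d \<in> D \<Longrightarrow> y \<in> carrier (ob Y d) \<Longrightarrow> (\<lambda>x. \<phi> d x y) \<in> lin_maps R (X d) P"
    and right: "\<And>d x. d \<in> D \<Longrightarrow> x \<in> carrier (X d) \<Longrightarrow> \<phi> d x \<in> lin_maps R (ob Y d) P"
    and bal: "\<And>d e f x y. d \<in> D \<Longrightarrow> e \<in> D \<Longrightarrow> f \<in> Cmor d e \<Longrightarrow> x \<in> carrier (X e) \<Longrightarrow> y \<in> carrier (ob Y d) \<Longrightarrow>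
      \<phi> d (xa d e f x) y = \<phi> e x (act Y d e f y)"
  obtains h where "h \<in> lin_maps R Q P"
    "\<And>d x y. d \<in> D \<Longrightarrow> x \<in> carrier (X d) \<Longrightarrow> y \<in> carrier (ob Y d) \<Longrightarrow> h (pure d x y) = \<phi> d x y"
proof -
  interpret P: module R P by fact
  define H where "H = free_ext P (\<lambda>(d, x, y). \<phi> d x y)"
  have H: "H \<in> lin_maps R F P"
    unfolding H_def F_eq by (rule free_ext_lin[OF P]) (auto intro: \<phi>)
  have Hg: "H (g d x y) = \<phi> d x y" if "d \<in> D" "x \<in> carrier (X d)" "y \<in> carrier (ob Y d)" for d x y
    unfolding H_def by (subst free_ext_gen[OF P]) (use \<phi>[OF that] in auto)
  note Fs = sm_carrier[OF F_module]
  have diff: "H (a \<ominus>\<^bsub>F\<^esub> b) = \<zero>\<^bsub>P\<^esub>" if "a \<in> carrier F" "b \<in> carrier F" "H a = H b" for a b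
    using lin_minus[OF H F_module P that(1,2)] lin_mapsD(1)[OF H that(2)] that(3)
    by (simp add: a_minus_def P.r_neg)
  have "rel_gens \<subseteq> {z \<in> carrier F. H z = \<zero>\<^bsub>P\<^esub>}"
  proof
    fix z assume z: "z \<in> rel_gens"
    have "H z = \<zero>\<^bsub>P\<^esub>"
      using z unfolding rel_gens_def
    proof (elim UnE CollectE exE conjE)
      fix d x x' y assume *: "z = g d (x \<oplus>\<^bsub>X d\<^esub> x') y \<ominus>\<^bsub>F\<^esub> (g d x y \<oplus>\<^bsub>F\<^esub> g d x' y)"
        "d \<in> D" "x \<in> carrier (X d)" "x' \<in> carrier (X d)" "y \<in> carrier (ob Y d)"
      have "H (g d x y \<oplus>\<^bsub>F\<^esub> g d x' y) = \<phi> d x y \<oplus>\<^bsub>P\<^esub> \<phi> d x' y"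
        using * by (simp add: lin_mapsD(2)[OF H g_in g_in] Hg)
      also have "\<dots> = H (g d (x \<oplus>\<^bsub>X d\<^esub> x') y)"
        using * lin_mapsD(2)[OF left, of d y x x'] by (simp add: Hg X_add)
      finally show "H z = \<zero>\<^bsub>P\<^esub>" unfolding *(1)
        by (intro diff) (use * in \<open>auto intro!: g_in X_add sm_add[OF Fs]\<close>)
    next
      fix d x y y' assume *: "z = g d x (y \<oplus>\<^bsub>ob Y d\<^esub> y') \<ominus>\<^bsub>F\<^esub> (g d x y \<oplus>\<^bsub>F\<^esub> g d x y')"
        "d \<in> D" "x \<in> carrier (X d)" "y \<in> carrier (ob Y d)" "y' \<in> carrier (ob Y d)"
      have "H (g d x y \<oplus>\<^bsub>F\<^esub> g d x y') = \<phi> d x y \<oplus>\<^bsub>P\<^esub> \<phi> d x y'"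
        using * by (simp add: lin_mapsD(2)[OF H g_in g_in] Hg)
      also have "\<dots> = H (g d x (y \<oplus>\<^bsub>ob Y d\<^esub> y'))"
        using * lin_mapsD(2)[OF right, of d x y y'] by (simp add: Hg Y_add)
      finally show "H z = \<zero>\<^bsub>P\<^esub>" unfolding *(1)
        by (intro diff) (use * in \<open>auto intro!: g_in Y_add sm_add[OF Fs]\<close>)
    next
      fix d c x y assume *: "z = g d (c \<odot>\<^bsub>X d\<^esub> x) y \<ominus>\<^bsub>F\<^esub> c \<odot>\<^bsub>F\<^esub> g d x y"
        "d \<in> D" "c \<in> carrier R" "x \<in> carrier (X d)" "y \<in> carrier (ob Y d)"
      have "H (c \<odot>\<^bsub>F\<^esub> g d x y) = H (g d (c \<odot>\<^bsub>X d\<^esub> x) y)"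
        using * lin_mapsD(3)[OF left, of d y x c] by (simp add: lin_mapsD(3)[OF H g_in] Hg X_smult)
      then show "H z = \<zero>\<^bsub>P\<^esub>" unfolding *(1)
        by (intro diff) (use * in \<open>auto intro!: g_in X_smult sm_smult[OF Fs]\<close>)
    next
      fix d c x y assume *: "z = g d x (c \<odot>\<^bsub>ob Y d\<^esub> y) \<ominus>\<^bsub>F\<^esub> c \<odot>\<^bsub>F\<^esub> g d x y"
        "d \<in> D" "c \<in> carrier R" "x \<in> carrier (X d)" "y \<in> carrier (ob Y d)"
      have "H (c \<odot>\<^bsub>F\<^esub> g d x y) = H (g d x (c \<odot>\<^bsub>ob Y d\<^esub> y))"
        using * lin_mapsD(3)[OF right, of d x y c] by (simp add: lin_mapsD(3)[OF H g_in] Hg Y_smult)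
      then show "H z = \<zero>\<^bsub>P\<^esub>" unfolding *(1)
        by (intro diff) (use * in \<open>auto intro!: g_in Y_smult sm_smult[OF Fs]\<close>)
    next
      fix d e f x y assume *: "z = g d (xa d e f x) y \<ominus>\<^bsub>F\<^esub> g e x (act Y d e f y)"
        "d \<in> D" "e \<in> D" "f \<in> Cmor d e" "x \<in> carrier (X e)" "y \<in> carrier (ob Y d)"
      have "H (g d (xa d e f x) y) = H (g e x (act Y d e f y))"
        using * bal[OF *(2-6)] by (simp add: Hg xa_in Ya_in)
      then show "H z = \<zero>\<^bsub>P\<^esub>" unfolding *(1)
        by (intro diff) (use * in \<open>auto intro!: g_in xa_in Ya_in\<close>)
    qed
    then show "z \<in> {z \<in> carrier F. H z = \<zero>\<^bsub>P\<^esub>}" using z rel_gens_in by auto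
  qed
  then have N: "N \<subseteq> {z \<in> carrier F. H z = \<zero>\<^bsub>P\<^esub>}"
    unfolding N_eq by (rule span_least[OF sm_kernel[OF H F_module P]])
  obtain h where h: "h \<in> lin_maps R Q P" "\<And>z. z \<in> carrier F \<Longrightarrow> h (cst F N z) = H z"
    by (rule quot_lift[OF H F_module N_sm P]) (use N in \<open>auto simp: tens_def\<close>)
  show thesis
    by (rule that[OF h(1)]) (simp add: pure_def h(2) g_in Hg)
qed

end

context coeff_ring
begin

section \<open>The generating degree\<close>

lemma free_ext_gen_on:
  assumes "module R M" "\<And>s. s \<in> S \<Longrightarrow> \<phi> s \<in> carrier M" "s \<in> S"
  shows "free_ext M \<phi> (free_gen R s) = \<phi> s"
  by (rule free_ext_gen[where \<phi> = \<phi>, OF assms(1) assms(2)[OF assms(3)]])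

lemma free_ext_in:
  assumes "module R M" "\<And>s. s \<in> S \<Longrightarrow> \<phi> s \<in> carrier M" "x \<in> carrier (free_mod R S)"
  shows "free_ext M \<phi> x \<in> carrier M"
  using lin_mapsD(1)[OF free_ext_lin[where \<phi> = \<phi>, OF assms(1,2)] assms(3)] .

text \<open>Linearity in the parameter \<open>y\<close> is an identity between maps that are linear
  in \<open>x\<close>, so it can be checked on free generators.\<close>

lemma free_ext_fun_lin:
  assumes N: "module R N" and M: "module R M" and x: "x \<in> carrier (free_mod R S)"
    and \<phi>: "\<And>s. s \<in> S \<Longrightarrow> \<phi> s \<in> lin_maps R N M"
  shows "(\<lambda>y. free_ext M (\<lambda>s. \<phi> s y) x) \<in> lin_maps R N M"
proof -
  interpret M: module R M by fact
  interpret N: module R N by fact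
  have c: "\<phi> s y \<in> carrier M" if "y \<in> carrier N" "s \<in> S" for y s
    using lin_mapsD(1)[OF \<phi>[OF that(2)] that(1)] .
  note L = free_ext_lin[OF M, where S = S]
  show ?thesis
  proof (rule lin_mapsI)
    fix y assume y: "y \<in> carrier N"
    show "free_ext M (\<lambda>s. \<phi> s y) x \<in> carrier M" by (rule free_ext_in[OF M c[OF y] x])
  next
    fix y z assume y: "y \<in> carrier N" and z: "z \<in> carrier N"
    have yz: "y \<oplus>\<^bsub>N\<^esub> z \<in> carrier N" using y z by simp
    show "free_ext M (\<lambda>s. \<phi> s (y \<oplus>\<^bsub>N\<^esub> z)) x = free_ext M (\<lambda>s. \<phi> s y) x \<oplus>\<^bsub>M\<^esub> free_ext M (\<lambda>s. \<phi> s z) x"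
    proof (rule free_lin_eq[OF L[OF c[OF yz]] lin_add_maps[OF L[OF c[OF y]] L[OF c[OF z]] free_module M] M _ x])
      fix s assume s: "s \<in> S"
      show "free_ext M (\<lambda>s. \<phi> s (y \<oplus>\<^bsub>N\<^esub> z)) (free_gen R s) =
          free_ext M (\<lambda>s. \<phi> s y) (free_gen R s) \<oplus>\<^bsub>M\<^esub> free_ext M (\<lambda>s. \<phi> s z) (free_gen R s)"
        by (simp only: free_ext_gen_on[OF M c[OF yz] s] free_ext_gen_on[OF M c[OF y] s]
            free_ext_gen_on[OF M c[OF z] s] lin_mapsD(2)[OF \<phi>[OF s] y z])
    qed
  next
    fix k y assume k: "k \<in> carrier R" and y: "y \<in> carrier N"
    have ky: "k \<odot>\<^bsub>N\<^esub> y \<in> carrier N" using k y by simp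
    show "free_ext M (\<lambda>s. \<phi> s (k \<odot>\<^bsub>N\<^esub> y)) x = k \<odot>\<^bsub>M\<^esub> free_ext M (\<lambda>s. \<phi> s y) x"
    proof (rule free_lin_eq[OF L[OF c[OF ky]] lin_smult_map[OF L[OF c[OF y]] free_module M k] M _ x])
      fix s assume s: "s \<in> S"
      show "free_ext M (\<lambda>s. \<phi> s (k \<odot>\<^bsub>N\<^esub> y)) (free_gen R s) = k \<odot>\<^bsub>M\<^esub> free_ext M (\<lambda>s. \<phi> s y) (free_gen R s)"
        by (simp only: free_ext_gen_on[OF M c[OF ky] s] free_ext_gen_on[OF M c[OF y] s]
            lin_mapsD(3)[OF \<phi>[OF s] y k])
    qed
  qed
qed

lemma precomp_lin: "f \<in> Cmor d e \<Longrightarrow> precomp R d e f \<in> lin_maps R (free_mod R (Cmor e n)) (free_mod R (Cmor d n))"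
  unfolding precomp_def by (rule free_map_lin) (rule Ccomp_in)

lemma precomp_gen: "precomp R d e f (free_gen R g) = free_gen R (Ccomp d g f)"
  unfolding precomp_def by (rule free_map_gen)

text \<open>The action of the category algebra on \<open>V\<close>, for a linear combination
  \<open>x\<close> of morphisms from \<open>d\<close> to \<open>n\<close>.\<close>

definition eval_at :: "('m, 'k, 'v) cmod \<Rightarrow> 'm obj \<Rightarrow> 'm obj \<Rightarrow> ('m mor \<Rightarrow> 'k) \<Rightarrow> 'v \<Rightarrow> 'v" where
  "eval_at V d n x y = free_ext (ob V n) (\<lambda>f. act V d n f y) x"

lemma eval_at_simps:
  assumes V: "cmodule R V"
  shows "y \<in> carrier (ob V d) \<Longrightarrow> (\<lambda>x. eval_at V d n x y) \<in> lin_maps R (free_mod R (Cmor d n)) (ob V n)"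
    and "x \<in> carrier (free_mod R (Cmor d n)) \<Longrightarrow> eval_at V d n x \<in> lin_maps R (ob V d) (ob V n)"
    and "y \<in> carrier (ob V d) \<Longrightarrow> f \<in> Cmor d n \<Longrightarrow> eval_at V d n (free_gen R f) y = act V d n f y"
proof -
  have c: "act V d n f y \<in> carrier (ob V n)" if "y \<in> carrier (ob V d)" "f \<in> Cmor d n" for f y
    by (rule act_in[OF V that(2,1)])
  show 1: "(\<lambda>x. eval_at V d n x y) \<in> lin_maps R (free_mod R (Cmor d n)) (ob V n)"
    if y: "y \<in> carrier (ob V d)" for y
    unfolding eval_at_def by (rule free_ext_lin[where \<phi> = "\<lambda>f. act V d n f y", OF cmD(1)[OF V] c[OF y]])
  show "eval_at V d n x \<in> lin_maps R (ob V d) (ob V n)" if x: "x \<in> carrier (free_mod R (Cmor d n))" for x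
    using free_ext_fun_lin[OF cmD(1)[OF V] cmD(1)[OF V] x cmD(2)[OF V]] by (simp add: eval_at_def[abs_def])
  show "eval_at V d n (free_gen R f) y = act V d n f y" if y: "y \<in> carrier (ob V d)" and f: "f \<in> Cmor d n" for f y
    unfolding eval_at_def by (rule free_ext_gen_on[where \<phi> = "\<lambda>f. act V d n f y", OF cmD(1)[OF V] c[OF y] f])
qed

lemma eval_at_precomp:
  assumes V: "cmodule R V" and f: "f \<in> Cmor d e" and x: "x \<in> carrier (free_mod R (Cmor e n))"
    and y: "y \<in> carrier (ob V d)"
  shows "eval_at V d n (precomp R d e f x) y = eval_at V e n x (act V d e f y)"
proof (rule free_lin_eq[OF _ _ cmD(1)[OF V] _ x])
  have fy: "act V d e f y \<in> carrier (ob V e)" by (rule act_in[OF V f y])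
  show "(\<lambda>x. eval_at V d n (precomp R d e f x) y) \<in> lin_maps R (free_mod R (Cmor e n)) (ob V n)"
    by (rule lin_comp[OF precomp_lin[OF f] eval_at_simps(1)[OF V y]])
  show "(\<lambda>x. eval_at V e n x (act V d e f y)) \<in> lin_maps R (free_mod R (Cmor e n)) (ob V n)"
    by (rule eval_at_simps(1)[OF V fy])
  fix g assume g: "g \<in> Cmor e n"
  show "eval_at V d n (precomp R d e f (free_gen R g)) y = eval_at V e n (free_gen R g) (act V d e f y)"
    by (simp add: precomp_gen eval_at_simps(3)[OF V y Ccomp_in[OF f g]] eval_at_simps(3)[OF V fy g]
        cmD(4)[OF V f g y])
qed

text \<open>The decomposable elements, that is, the value at \<open>n\<close> of the ideal times
  \<open>V\<close>: proper sets of points are the images of morphisms from smaller objects.\<close>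

definition dec :: "('m, 'k, 'v) cmod \<Rightarrow> 'm obj \<Rightarrow> 'v set" where
  "dec V n = psum V n {S. S \<subset> pts n}"

lemma mideal_gens: "{free_gen R f | f. f \<in> Cmor i n \<and> i < n} \<subseteq> carrier (free_mod R (Cmor i n))"
  by (auto intro: free_gen_in)

lemma mideal_sm: "submodule (mideal R i n) R (free_mod R (Cmor i n))"
  unfolding mideal_def by (rule span_sm[OF free_module mideal_gens])

lemma mideal_gen: "f \<in> Cmor i n \<Longrightarrow> i \<noteq> n \<Longrightarrow> free_gen R f \<in> mideal R i n"
  unfolding mideal_def using Cmor_le[of f i n] by (intro subsetD[OF span_incl]) (auto simp: less_le)

lemma precomp_mideal:
  assumes f: "f \<in> Cmor d e"
  shows "precomp R d e f ` mideal R e n \<subseteq> mideal R d n"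
  unfolding mideal_def[of R e n]
proof (rule span_lin_subset[OF precomp_lin[OF f] free_module free_module mideal_gens mideal_sm])
  show "precomp R d e f ` {free_gen R f | f. f \<in> Cmor e n \<and> e < n} \<subseteq> mideal R d n"
  proof
    fix z assume "z \<in> precomp R d e f ` {free_gen R f | f. f \<in> Cmor e n \<and> e < n}"
    then obtain g where g: "g \<in> Cmor e n" "e < n" "z = free_gen R (Ccomp d g f)"
      by (auto simp: precomp_gen)
    have "d < n" using Cmor_le[OF f] g(2) by (rule order_le_less_trans)
    then show "z \<in> mideal R d n" using g Ccomp_in[OF f g(1)] by (auto intro: mideal_gen)
  qed
qed

lemma H0_tens_data:
  assumes V: "cmodule R V"
  shows "tens_data R UNIV (\<lambda>i. quot_mod (free_mod R (Cmor i n)) (mideal R i n))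
     (\<lambda>d e f. quot_map (free_mod R (Cmor d n)) (mideal R d n) (precomp R d e f)) V"
proof (rule tens_data.intro[OF coeff_ring_axioms tens_data_axioms.intro])
  show "module R (quot_mod (free_mod R (Cmor d n)) (mideal R d n))" for d
    by (rule quot_module[OF free_module mideal_sm])
  show "module R (ob V d)" for d by (rule cmD(1)[OF V])
  show "act V d e f y \<in> carrier (ob V e)" if "f \<in> Cmor d e" "y \<in> carrier (ob V d)" for d e f y
    by (rule act_in[OF V that])
  fix d e f Z assume f: "f \<in> Cmor d e" and Z: "Z \<in> carrier (quot_mod (free_mod R (Cmor e n)) (mideal R e n))"
  then obtain x where "x \<in> carrier (free_mod R (Cmor e n))" "Z = cst (free_mod R (Cmor e n)) (mideal R e n) x"
    by (auto simp: quot_mod_simps[OF free_module mideal_sm])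
  then show "quot_map (free_mod R (Cmor d n)) (mideal R d n) (precomp R d e f) Z
      \<in> carrier (quot_mod (free_mod R (Cmor d n)) (mideal R d n))"
    using quot_map_cst[OF precomp_lin[OF f] free_module mideal_sm free_module mideal_sm precomp_mideal[OF f]]
      lin_mapsD(1)[OF precomp_lin[OF f]]
    by (auto simp: quot_mod_simps[OF free_module mideal_sm])
qed

text \<open>\<open>H0 R V n\<close> is \<open>V_n\<close> modulo \<open>dec V n\<close>. If every
  element is decomposable, a pure tensor vanishes because a morphism can be moved across it until
  the left factor lies in the ideal. Conversely, evaluation modulo \<open>dec V n\<close> is
  balanced and factors through the tensor product; it takes the tensor of the identity with
  \<open>v\<close> to the class of \<open>v\<close>.\<close>

lemma H0_zero_iff:
  fixes V :: "('m :: finite, 'k, 'v) cmod"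
  assumes V: "cmodule R V"
  shows "is_zero_mod (H0 R V n) \<longleftrightarrow> carrier (ob V n) \<subseteq> dec V n"
proof -
  let ?A = "\<lambda>i. free_mod R (Cmor i n)"
  let ?I = "\<lambda>i. mideal R i n"
  let ?X = "\<lambda>i. quot_mod (?A i) (?I i)"
  let ?xa = "\<lambda>d e f. quot_map (?A d) (?I d) (precomp R d e f)"
  interpret T: tens_data R UNIV ?X ?xa V by (rule H0_tens_data[OF V])
  have H0: "H0 R V n = T.Q" by (simp add: H0_def)
  have decs: "submodule (dec V n) R (ob V n)" unfolding dec_def by (rule psum_sm[OF V])
  have Xc: "carrier (?X i) = cst (?A i) (?I i) ` carrier (?A i)" for i
    by (rule quot_mod_simps(1)[OF free_module mideal_sm])
  have xa: "?xa d e f (cst (?A e) (?I e) x) = cst (?A d) (?I d) (precomp R d e f x)"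
    if f: "f \<in> Cmor d e" and x: "x \<in> carrier (?A e)" for d e f x
    by (rule quot_map_cst[OF precomp_lin[OF f] free_module mideal_sm free_module mideal_sm precomp_mideal[OF f] x])
  note cl = cst_lin[OF free_module mideal_sm]
  have Vn: "module R (ob V n)" by (rule cmD(1)[OF V])
  have X: "module R (?X i)" for i by (rule T.X) simp
  show ?thesis
  proof
    assume *: "carrier (ob V n) \<subseteq> dec V n"
    have small: "T.pure i (cst (?A i) (?I i) (free_gen R f)) y = \<zero>\<^bsub>T.Q\<^esub>"
      if f: "f \<in> Cmor i n" and y: "y \<in> carrier (ob V i)" and "i \<noteq> n" for i f y
    proof -
      have "cst (?A i) (?I i) (free_gen R f) = \<zero>\<^bsub>?X i\<^esub>"
        using cst_eq_zero_iff[OF free_module mideal_sm free_gen_in[OF f]] mideal_gen[OF f \<open>i \<noteq> n\<close>]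
        by (simp add: quot_mod_simps(2)[OF free_module mideal_sm])
      then show ?thesis using lin_zero[OF T.pure_lin_left X T.Q_module, of i y] y by simp
    qed
    have gen: "T.pure i (cst (?A i) (?I i) (free_gen R f)) y = \<zero>\<^bsub>T.Q\<^esub>"
      if f: "f \<in> Cmor i n" and y: "y \<in> carrier (ob V i)" for i f y
    proof (cases "i = n")
      case True
      note f' = f[unfolded True]
      let ?Z = "cst (?A n) (?I n) (free_gen R f)"
      have Z: "?Z \<in> carrier (?X n)" using free_gen_in[OF f'] by (auto simp: Xc)
      let ?H = "{y \<in> carrier (ob V n). T.pure n ?Z y = \<zero>\<^bsub>T.Q\<^esub>}"
      have H: "submodule ?H R (ob V n)"
        by (rule sm_kernel[OF T.pure_lin_right[OF UNIV_I Z] Vn T.Q_module])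
      have "dec V n \<subseteq> ?H"
        unfolding dec_def
      proof (rule psum_least[OF H])
        fix S assume S: "S \<in> {S. S \<subset> pts n}"
        show "part V n S \<subseteq> ?H"
        proof
          fix v assume v: "v \<in> part V n S"
          then obtain k g u where g: "g \<in> Cmor k n" "u \<in> carrier (ob V k)" "pmap g ` pts k \<subseteq> S" "v = act V k n g u"
            by (rule partE)
          have "k \<noteq> n" using g(3) S Cmor_self_image[of g k] g(1) by auto
          have "T.pure n ?Z v = T.pure k (?xa k n g ?Z) u"
            using T.pure_balance[OF UNIV_I UNIV_I g(1) Z g(2)] by (simp add: g(4))
          also have "\<dots> = \<zero>\<^bsub>T.Q\<^esub>"
            using small[OF Ccomp_in[OF g(1) f'] g(2) \<open>k \<noteq> n\<close>]
            by (simp add: xa[OF g(1) free_gen_in[OF f']] precomp_gen)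
          finally show "v \<in> ?H" using part_carrier[OF V] v by blast
        qed
      qed
      then show ?thesis using * y True by blast
    qed (use small f y in blast)
    have "T.pures \<subseteq> {\<zero>\<^bsub>T.Q\<^esub>}"
    proof
      fix q assume "q \<in> T.pures"
      then obtain i Z y where *: "Z \<in> carrier (?X i)" "y \<in> carrier (ob V i)" "q = T.pure i Z y"
        by (auto simp: T.pures_def)
      then obtain x where x: "x \<in> carrier (?A i)" "Z = cst (?A i) (?I i) x" by (auto simp: Xc)
      have "T.pure i (cst (?A i) (?I i) x) y = \<zero>\<^bsub>T.Q\<^esub>"
      proof (rule free_lin_eq[OF _ lin_const_zero[OF free_module T.Q_module] T.Q_module _ x(1)])
        show "(\<lambda>x. T.pure i (cst (?A i) (?I i) x) y) \<in> lin_maps R (?A i) T.Q"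
          by (rule lin_comp[OF cl T.pure_lin_left]) (use *(2) in auto)
      qed (rule gen[OF _ *(2)])
      then show "q \<in> {\<zero>\<^bsub>T.Q\<^esub>}" using *(3) x(2) by simp
    qed
    then have "carrier T.Q \<subseteq> {\<zero>\<^bsub>T.Q\<^esub>}"
      unfolding T.pure_span by (rule span_least[OF sm_zero_sub[OF T.Q_module]])
    moreover have "\<zero>\<^bsub>T.Q\<^esub> \<in> carrier T.Q" by (rule sm_zero[OF sm_carrier[OF T.Q_module]])
    ultimately show "is_zero_mod (H0 R V n)" by (auto simp: is_zero_mod_def H0)
  next
    assume z: "is_zero_mod (H0 R V n)"
    let ?P = "quot_mod (ob V n) (dec V n)"
    let ?c = "cst (ob V n) (dec V n)"
    have P: "module R ?P" by (rule quot_module[OF Vn decs])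
    note cP = cst_lin[OF Vn decs]
    have zP: "\<zero>\<^bsub>?P\<^esub> = dec V n" by (rule quot_mod_simps(2)[OF Vn decs])
    have ex: "\<exists>g. g \<in> lin_maps R (?X i) ?P \<and> (\<forall>x\<in>carrier (?A i). g (cst (?A i) (?I i) x) = ?c (eval_at V i n x y))"
      if y: "y \<in> carrier (ob V i)" for i y
    proof -
      have L: "(\<lambda>x. ?c (eval_at V i n x y)) \<in> lin_maps R (?A i) ?P"
        by (rule lin_comp[OF eval_at_simps(1)[OF V y] cP])
      have "mideal R i n \<subseteq> {x \<in> carrier (?A i). ?c (eval_at V i n x y) = \<zero>\<^bsub>?P\<^esub>}"
        unfolding mideal_def
      proof (rule span_least[OF sm_kernel[OF L free_module P]], rule subsetI)
        fix z assume "z \<in> {free_gen R f | f. f \<in> Cmor i n \<and> i < n}"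
        then obtain f where f: "f \<in> Cmor i n" and i: "i < n" and z: "z = free_gen R f" by blast
        have "pmap f ` pts i \<noteq> pts n" using csize_mimg[OF f] i by (metis csize_pts less_irrefl)
        then have "pmap f ` pts i \<subset> pts n" using pmap_image_subset[OF f subset_refl] by auto
        then have "act V i n f y \<in> dec V n"
          unfolding dec_def using partI[where V = V, OF f y subset_refl]
          by (intro subsetD[OF part_le_psum[of "pmap f ` pts i"]]) auto
        then have "?c (eval_at V i n (free_gen R f) y) = \<zero>\<^bsub>?P\<^esub>"
          using cst_eq_zero_iff[OF Vn decs act_in[OF V f y]] by (simp add: eval_at_simps(3)[OF V y f] zP)
        then show "z \<in> {x \<in> carrier (?A i). ?c (eval_at V i n x y) = \<zero>\<^bsub>?P\<^esub>}"
          using free_gen_in[OF f] z by simp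
      qed
      then have k: "?c (eval_at V i n x y) = \<zero>\<^bsub>?P\<^esub>" if "x \<in> mideal R i n" for x using that by blast
      obtain g where "g \<in> lin_maps R (?X i) ?P" "\<And>x. x \<in> carrier (?A i) \<Longrightarrow> g (cst (?A i) (?I i) x) = ?c (eval_at V i n x y)"
        by (rule quot_lift[OF L free_module mideal_sm P k]) simp_all
      then show ?thesis by blast
    qed
    \<comment> \<open>For each fixed \<open>y\<close> a map on cosets is chosen from those given by
      \<open>quot_lift\<close>. On representatives it is evaluation, from which linearity in
      \<open>y\<close> and balance follow.\<close>
    define \<phi> where "\<phi> i Z y = (SOME g. g \<in> lin_maps R (?X i) ?P \<and>
      (\<forall>x\<in>carrier (?A i). g (cst (?A i) (?I i) x) = ?c (eval_at V i n x y))) Z" for i Z y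
    have \<phi>L: "(\<lambda>Z. \<phi> i Z y) \<in> lin_maps R (?X i) ?P" if "y \<in> carrier (ob V i)" for i y
      using someI_ex[OF ex[OF that]] by (simp add: \<phi>_def)
    have \<phi>c: "\<phi> i (cst (?A i) (?I i) x) y = ?c (eval_at V i n x y)"
      if "y \<in> carrier (ob V i)" "x \<in> carrier (?A i)" for i y x
      using someI_ex[OF ex[OF that(1)]] that(2) by (simp add: \<phi>_def)
    obtain h where h: "h \<in> lin_maps R T.Q ?P"
      "\<And>i Z y. i \<in> UNIV \<Longrightarrow> Z \<in> carrier (?X i) \<Longrightarrow> y \<in> carrier (ob V i) \<Longrightarrow> h (T.pure i Z y) = \<phi> i Z y"
    proof (rule T.tens_lift[OF P, of \<phi>])
      show "\<phi> d x y \<in> carrier ?P" if "x \<in> carrier (?X d)" "y \<in> carrier (ob V d)" for d x y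
        using lin_mapsD(1)[OF \<phi>L[OF that(2)] that(1)] .
      show "(\<lambda>x. \<phi> d x y) \<in> lin_maps R (?X d) ?P" if "y \<in> carrier (ob V d)" for d y by (rule \<phi>L[OF that])
      show "\<phi> d Z \<in> lin_maps R (ob V d) ?P" if Z: "Z \<in> carrier (?X d)" for d Z
      proof -
        obtain x where x: "x \<in> carrier (?A d)" "Z = cst (?A d) (?I d) x" using Z by (auto simp: Xc)
        show ?thesis
          by (rule lin_cong[OF lin_comp[OF eval_at_simps(2)[OF V x(1)] cP] cmD(1)[OF V]])
            (simp add: x(2) \<phi>c[OF _ x(1)])
      qed
      show "\<phi> d (?xa d e f Z) y = \<phi> e Z (act V d e f y)"
        if f: "f \<in> Cmor d e" and Z: "Z \<in> carrier (?X e)" and y: "y \<in> carrier (ob V d)" for d e f Z y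
      proof -
        obtain x where x: "x \<in> carrier (?A e)" "Z = cst (?A e) (?I e) x" using Z by (auto simp: Xc)
        show ?thesis
          by (simp add: x(2) xa[OF f x(1)] \<phi>c[OF y lin_mapsD(1)[OF precomp_lin[OF f] x(1)]]
              \<phi>c[OF act_in[OF V f y] x(1)] eval_at_precomp[OF V f x(1) y])
      qed
    qed blast
    show "carrier (ob V n) \<subseteq> dec V n"
    proof
      fix v assume v: "v \<in> carrier (ob V n)"
      let ?Z = "cst (?A n) (?I n) (free_gen R (Cid n))"
      have Z: "?Z \<in> carrier (?X n)" using free_gen_in[OF Cid_in] by (auto simp: Xc)
      have "T.pure n ?Z v = \<zero>\<^bsub>T.Q\<^esub>"
        using T.pure_in[OF UNIV_I Z v] z by (auto simp: is_zero_mod_def H0)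
      then have "\<phi> n ?Z v = \<zero>\<^bsub>?P\<^esub>"
        using h(2)[OF UNIV_I Z v] lin_zero[OF h(1) T.Q_module P] by simp
      then have "?c v = dec V n"
        by (simp add: \<phi>c[OF v free_gen_in[OF Cid_in]] eval_at_simps(3)[OF V v Cid_in] cmD(3)[OF V v] zP)
      then show "v \<in> dec V n" using cst_eq_zero_iff[OF Vn decs v] by simp
    qed
  qed
qed

text \<open>For the converse, strong induction on \<open>deg t\<close>: from degree \<open>e\<close>
  on, all elements come from proper sets of points, that is from objects of smaller degree, where
  the induction hypothesis applies.\<close>

lemma gen_lt_iff:
  fixes V :: "('m :: finite, 'k, 'v) cmod"
  assumes V: "cmodule R V"
  shows "gen_lt V e \<longleftrightarrow> (\<forall>n. e \<le> deg n \<longrightarrow> carrier (ob V n) \<subseteq> dec V n)"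
proof
  assume g: "gen_lt V e"
  show "\<forall>n. e \<le> deg n \<longrightarrow> carrier (ob V n) \<subseteq> dec V n"
  proof (intro allI impI)
    fix n :: "'m obj" assume e: "e \<le> deg n"
    have "psum V n {S. S \<subseteq> pts n \<and> card S < e} \<subseteq> dec V n"
      unfolding dec_def by (rule psum_mono) (use e card_pts[of n] in auto)
    then show "carrier (ob V n) \<subseteq> dec V n" using g unfolding gen_lt_def by blast
  qed
next
  assume *: "\<forall>n. e \<le> deg n \<longrightarrow> carrier (ob V n) \<subseteq> dec V n"
  have "carrier (ob V t) \<subseteq> psum V t {S. S \<subseteq> pts t \<and> card S < e}" for t
  proof (induction "deg t" arbitrary: t rule: less_induct)
    case less
    show ?case
    proof (cases "deg t < e")
      case True
      then have "part V t (pts t) \<subseteq> psum V t {S. S \<subseteq> pts t \<and> card S < e}"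
        by (intro part_le_psum) (simp add: card_pts)
      then show ?thesis by (simp add: part_pts[OF V])
    next
      case False
      then have "carrier (ob V t) \<subseteq> dec V t" using * by simp
      also have "\<dots> \<subseteq> psum V t {S. S \<subseteq> pts t \<and> card S < e}"
        unfolding dec_def
      proof (rule psum_least[OF psum_sm[OF V]])
        fix S assume S: "S \<in> {S. S \<subset> pts t}"
        obtain h where h: "h \<in> Cmor (csize S) t" "pmap h ` pts (csize S) = S"
          using emb_exists[of S t] S by blast
        have "deg (csize S) < deg t"
          using psubset_card_mono[of "pts t" S] S card_csize[of S] finite_subset[of S "pts t"] by (auto simp: card_pts)
        note IH = less.hyps[OF this]
        let ?F = "{U. U \<subseteq> pts (csize S) \<and> card U < e}"
        have "part V t S = act V (csize S) t h ` carrier (ob V (csize S))"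
          using part_emb[OF V h(1)] h(2) by simp
        also have "\<dots> \<subseteq> act V (csize S) t h ` psum V (csize S) ?F" by (rule image_mono[OF IH])
        also have "\<dots> = psum V t ((`) (pmap h) ` ?F)" by (rule psum_act[OF V h(1)]) auto
        also have "\<dots> \<subseteq> psum V t {S. S \<subseteq> pts t \<and> card S < e}"
        proof (rule psum_mono)
          show "(`) (pmap h) ` ?F \<subseteq> {S. S \<subseteq> pts t \<and> card S < e}"
          proof
            fix U' assume "U' \<in> (`) (pmap h) ` ?F"
            then obtain U where U: "U \<subseteq> pts (csize S)" "card U < e" "U' = pmap h ` U" by auto
            then show "U' \<in> {S. S \<subseteq> pts t \<and> card S < e}"
              using card_image[OF inj_on_subset[OF CmorD(2)[OF h(1)] U(1)]] pmap_image_subset[OF h(1) U(1)] by simp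
          qed
        qed
        finally show "part V t S \<subseteq> psum V t {S. S \<subseteq> pts t \<and> card S < e}" .
      qed
      finally show ?thesis .
    qed
  qed
  then show "gen_lt V e" by (simp add: gen_lt_def)
qed

lemma gen_lt_H0:
  fixes V :: "('m :: finite, 'k, 'v) cmod"
  assumes V: "cmodule R V"
  shows "gen_lt V e \<longleftrightarrow> (\<forall>s\<in>{deg n | n. \<not> is_zero_mod (H0 R V n)}. s < e)"
  using gen_lt_iff[OF V, of e] H0_zero_iff[OF V] by (auto simp: not_le[symmetric])

lemma gd_le:
  fixes V :: "('m :: finite, 'k, 'v) cmod"
  assumes V: "cmodule R V" and g: "gen_lt V e"
  shows "gd R V \<le> ereal (real e - 1)"
proof -
  let ?S = "{deg n | n. \<not> is_zero_mod (H0 R V n)}"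
  have S: "s < e" if "s \<in> ?S" for s using g that unfolding gen_lt_H0[OF V] by blast
  have "(SUP s\<in>?S. ereal (real s)) \<le> ereal (real e - 1)"
    by (rule SUP_least) (use S in \<open>fastforce simp: ereal_less_eq(3)\<close>)
  moreover have "(-1 :: ereal) \<le> ereal (real e - 1)"
    using ereal_less_eq(3)[of "-1" "real e - 1"] by (simp add: one_ereal_def)
  ultimately show ?thesis by (simp add: gd_def sup_nat_set_def)
qed

text \<open>The bound is the successor of the largest degree at which \<open>H0\<close> is nonzero,
  or 0 if there is none, which matches the convention -1 for \<open>gd\<close>. Finite generation
  makes the set of degrees finite, so the supremum is a maximum.\<close>

lemma gd_eq:
  fixes V :: "('m :: finite, 'k, 'v) cmod"
  assumes V: "cmodule R V" and fg: "fgen V"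
  obtains e where "gen_lt V e" "gd R V = ereal (real e - 1)"
proof -
  let ?S = "{deg n | n. \<not> is_zero_mod (H0 R V n)}"
  obtain e0 where e0: "gen_lt V e0" using fgen_bound[OF V fg] .
  have fin: "finite ?S"
    by (rule finite_subset[of _ "{..<e0}"]) (use e0 in \<open>auto simp: gen_lt_H0[OF V]\<close>)
  show thesis
  proof (cases "?S = {}")
    case True
    have "gen_lt V 0" unfolding gen_lt_H0[OF V] True by simp
    moreover have "gd R V = ereal (real 0 - 1)"
      unfolding gd_def sup_nat_set_def True by (simp add: one_ereal_def)
    ultimately show thesis by (rule that)
  next
    case False
    have "gen_lt V (Suc (Max ?S))" unfolding gen_lt_H0[OF V] using Max_ge[OF fin] by (auto simp: less_Suc_eq_le)
    moreover have "(SUP s\<in>?S. ereal (real s)) = ereal (real (Max ?S))"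
    proof (rule antisym)
      show "(SUP s\<in>?S. ereal (real s)) \<le> ereal (real (Max ?S))"
        by (rule SUP_least) (use Max_ge[OF fin] in simp)
      show "ereal (real (Max ?S)) \<le> (SUP s\<in>?S. ereal (real s))"
        by (rule SUP_upper[OF Max_in[OF fin False]])
    qed
    then have "gd R V = ereal (real (Suc (Max ?S)) - 1)"
      unfolding gd_def sup_nat_set_def if_not_P[OF False] by simp
    ultimately show thesis by (rule that)
  qed
qed

section \<open>Distributivity for acyclic modules\<close>

lemma add_eq_swap:
  assumes M: "module R M" and c: "c \<in> carrier M" "l \<in> carrier M" "r \<in> carrier M" "a \<in> carrier M"
    and eq: "c \<oplus>\<^bsub>M\<^esub> l = r \<oplus>\<^bsub>M\<^esub> a"
  shows "c \<ominus>\<^bsub>M\<^esub> a = r \<ominus>\<^bsub>M\<^esub> l" and "c = (c \<ominus>\<^bsub>M\<^esub> a) \<oplus>\<^bsub>M\<^esub> a"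
proof -
  interpret M: module R M by fact
  have s: "(p \<ominus>\<^bsub>M\<^esub> q) \<oplus>\<^bsub>M\<^esub> (q \<oplus>\<^bsub>M\<^esub> s) = p \<oplus>\<^bsub>M\<^esub> s"
    if "p \<in> carrier M" "q \<in> carrier M" "s \<in> carrier M" for p q s
    using that by (simp add: a_minus_def M.a_assoc M.r_neg1)
  have "(c \<ominus>\<^bsub>M\<^esub> a) \<oplus>\<^bsub>M\<^esub> (a \<oplus>\<^bsub>M\<^esub> l) = (r \<ominus>\<^bsub>M\<^esub> l) \<oplus>\<^bsub>M\<^esub> (a \<oplus>\<^bsub>M\<^esub> l)"
    using s[OF c(1,4,2)] s[OF c(3,2,4)] eq M.a_comm[OF c(4,2)] by simp
  then show "c \<ominus>\<^bsub>M\<^esub> a = r \<ominus>\<^bsub>M\<^esub> l" using c by simp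
  show "c = (c \<ominus>\<^bsub>M\<^esub> a) \<oplus>\<^bsub>M\<^esub> a" using c by (simp add: a_minus_def M.a_assoc M.l_neg)
qed

text \<open>Acyclicity itself handles the complements of the points of \<open>A\<close>. The further
  sets in \<open>UU\<close> are treated by induction on the number of points of \<open>W\<close>
  outside \<open>A\<close> and, for a fixed value of it, on the number of sets in \<open>UU\<close>.
  A point that some set misses is either added to \<open>A\<close> or removed from \<open>W\<close>,
  and both lower the first number.\<close>

lemma acyc_dist_step:
  fixes V :: "('m :: finite, 'k, 'v) cmod"
  assumes V: "cmodule R V" and ac: "acyc V"
  shows "card (W - A) = a \<Longrightarrow> W \<subseteq> pts t \<Longrightarrow> A \<subseteq> W \<Longrightarrow> y \<in> W - A \<Longrightarrow> (\<forall>U\<in>UU. A \<subseteq> U \<and> U \<subseteq> W) \<Longrightarrow>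
    v \<in> part V t (W - {y}) \<Longrightarrow> v \<in> psum V t ((\<lambda>x. W - {x}) ` A \<union> UU) \<Longrightarrow>
    v \<in> psum V t ((\<lambda>x. W - {x, y}) ` A \<union> (\<lambda>U. U - {y}) ` UU)"
proof (induction a arbitrary: W A y UU v rule: less_induct)
  case (less a)
  note outer = less.IH
  from less.prems show ?case
  proof (induction "card UU" arbitrary: UU v y rule: less_induct)
    case less
    note inner = less.hyps
    note W = less.prems(2) and A = less.prems(3) and y = less.prems(4) and UU = less.prems(5) and vy = less.prems(6)
      and v = less.prems(7)
    let ?FA = "(\<lambda>x. W - {x}) ` A" and ?FAy = "(\<lambda>x. W - {x, y}) ` A" and ?Uy = "(\<lambda>U. U - {y}) ` UU"
    have Vt: "module R (ob V t)" by (rule cmD(1)[OF V])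
    have finW: "finite W" using finite_subset[OF W] by simp
    have finU: "finite UU" by (rule finite_subset[of _ "Pow W"]) (use UU finW in auto)
    note ps = psum_sm[OF V]
    consider "UU = {}" | "W \<in> UU" | U where "U \<in> UU" "y \<notin> U"
      | U0 where "U0 \<in> UU" "U0 \<noteq> W" "\<forall>U\<in>UU. y \<in> U" by blast
    then show ?case
    proof cases
      case 1
      then show ?thesis using acyc_window[OF V ac W A y vy] v by simp
    next
      case 2
      then have "W - {y} \<in> ?FAy \<union> ?Uy" by auto
      then show ?thesis by (rule subsetD[OF part_le_psum vy])
    next
      case (3 U)
      \<comment> \<open>The sets that avoid \<open>y\<close> are unaffected by its removal, and
        subtracting their contribution leaves a smaller family.\<close>
      define U1 where "U1 = {U \<in> UU. y \<in> U}"
      define U0 where "U0 = {U \<in> UU. y \<notin> U}"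
      have UUeq: "?FA \<union> UU = U0 \<union> (?FA \<union> U1)" by (auto simp: U0_def U1_def)
      obtain p q where pq: "p \<in> psum V t U0" "q \<in> psum V t (?FA \<union> U1)" "v = p \<oplus>\<^bsub>ob V t\<^esub> q"
        using v unfolding UUeq by (rule psum_Un_E[OF V])
      have pc: "p \<in> carrier (ob V t)" "q \<in> carrier (ob V t)" using sm_in[OF ps pq(1)] sm_in[OF ps pq(2)] .
      have "psum V t U0 \<subseteq> part V t (W - {y})"
        by (rule psum_le_part[OF V]) (use UU in \<open>auto simp: U0_def\<close>)
      then have py: "p \<in> part V t (W - {y})" using pq(1) by blast
      have "q = v \<ominus>\<^bsub>ob V t\<^esub> p" using add_minus_cancel[OF Vt pc] pq(3) by simp
      then have qy: "q \<in> part V t (W - {y})" using sm_minus[OF part_sm[OF V] vy py] by simp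
      have "card U1 < card UU" by (rule psubset_card_mono[OF finU]) (use 3 in \<open>auto simp: U1_def\<close>)
      then have "q \<in> psum V t (?FAy \<union> (\<lambda>U. U - {y}) ` U1)"
        by (rule inner[OF _ less.prems(1) W A y _ qy pq(2)]) (use UU in \<open>auto simp: U1_def\<close>)
      moreover have "psum V t (?FAy \<union> (\<lambda>U. U - {y}) ` U1) \<subseteq> psum V t (?FAy \<union> ?Uy)"
        by (rule psum_mono) (auto simp: U1_def)
      ultimately have q: "q \<in> psum V t (?FAy \<union> ?Uy)" by blast
      have "U0 \<subseteq> ?FAy \<union> ?Uy"
      proof
        fix S assume "S \<in> U0"
        then have "S \<in> UU" "S - {y} = S" by (auto simp: U0_def)
        then show "S \<in> ?FAy \<union> ?Uy" by (metis UnI2 imageI)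
      qed
      then have "psum V t U0 \<subseteq> psum V t (?FAy \<union> ?Uy)" by (rule psum_mono)
      then have "p \<in> psum V t (?FAy \<union> ?Uy)" using pq(1) by blast
      then show ?thesis unfolding pq(3) using q by (rule sm_add[OF ps])
    next
      case (4 W0)
      then obtain x where x: "x \<in> W" "x \<notin> W0" using UU by blast
      have xy: "x \<noteq> y" "x \<notin> A" using x(2) 4 UU by auto
      \<comment> \<open>Here every set of \<open>UU\<close> contains \<open>y\<close>, and
        \<open>W0\<close> misses \<open>x\<close>. The sets that miss \<open>x\<close> lie in
        \<open>W - {x}\<close>, so they are absorbed when \<open>x\<close> is added to
        \<open>A\<close>.\<close>
      define U1 where "U1 = {U \<in> UU. x \<in> U}"
      define U0 where "U0 = {U \<in> UU. x \<notin> U}"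
      have cU1: "card U1 < card UU" by (rule psubset_card_mono[OF finU]) (use 4(1) x(2) in \<open>auto simp: U1_def\<close>)
      have UUeq: "?FA \<union> UU = (?FA \<union> U1) \<union> U0" by (auto simp: U0_def U1_def)
      obtain r z where rz: "r \<in> psum V t (?FA \<union> U1)" "z \<in> psum V t U0" "v = r \<oplus>\<^bsub>ob V t\<^esub> z"
        using v unfolding UUeq by (rule psum_Un_E[OF V])
      have Uxy: "\<forall>U\<in>U1. insert x A \<subseteq> U \<and> U \<subseteq> W" using UU by (auto simp: U1_def)
      have "card (W - insert x A) < a"
        using less.prems(1) psubset_card_mono[of "W - A" "W - insert x A"] finW x(1) xy(2) by auto
      moreover have "v \<in> psum V t ((\<lambda>x. W - {x}) ` insert x A \<union> U1)"
      proof -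
        have "psum V t (?FA \<union> UU) \<subseteq> psum V t ((\<lambda>x. W - {x}) ` insert x A \<union> U1)"
        proof (rule psum_mono_sub[OF V])
          fix S assume S: "S \<in> ?FA \<union> UU"
          show "\<exists>T\<in>(\<lambda>x. W - {x}) ` insert x A \<union> U1. S \<subseteq> T"
          proof (cases "S \<in> U0")
            case True
            then have "S \<subseteq> W - {x}" using UU by (auto simp: U0_def)
            then show ?thesis by blast
          next
            case False
            then have "S \<in> (\<lambda>x. W - {x}) ` insert x A \<union> U1" using S by (auto simp: U0_def U1_def)
            then show ?thesis by blast
          qed
        qed
        then show ?thesis using v by blast
      qed
      ultimately have "v \<in> psum V t ((\<lambda>x. W - {x, y}) ` insert x A \<union> (\<lambda>U. U - {y}) ` U1)"
        by (intro outer[OF _ refl W _ _ Uxy vy]) (use A y x(1) xy in auto)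
      then have "v \<in> psum V t (insert (W - {x, y}) (?FAy \<union> (\<lambda>U. U - {y}) ` U1))" by simp
      then obtain c l where cl: "c \<in> part V t (W - {x, y})" "l \<in> psum V t (?FAy \<union> (\<lambda>U. U - {y}) ` U1)"
        "v = c \<oplus>\<^bsub>ob V t\<^esub> l"
        by (rule psum_insert_E[OF V])
      have car: "c \<in> carrier (ob V t)" "l \<in> carrier (ob V t)" "r \<in> carrier (ob V t)" "z \<in> carrier (ob V t)"
        using sm_in[OF part_sm[OF V] cl(1)] sm_in[OF ps cl(2)] sm_in[OF ps rz(1)] sm_in[OF ps rz(2)] .
      \<comment> \<open>The summand \<open>l\<close> already has the required form, so
        \<open>c\<close> remains. Comparing the two decompositions of \<open>v\<close> gives
        \<open>c - z = r - l\<close>. This element is supported off \<open>x\<close> and lies in the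
        sum for \<open>A\<close> and \<open>U1\<close>, so the inner induction applies with
        \<open>x\<close> in the role of \<open>y\<close>.\<close>
      note sw = add_eq_swap[OF Vt car] 
      have swp: "c \<ominus>\<^bsub>ob V t\<^esub> z = r \<ominus>\<^bsub>ob V t\<^esub> l" "c = (c \<ominus>\<^bsub>ob V t\<^esub> z) \<oplus>\<^bsub>ob V t\<^esub> z"
        using sw cl(3) rz(3) by simp_all
      have "psum V t (?FAy \<union> (\<lambda>U. U - {y}) ` U1) \<subseteq> psum V t (?FA \<union> U1)"
      proof (rule psum_mono_sub[OF V])
        fix S assume "S \<in> ?FAy \<union> (\<lambda>U. U - {y}) ` U1"
        then consider u where "u \<in> A" "S = W - {u, y}" | U where "U \<in> U1" "S = U - {y}" by blast
        then show "\<exists>T\<in>?FA \<union> U1. S \<subseteq> T"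
        proof cases
          case (1 u)
          then show ?thesis by (intro bexI[of _ "W - {u}"]) auto
        next
          case (2 U)
          then show ?thesis by (intro bexI[of _ U]) auto
        qed
      qed
      then have "r \<ominus>\<^bsub>ob V t\<^esub> l \<in> psum V t (?FA \<union> U1)" using cl(2) rz(1) by (intro sm_minus[OF ps]) auto
      then have d1: "c \<ominus>\<^bsub>ob V t\<^esub> z \<in> psum V t (?FA \<union> U1)" using swp(1) by simp
      have "psum V t U0 \<subseteq> part V t (W - {x})"
        by (rule psum_le_part[OF V]) (use UU in \<open>auto simp: U0_def\<close>)
      moreover have "part V t (W - {x, y}) \<subseteq> part V t (W - {x})" by (rule part_mono) auto
      ultimately have d2: "c \<ominus>\<^bsub>ob V t\<^esub> z \<in> part V t (W - {x})"
        using cl(1) rz(2) by (intro sm_minus[OF part_sm[OF V]]) auto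
      have "c \<ominus>\<^bsub>ob V t\<^esub> z \<in> psum V t ((\<lambda>u. W - {u, x}) ` A \<union> (\<lambda>U. U - {x}) ` U1)"
        by (rule inner[OF cU1 less.prems(1) W A _ _ d2 d1]) (use x xy Uxy in auto)
      moreover have "(\<lambda>u. W - {u, x}) ` A = (\<lambda>u. (W - {x}) - {u}) ` A" by (rule image_cong) auto
      then have "psum V t ((\<lambda>u. W - {u, x}) ` A \<union> (\<lambda>U. U - {x}) ` U1)
          \<subseteq> psum V t ((\<lambda>u. (W - {x}) - {u}) ` A \<union> ((\<lambda>U. U - {x}) ` U1 \<union> U0))"
        by (intro psum_mono) auto
      moreover have "psum V t U0 \<subseteq> psum V t ((\<lambda>u. (W - {x}) - {u}) ` A \<union> ((\<lambda>U. U - {x}) ` U1 \<union> U0))"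
        by (rule psum_mono) auto
      ultimately have c1: "c \<in> psum V t ((\<lambda>u. (W - {x}) - {u}) ` A \<union> ((\<lambda>U. U - {x}) ` U1 \<union> U0))"
        using rz(2) by (subst swp(2)) (intro sm_add[OF ps], auto)
      have c2: "c \<in> part V t ((W - {x}) - {y})"
        using cl(1) by (simp add: Diff_insert[symmetric] insert_commute)
      \<comment> \<open>Now \<open>c\<close> lies in a sum over sets inside \<open>W - {x}\<close>,
        and the outer induction applies to this smaller window, again with \<open>y\<close>.\<close>
      have "card ((W - {x}) - A) < a"
        using less.prems(1) psubset_card_mono[of "W - A" "(W - {x}) - A"] finW x(1) xy(2) by auto
      then have "c \<in> psum V t ((\<lambda>u. (W - {x}) - {u, y}) ` A \<union> (\<lambda>U. U - {y}) ` ((\<lambda>U. U - {x}) ` U1 \<union> U0))"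
        by (rule outer[OF _ refl _ _ _ _ c2 c1]) (use W A y xy UU in \<open>auto simp: U1_def U0_def\<close>)
      moreover have "psum V t ((\<lambda>u. (W - {x}) - {u, y}) ` A \<union> (\<lambda>U. U - {y}) ` ((\<lambda>U. U - {x}) ` U1 \<union> U0))
          \<subseteq> psum V t (?FAy \<union> ?Uy)"
      proof (rule psum_mono_sub[OF V])
        fix S assume "S \<in> (\<lambda>u. (W - {x}) - {u, y}) ` A \<union> (\<lambda>U. U - {y}) ` ((\<lambda>U. U - {x}) ` U1 \<union> U0)"
        then consider u where "u \<in> A" "S = (W - {x}) - {u, y}" | U where "U \<in> UU" "S = (U - {x}) - {y} \<or> S = U - {y}"
          by (auto simp: U0_def U1_def)
        then show "\<exists>T\<in>?FAy \<union> ?Uy. S \<subseteq> T"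
        proof cases
          case (1 u)
          then show ?thesis by (intro bexI[of _ "W - {u, y}"]) auto
        next
          case (2 U)
          then show ?thesis by (intro bexI[of _ "U - {y}"]) auto
        qed
      qed
      moreover have "psum V t (?FAy \<union> (\<lambda>U. U - {y}) ` U1) \<subseteq> psum V t (?FAy \<union> ?Uy)"
        by (rule psum_mono) (auto simp: U1_def)
      ultimately show ?thesis
        unfolding cl(3) using cl(2) by (intro sm_add[OF ps]) auto
    qed
  qed
qed

text \<open>The points of \<open>W\<close> outside \<open>S\<close> are removed from all sets of the
  family one at a time, by \<open>acyc_dist_step\<close> with \<open>A\<close> empty.\<close>

lemma acyc_distributive:
  fixes V :: "('m :: finite, 'k, 'v) cmod"
  assumes V: "cmodule R V" and ac: "acyc V"
    and "W \<subseteq> pts t" "S \<subseteq> W" "\<forall>U\<in>UU. U \<subseteq> W" "v \<in> part V t S" "v \<in> psum V t UU"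
  shows "v \<in> psum V t ((\<lambda>U. U \<inter> S) ` UU)"
  using assms(3-)
proof (induction "card (W - S)" arbitrary: W UU rule: less_induct)
  case less
  show ?case
  proof (cases "W = S")
    case True
    then have "(\<lambda>U. U \<inter> S) ` UU = (\<lambda>U. U) ` UU" using less.prems(3) by (intro image_cong) auto
    then show ?thesis using less.prems(5) by simp
  next
    case False
    then obtain y where y: "y \<in> W" "y \<notin> S" using less.prems(2) by blast
    have finW: "finite W" using finite_subset[OF less.prems(1)] by simp
    have "part V t S \<subseteq> part V t (W - {y})" by (rule part_mono) (use y less.prems(2) in auto)
    then have vy: "v \<in> part V t (W - {y})" using less.prems(4) by blast
    have "v \<in> psum V t ((\<lambda>x. W - {x, y}) ` {} \<union> (\<lambda>U. U - {y}) ` UU)"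
      by (rule acyc_dist_step[OF V ac refl less.prems(1) _ _ _ vy]) (use y less.prems in auto)
    then have v': "v \<in> psum V t ((\<lambda>U. U - {y}) ` UU)" by simp
    have "v \<in> psum V t ((\<lambda>U. U \<inter> S) ` (\<lambda>U. U - {y}) ` UU)"
    proof (rule less.hyps[of "W - {y}", OF _ _ _ _ less.prems(4) v'])
      show "card (W - {y} - S) < card (W - S)"
        by (rule psubset_card_mono) (use finW y in auto)
    qed (use less.prems y in auto)
    also have "(\<lambda>U. U \<inter> S) ` (\<lambda>U. U - {y}) ` UU = (\<lambda>U. U \<inter> S) ` UU"
      unfolding image_image by (rule image_cong) (use y in auto)
    finally show ?thesis .
  qed
qed

section \<open>Acyclic modules are relative projective\<close>

lemma lin_inverse:
  assumes h: "h \<in> lin_maps R M N" and M: "module R M" and N: "module R N"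
    and bij: "bij_betw h (carrier M) (carrier N)"
  shows "inv_into (carrier M) h \<in> lin_maps R N M"
proof (rule lin_mapsI)
  interpret M: module R M by fact
  interpret N: module R N by fact
  let ?g = "inv_into (carrier M) h"
  have gin: "?g x \<in> carrier M" and hg: "h (?g x) = x" if "x \<in> carrier N" for x
    using that bij by (auto simp: bij_betw_def inv_into_into f_inv_into_f)
  have inj: "x = y" if "h x = h y" "x \<in> carrier M" "y \<in> carrier M" for x y
    using bij that by (auto simp: bij_betw_def dest: inj_onD)
  show "?g x \<in> carrier M" if "x \<in> carrier N" for x by (rule gin[OF that])
  fix x y assume x: "x \<in> carrier N" and y: "y \<in> carrier N"
  show "?g (x \<oplus>\<^bsub>N\<^esub> y) = ?g x \<oplus>\<^bsub>M\<^esub> ?g y"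
  proof (rule inj)
    show "h (?g (x \<oplus>\<^bsub>N\<^esub> y)) = h (?g x \<oplus>\<^bsub>M\<^esub> ?g y)"
      using x y gin by (simp add: hg lin_mapsD(2)[OF h])
  qed (use x y gin in auto)
next
  interpret M: module R M by fact
  interpret N: module R N by fact
  let ?g = "inv_into (carrier M) h"
  have gin: "?g x \<in> carrier M" and hg: "h (?g x) = x" if "x \<in> carrier N" for x
    using that bij by (auto simp: bij_betw_def inv_into_into f_inv_into_f)
  have inj: "x = y" if "h x = h y" "x \<in> carrier M" "y \<in> carrier M" for x y
    using bij that by (auto simp: bij_betw_def dest: inj_onD)
  fix c x assume c: "c \<in> carrier R" and x: "x \<in> carrier N"
  show "?g (c \<odot>\<^bsub>N\<^esub> x) = c \<odot>\<^bsub>M\<^esub> ?g x"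
  proof (rule inj)
    show "h (?g (c \<odot>\<^bsub>N\<^esub> x)) = h (c \<odot>\<^bsub>M\<^esub> ?g x)"
      using c x gin by (simp add: hg lin_mapsD(3)[OF h])
  qed (use c x gin in auto)
qed

text \<open>If \<open>h\<close> kills a sum, the image of one summand is minus the image of the
  others, so this summand is zero by \<open>ind\<close>; the remaining sum is treated in the same
  way.\<close>

lemma inj_on_independent_sum:
  assumes h: "h \<in> lin_maps R M P" and M: "module R M" and P: "module R P"
    and fin: "finite UU" and Q: "\<And>U. U \<in> UU \<Longrightarrow> submodule (Q U) R M"
    and ind: "\<And>U x. U \<in> UU \<Longrightarrow> x \<in> Q U \<Longrightarrow> h x \<in> mod_span R P (\<Union>U'\<in>UU - {U}. h ` Q U') \<Longrightarrow> x = \<zero>\<^bsub>M\<^esub>"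
    and q: "q \<in> mod_span R M (\<Union>U\<in>UU. Q U)" "h q = \<zero>\<^bsub>P\<^esub>"
  shows "q = \<zero>\<^bsub>M\<^esub>"
proof -
  interpret M: module R M by fact
  interpret P: module R P by fact
  have Qc: "(\<Union>U\<in>F. Q U) \<subseteq> carrier M" if "F \<subseteq> UU" for F using that sm_subset[OF Q] by blast
  have "q = \<zero>\<^bsub>M\<^esub>" if "F \<subseteq> UU" "q \<in> mod_span R M (\<Union>U\<in>F. Q U)" "h q = \<zero>\<^bsub>P\<^esub>" for F q
    using finite_subset[OF that(1) fin] that
  proof (induction F arbitrary: q rule: finite_induct)
    case empty
    then show ?case by (simp add: span_empty[OF M])
  next
    case (insert U F)
    have U: "U \<in> UU" and F: "F \<subseteq> UU" using insert.prems by auto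
    have "q \<in> mod_span R M (Q U \<union> (\<Union>U\<in>F. Q U))" using insert.prems by simp
    then obtain a b where ab: "a \<in> mod_span R M (Q U)" "b \<in> mod_span R M (\<Union>U\<in>F. Q U)" "q = a \<oplus>\<^bsub>M\<^esub> b"
      by (rule span_Un_E[OF M sm_subset[OF Q[OF U]] Qc[OF F]])
    have a: "a \<in> Q U" using ab(1) span_of_sm[OF Q[OF U]] by simp
    have c: "a \<in> carrier M" "b \<in> carrier M"
      using sm_in[OF Q[OF U] a] sm_in[OF span_sm[OF M Qc[OF F]] ab(2)] .
    have "h a \<oplus>\<^bsub>P\<^esub> h b = \<zero>\<^bsub>P\<^esub>" using insert.prems(3) ab(3) lin_mapsD(2)[OF h c] by simp
    then have ha: "h a = \<ominus>\<^bsub>P\<^esub> h b"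
      using lin_mapsD(1)[OF h] c by (simp add: P.minus_equality)
    have hU: "h ` (\<Union>U\<in>F. Q U) \<subseteq> (\<Union>U'\<in>UU - {U}. h ` Q U')" using F insert.hyps by blast
    have "h b \<in> mod_span R P (h ` (\<Union>U\<in>F. Q U))"
      using ab(2) span_image[OF h M P Qc[OF F]] by blast
    then have "h b \<in> mod_span R P (\<Union>U'\<in>UU - {U}. h ` Q U')" using span_mono[OF hU] by blast
    moreover have "(\<Union>U'\<in>UU - {U}. h ` Q U') \<subseteq> carrier P"
      using Qc[OF subset_refl] lin_mapsD(1)[OF h] by blast
    ultimately have "h a \<in> mod_span R P (\<Union>U'\<in>UU - {U}. h ` Q U')"
      unfolding ha by (intro sm_neg[OF span_sm[OF P]])
    then have a0: "a = \<zero>\<^bsub>M\<^esub>" by (rule ind[OF U a])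
    then have "h b = \<zero>\<^bsub>P\<^esub>"
      using insert.prems(3) ab(3) c by simp
    then have "b = \<zero>\<^bsub>M\<^esub>" using insert.IH[OF F ab(2)] by simp
    then show ?case using ab(3) a0 by simp
  qed
  then show ?thesis using q by blast
qed

lemma precomp_postcomp:
  assumes \<sigma>: "\<sigma> \<in> Cmor d e" and f: "f \<in> Cmor t u" and x: "x \<in> carrier (free_mod R (Cmor e t))"
  shows "free_map R (Ccomp d f) (precomp R d e \<sigma> x) = precomp R d e \<sigma> (free_map R (Ccomp e f) x)"
proof (rule free_lin_eq[OF _ _ free_module _ x])
  have L: "free_map R (Ccomp d f) \<in> lin_maps R (free_mod R (Cmor d t)) (free_mod R (Cmor d u))" for d
    by (rule free_map_lin) (rule Ccomp_in[OF _ f])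
  show "(\<lambda>x. free_map R (Ccomp d f) (precomp R d e \<sigma> x)) \<in> lin_maps R (free_mod R (Cmor e t)) (free_mod R (Cmor d u))"
    by (rule lin_comp[OF precomp_lin[OF \<sigma>] L])
  show "(\<lambda>x. precomp R d e \<sigma> (free_map R (Ccomp e f) x)) \<in> lin_maps R (free_mod R (Cmor e t)) (free_mod R (Cmor d u))"
    by (rule lin_comp[OF L precomp_lin[OF \<sigma>]])
  fix g assume g: "g \<in> Cmor e t"
  show "free_map R (Ccomp d f) (precomp R d e \<sigma> (free_gen R g)) = precomp R d e \<sigma> (free_map R (Ccomp e f) (free_gen R g))"
    by (simp add: precomp_gen free_map_gen Ccomp_assoc[OF \<sigma> g f])
qed

lemma Mtens_data:
  assumes W: "cmodule R W"
  shows "tens_data R {n} (\<lambda>d. free_mod R (Cmor d t)) (precomp R) W"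
proof (rule tens_data.intro[OF coeff_ring_axioms tens_data_axioms.intro])
  fix d e f x assume f: "f \<in> Cmor d e" and x: "x \<in> carrier (free_mod R (Cmor e t))"
  show "precomp R d e f x \<in> carrier (free_mod R (Cmor d t))"
    by (rule lin_mapsD(1)[OF precomp_lin[OF f] x])
next
  fix d e f y assume f: "f \<in> Cmor d e" and y: "y \<in> carrier (ob W d)"
  show "act W d e f y \<in> carrier (ob W e)" by (rule act_in[OF W f y])
qed (auto simp: free_module cmD(1)[OF W])

text \<open>
  Each element of \<open>M(n) \<otimes> W\<^sub>n\<close> at \<open>t\<close> is a sum of tensors \<open>e \<otimes> w\<close> with one chosen \<open>e\<close> for each set of
  points of \<open>t\<close> of size \<open>n\<close>, so the hypotheses make the evaluation map bijective.
\<close>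

lemma basic_rel_projectiveI:
  fixes W :: "('m :: finite, 'k, 'v) cmod"
  assumes W: "cmodule R W"
    and gen: "\<And>t. carrier (ob W t) \<subseteq> psum W t {U. U \<subseteq> pts t \<and> csize U = n}"
    and ind: "\<And>t e w. e \<in> Cmor n t \<Longrightarrow> w \<in> carrier (ob W n) \<Longrightarrow>
      act W n t e w \<in> psum W t {U. U \<subseteq> pts t \<and> csize U = n \<and> U \<noteq> pmap e ` pts n} \<Longrightarrow> w = \<zero>\<^bsub>ob W n\<^esub>"
  shows "basic_rel_projective R W"
proof -
  let ?A = "\<lambda>t. free_mod R (Cmor n t)"
  let ?X = "\<lambda>t d. free_mod R (Cmor d t)"
  let ?Q = "\<lambda>t. tens R {n} (?X t) (precomp R) W"
  define pr where "pr t x y = tens_data.pure R {n} (?X t) (precomp R) W n x y" for t x y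
  note TD = Mtens_data[OF W, of n]
  note Wm = cmD(1)[OF W]
  have Qm: "module R (?Q t)" for t by (rule tens_data.Q_module[OF TD])
  have pr_in: "pr t x y \<in> carrier (?Q t)" if "x \<in> carrier (?A t)" "y \<in> carrier (ob W n)" for t x y
    unfolding pr_def by (rule tens_data.pure_in[OF TD]) (use that in auto)
  have prL: "(\<lambda>x. pr t x y) \<in> lin_maps R (?A t) (?Q t)" if "y \<in> carrier (ob W n)" for t y
    unfolding pr_def using tens_data.pure_lin_left[OF TD, of n y t] that by simp
  have prR: "pr t x \<in> lin_maps R (ob W n) (?Q t)" if "x \<in> carrier (?A t)" for t x
    using tens_data.pure_lin_right[OF TD, of n x t] that by (simp add: pr_def[abs_def])
  have prB: "pr t (precomp R n n \<sigma> x) y = pr t x (act W n n \<sigma> y)"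
    if "\<sigma> \<in> Cmor n n" "x \<in> carrier (?A t)" "y \<in> carrier (ob W n)" for t \<sigma> x y
    unfolding pr_def using tens_data.pure_balance[OF TD, of n n \<sigma> x t y] that by simp
  define prs where "prs t = {pr t x y | x y. x \<in> carrier (?A t) \<and> y \<in> carrier (ob W n)}" for t
  have prs: "prs t \<subseteq> carrier (?Q t)" for t using pr_in by (auto simp: prs_def)
  have Qspan: "carrier (?Q t) = mod_span R (?Q t) (prs t)" for t
  proof -
    have "tens_data.pures R {n} (?X t) (precomp R) W = prs t"
      unfolding tens_data.pures_def[OF TD] prs_def pr_def by (auto simp: image_iff)
    then show ?thesis using tens_data.pure_span[OF TD, of t] by simp
  qed
  have lift: "\<exists>h. h \<in> lin_maps R (?Q t) P \<and> (\<forall>x\<in>carrier (?A t). \<forall>y\<in>carrier (ob W n). h (pr t x y) = \<phi> x y)"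
    if P: "module R P" and \<phi>: "\<And>x y. x \<in> carrier (?A t) \<Longrightarrow> y \<in> carrier (ob W n) \<Longrightarrow> \<phi> x y \<in> carrier P"
      and left: "\<And>y. y \<in> carrier (ob W n) \<Longrightarrow> (\<lambda>x. \<phi> x y) \<in> lin_maps R (?A t) P"
      and right: "\<And>x. x \<in> carrier (?A t) \<Longrightarrow> \<phi> x \<in> lin_maps R (ob W n) P"
      and bal: "\<And>\<sigma> x y. \<sigma> \<in> Cmor n n \<Longrightarrow> x \<in> carrier (?A t) \<Longrightarrow> y \<in> carrier (ob W n) \<Longrightarrow>
        \<phi> (precomp R n n \<sigma> x) y = \<phi> x (act W n n \<sigma> y)"
    for t and P :: "('k, 'p) module" and \<phi>
  proof -
    obtain h where h: "h \<in> lin_maps R (?Q t) P"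
      "\<And>d x y. d \<in> {n} \<Longrightarrow> x \<in> carrier (?X t d) \<Longrightarrow> y \<in> carrier (ob W d) \<Longrightarrow>
        h (tens_data.pure R {n} (?X t) (precomp R) W d x y) = \<phi> x y"
    proof (rule tens_data.tens_lift[OF TD[of t] P, of "\<lambda>d. \<phi>"])
      show "\<phi> x y \<in> carrier P" if "d \<in> {n}" "x \<in> carrier (?X t d)" "y \<in> carrier (ob W d)" for d x y
        using that \<phi> by auto
      show "(\<lambda>x. \<phi> x y) \<in> lin_maps R (?X t d) P" if "d \<in> {n}" "y \<in> carrier (ob W d)" for d y
        using that left by auto
      show "\<phi> x \<in> lin_maps R (ob W d) P" if "d \<in> {n}" "x \<in> carrier (?X t d)" for d x
        using that right by auto
      show "\<phi> (precomp R d e f x) y = \<phi> x (act W d e f y)"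
        if "d \<in> {n}" "e \<in> {n}" "f \<in> Cmor d e" "x \<in> carrier (?X t e)" "y \<in> carrier (ob W d)" for d e f x y
        using that bal by auto
    qed blast
    then show ?thesis unfolding pr_def by blast
  qed
  have "\<exists>h. h \<in> lin_maps R (?Q t) (ob W t) \<and>
      (\<forall>x\<in>carrier (?A t). \<forall>y\<in>carrier (ob W n). h (pr t x y) = eval_at W n t x y)" for t
  proof (rule lift[OF Wm])
    show "eval_at W n t x y \<in> carrier (ob W t)" if "x \<in> carrier (?A t)" "y \<in> carrier (ob W n)" for x y
      by (rule lin_mapsD(1)[OF eval_at_simps(2)[OF W that(1)] that(2)])
  qed (simp_all add: eval_at_simps(1,2)[OF W] eval_at_precomp[OF W])
  then obtain \<Phi> where \<Phi>: "\<And>t. \<Phi> t \<in> lin_maps R (?Q t) (ob W t)"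
    and \<Phi>pr: "\<And>t x y. x \<in> carrier (?A t) \<Longrightarrow> y \<in> carrier (ob W n) \<Longrightarrow> \<Phi> t (pr t x y) = eval_at W n t x y"
    by metis
  have sur: "\<Phi> t ` carrier (?Q t) = carrier (ob W t)" for t
  proof
    show "\<Phi> t ` carrier (?Q t) \<subseteq> carrier (ob W t)" using lin_mapsD(1)[OF \<Phi>] by blast
    have im: "submodule (\<Phi> t ` carrier (?Q t)) R (ob W t)"
      by (rule sm_image[OF \<Phi> Qm Wm sm_carrier[OF Qm]])
    have "psum W t {U. U \<subseteq> pts t \<and> csize U = n} \<subseteq> \<Phi> t ` carrier (?Q t)"
    proof (rule psum_least[OF im])
      fix U assume U: "U \<in> {U. U \<subseteq> pts t \<and> csize U = n}"
      then obtain e where e: "e \<in> Cmor n t" "pmap e ` pts n = U" using emb_exists[of U t] by auto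
      have "part W t U = act W n t e ` carrier (ob W n)" using part_emb[OF W e(1)] e(2) by simp
      also have "\<dots> \<subseteq> \<Phi> t ` carrier (?Q t)"
      proof
        fix z assume "z \<in> act W n t e ` carrier (ob W n)"
        then obtain w where w: "w \<in> carrier (ob W n)" "z = act W n t e w" by blast
        then have "z = \<Phi> t (pr t (free_gen R e) w)"
          by (simp add: \<Phi>pr free_gen_in e(1) eval_at_simps(3)[OF W])
        then show "z \<in> \<Phi> t ` carrier (?Q t)" using pr_in[OF free_gen_in[OF e(1)] w(1)] by blast
      qed
      finally show "part W t U \<subseteq> \<Phi> t ` carrier (?Q t)" .
    qed
    then show "carrier (ob W t) \<subseteq> \<Phi> t ` carrier (?Q t)" using gen[of t] by (rule order_trans[rotated])
  qed
  have inj: "inj_on (\<Phi> t) (carrier (?Q t))" for t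
  proof (rule lin_inj_onI[OF \<Phi> Qm Wm])
    fix q assume q: "q \<in> carrier (?Q t)" "\<Phi> t q = \<zero>\<^bsub>ob W t\<^esub>"
    define UU where "UU = {U. U \<subseteq> pts t \<and> csize U = n}"
    have finUU: "finite UU" by (rule finite_subset[of _ "Pow (pts t)"]) (auto simp: UU_def)
    have "\<exists>e. e \<in> Cmor n t \<and> pmap e ` pts n = U" if U: "U \<in> UU" for U
    proof -
      obtain e where "e \<in> Cmor (csize U) t" "pmap e ` pts (csize U) = U"
        using emb_exists[of U t] U by (auto simp: UU_def)
      then show ?thesis using U by (auto simp: UU_def)
    qed
    then obtain em where em: "\<And>U. U \<in> UU \<Longrightarrow> em U \<in> Cmor n t" "\<And>U. U \<in> UU \<Longrightarrow> pmap (em U) ` pts n = U"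
      by metis
    \<comment> \<open>\<open>Qs U\<close> collects the tensors whose left factor is the embedding
      chosen for \<open>U\<close>.\<close>
    define Qs where "Qs U = pr t (free_gen R (em U)) ` carrier (ob W n)" for U
    have Qs: "submodule (Qs U) R (?Q t)" if "U \<in> UU" for U
      unfolding Qs_def by (rule sm_image[OF prR[OF free_gen_in[OF em(1)[OF that]]] Wm Qm sm_carrier[OF Wm]])
    have Qsc: "(\<Union>U\<in>UU. Qs U) \<subseteq> carrier (?Q t)" using sm_subset[OF Qs] by blast
    have sp: "submodule (mod_span R (?Q t) (\<Union>U\<in>UU. Qs U)) R (?Q t)" by (rule span_sm[OF Qm Qsc])
    have "prs t \<subseteq> mod_span R (?Q t) (\<Union>U\<in>UU. Qs U)"
    proof
      fix z assume "z \<in> prs t"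
      then obtain x y where xy: "x \<in> carrier (?A t)" "y \<in> carrier (ob W n)" "z = pr t x y"
        by (auto simp: prs_def)
      have "(\<lambda>x. pr t x y) ` mod_span R (?A t) (free_gen R ` Cmor n t) \<subseteq> mod_span R (?Q t) (\<Union>U\<in>UU. Qs U)"
      proof (rule span_lin_subset[OF prL[OF xy(2)] free_module Qm _ sp])
        show "free_gen R ` Cmor n t \<subseteq> carrier (?A t)" by (auto intro: free_gen_in)
        show "(\<lambda>x. pr t x y) ` free_gen R ` Cmor n t \<subseteq> mod_span R (?Q t) (\<Union>U\<in>UU. Qs U)"
        proof
          fix z assume "z \<in> (\<lambda>x. pr t x y) ` free_gen R ` Cmor n t"
          then obtain f where f: "f \<in> Cmor n t" "z = pr t (free_gen R f) y" by blast
          define U where "U = pmap f ` pts n"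
          have U: "U \<in> UU"
            using pmap_image_subset[OF f(1) subset_refl] csize_mimg[OF f(1)] by (simp add: UU_def U_def)
          have "pmap f ` pts n \<subseteq> pmap (em U) ` pts n" using em(2)[OF U] unfolding U_def by (rule equalityD2)
          then obtain \<sigma> where \<sigma>: "\<sigma> \<in> Cmor n n" "f = Ccomp n (em U) \<sigma>"
            by (rule factor_through[OF f(1) em(1)[OF U]])
          \<comment> \<open>\<open>f\<close> and the embedding chosen for its image differ by an
            automorphism of \<open>n\<close>, which moves across the tensor.\<close>
          have "z = pr t (free_gen R (em U)) (act W n n \<sigma> y)"
            using prB[OF \<sigma>(1) free_gen_in[OF em(1)[OF U]] xy(2)] f(2) \<sigma>(2) by (simp add: precomp_gen)
          then have "z \<in> Qs U" using act_in[OF W \<sigma>(1) xy(2)] by (simp add: Qs_def)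
          then show "z \<in> mod_span R (?Q t) (\<Union>U\<in>UU. Qs U)" using U by (intro subsetD[OF span_incl]) blast
        qed
      qed
      then show "z \<in> mod_span R (?Q t) (\<Union>U\<in>UU. Qs U)" using xy by (auto simp: free_gen_span)
    qed
    then have "carrier (?Q t) \<subseteq> mod_span R (?Q t) (\<Union>U\<in>UU. Qs U)"
      unfolding Qspan[of t] by (rule span_least[OF sp])
    then have qs: "q \<in> mod_span R (?Q t) (\<Union>U\<in>UU. Qs U)" using q(1) by blast
    have \<Phi>Qs: "\<Phi> t ` Qs U = part W t U" if U: "U \<in> UU" for U
    proof -
      have "\<Phi> t ` Qs U = act W n t (em U) ` carrier (ob W n)"
        unfolding Qs_def image_image
        by (rule image_cong) (simp_all add: \<Phi>pr free_gen_in em(1)[OF U] eval_at_simps(3)[OF W])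
      then show ?thesis using part_emb[OF W em(1)[OF U]] em(2)[OF U] by simp
    qed
    show "q = \<zero>\<^bsub>?Q t\<^esub>"
    proof (rule inj_on_independent_sum[OF \<Phi> Qm Wm finUU Qs _ qs q(2)])
      fix U x assume U: "U \<in> UU" and x: "x \<in> Qs U"
        and hx: "\<Phi> t x \<in> mod_span R (ob W t) (\<Union>U'\<in>UU - {U}. \<Phi> t ` Qs U')"
      obtain w where w: "w \<in> carrier (ob W n)" "x = pr t (free_gen R (em U)) w"
        using x by (auto simp: Qs_def)
      have "(\<Union>U'\<in>UU - {U}. \<Phi> t ` Qs U') = (\<Union>U'\<in>UU - {U}. part W t U')" using \<Phi>Qs by simp
      moreover have "UU - {U} = {U'. U' \<subseteq> pts t \<and> csize U' = n \<and> U' \<noteq> pmap (em U) ` pts n}"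
        using em(2)[OF U] by (auto simp: UU_def)
      ultimately have "act W n t (em U) w \<in> psum W t {U'. U' \<subseteq> pts t \<and> csize U' = n \<and> U' \<noteq> pmap (em U) ` pts n}"
        using hx w by (simp add: psum_def \<Phi>pr free_gen_in em(1)[OF U] eval_at_simps(3)[OF W])
      then have "w = \<zero>\<^bsub>ob W n\<^esub>" by (rule ind[OF em(1)[OF U] w(1)])
      then show "x = \<zero>\<^bsub>?Q t\<^esub>" using lin_zero[OF prR[OF free_gen_in[OF em(1)[OF U]]] Wm Qm] w(2) by simp
    qed
  qed
  have bij: "bij_betw (\<Phi> t) (carrier (?Q t)) (carrier (ob W t))" for t
    using inj sur by (simp add: bij_betw_def)
  let ?M = "Mtens R n W"
  have obM: "ob ?M t = ?Q t" for t by (simp add: Mtens_def Let_def Mfree_simps)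
  have actM: "act ?M t u f (pr t x y) = pr u (free_map R (Ccomp n f) x) y"
    and actL: "\<exists>L. L \<in> lin_maps R (?Q t) (?Q u) \<and> (\<forall>q\<in>carrier (?Q t). act ?M t u f q = L q)"
    if f: "f \<in> Cmor t u" and x: "x \<in> carrier (?A t)" and y: "y \<in> carrier (ob W n)" for t u f x y
  proof -
    let ?Ft = "tens_free R {n} (?X t) W" and ?Nt = "tens_rels R {n} (?X t) (precomp R) W"
    let ?Fu = "tens_free R {n} (?X u) W" and ?Nu = "tens_rels R {n} (?X u) (precomp R) W"
    define H where "H = free_map R (\<lambda>(d, x, y). (d, act (Mfree R d) t u f x, y :: 'v))"
    have fm: "free_map R (Ccomp d f) \<in> lin_maps R (free_mod R (Cmor d t)) (free_mod R (Cmor d u))" for d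
      by (rule free_map_lin) (rule Ccomp_in[OF _ f])
    have H: "H \<in> lin_maps R ?Ft ?Fu"
      unfolding H_def tens_free_def
      by (rule free_map_lin) (use lin_mapsD(1)[OF fm] in \<open>auto simp: Mfree_simps\<close>)
    have Hg: "H (free_gen R (n, x, y)) = free_gen R (n, free_map R (Ccomp n f) x, y)" for x y
      by (simp add: H_def free_map_gen Mfree_simps)
    have prc: "pr t x y = cst ?Ft ?Nt (free_gen R (n, x, y))" "pr u x y = cst ?Fu ?Nu (free_gen R (n, x, y))" for x y
      by (simp_all add: pr_def tens_data.pure_def[OF TD])
    \<comment> \<open>The action on the tensor product is defined through \<open>H\<close> on the
      free module. A linear map \<open>L\<close> with the expected values exists by the universal
      property; agreement with \<open>H\<close> on generators then shows that \<open>H\<close>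
      respects the relations, with no need to inspect them one by one.\<close>
    have "\<exists>L. L \<in> lin_maps R (?Q t) (?Q u) \<and> (\<forall>x\<in>carrier (?A t). \<forall>y\<in>carrier (ob W n).
        L (pr t x y) = pr u (free_map R (Ccomp n f) x) y)"
    proof (rule lift[OF Qm])
      show "pr u (free_map R (Ccomp n f) x) y \<in> carrier (?Q u)"
        if "x \<in> carrier (?A t)" "y \<in> carrier (ob W n)" for x y
        by (rule pr_in[OF lin_mapsD(1)[OF fm that(1)] that(2)])
      show "(\<lambda>x. pr u (free_map R (Ccomp n f) x) y) \<in> lin_maps R (?A t) (?Q u)"
        if "y \<in> carrier (ob W n)" for y
        by (rule lin_comp[OF fm prL[OF that]])
      show "pr u (free_map R (Ccomp n f) x) \<in> lin_maps R (ob W n) (?Q u)" if "x \<in> carrier (?A t)" for x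
        by (rule prR[OF lin_mapsD(1)[OF fm that]])
      show "pr u (free_map R (Ccomp n f) (precomp R n n \<sigma> x)) y = pr u (free_map R (Ccomp n f) x) (act W n n \<sigma> y)"
        if "\<sigma> \<in> Cmor n n" "x \<in> carrier (?A t)" "y \<in> carrier (ob W n)" for \<sigma> x y
        using prB[OF that(1) lin_mapsD(1)[OF fm that(2)] that(3)] by (simp add: precomp_postcomp[OF that(1) f that(2)])
    qed
    then obtain L where L: "L \<in> lin_maps R (?Q t) (?Q u)"
      and Lpr: "\<And>x y. x \<in> carrier (?A t) \<Longrightarrow> y \<in> carrier (ob W n) \<Longrightarrow> L (pr t x y) = pr u (free_map R (Ccomp n f) x) y"
      by blast
    have Ftm: "module R ?Ft" and Fum: "module R ?Fu" by (rule tens_data.F_module[OF TD])+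
    have Nts: "submodule ?Nt R ?Ft" and Nus: "submodule ?Nu R ?Fu" by (rule tens_data.N_sm[OF TD])+
    have ct: "cst ?Ft ?Nt \<in> lin_maps R ?Ft (?Q t)" and cu: "cst ?Fu ?Nu \<in> lin_maps R ?Fu (?Q u)"
      by (rule tens_data.cst_Q[OF TD])+
    have sq: "cst ?Fu ?Nu (H z) = L (cst ?Ft ?Nt z)" if z: "z \<in> carrier ?Ft" for z
    proof -
      let ?T = "{(d, x, y). d \<in> {n} \<and> x \<in> carrier (?X t d) \<and> y \<in> carrier (ob W d)}"
      have Ft: "?Ft = free_mod R ?T" by (simp add: tens_free_def)
      show ?thesis
      proof (rule free_lin_eq[of _ ?T])
        show "(\<lambda>z. cst ?Fu ?Nu (H z)) \<in> lin_maps R (free_mod R ?T) (?Q u)"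
          using lin_comp[OF H cu] by (simp add: Ft)
        show "(\<lambda>z. L (cst ?Ft ?Nt z)) \<in> lin_maps R (free_mod R ?T) (?Q u)"
          using lin_comp[OF ct L] by (simp add: Ft)
        show "module R (?Q u)" by (rule Qm)
        show "z \<in> carrier (free_mod R ?T)" using z by (simp add: Ft)
        fix s assume "s \<in> ?T"
        then obtain x y where s: "s = (n, x, y)" "x \<in> carrier (?A t)" "y \<in> carrier (ob W n)" by auto
        show "cst ?Fu ?Nu (H (free_gen R s)) = L (cst ?Ft ?Nt (free_gen R s))"
          using Lpr[OF s(2,3)] by (simp add: s(1) Hg prc)
      qed
    qed
    have HN: "H ` ?Nt \<subseteq> ?Nu"
    proof
      fix w assume "w \<in> H ` ?Nt"
      then obtain z where z: "z \<in> ?Nt" "w = H z" by blast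
      have zF: "z \<in> carrier ?Ft" by (rule sm_in[OF Nts z(1)])
      have zQ: "\<zero>\<^bsub>?Q t\<^esub> = ?Nt" "\<zero>\<^bsub>?Q u\<^esub> = ?Nu"
        by (simp_all add: tens_def quot_mod_simps(2)[OF Ftm Nts] quot_mod_simps(2)[OF Fum Nus])
      have "cst ?Ft ?Nt z = \<zero>\<^bsub>?Q t\<^esub>" using cst_eq_zero_iff[OF Ftm Nts zF] z(1) zQ by simp
      then have "cst ?Fu ?Nu (H z) = ?Nu" using sq[OF zF] lin_zero[OF L Qm Qm] zQ by simp
      then show "w \<in> ?Nu" using cst_eq_zero_iff[OF Fum Nus lin_mapsD(1)[OF H zF]] z(2) by simp
    qed
    have act: "act ?M t u f = quot_map ?Fu ?Nu H"
      by (simp add: Mtens_def Let_def Mfree_simps H_def)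
    have eqL: "act ?M t u f q = L q" if q: "q \<in> carrier (?Q t)" for q
    proof -
      obtain z where z: "z \<in> carrier ?Ft" "q = cst ?Ft ?Nt z"
        using q by (auto simp: tens_def quot_mod_simps(1)[OF Ftm Nts])
      have "act ?M t u f q = cst ?Fu ?Nu (H z)"
        unfolding act z(2) by (rule quot_map_cst[OF H Ftm Nts Fum Nus HN z(1)])
      then show ?thesis using sq[OF z(1)] z(2) by simp
    qed
    show "act ?M t u f (pr t x y) = pr u (free_map R (Ccomp n f) x) y"
      using eqL[OF pr_in[OF x y]] Lpr[OF x y] by simp
    show "\<exists>L. L \<in> lin_maps R (?Q t) (?Q u) \<and> (\<forall>q\<in>carrier (?Q t). act ?M t u f q = L q)"
      using L eqL by blast
  qed
  have zc: "\<zero>\<^bsub>?A t\<^esub> \<in> carrier (?A t)" "\<zero>\<^bsub>ob W n\<^esub> \<in> carrier (ob W n)" for t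
    by (rule sm_zero[OF sm_carrier[OF free_module]], rule sm_zero[OF sm_carrier[OF Wm]])
  have natural: "\<Phi> u (act ?M t u f q) = act W t u f (\<Phi> t q)" and act_closed: "act ?M t u f q \<in> carrier (?Q u)"
    if f: "f \<in> Cmor t u" and q: "q \<in> carrier (?Q t)" for t u f q
  proof -
    obtain L where L: "L \<in> lin_maps R (?Q t) (?Q u)" "\<And>q. q \<in> carrier (?Q t) \<Longrightarrow> act ?M t u f q = L q"
      using actL[OF f zc] by blast
    show "act ?M t u f q \<in> carrier (?Q u)" using L(2)[OF q] lin_mapsD(1)[OF L(1) q] by simp
    have "\<Phi> u (L q) = act W t u f (\<Phi> t q)"
    proof (rule lin_eq_on_span[OF lin_comp[OF L(1) \<Phi>] lin_comp[OF \<Phi> cmD(2)[OF W f]] Qm Wm _ prs])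
      show "q \<in> mod_span R (?Q t) (prs t)" using q Qspan by simp
      fix s assume s: "s \<in> prs t"
      then obtain x y where xy: "x \<in> carrier (?A t)" "y \<in> carrier (ob W n)" "s = pr t x y"
        by (auto simp: prs_def)
      have fm: "free_map R (Ccomp n f) \<in> lin_maps R (?A t) (?A u)"
        by (rule free_map_lin) (rule Ccomp_in[OF _ f])
      have "L s = pr u (free_map R (Ccomp n f) x) y"
        using L(2)[OF subsetD[OF prs s]] actM[OF f xy(1,2)] xy(3) by simp
      then have "\<Phi> u (L s) = eval_at W n u (free_map R (Ccomp n f) x) y"
        using \<Phi>pr[OF lin_mapsD(1)[OF fm xy(1)] xy(2)] by simp
      also have "\<dots> = act W t u f (eval_at W n t x y)"
      proof (rule free_lin_eq[OF lin_comp[OF fm eval_at_simps(1)[OF W xy(2)]]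
            lin_comp[OF eval_at_simps(1)[OF W xy(2)] cmD(2)[OF W f]] Wm _ xy(1)])
        fix g assume g: "g \<in> Cmor n t"
        show "eval_at W n u (free_map R (Ccomp n f) (free_gen R g)) y = act W t u f (eval_at W n t (free_gen R g) y)"
          by (simp add: free_map_gen eval_at_simps(3)[OF W xy(2)] g Ccomp_in[OF g f] cmD(4)[OF W g f xy(2)])
      qed
      also have "\<dots> = act W t u f (\<Phi> t s)" using \<Phi>pr[OF xy(1,2)] xy(3) by simp
      finally show "\<Phi> u (L s) = act W t u f (\<Phi> t s)" .
    qed
    then show "\<Phi> u (act ?M t u f q) = act W t u f (\<Phi> t q)" using L(2)[OF q] by simp
  qed
  \<comment> \<open>The isomorphism has to go from \<open>W\<close> to the tensor product, so the
    evaluation map is inverted.\<close>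
  define \<Psi> where "\<Psi> t = inv_into (carrier (?Q t)) (\<Phi> t)" for t
  have \<Psi>: "\<Psi> t \<in> lin_maps R (ob W t) (?Q t)" for t
    unfolding \<Psi>_def by (rule lin_inverse[OF \<Phi> Qm Wm bij])
  have \<Phi>\<Psi>: "\<Phi> t (\<Psi> t w) = w" if "w \<in> carrier (ob W t)" for t w
    unfolding \<Psi>_def using that sur[of t] by (simp add: f_inv_into_f)
  have \<Psi>bij: "bij_betw (\<Psi> t) (carrier (ob W t)) (carrier (?Q t))" for t
    unfolding \<Psi>_def by (rule bij_betw_inv_into[OF bij])
  have "\<Psi> \<in> cmod_hom R W ?M"
  proof (rule homI)
    show "\<Psi> t \<in> lin_maps R (ob W t) (ob ?M t)" for t using \<Psi> by (simp add: obM)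
    fix t u f w assume f: "f \<in> Cmor t u" and w: "w \<in> carrier (ob W t)"
    have \<Psi>w: "\<Psi> t w \<in> carrier (?Q t)" by (rule lin_mapsD(1)[OF \<Psi> w])
    have fw: "act W t u f w \<in> carrier (ob W u)" by (rule act_in[OF W f w])
    show "\<Psi> u (act W t u f w) = act ?M t u f (\<Psi> t w)"
    proof (rule inj_onD[OF inj])
      show "\<Phi> u (\<Psi> u (act W t u f w)) = \<Phi> u (act ?M t u f (\<Psi> t w))"
        using natural[OF f \<Psi>w] by (simp add: \<Phi>\<Psi>[OF fw] \<Phi>\<Psi>[OF w])
    qed (use lin_mapsD(1)[OF \<Psi> fw] act_closed[OF f \<Psi>w] in auto)
  qed
  then have "cmod_iso R W ?M" unfolding cmod_iso_def using \<Psi>bij by (auto simp: obM)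
  moreover have "functor_on R {n} W" using W unfolding cmodule_def functor_on_def by blast
  ultimately show ?thesis unfolding basic_rel_projective_def by blast
qed

theorem acyc_rel_projective:
  fixes V :: "('m :: finite, 'k, 'v) cmod"
  assumes V: "cmodule R V" and ac: "acyc V" and g: "gen_lt V e"
  shows "rel_projective R V"
proof -
  have fin: "finite {n :: 'm obj. deg n < e}"
  proof (rule finite_subset[OF _ finite_le_obj[of "\<lambda>_. e"]])
    have "n i \<le> e" if "deg n < e" for n :: "'m obj" and i
      using member_le_sum[of i UNIV n] that by (simp add: deg_def)
    then show "{n :: 'm obj. deg n < e} \<subseteq> {k. k \<le> (\<lambda>_. e)}" by (auto simp: le_fun_def)
  qed
  \<comment> \<open>The objects of degree below \<open>e\<close>, sorted by degree. The filtration
    adds one object at a time, and the sizes of proper subsets of a set of size \<open>n\<close>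
    occur before \<open>n\<close>.\<close>
  define ns where "ns = sort_key deg (SOME xs. set xs = {n :: 'm obj. deg n < e} \<and> distinct xs)"
  have "set (SOME xs. set xs = {n :: 'm obj. deg n < e} \<and> distinct xs) = {n. deg n < e} \<and>
      distinct (SOME xs. set xs = {n :: 'm obj. deg n < e} \<and> distinct xs)"
    by (rule someI_ex) (rule finite_distinct_list[OF fin])
  then have ns: "set ns = {n. deg n < e}" "distinct ns" "sorted (map deg ns)" by (simp_all add: ns_def)
  define X where "X s t = psum V t {S. S \<subseteq> pts t \<and> csize S \<in> set (take s ns)}" for s t
  have X: "subfunctor R V (X s)" for s
  proof (rule subfunctorI)
    show "submodule (X s n) R (ob V n)" for n unfolding X_def by (rule psum_sm[OF V])
    fix n t f x assume f: "f \<in> Cmor n t" and x: "x \<in> X s n"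
    have "act V n t f ` X s n = psum V t ((`) (pmap f) ` {S. S \<subseteq> pts n \<and> csize S \<in> set (take s ns)})"
      unfolding X_def by (rule psum_act[OF V f]) auto
    also have "\<dots> \<subseteq> X s t"
      unfolding X_def
    proof (rule psum_mono)
      show "(`) (pmap f) ` {S. S \<subseteq> pts n \<and> csize S \<in> set (take s ns)}
          \<subseteq> {S. S \<subseteq> pts t \<and> csize S \<in> set (take s ns)}"
        using pmap_image_subset[OF f] csize_image[OF f] by auto
    qed
    finally show "act V n t f x \<in> X s t" using x by blast
  qed
  have X0: "X 0 = zero_fam V" by (rule ext) (simp add: X_def zero_fam_def psum_empty[OF V])
  have Xr: "X (length ns) = (\<lambda>n. carrier (ob V n))"
  proof
    fix t
    have "{S. S \<subseteq> pts t \<and> card S < e} \<subseteq> {S. S \<subseteq> pts t \<and> csize S \<in> set (take (length ns) ns)}"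
    proof clarify
      fix S assume S: "S \<subseteq> pts t" "card S < e"
      then have "deg (csize S) < e" using card_csize[OF finite_subset[OF S(1) finite_pts]] by simp
      then show "csize S \<in> set (take (length ns) ns)" by (simp add: ns(1))
    qed
    then have "psum V t {S. S \<subseteq> pts t \<and> card S < e} \<subseteq> X (length ns) t"
      unfolding X_def by (rule psum_mono)
    then show "X (length ns) t = carrier (ob V t)"
      using g subfunctorD(3)[OF X] unfolding gen_lt_def by blast
  qed
  have Xm: "X s t \<subseteq> X (Suc s) t" for s t
    unfolding X_def by (rule psum_mono) (auto dest: in_set_takeD set_take_subset_set_take[THEN subsetD, rotated] intro: set_take_subset_set_take[of s "Suc s" ns, THEN subsetD])
  have basic: "basic_rel_projective R (subquot V (X (Suc s)) (X s))" if s: "s < length ns" for s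
  proof -
    define n where "n = ns ! s"
    have tk: "set (take (Suc s) ns) = insert n (set (take s ns))"
      using s by (simp add: take_Suc_conv_app_nth n_def)
    have n_notin: "n \<notin> set (take s ns)"
      using ns(2) s by (auto simp: n_def in_set_conv_nth nth_eq_iff_index_eq)
    have deg_le: "deg k \<le> deg n" if k: "k \<in> set (take s ns)" for k
    proof -
      obtain j where "j < s" "k = ns ! j" using k s by (auto simp: in_set_conv_nth)
      then show ?thesis using sorted_nth_mono[OF ns(3), of j s] s by (simp add: n_def)
    qed
    have deg_less: "k \<in> set (take s ns)" if "deg k < deg n" for k
    proof -
      have "deg n < e" using ns(1) s nth_mem[OF s] by (auto simp: n_def)
      then have "k \<in> set ns" using ns(1) that by auto
      then obtain j where j: "j < length ns" "k = ns ! j" by (auto simp: in_set_conv_nth)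
      have "j < s"
      proof (rule ccontr)
        assume "\<not> j < s"
        then have "deg n \<le> deg k" using sorted_nth_mono[OF ns(3), of s j] j by (simp add: n_def)
        then show False using that by simp
      qed
      then show ?thesis using j s by (auto simp: in_set_conv_nth)
    qed
    let ?Z = "X (Suc s)" and ?B = "X s"
    let ?W = "subquot V ?Z ?B"
    let ?c = "\<lambda>n. cst (ob V n) (?B n)"
    let ?U = "\<lambda>t. {U. U \<subseteq> pts t \<and> csize U = n}"
    note sq = subquot_cst[OF V X[of "Suc s"] X[of s] Xm]
    have Z: "cmodule R (subcmod V ?Z)" by (rule subcmod_cmodule[OF V X])
    have Zt: "?Z t = psum V t (?U t \<union> {S. S \<subseteq> pts t \<and> csize S \<in> set (take s ns)})" for t
      unfolding X_def tk by (rule arg_cong[where f = "psum V t"]) auto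
    have Zn: "?Z n = carrier (ob V n)"
    proof -
      have "part V n (pts n) \<subseteq> ?Z n" unfolding Zt by (rule part_le_psum) simp
      then show ?thesis using subfunctorD(3)[OF X] by (auto simp: part_pts[OF V])
    qed
    have partZ: "part (subcmod V ?Z) t U = part V t U" if U: "U \<in> ?U t" for t U
    proof -
      obtain h where h: "h \<in> Cmor n t" "pmap h ` pts n = U" using emb_exists[of U t] U by auto
      show ?thesis using part_emb[OF Z h(1)] part_emb[OF V h(1)] by (simp add: h(2) Zn)
    qed
    have psumZ: "psum (subcmod V ?Z) t FF = psum V t FF" if "FF \<subseteq> ?U t" for t FF
      unfolding subcmod_psum[OF V X] unfolding psum_def using partZ that by (metis (no_types, lifting) SUP_cong subsetD)
    have psumW: "psum ?W t FF = ?c t ` psum V t FF" if "FF \<subseteq> ?U t" for t FF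
      using onto_psum[OF Z sq(1) sq(2), of t FF] psumZ[OF that] by simp
    show ?thesis
    proof (rule basic_rel_projectiveI[OF sq(1), of n])
      fix t
      show "carrier (ob ?W t) \<subseteq> psum ?W t (?U t)"
      proof
        fix w assume "w \<in> carrier (ob ?W t)"
        then obtain x where x: "x \<in> ?Z t" "w = ?c t x" by (auto simp: sq(5))
        obtain a b where ab: "a \<in> psum V t (?U t)" "b \<in> ?B t" "x = a \<oplus>\<^bsub>ob V t\<^esub> b"
          using psum_Un_E[OF V x(1)[unfolded Zt]] unfolding X_def by blast
        have c: "a \<in> carrier (ob V t)" "b \<in> carrier (ob V t)"
          using sm_in[OF psum_sm[OF V] ab(1)] subfunctorD(3)[OF X ab(2)] .
        have "x \<ominus>\<^bsub>ob V t\<^esub> a = b" using add_minus_cancel[OF cmD(1)[OF V] c] ab(3) by simp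
        then have "?c t x = ?c t a"
          using cst_eq_iff[OF cmD(1)[OF V] subfunctorD(1)[OF X] subfunctorD(3)[OF X x(1)] c(1)] ab(2) by simp
        then show "w \<in> psum ?W t (?U t)" using x(2) ab(1) by (simp add: psumW)
      qed
    next
      fix t h w assume h: "h \<in> Cmor n t" and w: "w \<in> carrier (ob ?W n)"
        and hw: "act ?W n t h w \<in> psum ?W t {U. U \<subseteq> pts t \<and> csize U = n \<and> U \<noteq> pmap h ` pts n}"
      let ?I = "pmap h ` pts n"
      let ?O = "{U. U \<subseteq> pts t \<and> csize U = n \<and> U \<noteq> ?I}"
      obtain x where x: "x \<in> carrier (ob V n)" "w = ?c n x" using w by (auto simp: sq(5) Zn)
      have "act ?W n t h w = ?c t (act V n t h x)"
        using sq(2) homD(3)[of "\<lambda>n. ?c n" "subcmod V ?Z" ?W h n t x] h x by (auto simp: onto_def Zn)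
      then have "?c t (act V n t h x) \<in> ?c t ` psum V t ?O" using hw psumW[of ?O t] by auto
      then obtain b where b: "b \<in> psum V t ?O" "?c t (act V n t h x) = ?c t b" by blast
      have hx: "act V n t h x \<in> carrier (ob V t)" by (rule act_in[OF V h x(1)])
      have bc: "b \<in> carrier (ob V t)" by (rule sm_in[OF psum_sm[OF V] b(1)])
      have d: "act V n t h x \<ominus>\<^bsub>ob V t\<^esub> b \<in> ?B t"
        using cst_eq_iff[OF cmD(1)[OF V] subfunctorD(1)[OF X] hx bc] b(2) by simp
      \<comment> \<open>Lifted from the quotient, the hypothesis puts the element in the sum over
        the sets of earlier sizes and the sets of size \<open>n\<close> other than the image
        \<open>?I\<close> of \<open>h\<close>.\<close>
      let ?G = "{S. S \<subseteq> pts t \<and> csize S \<in> set (take s ns)} \<union> ?O"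
      have eq: "act V n t h x = (act V n t h x \<ominus>\<^bsub>ob V t\<^esub> b) \<oplus>\<^bsub>ob V t\<^esub> b"
      proof -
        interpret M: module R "ob V t" by (rule cmD(1)[OF V])
        show ?thesis using hx bc by (simp add: a_minus_def M.a_assoc M.l_neg)
      qed
      have m1: "act V n t h x \<ominus>\<^bsub>ob V t\<^esub> b \<in> psum V t ?G"
        using d psum_mono[of "{S. S \<subseteq> pts t \<and> csize S \<in> set (take s ns)}" ?G V t] unfolding X_def by blast
      have m2: "b \<in> psum V t ?G" using b(1) psum_mono[of ?O ?G V t] by blast
      have hG: "act V n t h x \<in> psum V t ?G"
        by (subst eq) (rule sm_add[OF psum_sm[OF V] m1 m2])
      have Ip: "?I \<subseteq> pts t" by (rule pmap_image_subset[OF h subset_refl])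
      have cI: "card ?I = deg n" using card_image[OF CmorD(2)[OF h]] by (simp add: card_pts)
      have hp: "act V n t h x \<in> part V t ?I" by (rule partI[OF h x(1) subset_refl])
      \<comment> \<open>By distributivity all sets are cut down to \<open>?I\<close>. Each cut is a
        proper subset, since a set in \<open>?G\<close> has at most as many points as
        \<open>?I\<close> and differs from it. Torsion freeness brings the statement back to
        \<open>n\<close>, where the sum over proper subsets lies in \<open>?B n\<close>.\<close>
      have "act V n t h x \<in> psum V t ((\<lambda>U. U \<inter> ?I) ` ?G)"
        by (rule acyc_distributive[OF V ac subset_refl Ip _ hp hG]) auto
      also have "\<dots> \<subseteq> psum V t ((`) (pmap h) ` {S. S \<subset> pts n})"
      proof (rule psum_mono)
        show "(\<lambda>U. U \<inter> ?I) ` ?G \<subseteq> (`) (pmap h) ` {S. S \<subset> pts n}"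
        proof
          fix T assume "T \<in> (\<lambda>U. U \<inter> ?I) ` ?G"
          then obtain U where U: "U \<in> ?G" "T = U \<inter> ?I" by blast
          have finU: "finite U" using U(1) finite_subset[OF _ finite_pts] by auto
          have ne: "T \<noteq> ?I"
          proof
            assume "T = ?I"
            then have IU: "?I \<subseteq> U" using U(2) by blast
            have "card U \<le> card ?I"
              using U(1) deg_le card_csize[OF finU] cI by auto
            then have "?I = U" by (rule card_seteq[OF finU IU])
            then show False using U(1) n_notin csize_mimg[OF h] by auto
          qed
          define S where "S = {p \<in> pts n. pmap h p \<in> T}"
          have ST: "pmap h ` S = T" using U(2) by (auto simp: S_def)
          then have "S \<noteq> pts n" using ne by auto
          then have "S \<subset> pts n" by (auto simp: S_def)
          then show "T \<in> (`) (pmap h) ` {S. S \<subset> pts n}" using ST by blast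
        qed
      qed
      also have "\<dots> = act V n t h ` psum V n {S. S \<subset> pts n}"
        by (rule psum_act[OF V h, symmetric]) auto
      finally obtain x' where x': "x' \<in> psum V n {S. S \<subset> pts n}" "act V n t h x = act V n t h x'" by blast
      have "x = x'"
      proof (rule inj_onD)
        show "inj_on (act V n t h) (carrier (ob V n))" using acycD(1)[OF ac] h by (simp add: tors_free_def)
      qed (use x x' sm_in[OF psum_sm[OF V] x'(1)] in auto)
      moreover have "psum V n {S. S \<subset> pts n} \<subseteq> ?B n"
        unfolding X_def
      proof (rule psum_mono)
        show "{S. S \<subset> pts n} \<subseteq> {S. S \<subseteq> pts n \<and> csize S \<in> set (take s ns)}"
        proof
          fix S assume S: "S \<in> {S. S \<subset> pts n}"
          then have "card S < deg n" using psubset_card_mono[of "pts n" S] by (simp add: card_pts)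
          moreover have "finite S" using S finite_subset[OF _ finite_pts] by auto
          ultimately have "deg (csize S) < deg n" by (simp add: card_csize)
          then show "S \<in> {S. S \<subseteq> pts n \<and> csize S \<in> set (take s ns)}" using deg_less S by auto
        qed
      qed
      ultimately have "x \<in> ?B n" using x'(1) by blast
      then have "w = ?B n"
        using sq(4)[of x n] x by (simp add: Zn)
      then show "w = \<zero>\<^bsub>ob ?W n\<^esub>" by (simp add: sq(3))
    qed
  qed
  show ?thesis
    unfolding rel_projective_def
    by (intro exI[of _ "length ns"] exI[of _ X]) (use X X0 Xr Xm basic in auto)
qed

section \<open>Copies with a prescribed type of elements\<close>

text \<open>Entry 0 of a sequence is the coefficient of the generator added last, and the tail
  describes the rest.\<close>

lemma span_param:
  assumes M: "module R M" and S: "finite S" "S \<subseteq> carrier M"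
  shows "\<exists>q :: (nat \<Rightarrow> 'k) \<Rightarrow> 'v. mod_span R (M :: ('k, 'v) module) S \<subseteq> range q"
  using S
proof (induction S rule: finite_induct)
  case empty
  then show ?case by (intro exI[of _ "\<lambda>_. \<zero>\<^bsub>M\<^esub>"]) (simp add: span_empty[OF M])
next
  case (insert s S)
  then obtain q :: "(nat \<Rightarrow> 'k) \<Rightarrow> 'v" where q: "mod_span R M S \<subseteq> range q" by auto
  have S: "S \<subseteq> carrier M" "s \<in> carrier M" using insert.prems by auto
  have "mod_span R M (insert s S) \<subseteq> range (\<lambda>c. c 0 \<odot>\<^bsub>M\<^esub> s \<oplus>\<^bsub>M\<^esub> q (\<lambda>i. c (Suc i)))"
  proof
    fix x assume "x \<in> mod_span R M (insert s S)"
    then obtain a b where ab: "b \<in> mod_span R M S" "x = a \<odot>\<^bsub>M\<^esub> s \<oplus>\<^bsub>M\<^esub> b"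
      using span_insert_E[OF M S] by metis
    obtain c where "b = q c" using q ab(1) by blast
    then show "x \<in> range (\<lambda>c. c 0 \<odot>\<^bsub>M\<^esub> s \<oplus>\<^bsub>M\<^esub> q (\<lambda>i. c (Suc i)))"
      using ab(2) by (intro image_eqI[of _ _ "case_nat a c"]) simp_all
  qed
  then show ?case by blast
qed

definition copy_mod :: "('v \<Rightarrow> 'w) \<Rightarrow> ('k, 'v) module \<Rightarrow> ('k, 'w) module" where
  "copy_mod e M = (let i = inv_into (carrier M) e in
     \<lparr>carrier = e ` carrier M, mult = undefined, one = undefined, zero = e \<zero>\<^bsub>M\<^esub>,
      add = (\<lambda>x y. e (i x \<oplus>\<^bsub>M\<^esub> i y)), smult = (\<lambda>c x. e (c \<odot>\<^bsub>M\<^esub> i x))\<rparr>)"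

definition copy_cmod :: "('m obj \<Rightarrow> 'v \<Rightarrow> 'w) \<Rightarrow> ('m, 'k, 'v) cmod \<Rightarrow> ('m, 'k, 'w) cmod" where
  "copy_cmod e V = \<lparr>ob = (\<lambda>n. copy_mod (e n) (ob V n)),
     act = (\<lambda>n t f x. e t (act V n t f (inv_into (carrier (ob V n)) (e n) x)))\<rparr>"

lemma copy_mod_module:
  assumes M: "module R M" and e: "inj_on e (carrier M)"
  shows "module R (copy_mod e M)" and "e \<in> lin_maps R M (copy_mod e M)"
proof -
  interpret M: module R M by fact
  show "module R (copy_mod e M)"
    by (rule module_image[OF M, of _ e]) (simp_all add: copy_mod_def Let_def e)
  show "e \<in> lin_maps R M (copy_mod e M)"
    by (rule lin_mapsI) (simp_all add: copy_mod_def Let_def e)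
qed

lemma copy_cmod_onto:
  assumes V: "cmodule R V" and e: "\<And>n. inj_on (e n) (carrier (ob V n))"
  shows "cmodule R (copy_cmod e V)" and "onto V (copy_cmod e V) e"
proof -
  let ?W = "copy_cmod e V"
  note M = cmD(1)[OF V]
  have ob: "ob ?W n = copy_mod (e n) (ob V n)" for n by (simp add: copy_cmod_def)
  have car: "carrier (ob ?W n) = e n ` carrier (ob V n)" for n
    by (simp add: ob copy_mod_def Let_def)
  have act: "act ?W n t f (e n v) = e t (act V n t f v)" if "v \<in> carrier (ob V n)" for n t f v
    using that by (simp add: copy_cmod_def inv_into_f_f[OF e])
  have lin: "e n \<in> lin_maps R (ob V n) (ob ?W n)" for n
    unfolding ob by (rule copy_mod_module(2)[OF M e])
  show W: "cmodule R ?W"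
  proof (rule cmI)
    show Wm: "module R (ob ?W n)" for n unfolding ob by (rule copy_mod_module(1)[OF M e])
    show "act ?W n t f \<in> lin_maps R (ob ?W n) (ob ?W t)" if f: "f \<in> Cmor n t" for n t f
    proof -
      have bij: "bij_betw (e n) (carrier (ob V n)) (carrier (ob ?W n))"
        using e car by (simp add: bij_betw_def)
      have "(\<lambda>x. act V n t f (inv_into (carrier (ob V n)) (e n) x)) \<in> lin_maps R (ob ?W n) (ob V t)"
        by (rule lin_comp[OF lin_inverse[OF lin M Wm bij] cmD(2)[OF V f]])
      from lin_comp[OF this lin] show ?thesis by (simp add: copy_cmod_def)
    qed
    show "act ?W n n (Cid n) x = x" if "x \<in> carrier (ob ?W n)" for n x
      using that by (auto simp: car act cmD(3)[OF V])
    show "act ?W n u (Ccomp n g f) x = act ?W t u g (act ?W n t f x)"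
      if f: "f \<in> Cmor n t" and g: "g \<in> Cmor t u" and x: "x \<in> carrier (ob ?W n)" for n t u f g x
    proof -
      obtain v where v: "v \<in> carrier (ob V n)" "x = e n v" using x by (auto simp: car)
      show ?thesis by (simp add: v(2) act v(1) act_in[OF V f v(1)] cmD(4)[OF V f g v(1)])
    qed
  qed
  have "e \<in> cmod_hom R V ?W"
    by (rule homI[OF lin]) (simp add: act)
  then show "onto V ?W e" using car by (simp add: onto_def)
qed

text \<open>Each value is spanned by finitely many images of the generators, so
  \<open>span_param\<close> gives a parametrisation \<open>q\<close> by sequences. An element is
  represented by its fibre under \<open>q\<close>; distinct elements have distinct fibres because
  the fibres are nonempty.\<close>

lemma exists_fg_copy:
  fixes V :: "('m :: finite, 'k, 'v) cmod"
  assumes V: "cmodule R V" and fg: "fgen V"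
  shows "\<exists>(W :: ('m, 'k, 'k fg_elt) cmod) e. cmodule R W \<and> onto V W e \<and> (\<forall>n. inj_on (e n) (carrier (ob V n)))"
proof -
  obtain G where G: "finite G" "\<forall>(n, v)\<in>G. v \<in> carrier (ob V n)"
    "\<And>t. carrier (ob V t) \<subseteq> mod_span R (ob V t) (orb V G t)"
    using fg unfolding fgen_def by blast
  have "\<exists>q :: (nat \<Rightarrow> 'k) \<Rightarrow> 'v. carrier (ob V t) \<subseteq> range q" for t
  proof -
    have "orb V G t \<subseteq> (\<Union>(n, v)\<in>G. (\<lambda>f. act V n t f v) ` Cmor n t)" unfolding orb_def by blast
    moreover have "finite (\<Union>(n, v)\<in>G. (\<lambda>f. act V n t f v) ` Cmor n t)"
      using G(1) finite_Cmor by auto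
    ultimately have "finite (orb V G t)" by (rule finite_subset)
    from span_param[OF cmD(1)[OF V] this orb_carrier[OF V G(2)]] show ?thesis
      using G(3)[of t] by (meson order_trans)
  qed
  then obtain q :: "'m obj \<Rightarrow> (nat \<Rightarrow> 'k) \<Rightarrow> 'v" where q: "\<And>t. carrier (ob V t) \<subseteq> range (q t)" by metis
  define e where "e t v = {c. q t c = v}" for t v
  have e: "inj_on (e t) (carrier (ob V t))" for t
  proof (rule inj_onI)
    fix x y assume x: "x \<in> carrier (ob V t)" and eq: "e t x = e t y"
    obtain c where c: "q t c = x" using q x by blast
    then have "c \<in> e t y" using eq by (auto simp: e_def)
    then show "x = y" using c by (simp add: e_def)
  qed
  show ?thesis using copy_cmod_onto[OF V, of e] e by blast
qed

lemma onto_inverse: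
  assumes V: "cmodule R V" and W: "cmodule R W" and h: "onto V W h"
    and inj: "\<And>n. inj_on (h n) (carrier (ob V n))"
  shows "onto W V (\<lambda>n. inv_into (carrier (ob V n)) (h n))"
    and "inj_on (inv_into (carrier (ob V n)) (h n)) (carrier (ob W n))"
proof -
  let ?g = "\<lambda>n. inv_into (carrier (ob V n)) (h n)"
  have hh: "h \<in> cmod_hom R V W" and hs: "h n ` carrier (ob V n) = carrier (ob W n)" for n
    using h by (auto simp: onto_def)
  have bij: "bij_betw (h n) (carrier (ob V n)) (carrier (ob W n))" for n
    using inj hs by (simp add: bij_betw_def)
  note bij' = bij_betw_inv_into[OF bij]
  show "inj_on (?g n) (carrier (ob W n))" using bij'[of n] by (simp add: bij_betw_def)
  have "?g \<in> cmod_hom R W V"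
  proof (rule homI)
    show "?g n \<in> lin_maps R (ob W n) (ob V n)" for n
      by (rule lin_inverse[OF homD(1)[OF hh] cmD(1)[OF V] cmD(1)[OF W] bij])
    fix n t f w assume f: "f \<in> Cmor n t" and w: "w \<in> carrier (ob W n)"
    obtain v where v: "v \<in> carrier (ob V n)" "w = h n v" using w hs[of n] by blast
    show "?g t (act W n t f w) = act V n t f (?g n w)"
      using inv_into_f_f[OF inj act_in[OF V f v(1)]]
      by (simp add: v(2) homD(3)[OF hh f v(1), symmetric] inv_into_f_f[OF inj v(1)])
  qed
  then show "onto W V ?g" using bij' by (simp add: onto_def bij_betw_def)
qed

lemma onto_comp: "onto U V g \<Longrightarrow> onto V W h \<Longrightarrow> onto U W (\<lambda>n v. h n (g n v))"
  unfolding onto_def using hom_comp[of g U V h W] by (auto simp: image_image[symmetric])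

lemma onto_inj_zero:
  assumes V: "cmodule R V" and W: "cmodule R W" and h: "onto V W h"
    and inj: "\<And>n. inj_on (h n) (carrier (ob V n))" and v: "v \<in> carrier (ob V n)"
  shows "h n v = \<zero>\<^bsub>ob W n\<^esub> \<longleftrightarrow> v = \<zero>\<^bsub>ob V n\<^esub>"
proof -
  have L: "h n \<in> lin_maps R (ob V n) (ob W n)" using h homD(1) by (auto simp: onto_def)
  have "h n \<zero>\<^bsub>ob V n\<^esub> = \<zero>\<^bsub>ob W n\<^esub>" by (rule lin_zero[OF L cmD(1)[OF V] cmD(1)[OF W]])
  then show ?thesis using inj_onD[OF inj _ v sm_zero[OF sm_carrier[OF cmD(1)[OF V]]]] by metis
qed

section \<open>The coresolution\<close>

text \<open>One stage of the complex: \<open>F\<close> is acyclic, \<open>D\<close> is a cokernel of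
  \<open>\<epsilon>\<close>, and the kernel of \<open>\<epsilon>\<close> is torsion. The cokernel is
  given by a surjection whose kernel is the image of \<open>\<epsilon>\<close>, so that any
  isomorphic copy of the quotient is allowed.\<close>

definition res_step :: "nat \<Rightarrow> ('m, 'k, 'v) cmod \<Rightarrow> ('m, 'k, 'f) cmod \<Rightarrow> ('m obj \<Rightarrow> 'v \<Rightarrow> 'f) \<Rightarrow>
    ('m, 'k, 'd) cmod \<Rightarrow> ('m obj \<Rightarrow> 'f \<Rightarrow> 'd) \<Rightarrow> bool" where
  "res_step e C F \<epsilon> D p \<longleftrightarrow> cmodule R F \<and> acyc F \<and> gen_lt F e \<and> fgen F \<and> \<epsilon> \<in> cmod_hom R C F \<and>
     onto F D p \<and> (\<forall>n. ker_fam F D p n = im_fam C \<epsilon> n) \<and>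
     (\<forall>n. ker_fam C F \<epsilon> n \<subseteq> torsion_elts C n)"

lemma cokernel_gen_lt:
  fixes V :: "('m :: finite, 'k, 'v) cmod"
  assumes V: "cmodule R V" and W: "cmodule R W" and g: "gen_lt V e"
    and p: "onto (shiftN N V) W p"
    and z: "\<And>n v. v \<in> carrier (ob V n) \<Longrightarrow> p n (act V n (oadd n N) (nu N n) v) = \<zero>\<^bsub>ob W n\<^esub>"
  shows "gen_lt W (e - 1)"
  unfolding gen_lt_def
proof (intro allI)
  fix t
  let ?tN = "oadd t N"
  let ?P = "psum W t {T. T \<subseteq> pts t \<and> card T < e - 1}"
  have ph: "p \<in> cmod_hom R (shiftN N V) W" and ps: "p t ` carrier (ob V ?tN) = carrier (ob W t)"
    using p by (auto simp: onto_def)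
  have pl: "p t \<in> lin_maps R (ob V ?tN) (ob W t)" using homD(1)[OF ph, of t] by simp
  note Ps = psum_sm[OF W, of t "{T. T \<subseteq> pts t \<and> card T < e - 1}"]
  have sm: "submodule {x \<in> carrier (ob V ?tN). p t x \<in> ?P} R (ob V ?tN)"
    by (rule sm_preimage[OF pl cmD(1)[OF V] cmD(1)[OF W] Ps])
  have "psum V ?tN {S. S \<subseteq> pts ?tN \<and> card S < e} \<subseteq> {x \<in> carrier (ob V ?tN). p t x \<in> ?P}"
  proof (rule psum_least[OF sm])
    fix S assume "S \<in> {S. S \<subseteq> pts ?tN \<and> card S < e}"
    then have S: "S \<subseteq> pts ?tN" "card S < e" by auto
    have "p t ` part V ?tN S \<subseteq> ?P"
    proof (cases "S \<inter> pts N = {}")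
      case True
      then have "S \<subseteq> pmap (nu N t) ` pts t" using S(1) by (auto simp: mimg_nu)
      then have "part V ?tN S \<subseteq> act V t ?tN (nu N t) ` carrier (ob V t)"
        using part_mono[of S "pmap (nu N t) ` pts t" V ?tN] part_emb[OF V nu_in[of N t]] by simp
      then have "p t ` part V ?tN S \<subseteq> {\<zero>\<^bsub>ob W t\<^esub>}" using z by blast
      also have "\<dots> \<subseteq> ?P" using sm_zero[OF Ps] by simp
      finally show ?thesis .
    next
      case False
      obtain T where T: "T \<subseteq> pts t" "S \<subseteq> up_set N T" "card T < card S"
        using card_up_Int[OF S(1)] False by metis
      have "part V ?tN S \<subseteq> part (shiftN N V) t T"
        unfolding shiftN_part[OF V T(1)] by (rule part_mono[OF T(2)])
      then have "p t ` part V ?tN S \<subseteq> part W t T" using onto_part[OF p, of t T] by blast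
      also have "\<dots> \<subseteq> ?P" by (rule part_le_psum) (use T S in auto)
      finally show ?thesis .
    qed
    then show "part V ?tN S \<subseteq> {x \<in> carrier (ob V ?tN). p t x \<in> ?P}"
      using part_carrier[OF V, of ?tN S] by blast
  qed
  moreover have "carrier (ob V ?tN) \<subseteq> psum V ?tN {S. S \<subseteq> pts ?tN \<and> card S < e}"
    using g unfolding gen_lt_def by blast
  ultimately show "carrier (ob W t) \<subseteq> ?P" unfolding ps[symmetric] by blast
qed

text \<open>\<open>F\<close> and \<open>D\<close> are copies of the shift and of the cokernel with
  elements in \<open>'k fg_elt\<close>, whatever the element type of \<open>V\<close>, so that the
  step can be repeated on \<open>D\<close>.\<close>

lemma res_step_exists:
  fixes V :: "('m :: finite, 'k, 'v) cmod"
  assumes noeth: "noetherian_ring R" and V: "cmodule R V" and fg: "fgen V" and g: "gen_lt V e"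
  shows "\<exists>(F :: ('m, 'k, 'k fg_elt) cmod) \<epsilon> (D :: ('m, 'k, 'k fg_elt) cmod) p.
    res_step e V F \<epsilon> D p \<and> cmodule R D \<and> fgen D \<and> gen_lt D (e - 1)"
proof -
  obtain N where ac: "acyc (shiftN N V)" by (rule shift_acyclic[OF noeth V fg])
  let ?S = "shiftN N V"
  let ?\<nu> = "\<lambda>n. act V n (oadd n N) (nu N n)"
  let ?Z = "\<lambda>n. carrier (ob ?S n)"
  let ?B = "im_fam V ?\<nu>"
  let ?Q = "subquot ?S ?Z ?B"
  let ?c = "\<lambda>n. cst (ob ?S n) (?B n)"
  have S: "cmodule R ?S" and Sf: "fgen ?S" and Sg: "gen_lt ?S e"
    by (rule shiftN_cmodule[OF V] fgen_shiftN[OF V fg] shiftN_gen_lt[OF V g])+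
  have Z: "subfunctor R ?S ?Z" by (rule carrier_subfunctor[OF S])
  have B: "subfunctor R ?S ?B" by (rule im_subfunctor[OF V S nu_hom[OF V]])
  have BZ: "?B n \<subseteq> ?Z n" for n by (rule sm_subset[OF subfunctorD(1)[OF B]])
  note sq = subquot_cst[OF S Z B BZ]
  have "subcmod ?S ?Z = ?S" by (simp add: subcmod_def shiftN_def)
  then have c: "onto ?S ?Q ?c" using sq(2) by simp
  have Qf: "fgen ?Q" by (rule onto_fgen[OF S sq(1) c Sf])
  have Qg: "gen_lt ?Q (e - 1)"
  proof (rule cokernel_gen_lt[OF V sq(1) g c])
    fix n v assume v: "v \<in> carrier (ob V n)"
    then have vB: "?\<nu> n v \<in> ?B n" by (simp add: im_fam_def)
    have "?c n (?\<nu> n v) = ?B n" using sq(4)[OF subsetD[OF BZ vB]] vB by simp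
    then show "?c n (?\<nu> n v) = \<zero>\<^bsub>ob ?Q n\<^esub>" by (simp only: sq(3))
  qed
  obtain F :: "('m, 'k, 'k fg_elt) cmod" and a where F: "cmodule R F" "onto ?S F a"
    "\<And>n. inj_on (a n) (carrier (ob ?S n))"
    using exists_fg_copy[OF S Sf] by blast
  obtain D :: "('m, 'k, 'k fg_elt) cmod" and b where D: "cmodule R D" "onto ?Q D b"
    "\<And>n. inj_on (b n) (carrier (ob ?Q n))"
    using exists_fg_copy[OF sq(1) Qf] by blast
  define i where "i n = inv_into (carrier (ob ?S n)) (a n)" for n
  define \<epsilon> where "\<epsilon> n v = a n (?\<nu> n v)" for n v
  define p where "p n x = b n (?c n (i n x))" for n x
  have i: "onto F ?S i" unfolding i_def[abs_def] by (rule onto_inverse(1)[OF S F])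
  have ia: "i n (a n y) = y" if "y \<in> carrier (ob ?S n)" for n y
    unfolding i_def by (rule inv_into_f_f[OF F(3) that])
  have ah: "a \<in> cmod_hom R ?S F" and as: "a n ` carrier (ob ?S n) = carrier (ob F n)" for n
    using F(2) by (auto simp: onto_def)
  have bh: "b \<in> cmod_hom R ?Q D" using D(2) by (auto simp: onto_def)
  have \<epsilon>: "\<epsilon> \<in> cmod_hom R V F" unfolding \<epsilon>_def[abs_def] by (rule hom_comp[OF nu_hom[OF V] ah])
  have p: "onto F D p" unfolding p_def[abs_def] by (rule onto_comp[OF onto_comp[OF i c] D(2)])
  \<comment> \<open>As \<open>b\<close> is injective and \<open>i\<close> undoes \<open>a\<close>,
    the kernel of \<open>p\<close> is computed in the quotient of the shift.\<close>
  have p0: "p n (a n y) = \<zero>\<^bsub>ob D n\<^esub> \<longleftrightarrow> y \<in> ?B n" if y: "y \<in> carrier (ob ?S n)" for n y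
  proof -
    have "?c n y \<in> carrier (ob ?Q n)" using sq(5)[of n] y by simp
    from onto_inj_zero[OF sq(1) D this] show ?thesis
      unfolding p_def ia[OF y] using sq(3)[of n] sq(4)[of y n] y by simp
  qed
  have ker: "ker_fam F D p n = im_fam V \<epsilon> n" for n
  proof -
    have "ker_fam F D p n = {x \<in> a n ` carrier (ob ?S n). p n x = \<zero>\<^bsub>ob D n\<^esub>}"
      unfolding ker_fam_def as ..
    also have "\<dots> = a n ` {y \<in> carrier (ob ?S n). p n (a n y) = \<zero>\<^bsub>ob D n\<^esub>}" by blast
    also have "\<dots> = a n ` {y \<in> carrier (ob ?S n). y \<in> ?B n}"
      by (rule arg_cong[where f = "\<lambda>X. a n ` X"], rule Collect_cong, rule conj_cong[OF refl p0])
    also have "\<dots> = a n ` ?B n" using BZ[of n] by (intro arg_cong[where f = "\<lambda>X. a n ` X"]) blast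
    finally show ?thesis by (simp add: im_fam_def \<epsilon>_def image_image)
  qed
  have tors: "ker_fam V F \<epsilon> n \<subseteq> torsion_elts V n" for n
  proof
    fix v assume "v \<in> ker_fam V F \<epsilon> n"
    then have v: "v \<in> carrier (ob V n)" "a n (?\<nu> n v) = \<zero>\<^bsub>ob F n\<^esub>" by (auto simp: ker_fam_def \<epsilon>_def)
    have "?\<nu> n v \<in> carrier (ob ?S n)" using act_in[OF V nu_in v(1)] by simp
    then have "?\<nu> n v = \<zero>\<^bsub>ob V (oadd n N)\<^esub>" using onto_inj_zero[OF S F] v(2) by simp
    then show "v \<in> torsion_elts V n" unfolding torsion_elts_def using v(1) nu_in by blast
  qed
  have "res_step e V F \<epsilon> D p"
    unfolding res_step_def
  proof (intro conjI allI)
    show "acyc F" by (rule iso_acyc[OF S F ac])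
    show "gen_lt F e" by (rule onto_gen_lt[OF S F(1,2) Sg])
    show "fgen F" by (rule onto_fgen[OF S F(1,2) Sf])
  qed (rule F \<epsilon> p ker tors)+
  moreover have "fgen D" by (rule onto_fgen[OF sq(1) D(1,2) Qf])
  moreover have "gen_lt D (e - 1)" by (rule onto_gen_lt[OF sq(1) D(1,2) Qg])
  ultimately show ?thesis using D(1) by blast
qed

text \<open>Dependent choice, for which all terms must share one type; hence the element type of
  \<open>V\<close> is already \<open>'k fg_elt\<close>. From \<open>j = e\<close> on the truncated
  bound \<open>e - j\<close> is 0 and all terms vanish.\<close>

lemma res_sequence:
  fixes V :: "('m :: finite, 'k, 'k fg_elt) cmod"
  assumes noeth: "noetherian_ring R" and V: "cmodule R V" and fg: "fgen V" and g: "gen_lt V e"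
  shows "\<exists>(C :: nat \<Rightarrow> ('m, 'k, 'k fg_elt) cmod) (F :: nat \<Rightarrow> ('m, 'k, 'k fg_elt) cmod) \<epsilon> p. C 0 = V \<and>
    (\<forall>j. cmodule R (C j) \<and> fgen (C j) \<and> gen_lt (C j) (e - j) \<and>
      res_step (e - j) (C j) (F j) (\<epsilon> j) (C (Suc j)) (p j))"
proof -
  define P where "P j (W :: ('m, 'k, 'k fg_elt) cmod) \<longleftrightarrow>
    cmodule R W \<and> fgen W \<and> gen_lt W (e - j) \<and> (j = 0 \<longrightarrow> W = V)" for j W
  define Q where "Q j (W :: ('m, 'k, 'k fg_elt) cmod) D \<longleftrightarrow>
    (\<exists>(F :: ('m, 'k, 'k fg_elt) cmod) \<epsilon> p. res_step (e - j) W F \<epsilon> D p)" for j W and D :: "('m, 'k, 'k fg_elt) cmod"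
  have "\<exists>D. P (Suc j) D \<and> Q j W D" if "P j W" for j W
  proof -
    have W: "cmodule R W" "fgen W" "gen_lt W (e - j)" using that by (auto simp: P_def)
    obtain F \<epsilon> p and D :: "('m, 'k, 'k fg_elt) cmod"
      where "res_step (e - j) W (F :: ('m, 'k, 'k fg_elt) cmod) \<epsilon> D p"
        "cmodule R D" "fgen D" "gen_lt D (e - j - 1)"
      using res_step_exists[OF noeth W] by blast
    then show ?thesis unfolding P_def Q_def by (intro exI[of _ D]) auto
  qed
  moreover have "P 0 V" using V fg g by (simp add: P_def)
  ultimately obtain C where C: "\<forall>j. P j (C j)" "\<forall>j. Q j (C j) (C (Suc j))"
    using dependent_nat_choice[of P Q] by metis
  have "\<forall>j. \<exists>F \<epsilon> p. res_step (e - j) (C j) (F :: ('m, 'k, 'k fg_elt) cmod) \<epsilon> (C (Suc j)) p"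
    using C(2) unfolding Q_def by blast
  then obtain F \<epsilon> p where
    "\<forall>j. res_step (e - j) (C j) (F j :: ('m, 'k, 'k fg_elt) cmod) (\<epsilon> j) (C (Suc j)) (p j)"
    by metis
  then show ?thesis
    using C(1) unfolding P_def by (intro exI[of _ C] exI[of _ F] exI[of _ \<epsilon>] exI[of _ p]) auto
qed

lemma gen_lt_zero:
  assumes V: "cmodule R V" and g: "gen_lt V 0"
  shows "carrier (ob V n) = {\<zero>\<^bsub>ob V n\<^esub>}"
  using g sm_zero[OF sm_carrier[OF cmD(1)[OF V]], of n] psum_empty[OF V, of n]
  unfolding gen_lt_def by auto

text \<open>The start of the downward induction along the complex.\<close>

lemma zero_acyc:
  assumes V: "cmodule R V" and z: "\<And>n. carrier (ob V n) = {\<zero>\<^bsub>ob V n\<^esub>}"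
  shows "acyc V"
  unfolding acyc_def
proof (intro conjI allI impI)
  show "tors_free V" unfolding tors_free_def z by simp
  fix t A y
  show "part V t (pts t - {y}) \<inter> psum V t ((\<lambda>x. pts t - {x}) ` A) \<subseteq> psum V t ((\<lambda>x. pts t - {x, y}) ` A)"
    using part_carrier[OF V, of t "pts t - {y}"] sm_zero[OF psum_sm[OF V]] unfolding z by blast
qed

section \<open>Torsion and vanishing\<close>

text \<open>The homology modules consist of torsion elements, which is stronger than being generated
  by them. The stronger form is also what \<open>td_vanish\<close> starts from.\<close>

lemma torsion_moduleI:
  assumes "cmodule R H" and t: "\<And>n. carrier (ob H n) \<subseteq> torsion_elts H n"
  shows "torsion_module R H"
  unfolding torsion_module_def
proof
  fix n
  have s: "subfunctor R H (\<lambda>n. carrier (ob H n))" by (rule carrier_subfunctor) fact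
  show "gen_sub R H (torsion_elts H) n = carrier (ob H n)"
  proof
    show "gen_sub R H (torsion_elts H) n \<subseteq> carrier (ob H n)"
      unfolding gen_sub_def by (rule Inter_lower) (use s in \<open>auto simp: torsion_elts_def\<close>)
    show "carrier (ob H n) \<subseteq> gen_sub R H (torsion_elts H) n"
      unfolding gen_sub_def using t by blast
  qed
qed

text \<open>An element of \<open>Z/B\<close> is torsion when some morphism carries a representative
  into \<open>B\<close>.\<close>

lemma subquot_torsion:
  assumes V: "cmodule R V" and Z: "subfunctor R V Z" and B: "subfunctor R V B" and BZ: "\<And>n. B n \<subseteq> Z n"
    and t: "\<And>n z. z \<in> Z n \<Longrightarrow> \<exists>t. \<exists>f\<in>Cmor n t. act V n t f z \<in> B t"
  shows "carrier (ob (subquot V Z B) n) \<subseteq> torsion_elts (subquot V Z B) n"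
proof
  note sq = subquot_cst[OF V Z B BZ]
  fix x assume x: "x \<in> carrier (ob (subquot V Z B) n)"
  then obtain z where z: "z \<in> Z n" "x = cst (ob V n) (B n) z" by (auto simp: sq(5))
  obtain t f where f: "f \<in> Cmor n t" "act V n t f z \<in> B t" using t[OF z(1)] by blast
  have "act (subquot V Z B) n t f x = cst (ob V t) (B t) (act V n t f z)"
    using homD(3)[of _ "subcmod V Z" "subquot V Z B" f n t z] sq(2) f(1) z by (auto simp: onto_def)
  also have "\<dots> = B t" using sq(4)[of "act V n t f z" t] f(2) BZ by blast
  finally show "x \<in> torsion_elts (subquot V Z B) n"
    unfolding torsion_elts_def using x f(1) sq(3)[of t] by auto
qed

text \<open>The set in \<open>td\<close> is nonempty here, so the default -1 does not interfere. The
  summand 1 turns the bound by the supremum into a strict inequality.\<close>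

lemma td_less:
  assumes "x \<in> K_fam i H u" "x \<noteq> \<zero>\<^bsub>ob H u\<^esub>" "td i H + 1 \<le> ereal (real k)"
  shows "u i < k"
proof -
  define S where "S = {n i | n. K_fam i H n \<noteq> {\<zero>\<^bsub>ob H n\<^esub>}}"
  have u: "u i \<in> S" unfolding S_def using assms(1,2) by blast
  then have "td i H = (SUP s\<in>S. ereal (real s))"
    unfolding td_def sup_nat_set_def S_def[symmetric] by auto
  then have "ereal (real (u i)) \<le> td i H" using SUP_upper[OF u, of "\<lambda>s. ereal (real s)"] by simp
  then have "ereal (real (u i)) + 1 \<le> ereal (real k)"
    using assms(3) by (meson add_right_mono order_trans)
  then show ?thesis by (simp add: one_ereal_def)
qed

text \<open>A morphism that kills \<open>x\<close> and misses a point of coordinate \<open>i\<close>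
  factors through \<open>pi_mor u i\<close>. By induction on the distance to the target,
  \<open>pi_mor u i\<close> already kills \<open>x\<close>, so \<open>x\<close> lies in
  \<open>K_i\<close> at an object whose coordinate \<open>i\<close> exceeds
  \<open>td i H\<close>.\<close>

lemma td_vanish:
  fixes H :: "('m :: finite, 'k, 'v) cmod"
  assumes H: "cmodule R H" and t: "\<And>n. carrier (ob H n) \<subseteq> torsion_elts H n"
    and td: "\<And>i. td i H + 1 \<le> ereal (real (n i))" and u: "n \<le> u" and x: "x \<in> carrier (ob H u)"
  shows "x = \<zero>\<^bsub>ob H u\<^esub>"
proof -
  obtain t f where "f \<in> Cmor u t" "act H u t f x = \<zero>\<^bsub>ob H t\<^esub>"
    using t[of u] x unfolding torsion_elts_def by blast
  then show ?thesis
    using u x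
  proof (induction "deg t - deg u" arbitrary: u f x rule: less_induct)
    case less
    note f = less.prems(1) and fx = less.prems(2) and u = less.prems(3) and x = less.prems(4)
    show ?case
    proof (cases "u = t")
      case True
      obtain g where g: "g \<in> Cmor u u" "Ccomp u g f = Cid u"
        using iso_inverse[of f u] f True by metis
      have "x = act H u u (Ccomp u g f) x" using cmD(3)[OF H x] g(2) by simp
      also have "\<dots> = act H u u g (act H u u f x)" using cmD(4)[OF H _ g(1) x] f True by simp
      also have "\<dots> = \<zero>\<^bsub>ob H u\<^esub>" using fx True act_zero[OF H g(1)] by simp
      finally show ?thesis .
    next
      case False
      obtain i b where b: "(i, b) \<in> pts t" "(i, b) \<notin> pmap f ` pts u" by (rule missing_point[OF f False])
      obtain g where g: "g \<in> Cmor (add1 i u) t" "f = Ccomp u g (pi_mor u i)" by (rule factor_pi[OF f b])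
      let ?y = "act H u (add1 i u) (pi_mor u i) x"
      have y: "?y \<in> carrier (ob H (add1 i u))" by (rule act_in[OF H pi_mor_in x])
      have gy: "act H (add1 i u) t g ?y = \<zero>\<^bsub>ob H t\<^esub>"
        using fx cmD(4)[OF H pi_mor_in g(1) x] g(2) by simp
      have d1: "deg u < deg (add1 i u)"
        unfolding deg_def by (rule sum_strict_mono_ex1) (auto simp: add1_def)
      have d2: "deg (add1 i u) \<le> deg t" by (rule deg_mono[OF Cmor_le[OF g(1)]])
      have nu: "n \<le> add1 i u" using u by (auto simp: add1_def le_fun_def le_SucI)
      have "?y = \<zero>\<^bsub>ob H (add1 i u)\<^esub>"
        by (rule less.hyps[OF _ g(1) gy nu y]) (use d1 d2 in linarith)
      then have K: "x \<in> K_fam i H u" using x by (simp add: K_fam_def ker_fam_def shift_def)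
      show ?thesis
      proof (rule ccontr)
        assume "x \<noteq> \<zero>\<^bsub>ob H u\<^esub>"
        then have "u i < n i" by (rule td_less[OF K _ td])
        then show False using u by (simp add: le_fun_def not_less[symmetric])
      qed
    qed
  qed
qed

section \<open>Iterated shifts\<close>

text \<open>
  \<^const>\<open>shift\<close> and \<^const>\<open>shiftN\<close> differ on tuples that are not morphisms, so iterated shifts can only be
  compared on morphisms.
\<close>

definition agree :: "('m, 'k, 'v) cmod \<Rightarrow> ('m, 'k, 'v) cmod \<Rightarrow> bool" where
  "agree V W \<longleftrightarrow> ob V = ob W \<and> (\<forall>n t. \<forall>f\<in>Cmor n t. act V n t f = act W n t f)"

text \<open>\<open>iota\<close> keeps the other components as they are while \<open>iotaN\<close>
  restricts all of them; the results agree because components of morphisms are undefined outside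
  their domain.\<close>

lemma iota_iotaN:
  assumes f: "f \<in> Cmor n t"
  shows "iota i n f = iotaN (unit_obj i) n f"
proof (intro ext)
  fix j a
  have "f j a = undefined" if "a \<notin> {1..n j}" using CmorD(3)[OF f, of j] that by (auto simp: extensional_def)
  then show "iota i n f j a = iotaN (unit_obj i) n f j a"
    by (auto simp: iota_def iotaN_def mk_mor_def oadd_def unit_obj_def restrict_def)
qed

lemma agree_shift:
  fixes V :: "('m, 'k, 'v) cmod"
  assumes a: "agree V (shiftN N W)"
  shows "agree (shift i V) (shiftN (oadd (unit_obj i) N) W)"
  unfolding agree_def
proof (intro conjI allI ballI)
  show "ob (shift i V) = ob (shiftN (oadd (unit_obj i) N) W)"
    using a by (auto simp: agree_def shift_def add1_oadd oadd_def add.assoc)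
  fix n t :: "'m obj" and f assume f: "f \<in> Cmor n t"
  have "iotaN N (add1 i n) (iota i n f) = iotaN (oadd (unit_obj i) N) n f"
    unfolding iota_iotaN[OF f] add1_oadd
    by (intro ext) (auto simp: iotaN_def mk_mor_def oadd_def restrict_def add.commute)
  moreover have "iota i n f \<in> Cmor (add1 i n) (add1 i t)"
    unfolding iota_iotaN[OF f] add1_oadd by (rule iotaN_in[OF f])
  ultimately show "act (shift i V) n t f = act (shiftN (oadd (unit_obj i) N) W) n t f"
    using a by (simp add: agree_def shift_def) (simp add: add1_oadd oadd_def add.assoc)
qed

lemma agree_shiftN_zero: "agree (V :: ('m, 'k, 'v) cmod) (shiftN (\<lambda>_. 0) V)"
  unfolding agree_def
proof (intro conjI allI ballI)
  show "ob V = ob (shiftN (\<lambda>_. 0) V)" by (auto simp: oadd_def)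
  fix n t :: "'m obj" and f assume f: "f \<in> Cmor n t"
  have "iotaN (\<lambda>_. 0) n f = f"
  proof (intro ext)
    fix j a
    have "f j a = undefined" if "a \<notin> {1..n j}" using CmorD(3)[OF f, of j] that by (auto simp: extensional_def)
    then show "iotaN (\<lambda>_. 0) n f j a = f j a"
      by (auto simp: iotaN_def mk_mor_def oadd_def restrict_def)
  qed
  then show "act V n t f = act (shiftN (\<lambda>_. 0) V) n t f" by (simp add: oadd_def)
qed

text \<open>Distinctness makes each index of the list contribute its \<open>n i\<close> shifts
  exactly once. The inner induction runs over the power of a single \<open>shift i\<close>.\<close>

lemma agree_shifts:
  assumes "distinct is"
  shows "agree (shifts is n V) (shiftN (\<lambda>j. if j \<in> set is then n j else 0) V)"
  using assms
proof (induction "is")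
  case Nil
  then show ?case using agree_shiftN_zero by (simp add: shifts_def)
next
  case (Cons i "is")
  have "agree ((shift i ^^ k) (shifts is n V)) (shiftN (\<lambda>j. if j \<in> set is then n j else if j = i then k else 0) V)" for k
  proof (induction k)
    case 0
    have "(\<lambda>j. if j \<in> set is then n j else if j = i then 0 else 0) = (\<lambda>j. if j \<in> set is then n j else 0)" by auto
    then show ?case using Cons.IH Cons.prems by simp
  next
    case (Suc k)
    have "oadd (unit_obj i) (\<lambda>j. if j \<in> set is then n j else if j = i then k else 0)
        = (\<lambda>j. if j \<in> set is then n j else if j = i then Suc k else 0)"
      using Cons.prems by (auto simp: oadd_def unit_obj_def)
    then show ?case using agree_shift[OF Suc.IH, of i] by simp
  qed
  from this[of "n i"]
  have "agree (shifts (i # is) n V) (shiftN (\<lambda>j. if j \<in> set is then n j else if j = i then n i else 0) V)"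
    by (simp add: shifts_def)
  moreover have "(\<lambda>j. if j \<in> set is then n j else if j = i then n i else 0)
      = (\<lambda>j. if j \<in> set (i # is) then n j else 0)" by auto
  ultimately show ?case by simp
qed

lemma agree_onto:
  assumes V: "cmodule R V" and a: "agree W V"
  shows "cmodule R W" and "onto V W (\<lambda>n x. x)"
proof -
  have ob: "ob W = ob V" and act: "f \<in> Cmor n t \<Longrightarrow> act W n t f = act V n t f" for n t f
    using a by (auto simp: agree_def)
  show "cmodule R W"
    by (rule cmI) (simp_all add: ob act cmD[OF V] Cid_in Ccomp_in)
  have "(\<lambda>n x. x) \<in> cmod_hom R V W"
    by (rule homI) (simp_all add: ob act lin_id)
  then show "onto V W (\<lambda>n x. x)" by (simp add: onto_def ob)
qed

lemma shiftN_onto: "onto V W h \<Longrightarrow> onto (shiftN N V) (shiftN N W) (\<lambda>n. h (oadd n N))"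
  unfolding onto_def using shiftN_hom by auto

section \<open>Assembling the complex\<close>

theorem coresolution_exists:
  fixes V :: "('m :: finite, 'k, 'v) cmod"
  assumes noeth: "noetherian_ring R" and V: "cmodule R V" and fg: "fgen V"
  shows "\<exists>(l :: int) (F :: nat \<Rightarrow> ('m, 'k, 'k fg_elt) cmod) \<epsilon> d.
    cochain_complex R l V F \<epsilon> d \<and>
    (\<forall>j. int j \<le> l \<longrightarrow> rel_projective R (F j) \<and> gd R (F j) \<le> gd R V - ereal (real j)) \<and>
    ereal (real_of_int l) \<le> gd R V \<and>
    fin_gen R (homology_V V F \<epsilon>) \<and> torsion_module R (homology_V V F \<epsilon>) \<and>
    (\<forall>j. int j \<le> l \<longrightarrow>
       fin_gen R (homology_F V F \<epsilon> d j) \<and> torsion_module R (homology_F V F \<epsilon> d j)) \<and>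
    (\<forall>n is. distinct is \<longrightarrow> set is = UNIV \<longrightarrow>
       (\<forall>i. td i (homology_V V F \<epsilon>) + 1 \<le> ereal (real (n i)) \<and>
            (\<forall>j. int j \<le> l \<longrightarrow> td i (homology_F V F \<epsilon> d j) + 1 \<le> ereal (real (n i)))) \<longrightarrow>
       rel_projective R (shifts is n V))"
proof -
  obtain e where e: "gen_lt V e" "gd R V = ereal (real e - 1)" by (rule gd_eq[OF V fg])
  obtain V' :: "('m, 'k, 'k fg_elt) cmod" and c where V': "cmodule R V'" and c: "onto V V' c"
    and ci: "\<And>n. inj_on (c n) (carrier (ob V n))"
    using exists_fg_copy[OF V fg] by blast
  have "\<exists>(C :: nat \<Rightarrow> ('m, 'k, 'k fg_elt) cmod) (F :: nat \<Rightarrow> ('m, 'k, 'k fg_elt) cmod) a p. C 0 = V' \<and>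
    (\<forall>j. cmodule R (C j) \<and> fgen (C j) \<and> gen_lt (C j) (e - j) \<and>
      res_step (e - j) (C j) (F j) (a j) (C (Suc j)) (p j))"
    by (rule res_sequence[OF noeth V' onto_fgen[OF V V' c fg] onto_gen_lt[OF V V' c e(1)]])
  then obtain C F :: "nat \<Rightarrow> ('m, 'k, 'k fg_elt) cmod" and a p where C0: "C 0 = V'"
    and seq: "\<And>j. cmodule R (C j) \<and> fgen (C j) \<and> gen_lt (C j) (e - j) \<and>
      res_step (e - j) (C j) (F j) (a j) (C (Suc j)) (p j)" by blast
  have C: "cmodule R (C j)" and Cg: "gen_lt (C j) (e - j)"
    and F: "cmodule R (F j)" and Fac: "acyc (F j)" and Fg: "gen_lt (F j) (e - j)" and Ff: "fgen (F j)"
    and a: "a j \<in> cmod_hom R (C j) (F j)" and p: "onto (F j) (C (Suc j)) (p j)"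
    and ker: "ker_fam (F j) (C (Suc j)) (p j) n = im_fam (C j) (a j) n"
    and tors: "ker_fam (C j) (F j) (a j) n \<subseteq> torsion_elts (C j) n" for j n
    using seq[of j] unfolding res_step_def by auto
  have ch: "c \<in> cmod_hom R V (C 0)" and cs: "c n ` carrier (ob V n) = carrier (ob (C 0) n)" for n
    using c by (auto simp: onto_def C0)
  have ph: "p j \<in> cmod_hom R (F j) (C (Suc j))"
    and ps: "p j n ` carrier (ob (F j) n) = carrier (ob (C (Suc j)) n)" for j n
    using p by (auto simp: onto_def)
  have c0: "c n v = \<zero>\<^bsub>ob (C 0) n\<^esub> \<longleftrightarrow> v = \<zero>\<^bsub>ob V n\<^esub>" if "v \<in> carrier (ob V n)" for n v
    unfolding C0 by (rule onto_inj_zero[OF V V' c ci that])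
  define \<epsilon> where "\<epsilon> n v = a 0 n (c n v)" for n v
  define d where "d j n x = a (Suc j) n (p j n x)" for j n x
  \<comment> \<open>\<open>e\<close> is the sharp bound, so \<open>l\<close> equals
    \<open>gd R V\<close>; it is -1 when \<open>V\<close> is zero.\<close>
  define l where "l = int e - 1"
  have \<epsilon>: "\<epsilon> \<in> cmod_hom R V (F 0)" unfolding \<epsilon>_def[abs_def] by (rule hom_comp[OF ch a])
  have d: "d j \<in> cmod_hom R (F j) (F (Suc j))" for j
    unfolding d_def[abs_def] by (rule hom_comp[OF ph a])
  have pa: "p j n (a j n x) = \<zero>\<^bsub>ob (C (Suc j)) n\<^esub>" if "x \<in> carrier (ob (C j) n)" for j n x
  proof -
    have "a j n x \<in> im_fam (C j) (a j) n" using that by (simp add: im_fam_def)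
    then show ?thesis unfolding ker[symmetric] by (simp add: ker_fam_def)
  qed
  have a0: "a j n \<zero>\<^bsub>ob (C j) n\<^esub> = \<zero>\<^bsub>ob (F j) n\<^esub>" for j n
    by (rule lin_zero[OF homD(1)[OF a] cmD(1)[OF C] cmD(1)[OF F]])
  have complex: "cochain_complex R l V F \<epsilon> d"
    unfolding cochain_complex_def
  proof (intro conjI allI ballI impI)
    show "is_zero_mod (ob (F j) n)" if "l < int j" for j n
    proof -
      have "e - j = 0" using that by (simp add: l_def)
      then show ?thesis using gen_lt_zero[OF F, of j n] Fg[of j] by (simp add: is_zero_mod_def)
    qed
    show "d 0 n (\<epsilon> n v) = \<zero>\<^bsub>ob (F 1) n\<^esub>" if "v \<in> carrier (ob V n)" for n v
      using pa[OF homD(2)[OF ch that]] a0[of "Suc 0" n] by (simp add: d_def \<epsilon>_def)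
    show "d (Suc j) n (d j n x) = \<zero>\<^bsub>ob (F (Suc (Suc j))) n\<^esub>" if "x \<in> carrier (ob (F j) n)" for j n x
      using pa[OF homD(2)[OF ph that]] a0[of "Suc (Suc j)" n] by (simp add: d_def)
  qed (simp_all add: l_def V F \<epsilon> d)
  have proj: "rel_projective R (F j)" for j by (rule acyc_rel_projective[OF F Fac Fg])
  have gd: "gd R (F j) \<le> gd R V - ereal (real j)" if "int j \<le> l" for j
    using gd_le[OF F Fg, of j] that by (simp add: e(2) l_def of_nat_diff algebra_simps)
  define ZF where "ZF j = ker_fam (F j) (F (Suc j)) (d j)" for j
  define BF where "BF j = ker_fam (F j) (C (Suc j)) (p j)" for j
  \<comment> \<open>The incoming image at \<open>F j\<close> is the image of \<open>a j\<close>,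
    because \<open>c\<close> and the \<open>p i\<close> are onto, and this is the kernel of
    \<open>p j\<close>. Hence \<open>p j\<close> identifies the homology at \<open>F j\<close> with
    the kernel of \<open>a (Suc j)\<close>, which is torsion.\<close>
  have im: "(case j of 0 \<Rightarrow> im_fam V \<epsilon> | Suc i \<Rightarrow> im_fam (F i) (d i)) = BF j" for j
  proof
    fix n
    show "(case j of 0 \<Rightarrow> im_fam V \<epsilon> | Suc i \<Rightarrow> im_fam (F i) (d i)) n = BF j n"
    proof (cases j)
      case 0
      have "im_fam V \<epsilon> n = a 0 n ` c n ` carrier (ob V n)" by (simp add: im_fam_def \<epsilon>_def image_image)
      then show ?thesis using 0 by (simp add: BF_def ker im_fam_def cs)
    next
      case (Suc i)
      have "im_fam (F i) (d i) n = a (Suc i) n ` p i n ` carrier (ob (F i) n)"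
        by (simp add: im_fam_def d_def image_image)
      then show ?thesis using Suc by (simp add: BF_def ker im_fam_def ps)
    qed
  qed
  have HF: "homology_F V F \<epsilon> d j = subquot (F j) (ZF j) (BF j)" for j
    by (simp add: homology_F_def im ZF_def)
  define ZV where "ZV = ker_fam V (F 0) \<epsilon>"
  have HV: "homology_V V F \<epsilon> = subquot V ZV (zero_fam V)"
    by (simp add: homology_V_def ZV_def)
  have ZV: "subfunctor R V ZV" unfolding ZV_def by (rule ker_subfunctor[OF V F \<epsilon>])
  have BV: "subfunctor R V (zero_fam V)" by (rule zero_subfunctor[OF V])
  have BZV: "zero_fam V n \<subseteq> ZV n" for n
    using sm_zero[OF subfunctorD(1)[OF ZV]] by (simp add: zero_fam_def)
  have ZF: "subfunctor R (F j) (ZF j)" for j unfolding ZF_def by (rule ker_subfunctor[OF F F d])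
  have BF: "subfunctor R (F j) (BF j)" for j unfolding BF_def by (rule ker_subfunctor[OF F C ph])
  have BZF: "BF j n \<subseteq> ZF j n" for j n
    using a0 by (auto simp: BF_def ZF_def ker_fam_def d_def)
  have tV: "\<exists>t. \<exists>f\<in>Cmor n t. act V n t f v \<in> zero_fam V t" if "v \<in> ZV n" for n v
  proof -
    have v: "v \<in> carrier (ob V n)" "a 0 n (c n v) = \<zero>\<^bsub>ob (F 0) n\<^esub>"
      using that by (auto simp: ZV_def ker_fam_def \<epsilon>_def)
    have "c n v \<in> ker_fam (C 0) (F 0) (a 0) n" using v homD(2)[OF ch v(1)] by (simp add: ker_fam_def)
    then obtain t f where f: "f \<in> Cmor n t" "act (C 0) n t f (c n v) = \<zero>\<^bsub>ob (C 0) t\<^esub>"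
      using subsetD[OF tors[of 0 n]] unfolding torsion_elts_def by blast
    have "c t (act V n t f v) = \<zero>\<^bsub>ob (C 0) t\<^esub>" using homD(3)[OF ch f(1) v(1)] f(2) by simp
    then have "act V n t f v = \<zero>\<^bsub>ob V t\<^esub>" using c0[OF act_in[OF V f(1) v(1)]] by simp
    then show ?thesis using f(1) by (auto simp: zero_fam_def)
  qed
  have tF: "\<exists>t. \<exists>f\<in>Cmor n t. act (F j) n t f z \<in> BF j t" if "z \<in> ZF j n" for j n z
  proof -
    have z: "z \<in> carrier (ob (F j) n)" "a (Suc j) n (p j n z) = \<zero>\<^bsub>ob (F (Suc j)) n\<^esub>"
      using that by (auto simp: ZF_def ker_fam_def d_def)
    have "p j n z \<in> ker_fam (C (Suc j)) (F (Suc j)) (a (Suc j)) n"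
      using z homD(2)[OF ph z(1)] by (simp add: ker_fam_def)
    then obtain t f where f: "f \<in> Cmor n t" "act (C (Suc j)) n t f (p j n z) = \<zero>\<^bsub>ob (C (Suc j)) t\<^esub>"
      using subsetD[OF tors[of "Suc j" n]] unfolding torsion_elts_def by blast
    have "act (F j) n t f z \<in> BF j t"
      using homD(3)[OF ph f(1) z(1)] f(2) act_in[OF F f(1) z(1)] by (simp add: BF_def ker_fam_def)
    then show ?thesis using f(1) by blast
  qed
  have torV: "carrier (ob (homology_V V F \<epsilon>) n) \<subseteq> torsion_elts (homology_V V F \<epsilon>) n" for n
    unfolding HV by (rule subquot_torsion[OF V ZV BV BZV tV])
  have torF: "carrier (ob (homology_F V F \<epsilon> d j) n) \<subseteq> torsion_elts (homology_F V F \<epsilon> d j) n" for j n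
    unfolding HF by (rule subquot_torsion[OF F ZF BF BZF tF])
  have cmV: "cmodule R (homology_V V F \<epsilon>)" unfolding HV by (rule subquot_cst(1)[OF V ZV BV BZV])
  have cmF: "cmodule R (homology_F V F \<epsilon> d j)" for j unfolding HF by (rule subquot_cst(1)[OF F ZF BF BZF])
  have shifted: "rel_projective R (shifts is n V)"
    if "is": "distinct is" "set is = UNIV"
      and td: "\<And>i. td i (homology_V V F \<epsilon>) + 1 \<le> ereal (real (n i))"
        "\<And>i j. int j \<le> l \<Longrightarrow> td i (homology_F V F \<epsilon> d j) + 1 \<le> ereal (real (n i))"
    for n "is"
  proof -
    have exV: "v = \<zero>\<^bsub>ob V u\<^esub>" if u: "n \<le> u" and v: "v \<in> ZV u" for u v
    proof -
      note sq = subquot_cst[OF V ZV BV BZV]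
      have "cst (ob V u) (zero_fam V u) v \<in> carrier (ob (homology_V V F \<epsilon>) u)"
        unfolding HV sq(5) using v by blast
      from td_vanish[OF cmV torV td(1) u this]
      have "cst (ob V u) (zero_fam V u) v = zero_fam V u" by (simp add: HV sq(3))
      then show ?thesis using sq(4)[OF v] by (simp add: zero_fam_def)
    qed
    have exF: "z \<in> BF j u" if u: "n \<le> u" and z: "z \<in> ZF j u" for j u z
    proof (cases "int j \<le> l")
      case True
      note sq = subquot_cst[OF F[of j] ZF[of j] BF[of j] BZF]
      have "cst (ob (F j) u) (BF j u) z \<in> carrier (ob (homology_F V F \<epsilon> d j) u)"
        unfolding HF sq(5) using z by blast
      from td_vanish[OF cmF torF td(2)[OF True] u this]
      have "cst (ob (F j) u) (BF j u) z = BF j u" by (simp add: HF sq(3))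
      then show ?thesis using sq(4)[OF z] by simp
    next
      case False
      then have "e - j = 0" by (simp add: l_def)
      then have "carrier (ob (F j) u) = {\<zero>\<^bsub>ob (F j) u\<^esub>}" using gen_lt_zero[OF F] Fg[of j] by simp
      then show ?thesis using subfunctorD(3)[OF ZF z] sm_zero[OF subfunctorD(1)[OF BF]] by simp
    qed
    \<comment> \<open>Above \<open>n\<close> the homology vanishes, which says that each
      \<open>a j\<close> is injective there.\<close>
    have inj0: "x = \<zero>\<^bsub>ob (C j) u\<^esub>"
      if u: "n \<le> u" and x: "x \<in> carrier (ob (C j) u)" and ax: "a j u x = \<zero>\<^bsub>ob (F j) u\<^esub>" for j u x
    proof (cases j)
      case 0
      obtain v where v: "v \<in> carrier (ob V u)" "x = c u v" using x cs[of u] 0 by blast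
      have "v \<in> ZV u" using v ax 0 by (simp add: ZV_def ker_fam_def \<epsilon>_def)
      then have "v = \<zero>\<^bsub>ob V u\<^esub>" by (rule exV[OF u])
      then show ?thesis using c0[OF v(1)] v(2) 0 by simp
    next
      case (Suc i)
      obtain z where z: "z \<in> carrier (ob (F i) u)" "x = p i u z" using x ps[of i u] Suc by blast
      have "z \<in> ZF i u" using z ax Suc by (simp add: ZF_def ker_fam_def d_def)
      then have "z \<in> BF i u" by (rule exF[OF u])
      then show ?thesis using z(2) Suc by (simp add: BF_def ker_fam_def)
    qed
    let ?C = "\<lambda>j. shiftN n (C j)" and ?F = "\<lambda>j. shiftN n (F j)"
    have Cm: "cmodule R (?C j)" and Fm: "cmodule R (?F j)" for j
      by (rule shiftN_cmodule[OF C] shiftN_cmodule[OF F])+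
    have le: "n \<le> oadd u n" for u by (simp add: le_fun_def oadd_def)
    \<comment> \<open>After the shift, \<open>a j\<close> identifies \<open>C j\<close> with the
      kernel of \<open>F j\<close> onto \<open>C (Suc j)\<close>, so acyclicity passes from
      \<open>C (Suc j)\<close> to \<open>C j\<close>.\<close>
    have step: "acyc (?C j)" if ac: "acyc (?C (Suc j))" for j
    proof -
      let ?p = "\<lambda>u. p j (oadd u n)" and ?a = "\<lambda>u. a j (oadd u n)"
      let ?K = "ker_fam (?F j) (?C (Suc j)) ?p"
      have po: "onto (?F j) (?C (Suc j)) ?p" by (rule shiftN_onto[OF p])
      have ah: "?a \<in> cmod_hom R (?C j) (?F j)" by (rule shiftN_hom[OF a])
      have Ks: "subfunctor R (?F j) ?K"
        by (rule ker_subfunctor[OF Fm Cm]) (use po in \<open>simp add: onto_def\<close>)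
      have K: "cmodule R (subcmod (?F j) ?K)" by (rule subcmod_cmodule[OF Fm Ks])
      have Kac: "acyc (subcmod (?F j) ?K)"
        by (rule ker_acyc[OF Fm Cm po shiftN_acyc[OF F Fac] ac])
      have Ke: "?K u = ?a u ` carrier (ob (?C j) u)" for u
        using ker[of j "oadd u n"] by (simp add: ker_fam_def im_fam_def)
      have ao: "onto (?C j) (subcmod (?F j) ?K) ?a"
        unfolding onto_def
      proof
        show "?a \<in> cmod_hom R (?C j) (subcmod (?F j) ?K)"
        proof (rule homI)
          show "?a u \<in> lin_maps R (ob (?C j) u) (ob (subcmod (?F j) ?K) u)" for u
            by (rule lin_mapsI) (use lin_mapsD[OF homD(1)[OF ah, of u]] Ke in simp_all)
        qed (use homD(3)[OF ah] in simp)
        show "\<forall>u. ?a u ` carrier (ob (?C j) u) = carrier (ob (subcmod (?F j) ?K) u)" using Ke by simp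
      qed
      have ai: "inj_on (?a u) (carrier (ob (?C j) u))" for u
        by (rule lin_inj_onI[OF homD(1)[OF ah] cmD(1)[OF Cm] cmD(1)[OF Fm]]) (use inj0[OF le] in simp)
      note inv = onto_inverse[OF Cm K ao ai]
      show ?thesis by (rule iso_acyc[OF K Cm inv Kac])
    qed
    have base: "acyc (?C e)"
    proof (rule zero_acyc[OF Cm])
      show "carrier (ob (?C e) u) = {\<zero>\<^bsub>ob (?C e) u\<^esub>}" for u
        using gen_lt_zero[OF C, of e "oadd u n"] Cg[of e] by simp
    qed
    \<comment> \<open>Downward induction from the index \<open>e\<close>, where the term is
      zero.\<close>
    have "acyc (?C 0)"
    proof (rule inc_induct[of 0 e "\<lambda>j. acyc (?C j)"])
      show "acyc (?C k)" if "acyc (?C (Suc k))" for k by (rule step[OF that])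
    qed (simp_all add: base)
    then have acC: "acyc (shiftN n V')" by (simp add: C0)
    have Vn: "cmodule R (shiftN n V)" by (rule shiftN_cmodule[OF V])
    have ci': "inj_on (c (oadd u n)) (carrier (ob (shiftN n V) u))" for u using ci by simp
    note inv = onto_inverse[OF Vn shiftN_cmodule[OF V'] shiftN_onto[OF c] ci']
    have acV: "acyc (shiftN n V)" by (rule iso_acyc[OF shiftN_cmodule[OF V'] Vn inv acC])
    \<comment> \<open>The iterated single shifts and the shift by \<open>n\<close> in one step are
      isomorphic through the identity map.\<close>
    have "agree (shifts is n V) (shiftN n V)" using agree_shifts[OF "is"(1), of n V] "is"(2) by simp
    note W = agree_onto[OF Vn this]
    show ?thesis
      by (rule acyc_rel_projective[OF W(1) iso_acyc[OF Vn W _ acV] onto_gen_lt[OF Vn W shiftN_gen_lt[OF V e(1)]]]) simp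
  qed
  have fgV: "fin_gen R (homology_V V F \<epsilon>)" unfolding HV by (rule subquot_fin_gen[OF noeth V fg ZV BV BZV])
  have fgF: "fin_gen R (homology_F V F \<epsilon> d j)" for j
    unfolding HF by (rule subquot_fin_gen[OF noeth F Ff ZF BF BZF])
  have lgd: "ereal (real_of_int l) \<le> gd R V" by (simp add: e(2) l_def)
  show ?thesis
    by (intro exI[of _ l] exI[of _ F] exI[of _ \<epsilon>] exI[of _ d] conjI allI impI)
      (use complex proj gd lgd fgV fgF torsion_moduleI[OF cmV torV] torsion_moduleI[OF cmF torF] shifted in auto)
qed

end

theorem theorem1p5:
  fixes R :: "('k, 'b) ring_scheme"
    and V :: "('m :: finite, 'k, 'v) cmod"
  assumes "cring R" and "noetherian_ring R"
    and "cmodule R V" and "fin_gen R V"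
  shows "\<exists>(l :: int) (F :: nat \<Rightarrow> ('m, 'k, 'k fg_elt) cmod) \<epsilon> d.
    cochain_complex R l V F \<epsilon> d \<and>
    (\<forall>j. int j \<le> l \<longrightarrow> rel_projective R (F j) \<and> gd R (F j) \<le> gd R V - ereal (real j)) \<and>
    ereal (real_of_int l) \<le> gd R V \<and>
    fin_gen R (homology_V V F \<epsilon>) \<and> torsion_module R (homology_V V F \<epsilon>) \<and>
    (\<forall>j. int j \<le> l \<longrightarrow>
       fin_gen R (homology_F V F \<epsilon> d j) \<and> torsion_module R (homology_F V F \<epsilon> d j)) \<and>
    (\<forall>n is. distinct is \<longrightarrow> set is = UNIV \<longrightarrow>
       (\<forall>i. td i (homology_V V F \<epsilon>) + 1 \<le> ereal (real (n i)) \<and>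
            (\<forall>j. int j \<le> l \<longrightarrow> td i (homology_F V F \<epsilon> d j) + 1 \<le> ereal (real (n i)))) \<longrightarrow>
       rel_projective R (shifts is n V))"
proof -
  interpret coeff_ring R by (intro coeff_ring.intro) fact
  show ?thesis
    by (rule coresolution_exists) (use assms fin_gen_imp_fgen in auto)
qed

end
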